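(* Let $du=\Omega u$ be a completely integrable Pfaffian system $$\Omega=\sum_{i=1}^nS_{x_i}(\boldsymbol{x})\,dx_i+\sum_{H\in\mathcal A}A_H\,d\log f_H,\qquad S_{x_i}(\boldsymbol{x})=A_{x_i}+\sum_{j\ne i}A_{x_ix_j}x_j,$$ with constant matrices $A_{x_i},A_{x_ix_j}=A_{x_jx_i},A_H\in\mathrm{Mat}(N,\mathbb C)$, $N\ge1$, satisfying, for the variable $x=x_\ell$, the conditions (D) and (I) of the context. If the system is irreducible and non-exceptional in $x_\ell$-direction, then the following hold. (i) $\mathcal{ML}^{-x_\ell}\circ\mathcal{ML}^{x_\ell}(\Omega)\sim\Omega$ and $\mathcal{ML}^{x_\ell}\circ\mathcal{ML}^{-x_\ell}(\Omega)\sim\Omega$, where $\Omega\sim\Omega'$ means that there exists $P\in\mathrm{GL}(N,\mathbb C)$ (constant) with $\Omega'=P^{-1}\Omega P$. (ii) The middle Laplace transformed system $dv=\mathcal{ML}^{x_\ell}(\Omega)v$ and the inverse middle Laplace transformed system $dw=\mathcal{ML}^{-x_\ell}(\Omega)w$ are also irreducible and non-exceptional in $x_\ell$-direction.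
   Context: Setting. $\mathcal A$ is a finite arrangement of (affine) hyperplanes in $\mathbb C^n$ with coordinates $\boldsymbol{x}=(x_1,\dots,x_n)$; $f_H$ is a defining polynomial (degree one) of $H$; subscripts by variables on polynomials denote partial derivatives. Complete integrability means $\Omega\wedge\Omega=0$ (given $A_{x_ix_j}=A_{x_jx_i}$). $\mathcal A_{x_i}=\{H\in\mathcal A: (f_H)_{x_i}\ne0\}$. Fix $\ell$, write $x=x_\ell$, and let $x'$ be the set (tuple) of the other variables; for $y\in x'$ let $x''$ be the variables other than $x,y$. (D) $A_x$ and $A_{xz}$ are diagonalizable for all $z\in x'$. (I) If $\mathcal A_x\cap\mathcal A_z\ne\emptyset$ for some $z\in x'$, then $A_{xz}=O$ for all $z\in x'$. Irreducible in $x_\ell$-direction: no subspace of $\mathbb C^N$ other than $\{0\},\mathbb C^N$ is invariant under $A_{x_\ell}$, all $A_{x_\ell x_j}$ ($j\ne\ell$) and all $A_H$ ($H\in\mathcal A_{x_\ell}$). Exceptional in $x_\ell$-direction: $N=1$ and $A_H=0$ for all $H\in\mathcal A_{x_\ell}$; otherwise non-exceptional. Notation. $\mathcal A_x=\{H_1,\dots,H_q\}$. For $H\in\mathcal A_x$: $f_H=(f_H)_x(x-a_H)$ with $a_H\in\mathbb C[x']$. For $H\in\mathcal A_y$: $f_H=(f_H)_y(y-b_H)$. For $H\in\mathcal A_x$: $\mathcal C_{H,y}=\{H'\in\mathcal A_x\setminus\{H\}:(a_H-a_{H'})_y\ne0\}$, and for $H'\in\mathcal C_{H,y}$: $a_H-a_{H'}=(a_H-a_{H'})_y(y-c_{HH'})$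 with $c_{HH'}\in\mathbb C[x'']$. Integrability implies that $A_x$ and the $A_{xz}$ ($z\in x'$) commute, so $S_x=A_x+\sum_{z\in x'}A_{xz}z=\sum_{k=1}^{\hat q}\hat a_kE_k$, where $\hat a_1,\dots,\hat a_{\hat q}\in\mathbb C[x']$ are the distinct eigenvalues (polynomials of degree $\le1$) and $E_k$ are the projections onto the corresponding joint eigenspaces. Laplace transforms. $\mathcal L^{\pm x}(\Omega)=\sum_iM^{\pm}_{x_i}dx_i$ is the 1-form with values in endomorphisms of $(\mathbb C^N)^q$ given on $v=(v_1,\dots,v_q)$ by $$(M^{+}_xv)_i=-a_{H_i}v_i-\sum_k\frac{1}{x-\hat a_k}E_k\sum_jA_{H_j}v_j,\qquad (M^-_xv)_i=a_{H_i}v_i-\sum_k\frac1{x+\hat a_k}E_k\sum_jA_{H_j}v_j,$$ and for $y\in x'$: for $H_i\in\mathcal A_x\setminus\mathcal A_y$, $$(M_y^{\pm}v)_i=\Big(A_y+\sum_{z\in x''}A_{yz}z+a_{H_i}A_{yx}+\sum_{H\in\mathcal A_y\setminus\mathcal A_x}\frac{A_H}{y-b_H}\Big)v_i+\sum_{H_j\in\mathcal A_x\cap\mathcal A_y}\frac{A_{H_j}}{y-c_{H_iH_j}}(v_i-v_j)\pm\sum_k\frac{(\hat a_k)_y}{x\mp\hat a_k}E_k\sum_jA_{H_j}v_j;$$ for $H_i\in\mathcal A_x\cap\mathcal A_y$, $$(M^{\pm}_yv)_i=\Big(A_y+(a_{H_i})_yA_x\mp(a_{H_i})_yx+\sum_{z\in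 x''}A_{yz}z+\sum_{H\in\mathcal A_y\setminus\mathcal A_x}\frac{A_H}{y-b_H}\Big)v_i+\sum_{H_j\in\mathcal C_{H_i,y}}\frac{A_{H_j}}{y-c_{H_iH_j}}(v_i-v_j).$$ (Here upper/lower signs correspond to $\mathcal L^{x}$/$\mathcal L^{-x}$.) The subspace $\mathcal K^x=\bigoplus_{i=1}^q\mathrm{Ker}A_{H_i}\subset(\mathbb C^N)^q$ is invariant under $\mathcal L^{\pm x}(\Omega)$. The middle Laplace transform $\mathcal{ML}^{x}(\Omega)$ and inverse middle Laplace transform $\mathcal{ML}^{-x}(\Omega)$ in $x_\ell$-direction are the matrix 1-forms (in some basis; defined up to $\sim$) of the operators induced by $\mathcal L^{x}(\Omega)$, resp. $\mathcal L^{-x}(\Omega)$, on $(\mathbb C^N)^q/\mathcal K^x$. They again define completely integrable systems of the form $\sum_{i=1}^n\big(B_{x_i}+\sum_{j\ne i}B_{x_ix_j}x_j\big)dx_i+\sum_{H\in\mathcal B}B_H\,d\log f_H$, with $\mathcal B$ a finite arrangement of affine hyperplanes in $\mathbb C^n$ and constant square matrices $B_{x_i},B_{x_ix_j}=B_{x_jx_i},B_H$ of size $\dim\big((\mathbb C^N)^q/\mathcal K^x\big)$, satisfying (D) and (I) for $x=x_\ell$ (with $\mathcal A$ and the matrices $A$ replaced by $\mathcal B$ and the matrices $B$): the hyperplanes depending on $x$ are $\{x=\hat a_k\}$ for $\mathcal{ML}^x$ and $\{x=-\hat a_k\}$ for $\mathcal{ML}^{-x}$. *)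

theory Defs
  imports "Jordan_Normal_Form.Matrix_Kernel" "HOL-Library.FuncSet"
begin

text \<open>Points of \<open>\<complex>\<^sup>n\<close> are functions on a finite index type \<open>'n\<close>; a polynomial of degree at most
  one in the variables \<open>x\<^sub>i\<close> is given by its coefficients.\<close>

type_synonym 'n point = "'n \<Rightarrow> complex"

datatype 'n aff = Aff (pd: "'n \<Rightarrow> complex") (const_term: complex)
  \<comment> \<open>\<open>pd f i\<close> is both the coefficient of \<open>x\<^sub>i\<close> and the (constant) partial derivative of \<open>f\<close>.\<close>

definition aff_eval :: "'n::finite aff \<Rightarrow> 'n point \<Rightarrow> complex" where
  "aff_eval f p = (\<Sum>i\<in>UNIV. pd f i * p i) + const_term f"

definition aff_diff :: "'n aff \<Rightarrow> 'n aff \<Rightarrow> 'n aff" where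
  "aff_diff f g = Aff (\<lambda>i. pd f i - pd g i) (const_term f - const_term g)"

text \<open>If \<open>pd f i \<noteq> 0\<close>, then \<open>aff_root i f\<close> is the polynomial \<open>r\<close> not involving \<open>x\<^sub>i\<close> with
  \<open>f = pd f i * (x\<^sub>i - r)\<close>.\<close>

definition aff_root :: "'n \<Rightarrow> 'n aff \<Rightarrow> 'n aff" where
  "aff_root i f = Aff (\<lambda>j. if j = i then 0 else - pd f j / pd f i) (- const_term f / pd f i)"

definition defines_hyperplane :: "'n::finite aff \<Rightarrow> 'n point set \<Rightarrow> bool" where
  "defines_hyperplane f H \<longleftrightarrow> (\<exists>i. pd f i \<noteq> 0) \<and> H = {p. aff_eval f p = 0}"

definition arrangement :: "'n::finite point set set \<Rightarrow> bool" where
  "arrangement \<A> \<longleftrightarrow> finite \<A> \<and> (\<forall>H\<in>\<A>. \<exists>f. defines_hyperplane f H)"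

text \<open>A chosen defining polynomial of \<open>H\<close>. It is unique up to a nonzero constant factor, and
  everything below (\<open>d log f\<^sub>H\<close>, \<open>a\<^sub>H\<close>, \<open>b\<^sub>H\<close>, \<open>c\<^sub>H\<^sub>H\<^sub>'\<close>, \<open>\<A>\<^sub>x\<close>) is independent of that factor.\<close>

definition defpoly :: "'n::finite point set \<Rightarrow> 'n aff" where
  "defpoly H = (SOME f. defines_hyperplane f H)"

text \<open>Equality of rational functions and rational forms is equality outside some finite union
  of hyperplanes; this excludes the poles, where division by zero returns \<open>0\<close>.\<close>

definition generically :: "('n::finite point \<Rightarrow> bool) \<Rightarrow> bool" where
  "generically Q \<longleftrightarrow> (\<exists>\<G>. arrangement \<G> \<and> (\<forall>p. p \<notin> \<Union>\<G> \<longrightarrow> Q p))"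

text \<open>Finite sums of \<open>N \<times> N\<close> matrices and of vectors in \<open>\<complex>\<^sup>N\<close>.\<close>

definition msum :: "nat \<Rightarrow> ('s \<Rightarrow> complex mat) \<Rightarrow> 's set \<Rightarrow> complex mat" where
  "msum N F S = mat N N (\<lambda>(r, c). \<Sum>s\<in>S. F s $$ (r, c))"

definition vsum :: "nat \<Rightarrow> ('s \<Rightarrow> complex vec) \<Rightarrow> 's set \<Rightarrow> complex vec" where
  "vsum N F S = vec N (\<lambda>r. \<Sum>s\<in>S. F s $ r)"

definition diagonalizable_mat :: "complex mat \<Rightarrow> bool" where
  "diagonalizable_mat A \<longleftrightarrow> (\<exists>D. similar_mat A D \<and> diagonal_mat D)"

text \<open>The data of a form \<open>\<Omega> = (\<Sum>i. (A\<^sub>i + (\<Sum>j\<noteq>i. A\<^sub>i\<^sub>j x\<^sub>j)) dx\<^sub>i) + (\<Sum>H\<in>\<A>. A\<^sub>H d log f\<^sub>H)\<close>. The diagonal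
  entries \<open>mlin \<Omega> i i\<close> and the residues outside the arrangement are irrelevant.\<close>

record 'n pfaff =
  rk :: nat
  mconst :: "'n \<Rightarrow> complex mat"
  mlin :: "'n \<Rightarrow> 'n \<Rightarrow> complex mat"
  hyps :: "'n point set set"
  res :: "'n point set \<Rightarrow> complex mat"

definition pfaff_form :: "'n::finite pfaff \<Rightarrow> bool" where
  "pfaff_form \<Omega> \<longleftrightarrow> arrangement (hyps \<Omega>) \<and>
     (\<forall>i. mconst \<Omega> i \<in> carrier_mat (rk \<Omega>) (rk \<Omega>)) \<and>
     (\<forall>i j. i \<noteq> j \<longrightarrow> mlin \<Omega> i j \<in> carrier_mat (rk \<Omega>) (rk \<Omega>) \<and> mlin \<Omega> i j = mlin \<Omega> j i) \<and>
     (\<forall>H\<in>hyps \<Omega>. res \<Omega> H \<in> carrier_mat (rk \<Omega>) (rk \<Omega>))"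

definition S_coeff :: "'n::finite pfaff \<Rightarrow> 'n \<Rightarrow> 'n point \<Rightarrow> complex mat" where
  "S_coeff \<Omega> i p = mconst \<Omega> i + msum (rk \<Omega>) (\<lambda>j. p j \<cdot>\<^sub>m mlin \<Omega> i j) (UNIV - {i})"

text \<open>The value at \<open>p\<close> of the coefficient of \<open>dx\<^sub>i\<close> in \<open>\<Omega>\<close>.\<close>

definition form_coeff :: "'n::finite pfaff \<Rightarrow> 'n \<Rightarrow> 'n point \<Rightarrow> complex mat" where
  "form_coeff \<Omega> i p = S_coeff \<Omega> i p +
     msum (rk \<Omega>) (\<lambda>H. (pd (defpoly H) i / aff_eval (defpoly H) p) \<cdot>\<^sub>m res \<Omega> H) (hyps \<Omega>)"

text \<open>Vanishing of the coefficients of \<open>\<Omega> \<and> \<Omega>\<close>; here \<open>d\<Omega> = 0\<close> holds by the symmetry of \<open>mlin\<close>.\<close>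

definition completely_integrable :: "'n::finite pfaff \<Rightarrow> bool" where
  "completely_integrable \<Omega> \<longleftrightarrow> (\<forall>p. p \<notin> \<Union>(hyps \<Omega>) \<longrightarrow> (\<forall>i j.
     form_coeff \<Omega> i p * form_coeff \<Omega> j p - form_coeff \<Omega> j p * form_coeff \<Omega> i p
       = 0\<^sub>m (rk \<Omega>) (rk \<Omega>)))"

definition hyps_dep :: "'n::finite pfaff \<Rightarrow> 'n \<Rightarrow> 'n point set set" where
  "hyps_dep \<Omega> i = {H \<in> hyps \<Omega>. pd (defpoly H) i \<noteq> 0}"

definition cond_D :: "'n::finite pfaff \<Rightarrow> 'n \<Rightarrow> bool" where
  "cond_D \<Omega> l \<longleftrightarrow> diagonalizable_mat (mconst \<Omega> l) \<and>
     (\<forall>z. z \<noteq> l \<longrightarrow> diagonalizable_mat (mlin \<Omega> l z))"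

definition cond_I :: "'n::finite pfaff \<Rightarrow> 'n \<Rightarrow> bool" where
  "cond_I \<Omega> l \<longleftrightarrow> (\<exists>z. z \<noteq> l \<and> hyps_dep \<Omega> l \<inter> hyps_dep \<Omega> z \<noteq> {}) \<longrightarrow>
     (\<forall>z. z \<noteq> l \<longrightarrow> mlin \<Omega> l z = 0\<^sub>m (rk \<Omega>) (rk \<Omega>))"

definition admissible :: "'n::finite pfaff \<Rightarrow> 'n \<Rightarrow> bool" where
  "admissible \<Omega> l \<longleftrightarrow> pfaff_form \<Omega> \<and> rk \<Omega> \<ge> 1 \<and> completely_integrable \<Omega> \<and>
     cond_D \<Omega> l \<and> cond_I \<Omega> l"

definition stable :: "complex mat \<Rightarrow> complex vec set \<Rightarrow> bool" where
  "stable A W \<longleftrightarrow> (\<forall>w\<in>W. A *\<^sub>v w \<in> W)"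

definition irreducible_dir :: "'n::finite pfaff \<Rightarrow> 'n \<Rightarrow> bool" where
  "irreducible_dir \<Omega> l \<longleftrightarrow>
     (\<forall>W. VectorSpace.subspace class_ring W (module_vec TYPE(complex) (rk \<Omega>)) \<and>
       stable (mconst \<Omega> l) W \<and> (\<forall>j. j \<noteq> l \<longrightarrow> stable (mlin \<Omega> l j) W) \<and>
       (\<forall>H\<in>hyps_dep \<Omega> l. stable (res \<Omega> H) W)
       \<longrightarrow> W = {0\<^sub>v (rk \<Omega>)} \<or> W = carrier_vec (rk \<Omega>))"

definition exceptional_dir :: "'n::finite pfaff \<Rightarrow> 'n \<Rightarrow> bool" where
  "exceptional_dir \<Omega> l \<longleftrightarrow> rk \<Omega> = 1 \<and> (\<forall>H\<in>hyps_dep \<Omega> l. res \<Omega> H = 0\<^sub>m 1 1)"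

text \<open>\<open>\<Omega>' = P\<^sup>-\<^sup>1 \<Omega> P\<close> as rational forms, with \<open>P\<close> constant and \<open>Q = P\<^sup>-\<^sup>1\<close>.\<close>

definition form_sim :: "'n::finite pfaff \<Rightarrow> 'n pfaff \<Rightarrow> bool" where
  "form_sim \<Omega> \<Omega>' \<longleftrightarrow> rk \<Omega>' = rk \<Omega> \<and>
     (\<exists>P \<in> carrier_mat (rk \<Omega>) (rk \<Omega>). \<exists>Q \<in> carrier_mat (rk \<Omega>) (rk \<Omega>).
        P * Q = 1\<^sub>m (rk \<Omega>) \<and> Q * P = 1\<^sub>m (rk \<Omega>) \<and>
        (\<forall>i. generically (\<lambda>p. form_coeff \<Omega>' i p = Q * form_coeff \<Omega> i p * P)))"

text \<open>The joint eigenspaces of \<open>A\<^sub>x\<close> and the \<open>A\<^sub>x\<^sub>z\<close>, indexed by the eigenvalues of \<open>S\<^sub>x\<close>, and the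
  projections onto them along the other ones.\<close>

definition eigsp :: "'n::finite pfaff \<Rightarrow> 'n \<Rightarrow> 'n aff \<Rightarrow> complex vec set" where
  "eigsp \<Omega> l \<alpha> = {v \<in> carrier_vec (rk \<Omega>). \<forall>p. S_coeff \<Omega> l p *\<^sub>v v = aff_eval \<alpha> p \<cdot>\<^sub>v v}"

definition eigvals :: "'n::finite pfaff \<Rightarrow> 'n \<Rightarrow> 'n aff set" where
  "eigvals \<Omega> l = {\<alpha>. \<exists>v \<in> eigsp \<Omega> l \<alpha>. v \<noteq> 0\<^sub>v (rk \<Omega>)}"

definition eigproj :: "'n::finite pfaff \<Rightarrow> 'n \<Rightarrow> 'n aff \<Rightarrow> complex mat" where
  "eigproj \<Omega> l \<alpha> = (THE E. E \<in> carrier_mat (rk \<Omega>) (rk \<Omega>) \<and>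
     (\<forall>v \<in> eigsp \<Omega> l \<alpha>. E *\<^sub>v v = v) \<and>
     (\<forall>\<beta> \<in> eigvals \<Omega> l - {\<alpha>}. \<forall>v \<in> eigsp \<Omega> l \<beta>. E *\<^sub>v v = 0\<^sub>v (rk \<Omega>)))"

definition aH :: "'n::finite \<Rightarrow> 'n point set \<Rightarrow> 'n aff" where
  "aH l H = aff_root l (defpoly H)"

definition bH :: "'n::finite \<Rightarrow> 'n point set \<Rightarrow> 'n aff" where
  "bH y H = aff_root y (defpoly H)"

definition cH :: "'n::finite \<Rightarrow> 'n \<Rightarrow> 'n point set \<Rightarrow> 'n point set \<Rightarrow> 'n aff" where
  "cH l y H H' = aff_root y (aff_diff (aH l H) (aH l H'))"

definition CH :: "'n::finite pfaff \<Rightarrow> 'n \<Rightarrow> 'n \<Rightarrow> 'n point set \<Rightarrow> 'n point set set" where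
  "CH \<Omega> l y H = {H' \<in> hyps_dep \<Omega> l - {H}. pd (aff_diff (aH l H) (aH l H')) y \<noteq> 0}"

text \<open>Elements of \<open>(\<complex>\<^sup>N)\<^sup>q\<close> are families \<open>v\<close> indexed by the hyperplanes in \<open>\<A>\<^sub>x\<close>; values outside \<open>\<A>\<^sub>x\<close>
  are never used.\<close>

type_synonym 'n blockvec = "'n point set \<Rightarrow> complex vec"

definition blockspace :: "'n::finite pfaff \<Rightarrow> 'n \<Rightarrow> 'n blockvec set" where
  "blockspace \<Omega> l = hyps_dep \<Omega> l \<rightarrow> carrier_vec (rk \<Omega>)"

definition kernelspace :: "'n::finite pfaff \<Rightarrow> 'n \<Rightarrow> 'n blockvec set" where
  "kernelspace \<Omega> l = {v \<in> blockspace \<Omega> l. \<forall>H\<in>hyps_dep \<Omega> l. v H \<in> mat_kernel (res \<Omega> H)}"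

definition res_apply :: "'n::finite pfaff \<Rightarrow> 'n \<Rightarrow> 'n blockvec \<Rightarrow> complex vec" where
  "res_apply \<Omega> l v = vsum (rk \<Omega>) (\<lambda>H. res \<Omega> H *\<^sub>v v H) (hyps_dep \<Omega> l)"

text \<open>\<open>\<L>\<^sup>x\<close> and \<open>\<L>\<^sup>-\<^sup>x\<close> are the cases \<open>\<epsilon> = 1\<close> and \<open>\<epsilon> = -1\<close> of the following operators.
  \<open>laplace_op \<epsilon> \<Omega> l y p v H\<close> is the \<open>H\<close>-component of \<open>M\<^sub>y v\<close> at the point \<open>p\<close>.\<close>

definition laplace_op_x ::
    "complex \<Rightarrow> 'n::finite pfaff \<Rightarrow> 'n \<Rightarrow> 'n point \<Rightarrow> 'n blockvec \<Rightarrow> 'n blockvec" where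
  "laplace_op_x \<epsilon> \<Omega> l p v H =
     (- \<epsilon> * aff_eval (aH l H) p) \<cdot>\<^sub>v v H
     - vsum (rk \<Omega>) (\<lambda>\<alpha>. (1 / (p l - \<epsilon> * aff_eval \<alpha> p)) \<cdot>\<^sub>v (eigproj \<Omega> l \<alpha> *\<^sub>v res_apply \<Omega> l v))
         (eigvals \<Omega> l)"

definition laplace_op_y ::
    "complex \<Rightarrow> 'n::finite pfaff \<Rightarrow> 'n \<Rightarrow> 'n \<Rightarrow> 'n point \<Rightarrow> 'n blockvec \<Rightarrow> 'n blockvec" where
  "laplace_op_y \<epsilon> \<Omega> l y p v H = (let
       N = rk \<Omega>;
       common = msum N (\<lambda>z. p z \<cdot>\<^sub>m mlin \<Omega> y z) (UNIV - {l, y})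
         + msum N (\<lambda>H'. (1 / (p y - aff_eval (bH y H') p)) \<cdot>\<^sub>m res \<Omega> H')
             (hyps_dep \<Omega> y - hyps_dep \<Omega> l);
       exchange = (\<lambda>H'. (1 / (p y - aff_eval (cH l y H H') p)) \<cdot>\<^sub>v (res \<Omega> H' *\<^sub>v (v H - v H')))
     in if H \<notin> hyps_dep \<Omega> y then
         (mconst \<Omega> y + aff_eval (aH l H) p \<cdot>\<^sub>m mlin \<Omega> y l + common) *\<^sub>v v H
         + vsum N exchange (hyps_dep \<Omega> l \<inter> hyps_dep \<Omega> y)
         + \<epsilon> \<cdot>\<^sub>v vsum N (\<lambda>\<alpha>. (pd \<alpha> y / (p l - \<epsilon> * aff_eval \<alpha> p)) \<cdot>\<^sub>v
                        (eigproj \<Omega> l \<alpha> *\<^sub>v res_apply \<Omega> l v)) (eigvals \<Omega> l)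
       else
         (mconst \<Omega> y + pd (aH l H) y \<cdot>\<^sub>m mconst \<Omega> l - (\<epsilon> * pd (aH l H) y * p l) \<cdot>\<^sub>m 1\<^sub>m N
           + common) *\<^sub>v v H
         + vsum N exchange (CH \<Omega> l y H))"

definition laplace_op ::
    "complex \<Rightarrow> 'n::finite pfaff \<Rightarrow> 'n \<Rightarrow> 'n \<Rightarrow> 'n point \<Rightarrow> 'n blockvec \<Rightarrow> 'n blockvec" where
  "laplace_op \<epsilon> \<Omega> l y =
     (if y = l then laplace_op_x \<epsilon> \<Omega> l else laplace_op_y \<epsilon> \<Omega> l y)"

text \<open>A basis of \<open>(\<complex>\<^sup>N)\<^sup>q / \<K>\<^sup>x\<close> is encoded by its coordinate map: a surjective linear map
  \<open>(\<complex>\<^sup>N)\<^sup>q \<rightarrow> \<complex>\<^sup>m\<close> with kernel \<open>\<K>\<^sup>x\<close>, written as a row of \<open>m \<times> N\<close> blocks \<open>\<kappa> H\<close>.\<close>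

definition coord_map ::
    "'n::finite pfaff \<Rightarrow> 'n \<Rightarrow> nat \<Rightarrow> ('n point set \<Rightarrow> complex mat) \<Rightarrow> 'n blockvec \<Rightarrow> complex vec" where
  "coord_map \<Omega> l m \<kappa> v = vsum m (\<lambda>H. \<kappa> H *\<^sub>v v H) (hyps_dep \<Omega> l)"

definition quotient_basis ::
    "'n::finite pfaff \<Rightarrow> 'n \<Rightarrow> nat \<Rightarrow> ('n point set \<Rightarrow> complex mat) \<Rightarrow> bool" where
  "quotient_basis \<Omega> l m \<kappa> \<longleftrightarrow>
     (\<forall>H\<in>hyps_dep \<Omega> l. \<kappa> H \<in> carrier_mat m (rk \<Omega>)) \<and>
     coord_map \<Omega> l m \<kappa> ` blockspace \<Omega> l = carrier_vec m \<and>
     {v \<in> blockspace \<Omega> l. coord_map \<Omega> l m \<kappa> v = 0\<^sub>v m} = kernelspace \<Omega> l"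

text \<open>\<open>\<Omega>'\<close> is the matrix, in one fixed basis of \<open>(\<complex>\<^sup>N)\<^sup>q / \<K>\<^sup>x\<close>, of the form induced by the Laplace
  transform of \<open>\<Omega>\<close>. This is a relation since it involves the choice of a basis. The condition
  on \<open>hyps_dep \<Omega>' l\<close> excludes spurious hyperplanes with residue zero, on which \<open>cond_I\<close> depends.\<close>

definition middle_laplace_gen :: "complex \<Rightarrow> 'n::finite \<Rightarrow> 'n pfaff \<Rightarrow> 'n pfaff \<Rightarrow> bool" where
  "middle_laplace_gen \<epsilon> l \<Omega> \<Omega>' \<longleftrightarrow> pfaff_form \<Omega>' \<and>
     hyps_dep \<Omega>' l = (\<lambda>\<alpha>. {p. p l = \<epsilon> * aff_eval \<alpha> p}) ` eigvals \<Omega> l \<and>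
     (\<exists>\<kappa>. quotient_basis \<Omega> l (rk \<Omega>') \<kappa> \<and>
        (\<forall>y. generically (\<lambda>p. \<forall>v \<in> blockspace \<Omega> l.
           coord_map \<Omega> l (rk \<Omega>') \<kappa> (laplace_op \<epsilon> \<Omega> l y p v)
             = form_coeff \<Omega>' y p *\<^sub>v coord_map \<Omega> l (rk \<Omega>') \<kappa> v)))"

definition middle_laplace :: "'n::finite \<Rightarrow> 'n pfaff \<Rightarrow> 'n pfaff \<Rightarrow> bool" where
  "middle_laplace l = middle_laplace_gen 1 l"

definition inv_middle_laplace :: "'n::finite \<Rightarrow> 'n pfaff \<Rightarrow> 'n pfaff \<Rightarrow> bool" where
  "inv_middle_laplace l = middle_laplace_gen (- 1) l"

end

theory Submission
  imports Defs "HOL-Library.Function_Algebras"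
begin

text \<open>The theorem is an instance of Harnad duality. With the quotient of \<open>(\<complex>\<^sup>N)\<^sup>q\<close> by the kernels as
  an intermediate space, the \<open>dx\<close>-coefficient of \<open>\<Omega>\<close> becomes \<open>S + P (x - T)\<^sup>-\<^sup>1 Q\<close>, where \<open>S = S\<^sub>x\<close>, the
  operator \<open>T\<close> is diagonal with eigenvalues \<open>a\<^sub>H\<close>, and \<open>P\<close>, \<open>Q\<close> factor the residues. The middle Laplace
  transforms replace \<open>(S, T, P, Q)\<close> by \<open>(- \<epsilon> T, \<epsilon> S, - Q, P)\<close> with \<open>\<epsilon> = 1\<close> or \<open>-1\<close>; applying the two
  transforms in succession only changes the signs of \<open>P\<close> and \<open>Q\<close>. If \<open>\<Omega>\<close> is irreducible and
  non-exceptional, then \<open>Q\<close> is injective on every eigenspace of \<open>S\<close> and \<open>P\<close> maps onto it after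
  projection, so that no further quotient has to be taken for the dual system. The \<open>dy\<close>-coefficients
  are tied to \<open>(S, T, P, Q)\<close> by relations invariant under the duality. These relations also follow
  from integrability, so they are carried over to the transforms.\<close>

section \<open>Matrices as linear operators\<close>

text \<open>The quadruple \<open>(S, T, P, Q)\<close> controls only the dx-coefficient; the
  difficulty lies in the dy-coefficients. Their parts free of x, called \<open>R\<close> for
  \<Omega> and \<open>R'\<close> for the transform, satisfy linear relations with
  \<open>(S, T, P, Q)\<close>, which come from comparing partial fractions in x in the integrability
  condition. The relations do not visibly determine \<open>R\<close>: a discrepancy may remain,
  namely an operator that commutes with \<open>S\<close> and kills \<open>P\<close>. It vanishes on
  every eigenspace of \<open>S\<close> because \<open>P\<close> is onto there after projection, and
  this settles the double transform. In the same way the commutator of \<open>R'\<close> for two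
  variables commutes with \<open>T\<close> and kills \<open>Q\<close>, so it vanishes because the
  components of \<open>Q\<close> in the eigenspaces of \<open>T\<close> span the quotient. Condition
  (I) enters as a dichotomy: \<open>S\<close> or \<open>T\<close> does not involve the other
  variables, so mixed products of their derivatives disappear. All identities between coefficients
  are proved at generic points only; commutation at every point off the poles, as integrability
  demands, is then recovered by continuity along lines.\<close>

definition fscale :: "complex \<Rightarrow> ('b \<Rightarrow> complex) \<Rightarrow> 'b \<Rightarrow> complex" where
  "fscale c f = (\<lambda>i. c * f i)"

lemma fscale_apply [simp]: "fscale c f i = c * f i"
  by (simp add: fscale_def)

interpretation fvs: vector_space "fscale :: complex \<Rightarrow> ('b \<Rightarrow> complex) \<Rightarrow> _"
  by unfold_locales (auto simp: fun_eq_iff algebra_simps)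

lemma sum_fun_apply: "(\<Sum>s\<in>S. f s) i = (\<Sum>s\<in>S. (f s i :: 'a::comm_monoid_add))"
  by (induction S rule: infinite_finite_induct) (auto simp: plus_fun_def zero_fun_def)

text \<open>Matrices of varying sizes are treated as elements of one ring, the endomorphisms of
  \<open>nat \<Rightarrow> complex\<close>; a matrix acts on the first coordinates and forgets the others.\<close>

typedef linop = "{f :: (nat \<Rightarrow> complex) \<Rightarrow> nat \<Rightarrow> complex.
    (\<forall>u v. f (u + v) = f u + f v) \<and> (\<forall>c u. f (fscale c u) = fscale c (f u))}"
  morphisms app Abs_linop
  by (rule exI[of _ id]) auto

setup_lifting type_definition_linop

lemma linop_eqI: "(\<And>u. app X u = app Y u) \<Longrightarrow> X = Y"
  by (metis app_inject ext)

instantiation linop :: ring_1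
begin
lift_definition zero_linop :: linop is "\<lambda>u. 0" by (auto simp: fun_eq_iff)
lift_definition one_linop :: linop is "\<lambda>u. u" by auto
lift_definition plus_linop :: "linop \<Rightarrow> linop \<Rightarrow> linop" is "\<lambda>f g u. f u + g u"
  by (auto simp: fun_eq_iff algebra_simps)
lift_definition uminus_linop :: "linop \<Rightarrow> linop" is "\<lambda>f u. - f u"
  by (auto simp: fun_eq_iff algebra_simps)
lift_definition minus_linop :: "linop \<Rightarrow> linop \<Rightarrow> linop" is "\<lambda>f g u. f u - g u"
  by (auto simp: fun_eq_iff algebra_simps)
lift_definition times_linop :: "linop \<Rightarrow> linop \<Rightarrow> linop" is "\<lambda>f g u. f (g u)"
  by auto
instance
proof
  show "(0::linop) \<noteq> 1"
    by transfer (auto simp: fun_eq_iff intro!: exI[of _ "\<lambda>_. 1"])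
qed (transfer; auto simp: fun_eq_iff algebra_simps)+
end

lift_definition scl :: "complex \<Rightarrow> linop \<Rightarrow> linop" (infixr "\<odot>\<^sub>C" 75) is "\<lambda>c f u. fscale c (f u)"
  by (auto simp: fun_eq_iff algebra_simps)

lemma app_0 [simp]: "app 0 u = 0" by (rule zero_linop.rep_eq[THEN fun_cong])
lemma app_plus [simp]: "app (X + Y) u = app X u + app Y u" by (rule plus_linop.rep_eq[THEN fun_cong])
lemma app_minus [simp]: "app (X - Y) u = app X u - app Y u" by (rule minus_linop.rep_eq[THEN fun_cong])
lemma app_uminus [simp]: "app (- X) u = - app X u" by (rule uminus_linop.rep_eq[THEN fun_cong])
lemma app_times [simp]: "app (X * Y) u = app X (app Y u)" by (rule times_linop.rep_eq[THEN fun_cong])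
lemma app_scl [simp]: "app (c \<odot>\<^sub>C X) u = fscale c (app X u)" by (rule scl.rep_eq[THEN fun_cong])
lemma app_sum: "app (\<Sum>s\<in>S. F s) u = (\<Sum>s\<in>S. app (F s) u)"
  by (induction S rule: infinite_finite_induct) auto

lemma app_add_vec [simp]: "app X (u + v) = app X u + app X v" using app[of X] by auto
lemma app_scale_vec [simp]: "app X (fscale c u) = fscale c (app X u)" using app[of X] by auto
lemma app_zero_vec [simp]: "app X 0 = 0"
  by (metis add_cancel_right_right app_add_vec)
lemma app_minus_vec [simp]: "app X (- u) = - app X u"
  by (metis add.right_inverse app_add_vec app_zero_vec minus_unique)
lemma app_diff_vec [simp]: "app X (u - v) = app X u - app X v"
  by (metis app_add_vec app_minus_vec diff_conv_add_uminus)
lemma app_sum_vec: "app X (\<Sum>s\<in>S. f s) = (\<Sum>s\<in>S. app X (f s))"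
proof (induction S rule: infinite_finite_induct)
  case (insert x F)
  then show ?case by (simp only: sum.insert app_add_vec not_False_eq_True)
qed (simp_all only: sum.infinite sum.empty app_zero_vec not_False_eq_True)

lemma linear_app: "Vector_Spaces.linear fscale fscale (app X)"
  by unfold_locales auto

lemma app_Abs_linear: "Vector_Spaces.linear fscale fscale f \<Longrightarrow> app (Abs_linop f) = f"
  by (subst Abs_linop_inverse)
    (auto simp: Vector_Spaces.linear_iff)

lemma scl_simps [simp]:
  "(c \<odot>\<^sub>C X) * Y = c \<odot>\<^sub>C (X * Y)" "X * (c \<odot>\<^sub>C Y) = c \<odot>\<^sub>C (X * Y)"
  "c \<odot>\<^sub>C d \<odot>\<^sub>C X = (c * d) \<odot>\<^sub>C X" "0 \<odot>\<^sub>C X = 0" "1 \<odot>\<^sub>C X = X" "c \<odot>\<^sub>C 0 = 0"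
  "(- c) \<odot>\<^sub>C X = - (c \<odot>\<^sub>C X)" "c \<odot>\<^sub>C (- X) = - (c \<odot>\<^sub>C X)"
  by (auto intro!: linop_eqI simp: fun_eq_iff algebra_simps)

lemma scl_distrib:
  "c \<odot>\<^sub>C (X + Y) = c \<odot>\<^sub>C X + c \<odot>\<^sub>C Y" "(c + d) \<odot>\<^sub>C X = c \<odot>\<^sub>C X + d \<odot>\<^sub>C X"
  "c \<odot>\<^sub>C (X - Y) = c \<odot>\<^sub>C X - c \<odot>\<^sub>C Y" "(c - d) \<odot>\<^sub>C X = c \<odot>\<^sub>C X - d \<odot>\<^sub>C X"
  by (auto intro!: linop_eqI simp: fun_eq_iff algebra_simps)

lemma scl_sum_right: "c \<odot>\<^sub>C (\<Sum>s\<in>S. F s) = (\<Sum>s\<in>S. c \<odot>\<^sub>C F s)"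
  by (induction S rule: infinite_finite_induct) (auto simp: scl_distrib)

lemma scl_sum_left: "(\<Sum>s\<in>S. g s) \<odot>\<^sub>C X = (\<Sum>s\<in>S. g s \<odot>\<^sub>C X)"
  by (induction S rule: infinite_finite_induct) (auto simp: scl_distrib)

lemma scl_cancel: "c \<noteq> 0 \<Longrightarrow> c \<odot>\<^sub>C X = c \<odot>\<^sub>C Y \<longleftrightarrow> X = Y"
  by (metis left_inverse scl_simps(3,5))

lemma scl_eq_0_iff: "c \<odot>\<^sub>C X = 0 \<longleftrightarrow> c = 0 \<or> X = 0"
  by (metis scl_cancel scl_simps(4,6))

text \<open>Simplification associates products to the right, so an equation for \<open>a * b\<close>
  no longer matches inside a longer product. This form does match, and is used for every relation
  that has to be applied in the middle of a word.\<close>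

lemma mult_rewrite: "(a::'a::semigroup_mult) * b = c \<Longrightarrow> a * (b * d) = c * d"
  by (metis mult.assoc)

section \<open>Embedding of matrices and vectors\<close>

definition emb :: "complex mat \<Rightarrow> linop" where
  "emb A = Abs_linop (\<lambda>f i. if i < dim_row A then \<Sum>j<dim_col A. A $$ (i, j) * f j else 0)"

definition idn :: "nat \<Rightarrow> linop" where
  "idn n = Abs_linop (\<lambda>f i. if i < n then f i else 0)"

definition delta :: "nat \<Rightarrow> nat \<Rightarrow> complex" where
  "delta j = (\<lambda>i. if i = j then 1 else 0)"

definition unemb :: "nat \<Rightarrow> nat \<Rightarrow> linop \<Rightarrow> complex mat" where
  "unemb n m X = mat n m (\<lambda>(i, j). app X (delta j) i)"

definition seq_of :: "complex vec \<Rightarrow> nat \<Rightarrow> complex" where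
  "seq_of v i = (if i < dim_vec v then v $ i else 0)"

lemma app_emb: "app (emb A) f i = (if i < dim_row A then \<Sum>j<dim_col A. A $$ (i, j) * f j else 0)"
proof -
  have "app (emb A) = (\<lambda>f i. if i < dim_row A then \<Sum>j<dim_col A. A $$ (i, j) * f j else 0)"
    unfolding emb_def
    by (rule app_Abs_linear, unfold_locales)
      (auto simp: fun_eq_iff algebra_simps sum.distrib sum_distrib_left)
  then show ?thesis by simp
qed

lemma app_idn: "app (idn n) f i = (if i < n then f i else 0)"
proof -
  have "app (idn n) = (\<lambda>f i. if i < n then f i else 0)"
    unfolding idn_def by (rule app_Abs_linear, unfold_locales) (auto simp: fun_eq_iff)
  then show ?thesis by simp
qed

lemma idn_idem [simp]: "idn n * idn n = idn n"
  by (rule linop_eqI) (auto simp: fun_eq_iff app_idn)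

lemma app_idn_sum: "app (idn n) f = (\<Sum>j<n. fscale (f j) (delta j))"
  by (auto simp: fun_eq_iff app_idn sum_fun_apply delta_def if_distrib cong: if_cong)

lemma emb_mult:
  assumes "A \<in> carrier_mat n k" "B \<in> carrier_mat k m"
  shows "emb (A * B) = emb A * emb B"
proof (rule linop_eqI, rule ext)
  fix f i
  have "(\<Sum>j<m. (\<Sum>t<k. A $$ (i, t) * B $$ (t, j)) * f j)
      = (\<Sum>t<k. A $$ (i, t) * (\<Sum>j<m. B $$ (t, j) * f j))"
    by (simp add: sum_distrib_left sum_distrib_right mult.assoc) (rule sum.swap)
  then show "app (emb (A * B)) f i = app (emb A * emb B) f i"
    using assms by (auto simp: app_emb scalar_prod_def lessThan_atLeast0 intro!: sum.cong)
qed

lemma emb_add: "A \<in> carrier_mat n m \<Longrightarrow> B \<in> carrier_mat n m \<Longrightarrow> emb (A + B) = emb A + emb B"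
  by (rule linop_eqI) (auto simp: fun_eq_iff app_emb algebra_simps sum.distrib)

lemma emb_minus: "A \<in> carrier_mat n m \<Longrightarrow> B \<in> carrier_mat n m \<Longrightarrow> emb (A - B) = emb A - emb B"
  by (rule linop_eqI) (auto simp: fun_eq_iff app_emb algebra_simps sum_subtractf)

lemma emb_smult: "emb (c \<cdot>\<^sub>m A) = c \<odot>\<^sub>C emb A"
  by (rule linop_eqI) (auto simp: fun_eq_iff app_emb algebra_simps sum_distrib_left)

lemma emb_zero [simp]: "emb (0\<^sub>m n m) = 0"
  by (rule linop_eqI) (auto simp: fun_eq_iff app_emb)

lemma emb_one [simp]: "emb (1\<^sub>m n) = idn n"
proof (rule linop_eqI, rule ext)
  fix u i show "app (emb (1\<^sub>m n)) u i = app (idn n) u i"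
    by (cases "i < n") (simp_all add: app_emb app_idn if_distrib[of "\<lambda>x. x * _"] cong: if_cong)
qed

lemma emb_msum:
  "(\<And>s. s \<in> S \<Longrightarrow> F s \<in> carrier_mat N N) \<Longrightarrow> emb (msum N F S) = (\<Sum>s\<in>S. emb (F s))"
proof (rule linop_eqI, rule ext)
  fix f i assume *: "\<And>s. s \<in> S \<Longrightarrow> F s \<in> carrier_mat N N"
  have "app (emb (msum N F S)) f i = (if i < N then \<Sum>j<N. (\<Sum>s\<in>S. F s $$ (i, j)) * f j else 0)"
    by (auto simp: app_emb msum_def intro!: sum.cong)
  also have "\<dots> = (\<Sum>s\<in>S. if i < N then \<Sum>j<N. F s $$ (i, j) * f j else 0)"
    by (simp add: sum_distrib_right) (auto intro: sum.swap)
  also have "\<dots> = (\<Sum>s\<in>S. app (emb (F s)) f i)"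
    using * by (intro sum.cong) (auto simp: app_emb dest!: *)
  finally show "app (emb (msum N F S)) f i = app (\<Sum>s\<in>S. emb (F s)) f i"
    by (simp add: app_sum sum_fun_apply)
qed

lemma msum_carrier [simp]: "msum N F S \<in> carrier_mat N N" by (simp add: msum_def)
lemma vsum_carrier [simp]: "vsum N F S \<in> carrier_vec N" by (simp add: vsum_def)

lemma idn_emb: "A \<in> carrier_mat n m \<Longrightarrow> idn n * emb A = emb A"
  by (rule linop_eqI) (auto simp: fun_eq_iff app_emb app_idn)

lemma emb_idn: "A \<in> carrier_mat n m \<Longrightarrow> emb A * idn m = emb A"
  by (rule linop_eqI) (auto simp: fun_eq_iff app_emb app_idn)

lemma app_delta: "j < dim_col A \<Longrightarrow> i < dim_row A \<Longrightarrow> app (emb A) (delta j) i = A $$ (i, j)"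
  by (simp add: app_emb delta_def if_distrib cong: if_cong)

lemma emb_inj:
  assumes "A \<in> carrier_mat n m" "B \<in> carrier_mat n m" "emb A = emb B" shows "A = B"
proof (rule eq_matI)
  fix i j assume "i < dim_row B" "j < dim_col B"
  then show "A $$ (i, j) = B $$ (i, j)"
    using assms app_delta[of j A i] app_delta[of j B i] by auto
qed (use assms in auto)

lemma unemb_carrier [simp]: "unemb n m X \<in> carrier_mat n m" by (simp add: unemb_def)

lemma emb_unemb: "emb (unemb n m X) = idn n * X * idn m"
proof (rule linop_eqI, rule ext)
  fix u i
  have "app X (app (idn m) u) i = (\<Sum>j<m. u j * app X (delta j) i)"
    unfolding app_idn_sum[of m u] by (simp add: app_sum_vec sum_fun_apply)
  then show "app (emb (unemb n m X)) u i = app (idn n * X * idn m) u i"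
    by (auto simp: app_emb app_idn[of n] unemb_def mult.commute intro!: sum.cong)
qed

lemma seq_of_mult: "A \<in> carrier_mat n m \<Longrightarrow> v \<in> carrier_vec m \<Longrightarrow> seq_of (A *\<^sub>v v) = app (emb A) (seq_of v)"
  by (auto simp: fun_eq_iff app_emb seq_of_def scalar_prod_def lessThan_atLeast0 intro!: sum.cong)

lemma seq_of_add: "v \<in> carrier_vec n \<Longrightarrow> w \<in> carrier_vec n \<Longrightarrow> seq_of (v + w) = seq_of v + seq_of w"
  by (auto simp: fun_eq_iff seq_of_def)

lemma seq_of_minus: "v \<in> carrier_vec n \<Longrightarrow> w \<in> carrier_vec n \<Longrightarrow> seq_of (v - w) = seq_of v - seq_of w"
  by (auto simp: fun_eq_iff seq_of_def)

lemma seq_of_smult: "seq_of (c \<cdot>\<^sub>v v) = fscale c (seq_of v)"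
  by (auto simp: fun_eq_iff seq_of_def)

lemma seq_of_zero [simp]: "seq_of (0\<^sub>v n) = 0"
  by (auto simp: fun_eq_iff seq_of_def)

lemma seq_of_vsum:
  assumes F: "\<And>s. s \<in> S \<Longrightarrow> F s \<in> carrier_vec N"
  shows "seq_of (vsum N F S) = (\<Sum>s\<in>S. seq_of (F s))"
proof
  fix i
  have "(\<Sum>s\<in>S. seq_of (F s) i) = (\<Sum>s\<in>S. if i < N then F s $ i else 0)"
    using F by (intro sum.cong) (auto simp: seq_of_def dest!: F)
  then show "seq_of (vsum N F S) i = (\<Sum>s\<in>S. seq_of (F s)) i"
    by (auto simp: seq_of_def vsum_def sum_fun_apply)
qed

lemma idn_seq_of: "v \<in> carrier_vec n \<Longrightarrow> app (idn n) (seq_of v) = seq_of v"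
  by (auto simp: fun_eq_iff app_idn seq_of_def)

lemma seq_of_inj: "v \<in> carrier_vec n \<Longrightarrow> w \<in> carrier_vec n \<Longrightarrow> seq_of v = seq_of w \<Longrightarrow> v = w"
  by (intro eq_vecI) (auto simp: fun_eq_iff seq_of_def, metis)

lemma seq_of_vec: "seq_of (vec n f) = app (idn n) f"
  by (auto simp: fun_eq_iff app_idn seq_of_def)

lemma linop_eq_vecI:
  assumes "X * idn n = X" "Y * idn n = Y" "\<And>v. v \<in> carrier_vec n \<Longrightarrow> app X (seq_of v) = app Y (seq_of v)"
  shows "X = Y"
proof (rule linop_eqI)
  fix u show "app X u = app Y u"
    using assms(3)[of "vec n u"] assms(1,2) by (metis app_times seq_of_vec vec_carrier)
qed

section \<open>Spectral resolutions\<close>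

interpretation fvp: vector_space_pair
  "fscale :: complex \<Rightarrow> ('b \<Rightarrow> complex) \<Rightarrow> _" "fscale :: complex \<Rightarrow> ('c \<Rightarrow> complex) \<Rightarrow> _" ..

lemma inj_delta: "inj delta"
  by (auto simp: inj_def delta_def fun_eq_iff split: if_splits)

lemma independent_delta: "fvs.independent (delta ` {..<m})"
proof (rule fvs.independent_if_scalars_zero)
  fix f x assume *: "(\<Sum>x\<in>delta ` {..<m}. fscale (f x) x) = 0" "x \<in> delta ` {..<m}"
  then obtain k where k: "x = delta k" "k < m" by auto
  have "(\<Sum>j<m. fscale (f (delta j)) (delta j)) = 0"
    using * by (subst (asm) sum.reindex) (auto intro: inj_on_subset[OF inj_delta])
  from fun_cong[OF this, of k] show "f x = 0"
    using k by (simp add: sum_fun_apply delta_def if_distrib cong: if_cong)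
qed simp

lemma span_delta: "app (idn m) u \<in> fvs.span (delta ` {..<m})"
  unfolding app_idn_sum by (intro fvs.span_sum fvs.span_scale fvs.span_base) auto

text \<open>\<open>Y\<close> is injective on the span of the first \<open>m\<close> unit vectors and
  maps it into the span of the first \<open>n\<close>. Applied to both factors of an inverse pair
  this gives equality of sizes, the only dimension count that is made.\<close>

lemma idn_le_of_left_inverse:
  assumes "X * Y = idn m" "idn n * Y = Y" shows "m \<le> n"
proof -
  have inj: "inj_on (app Y) (fvs.span (delta ` {..<m}))"
  proof (rule inj_onI)
    fix u v assume *: "u \<in> fvs.span (delta ` {..<m})" "v \<in> fvs.span (delta ` {..<m})" "app Y u = app Y v"
    have "fvs.span (delta ` {..<m}) \<subseteq> {u. app (idn m) u = u}"
      by (rule fvs.span_minimal) (auto simp: fvs.subspace_def fun_eq_iff app_idn delta_def)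
    then have "app (idn m) u = u" "app (idn m) v = v" using * by auto
    moreover have "app X (app Y w) = app (idn m) w" for w
      using assms(1) by (metis app_times)
    ultimately show "u = v" using * by metis
  qed
  have "fvs.independent (app Y ` delta ` {..<m})"
    using fvp.linear_independent_injective_image[OF linear_app independent_delta inj] by simp
  moreover have "app Y ` delta ` {..<m} \<subseteq> fvs.span (delta ` {..<n})"
    using span_delta[of n] assms(2) by (metis app_times image_subsetI)
  ultimately have "card (app Y ` delta ` {..<m}) \<le> card (delta ` {..<n})"
    by (intro fvs.independent_span_bound[THEN conjunct2]) auto
  moreover have "inj_on (app Y) (delta ` {..<m})"
    using inj by (rule inj_on_subset) (auto intro: fvs.span_base)
  ultimately show ?thesis
    using inj_delta by (simp add: card_image inj_on_subset)
qed

text \<open>The basis of the span is chosen inside \<open>S\<close>, which need not be a subspace.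
  For a union of eigenspaces this yields a basis of eigenvectors. \<Phi> parametrises the span by
  the first \<open>m\<close> coordinates, and \<Psi> is a linear left inverse of it there.\<close>

lemma subspace_coordinates:
  fixes S :: "('b \<Rightarrow> complex) set"
  assumes "finite T" "S \<subseteq> fvs.span T"
  obtains m \<Phi> \<Psi> where
    "Vector_Spaces.linear fscale fscale \<Phi>" "Vector_Spaces.linear fscale fscale \<Psi>"
    "\<And>j. j < m \<Longrightarrow> \<Phi> (delta j) \<in> S" "\<And>x. \<Phi> (app (idn m) x) = \<Phi> x" "\<And>x. \<Phi> x \<in> fvs.span S"
    "\<And>u. u \<in> fvs.span S \<Longrightarrow> \<Phi> (\<Psi> u) = u" "\<And>x. \<Psi> (\<Phi> x) = app (idn m) x"
    "\<And>u. app (idn m) (\<Psi> u) = \<Psi> u"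
proof -
  obtain B where B: "B \<subseteq> S" "fvs.independent B" "S \<subseteq> fvs.span B"
    using fvs.maximal_independent_subset by blast
  have fin: "finite B" using fvs.independent_span_bound[OF assms(1) B(2)] B(1) assms(2) by blast
  then obtain b where b: "bij_betw b {..<card B} B"
    using ex_bij_betw_nat_finite[of B] by (auto simp: lessThan_atLeast0)
  define m where "m = card B"
  note b = b[folded m_def]
  define \<Phi> where "\<Phi> x = (\<Sum>j<m. fscale (x j) (b j))" for x :: "nat \<Rightarrow> complex"
  have lin: "Vector_Spaces.linear fscale fscale \<Phi>"
    by unfold_locales (auto simp: \<Phi>_def fun_eq_iff sum_fun_apply algebra_simps sum.distrib sum_distrib_left)
  have bB: "b j \<in> B" if "j < m" for j using b that by (auto simp: bij_betw_def)
  have \<Phi>idn: "\<Phi> (app (idn m) x) = \<Phi> x" for x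
    by (simp add: \<Phi>_def app_idn)
  have \<Phi>delta: "\<Phi> (delta j) = b j" if "j < m" for j
    using that by (simp add: \<Phi>_def fun_eq_iff sum_fun_apply delta_def if_distrib[of "\<lambda>x. x * _"] cong: if_cong)
  let ?V = "{x. app (idn m) x = x}"
  have subV: "fvs.subspace ?V" by (auto simp: fvs.subspace_def)
  have inj: "inj_on \<Phi> ?V"
  proof (subst fvp.linear_inj_on_iff_eq_0[OF lin subV], clarify)
    fix x assume x: "app (idn m) x = x" "\<Phi> x = 0"
    have "(\<Sum>v\<in>B. fscale (x (inv_into {..<m} b v)) v) = \<Phi> x"
      unfolding \<Phi>_def by (subst sum.reindex_bij_betw[OF b, symmetric])
        (use b in \<open>auto simp: bij_betw_def inv_into_f_f intro!: sum.cong\<close>)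
    then have "x (inv_into {..<m} b v) = 0" if "v \<in> B" for v
      using fvs.independentD[OF B(2) fin order.refl _ that] x(2) by metis
    then have "x j = 0" if "j < m" for j
      using bB[OF that] b that by (metis bij_betw_def inv_into_f_f lessThan_iff)
    then have "app (idn m) x = 0" by (auto simp: fun_eq_iff app_idn)
    then show "x = 0" using x by simp
  qed
  obtain \<Psi> where \<Psi>: "\<Psi> ` UNIV \<subseteq> ?V" "Vector_Spaces.linear fscale fscale \<Psi>" "\<forall>v\<in>?V. \<Psi> (\<Phi> v) = v"
    using fvp.linear_exists_left_inverse_on[OF lin subV inj] by auto
  have spanSB: "fvs.span S = fvs.span B"
    using B by (metis fvs.span_mono fvs.span_minimal fvs.subspace_span subset_antisym)
  have \<Phi>span: "\<Phi> x \<in> fvs.span S" for x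
    unfolding \<Phi>_def spanSB by (intro fvs.span_sum fvs.span_scale fvs.span_base) (auto intro: bB)
  have surj: "\<exists>x. u = \<Phi> x" if u: "u \<in> fvs.span S" for u
  proof -
    obtain c where "u = (\<Sum>v\<in>B. fscale (c v) v)"
      using u fvs.span_finite[OF fin] spanSB by auto
    then have "u = \<Phi> (\<lambda>j. c (b j))"
      unfolding \<Phi>_def by (subst (asm) sum.reindex_bij_betw[OF b, symmetric]) auto
    then show ?thesis by blast
  qed
  have \<Psi>\<Phi>: "\<Psi> (\<Phi> x) = app (idn m) x" for x
    using \<Psi>(3)[rule_format, of "app (idn m) x"] \<Phi>idn[of x]
    by (metis (mono_tags, lifting) app_times idn_idem mem_Collect_eq)
  show thesis
  proof (rule that[OF lin \<Psi>(2) _ \<Phi>idn \<Phi>span _ \<Psi>\<Phi>])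
    show "\<Phi> (delta j) \<in> S" if "j < m" for j using \<Phi>delta[OF that] bB[OF that] B(1) by auto
    show "\<Phi> (\<Psi> u) = u" if "u \<in> fvs.span S" for u
      using surj[OF that] \<Psi>\<Phi> \<Phi>idn by auto
    show "app (idn m) (\<Psi> u) = \<Psi> u" for u using \<Psi>(1) by auto
  qed
qed

text \<open>A complete family of orthogonal idempotents; some of them may be zero. The unit
  \<open>e\<close> is a parameter because the matrices of size \<open>n\<close> form a corner of the
  ring \<open>linop\<close>, whose unit is \<open>idn n\<close> and not \<open>1\<close>.\<close>

definition resolution :: "linop \<Rightarrow> 'i set \<Rightarrow> ('i \<Rightarrow> linop) \<Rightarrow> bool" where
  "resolution e I E \<longleftrightarrow> finite I \<and> (\<Sum>i\<in>I. E i) = e \<and>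
     (\<forall>i\<in>I. \<forall>j\<in>I. E i * E j = (if i = j then E i else 0))"

lemma resolution_finite: "resolution e I E \<Longrightarrow> finite I" by (simp add: resolution_def)
lemma resolution_sum: "resolution e I E \<Longrightarrow> (\<Sum>i\<in>I. E i) = e" by (simp add: resolution_def)
lemma resolution_mult:
  "resolution e I E \<Longrightarrow> i \<in> I \<Longrightarrow> j \<in> I \<Longrightarrow> E i * E j = (if i = j then E i else 0)"
  by (simp add: resolution_def)

lemma resolution_lin_mult:
  assumes "resolution e I E" "j \<in> I"
  shows "(\<Sum>i\<in>I. c i \<odot>\<^sub>C E i) * E j = c j \<odot>\<^sub>C E j" "E j * (\<Sum>i\<in>I. c i \<odot>\<^sub>C E i) = c j \<odot>\<^sub>C E j"
proof -
  have "(\<Sum>i\<in>I. c i \<odot>\<^sub>C (E i * E j)) = (\<Sum>i\<in>I. if i = j then c j \<odot>\<^sub>C E j else 0)"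
    using resolution_mult[OF assms(1) _ assms(2)] by (intro sum.cong) auto
  then show "(\<Sum>i\<in>I. c i \<odot>\<^sub>C E i) * E j = c j \<odot>\<^sub>C E j"
    using assms by (simp add: sum_distrib_right resolution_finite)
  have "(\<Sum>i\<in>I. c i \<odot>\<^sub>C (E j * E i)) = (\<Sum>i\<in>I. if i = j then c j \<odot>\<^sub>C E j else 0)"
    using resolution_mult[OF assms(1) assms(2)] by (intro sum.cong) auto
  then show "E j * (\<Sum>i\<in>I. c i \<odot>\<^sub>C E i) = c j \<odot>\<^sub>C E j"
    using assms by (simp add: sum_distrib_left resolution_finite)
qed

lemma resolution_unit:
  assumes "resolution e I E" "j \<in> I" shows "e * E j = E j" "E j * e = E j"
  using resolution_lin_mult[OF assms, of "\<lambda>_. 1"] resolution_sum[OF assms(1)] by auto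

lemma resolution_mult_lin:
  assumes "resolution e I E"
  shows "(\<Sum>i\<in>I. c i \<odot>\<^sub>C E i) * (\<Sum>i\<in>I. d i \<odot>\<^sub>C E i) = (\<Sum>i\<in>I. (c i * d i) \<odot>\<^sub>C E i)"
  unfolding sum_distrib_left[of "\<Sum>i\<in>I. c i \<odot>\<^sub>C E i"]
  by (intro sum.cong) (simp_all add: resolution_lin_mult[OF assms] mult.commute)

text \<open>Commuting with the combination multiplies the block \<open>E i * X * E j\<close> by
  \<open>c i\<close> on one side and by \<open>c j\<close> on the other. As the coefficients are
  distinct, the off-diagonal blocks of \<open>X\<close> vanish.\<close>

lemma resolution_commute:
  assumes r: "resolution e I E" and X: "e * X = X" "X * e = X"
    and inj: "inj_on c I" and comm: "X * (\<Sum>i\<in>I. c i \<odot>\<^sub>C E i) = (\<Sum>i\<in>I. c i \<odot>\<^sub>C E i) * X"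
    and i: "i \<in> I"
  shows "E i * X = X * E i"
proof -
  let ?B = "\<Sum>i\<in>I. c i \<odot>\<^sub>C E i"
  have z: "E i * X * E j = 0" if "i \<in> I" "j \<in> I" "i \<noteq> j" for i j
  proof -
    have "c i \<odot>\<^sub>C (E i * X * E j) = E i * ?B * X * E j"
      by (simp add: resolution_lin_mult[OF r that(1)])
    also have "\<dots> = E i * X * (?B * E j)" using comm by (metis mult.assoc)
    also have "\<dots> = c j \<odot>\<^sub>C (E i * X * E j)"
      by (simp add: resolution_lin_mult[OF r that(2)])
    finally have "(c i - c j) \<odot>\<^sub>C (E i * X * E j) = 0" by (simp add: scl_distrib)
    then show ?thesis using inj that by (auto simp: scl_eq_0_iff inj_on_def)
  qed
  have "E i * X = (\<Sum>j\<in>I. E i * X * E j)"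
    using X(2) resolution_sum[OF r] by (metis mult.assoc sum_distrib_left)
  also have "\<dots> = (\<Sum>j\<in>I. if j = i then E i * X * E i else 0)"
    using z[OF i] by (intro sum.cong) auto
  finally have 1: "E i * X = E i * X * E i" using i resolution_finite[OF r] by simp
  have "X * E i = (\<Sum>j\<in>I. E j * X * E i)"
    using X(1) resolution_sum[OF r] by (metis (no_types) sum_distrib_right)
  also have "\<dots> = (\<Sum>j\<in>I. if j = i then E i * X * E i else 0)"
    using z[OF _ i] by (intro sum.cong) auto
  finally show ?thesis using 1 i resolution_finite[OF r] by simp
qed

lemma diagonalizable_resolution:
  assumes A: "A \<in> carrier_mat N N" and d: "diagonalizable_mat A"
  shows "\<exists>\<Lambda> E. resolution (idn N) \<Lambda> E \<and> emb A = (\<Sum>t\<in>\<Lambda>. t \<odot>\<^sub>C E t)"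
proof -
  obtain D X Y where DXY: "D \<in> carrier_mat N N" "X \<in> carrier_mat N N" "Y \<in> carrier_mat N N"
      "X * Y = 1\<^sub>m N" "Y * X = 1\<^sub>m N" "A = X * D * Y" and diag: "diagonal_mat D"
    using d A unfolding diagonalizable_mat_def
    by (metis carrier_matD(1) insert_subset similar_matD)
  \<comment> \<open>\<open>F t\<close> is the projection onto the coordinates at which the diagonal
    matrix has the entry \<open>t\<close>; equal entries are thus collected into one
    eigenprojection.\<close>
  define F where "F t = emb (mat N N (\<lambda>(i, j). if i = j \<and> D $$ (i, i) = t then 1 else 0))" for t
  have appF: "app (F t) u i = (if i < N \<and> D $$ (i, i) = t then u i else 0)" for t u i
    by (auto simp: F_def app_emb if_distrib[of "\<lambda>x. x * _"] cong: if_cong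
      intro!: trans[OF sum.cong[OF refl, of _ _ "\<lambda>j. if j = i then if D $$ (i, i) = t then u i else 0 else 0"]])
  define \<Lambda> where "\<Lambda> = (\<lambda>i. D $$ (i, i)) ` {..<N}"
  have fin: "finite \<Lambda>" by (simp add: \<Lambda>_def)
  have sumF: "(\<Sum>t\<in>\<Lambda>. F t) = idn N"
    by (rule linop_eqI, rule ext) (auto simp: app_sum sum_fun_apply appF app_idn fin \<Lambda>_def cong: if_cong)
  have FF: "F s * F t = (if s = t then F s else 0)" for s t
    by (rule linop_eqI, rule ext) (auto simp: appF)
  have "app (emb D) u i = (if i < N then D $$ (i, i) * u i else 0)" for u i
  proof (cases "i < N")
    case True
    have "(\<Sum>j<N. D $$ (i, j) * u j) = (\<Sum>j<N. if j = i then D $$ (i, i) * u i else 0)"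
      using diag DXY(1) True by (intro sum.cong) (auto simp: diagonal_mat_def)
    then show ?thesis using True DXY(1) by (simp add: app_emb)
  qed (use DXY(1) in \<open>simp add: app_emb\<close>)
  moreover have "(\<Sum>t\<in>\<Lambda>. if D $$ (i, i) = t then t * u i else 0) = D $$ (i, i) * u i" if "i < N" for u :: "nat \<Rightarrow> complex" and i
    using fin that by (auto simp: \<Lambda>_def)
  ultimately have embD: "emb D = (\<Sum>t\<in>\<Lambda>. t \<odot>\<^sub>C F t)"
    by (intro linop_eqI ext) (auto simp: app_sum sum_fun_apply appF if_distrib[of "\<lambda>x. _ * x"] cong: if_cong)
  have XY: "emb X * emb Y = idn N" "emb Y * emb X = idn N"
    using DXY by (simp_all flip: emb_mult)
  have idF: "idn N * F t = F t" "F t * idn N = F t" for t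
    by (simp_all add: F_def idn_emb[of _ N N] emb_idn[of _ N N])
  define E where "E t = emb X * F t * emb Y" for t
  have EE: "E s * E t = (if s = t then E s else 0)" for s t
  proof -
    have "E s * E t = emb X * F s * (emb Y * emb X) * F t * emb Y" by (simp add: E_def mult.assoc)
    also have "\<dots> = emb X * (F s * F t) * emb Y" by (simp add: XY mult.assoc mult_rewrite[OF idF(1)] mult_rewrite[OF idF(2)] idF)
    finally show ?thesis by (simp add: FF E_def)
  qed
  have "(\<Sum>t\<in>\<Lambda>. E t) = emb X * (\<Sum>t\<in>\<Lambda>. F t) * emb Y"
    by (simp add: E_def sum_distrib_left sum_distrib_right)
  then have "(\<Sum>t\<in>\<Lambda>. E t) = idn N"
    using DXY XY by (simp add: sumF emb_idn)
  then have "resolution (idn N) \<Lambda> E" using EE fin by (simp add: resolution_def)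
  moreover have "emb A = emb X * emb D * emb Y"
    using DXY(1-3) unfolding DXY(6)
    by (metis emb_mult mult_carrier_mat)
  then have "emb A = (\<Sum>t\<in>\<Lambda>. t \<odot>\<^sub>C E t)"
    by (simp add: embD E_def sum_distrib_left sum_distrib_right)
  ultimately show ?thesis by blast
qed

text \<open>The vectors fixed by some \<open>E i\<close> span C^N and are eigenvectors of
  \<open>B\<close>, so a basis can be picked among them, even if the numbers \<open>c i\<close> are
  not distinct. This direction is what shows that the transform again satisfies condition
  (D).\<close>

lemma resolution_diagonalizable:
  assumes r: "resolution (idn N) I E" and B: "B \<in> carrier_mat N N" and eq: "emb B = (\<Sum>i\<in>I. c i \<odot>\<^sub>C E i)"
  shows "diagonalizable_mat B"
proof -
  define S where "S = (\<Union>i\<in>I. {u. app (E i) u = u})"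
  have ES: "app (E i) u \<in> S" if "i \<in> I" for i u
    using resolution_mult[OF r that that] that unfolding S_def
    by (intro UN_I[of i]) (simp_all flip: app_times)
  have idS: "app (idn N) u = u" if "u \<in> S" for u
  proof -
    obtain i where i: "i \<in> I" "app (E i) u = u" using \<open>u \<in> S\<close> by (auto simp: S_def)
    have "app (idn N) (app (E i) u) = app (E i) u"
      using resolution_unit(1)[OF r i(1)] by (simp flip: app_times)
    then show ?thesis using i by simp
  qed
  have "finite (delta ` {..<N})" by simp
  moreover have "S \<subseteq> fvs.span (delta ` {..<N})"
    using span_delta idS by (metis subsetI)
  ultimately obtain m \<Phi> \<Psi> where lin: "Vector_Spaces.linear fscale fscale \<Phi>" "Vector_Spaces.linear fscale fscale \<Psi>"
    and deltaS: "\<And>j. j < m \<Longrightarrow> \<Phi> (delta j) \<in> S" and \<Phi>idn: "\<And>x. \<Phi> (app (idn m) x) = \<Phi> x"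
    and \<Phi>span: "\<And>x. \<Phi> x \<in> fvs.span S"
    and \<Phi>\<Psi>: "\<And>u. u \<in> fvs.span S \<Longrightarrow> \<Phi> (\<Psi> u) = u" and \<Psi>\<Phi>: "\<And>x. \<Psi> (\<Phi> x) = app (idn m) x"
    and \<Psi>idn: "\<And>u. app (idn m) (\<Psi> u) = \<Psi> u"
    by (rule subspace_coordinates) blast
  have spanS: "app (idn N) u \<in> fvs.span S" for u
    unfolding resolution_sum[OF r, symmetric] app_sum by (intro fvs.span_sum fvs.span_base ES)
  have idspan: "app (idn N) u = u" if "u \<in> fvs.span S" for u
  proof -
    have "fvs.span S \<subseteq> {u. app (idn N) u = u}"
      by (rule fvs.span_minimal) (auto simp: fvs.subspace_def idS)
    then show ?thesis using that by auto
  qed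
  define X where "X = Abs_linop \<Phi>"
  define Y where "Y = Abs_linop \<Psi> * idn N"
  have apps: "app X = \<Phi>" "app (Abs_linop \<Psi>) = \<Psi>"
    using lin by (simp_all add: X_def app_Abs_linear)
  have XY: "X * Y = idn N"
    by (rule linop_eqI) (simp add: apps Y_def \<Phi>\<Psi> spanS)
  have YX: "Y * X = idn m"
    by (rule linop_eqI) (simp add: apps Y_def idspan \<Phi>span \<Psi>\<Phi>)
  have Xid: "idn N * X = X" "X * idn m = X"
    by (rule linop_eqI, simp add: apps idspan \<Phi>span \<Phi>idn)+
  have Yid: "idn m * Y = Y" "Y * idn N = Y"
    by (rule linop_eqI, simp add: apps Y_def \<Psi>idn) (simp add: Y_def mult.assoc)
  have mN: "m = N"
    using idn_le_of_left_inverse[OF YX Xid(1)] idn_le_of_left_inverse[OF XY Yid(1)] by simp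
  have "\<exists>i\<in>I. app (E i) (\<Phi> (delta j)) = \<Phi> (delta j)" if "j < m" for j
    using deltaS[OF that] by (auto simp: S_def)
  then obtain k where k: "\<And>j. j < m \<Longrightarrow> k j \<in> I" "\<And>j. j < m \<Longrightarrow> app (E (k j)) (\<Phi> (delta j)) = \<Phi> (delta j)"
    by metis
  have eig: "app (emb B) (\<Phi> (delta j)) = fscale (c (k j)) (\<Phi> (delta j))" if "j < m" for j
    using resolution_lin_mult(1)[OF r k(1)[OF that], of c] k(2)[OF that] unfolding eq
    by (metis app_scl app_times)
  define D where "D = mat N N (\<lambda>(i, j). if i = j then c (k j) else 0)"
  have D: "D \<in> carrier_mat N N" by (simp add: D_def)
  have appD: "app (emb D) (delta j) = fscale (c (k j)) (delta j)" if "j < N" for j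
    using that by (auto simp: D_def fun_eq_iff app_emb delta_def if_distrib[of "\<lambda>x. x * _"] if_distrib[of "\<lambda>x. _ * x"] cong: if_cong)
  have BX: "emb B * X = X * emb D"
  proof (rule linop_eqI)
    fix u
    have "app (emb B * X) u = app (emb B * X) (app (idn N) u)"
      using Xid mN by (metis app_times mult.assoc)
    also have "\<dots> = app (X * emb D) (app (idn N) u)"
      by (simp add: app_idn_sum app_sum_vec eig appD mN flip: apps) (simp add: apps eig mN appD)
    also have "\<dots> = app (X * emb D) u"
      using emb_idn[OF D] by (metis app_times mult.assoc)
    finally show "app (emb B * X) u = app (X * emb D) u" .
  qed
  let ?X = "unemb N N X" and ?Y = "unemb N N Y"
  have emb: "emb ?X = X" "emb ?Y = Y" using Xid Yid mN by (simp_all add: emb_unemb)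
  have "emb B = emb B * (X * Y)" by (simp add: XY emb_idn[OF B])
  also have "\<dots> = emb ?X * emb D * emb ?Y" by (simp add: BX emb flip: mult.assoc)
  also have "\<dots> = emb (?X * D * ?Y)"
    using D by (metis emb_mult mult_carrier_mat unemb_carrier)
  finally have "emb B = emb (?X * D * ?Y)" .
  then have "B = ?X * D * ?Y"
    by (rule emb_inj[rotated 2]) (use B D in \<open>auto intro!: mult_carrier_mat\<close>)
  moreover have "?X * ?Y = 1\<^sub>m N" "?Y * ?X = 1\<^sub>m N"
    using XY YX mN
    by (auto intro!: emb_inj[of _ N N] mult_carrier_mat[of _ N N] simp: emb_mult[of _ N N _ N] emb)
  ultimately have "similar_mat B D"
    using B D by (intro similar_matI[of _ _ ?X ?Y N]) auto
  moreover have "diagonal_mat D" by (simp add: D_def diagonal_mat_def)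
  ultimately show ?thesis unfolding diagonalizable_mat_def by blast
qed

text \<open>Restricting the joint spectrum to functions vanishing outside \<open>J\<close> makes a joint
  eigenvalue determine its index.\<close>

lemma joint_resolution:
  assumes "finite J"
    and "\<And>j. j \<in> J \<Longrightarrow> \<exists>\<Lambda> E. resolution e \<Lambda> E \<and> B j = (\<Sum>t\<in>\<Lambda>. t \<odot>\<^sub>C E t)"
    and "\<And>i j. i \<in> J \<Longrightarrow> j \<in> J \<Longrightarrow> B i * B j = B j * B i" and "e * e = e"
  shows "\<exists>\<A> E. resolution e \<A> E \<and> (\<forall>\<alpha>\<in>\<A>. \<forall>j. j \<notin> J \<longrightarrow> \<alpha> j = 0) \<and>
    (\<forall>j\<in>J. B j = (\<Sum>\<alpha>\<in>\<A>. \<alpha> j \<odot>\<^sub>C E \<alpha>)) \<and>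
    (\<forall>X. e * X = X \<longrightarrow> X * e = X \<longrightarrow> (\<forall>j\<in>J. X * B j = B j * X) \<longrightarrow> (\<forall>\<alpha>\<in>\<A>. E \<alpha> * X = X * E \<alpha>))" (is "?Q J")
  using assms(1-3)
proof (induction J)
  case empty
  show ?case
    using assms(4) by (intro exI[of _ "{\<lambda>_. 0}"] exI[of _ "\<lambda>_. e"]) (auto simp: resolution_def)
next
  case (insert j J)
  have "?Q J" by (rule insert.IH) (use insert.prems in auto)
  then obtain \<A> E where r: "resolution e \<A> E" and ext0: "\<forall>\<alpha>\<in>\<A>. \<forall>i. i \<notin> J \<longrightarrow> \<alpha> i = 0"
    and BE0: "\<forall>i\<in>J. B i = (\<Sum>\<alpha>\<in>\<A>. \<alpha> i \<odot>\<^sub>C E \<alpha>)"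
    and comm0: "\<forall>X. e * X = X \<longrightarrow> X * e = X \<longrightarrow> (\<forall>i\<in>J. X * B i = B i * X) \<longrightarrow> (\<forall>\<alpha>\<in>\<A>. E \<alpha> * X = X * E \<alpha>)"
    by (elim exE conjE)
  note ext = ext0[rule_format] and BE = BE0[rule_format]
  have comm: "E \<alpha> * X = X * E \<alpha>"
    if "e * X = X" "X * e = X" "\<forall>i\<in>J. X * B i = B i * X" "\<alpha> \<in> \<A>" for X \<alpha>
    using comm0 that by blast
  obtain \<Lambda> F where rF: "resolution e \<Lambda> F" and BF: "B j = (\<Sum>t\<in>\<Lambda>. t \<odot>\<^sub>C F t)"
    using insert.prems(1) by blast
  have commF: "F t * X = X * F t" if "e * X = X" "X * e = X" "X * B j = B j * X" "t \<in> \<Lambda>" for X t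
    using resolution_commute[OF rF that(1,2) inj_on_id2 _ that(4)] that(3) BF by simp
  have BeJ: "e * B i = B i" "B i * e = B i" if "i \<in> J" for i
    using resolution_unit[OF r] by (simp_all add: BE[OF that] sum_distrib_left sum_distrib_right)
  \<comment> \<open>The commutant clause of the statement is carried through the induction for the
    sake of this step: \<open>F t\<close> commutes with all earlier operators, hence with their
    joint projections.\<close>
  have EF: "E \<alpha> * F t = F t * E \<alpha>" if "\<alpha> \<in> \<A>" "t \<in> \<Lambda>" for \<alpha> t
  proof (rule comm[OF _ _ _ that(1)])
    show "\<forall>i\<in>J. F t * B i = B i * F t"
      using insert.prems(2) by (auto intro!: commF that BeJ)
  qed (use resolution_unit[OF rF that(2)] in auto)
  define g where "g = (\<lambda>(\<alpha>::'a \<Rightarrow> complex, t). \<alpha>(j := t))"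
  have inj: "inj_on g (\<A> \<times> \<Lambda>)"
  proof (rule inj_onI, clarify)
    fix \<alpha> t \<beta> s assume *: "\<alpha> \<in> \<A>" "\<beta> \<in> \<A>" "g (\<alpha>, t) = g (\<beta>, s)"
    have "\<alpha> j = 0" "\<beta> j = 0" using * ext insert.hyps by auto
    then have "\<alpha> = (g (\<alpha>, t))(j := 0)" "\<beta> = (g (\<beta>, s))(j := 0)" by (auto simp: g_def)
    then show "\<alpha> = \<beta> \<and> t = s" using *(3) by (metis case_prod_conv fun_upd_same g_def)
  qed
  define G where "G \<gamma> = E (\<gamma>(j := 0)) * F (\<gamma> j)" for \<gamma>
  have Gg: "G (g (\<alpha>, t)) = E \<alpha> * F t" if "\<alpha> \<in> \<A>" for \<alpha> t
  proof -
    have "(\<alpha>(j := t))(j := 0) = \<alpha>" using ext[OF that] insert.hyps by (auto simp: fun_eq_iff)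
    then show ?thesis by (simp add: G_def g_def)
  qed
  have sumG: "(\<Sum>\<gamma>\<in>g ` (\<A> \<times> \<Lambda>). h \<gamma> \<odot>\<^sub>C G \<gamma>) = (\<Sum>\<alpha>\<in>\<A>. \<Sum>t\<in>\<Lambda>. h (g (\<alpha>, t)) \<odot>\<^sub>C (E \<alpha> * F t))" for h
    unfolding sum.reindex[OF inj] sum.cartesian_product
    by (intro sum.cong) (auto simp: Gg)
  have "resolution e (g ` (\<A> \<times> \<Lambda>)) G"
    unfolding resolution_def
  proof (intro conjI ballI)
    show "finite (g ` (\<A> \<times> \<Lambda>))" using resolution_finite[OF r] resolution_finite[OF rF] by simp
    have "(\<Sum>\<gamma>\<in>g ` (\<A> \<times> \<Lambda>). G \<gamma>) = (\<Sum>\<alpha>\<in>\<A>. E \<alpha>) * (\<Sum>t\<in>\<Lambda>. F t)"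
      using sumG[of "\<lambda>_. 1"] by (simp add: sum_product)
    then show "(\<Sum>\<gamma>\<in>g ` (\<A> \<times> \<Lambda>). G \<gamma>) = e"
      using assms(4) by (simp add: resolution_sum[OF r] resolution_sum[OF rF])
    fix \<gamma> \<gamma>' assume "\<gamma> \<in> g ` (\<A> \<times> \<Lambda>)" "\<gamma>' \<in> g ` (\<A> \<times> \<Lambda>)"
    then obtain \<alpha> t \<beta> s where *: "\<gamma> = g (\<alpha>, t)" "\<gamma>' = g (\<beta>, s)" "\<alpha> \<in> \<A>" "\<beta> \<in> \<A>" "t \<in> \<Lambda>" "s \<in> \<Lambda>" by auto
    have "G \<gamma> * G \<gamma>' = E \<alpha> * (F t * E \<beta>) * F s" using * by (simp add: Gg mult.assoc)
    also have "\<dots> = (E \<alpha> * E \<beta>) * (F t * F s)" using EF[of \<beta> t] * by (metis mult.assoc)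
    also have "\<dots> = (if \<alpha> = \<beta> \<and> t = s then E \<alpha> * F t else 0)"
      using * by (auto simp: resolution_mult[OF r] resolution_mult[OF rF])
    also have "\<dots> = (if \<gamma> = \<gamma>' then G \<gamma> else 0)"
      using * inj by (auto simp: Gg inj_on_def)
    finally show "G \<gamma> * G \<gamma>' = (if \<gamma> = \<gamma>' then G \<gamma> else 0)" .
  qed
  moreover have "\<forall>\<gamma>\<in>g ` (\<A> \<times> \<Lambda>). \<forall>i. i \<notin> insert j J \<longrightarrow> \<gamma> i = 0"
    using ext by (auto simp: g_def)
  moreover have "\<forall>i\<in>insert j J. B i = (\<Sum>\<gamma>\<in>g ` (\<A> \<times> \<Lambda>). \<gamma> i \<odot>\<^sub>C G \<gamma>)"
  proof
    fix i assume "i \<in> insert j J"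
    then consider "i = j" | "i \<in> J" "i \<noteq> j" using insert.hyps by blast
    then show "B i = (\<Sum>\<gamma>\<in>g ` (\<A> \<times> \<Lambda>). \<gamma> i \<odot>\<^sub>C G \<gamma>)"
    proof cases
      case 1
      have "B j = (\<Sum>\<alpha>\<in>\<A>. E \<alpha>) * (\<Sum>t\<in>\<Lambda>. t \<odot>\<^sub>C F t)"
        using resolution_unit[OF rF] by (simp add: resolution_sum[OF r] BF sum_distrib_left)
      then show ?thesis unfolding sumG by (simp add: g_def 1 sum_product)
    next
      case 2
      have "B i = (\<Sum>\<alpha>\<in>\<A>. \<alpha> i \<odot>\<^sub>C E \<alpha>) * (\<Sum>t\<in>\<Lambda>. F t)"
        using resolution_unit[OF r] 2 by (simp add: resolution_sum[OF rF] BE sum_distrib_right)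
      then show ?thesis unfolding sumG using 2 by (simp add: g_def sum_product)
    qed
  qed
  moreover have "\<forall>X. e * X = X \<longrightarrow> X * e = X \<longrightarrow> (\<forall>i\<in>insert j J. X * B i = B i * X) \<longrightarrow>
      (\<forall>\<gamma>\<in>g ` (\<A> \<times> \<Lambda>). G \<gamma> * X = X * G \<gamma>)"
  proof (intro allI impI ballI)
    fix X \<gamma> assume X: "e * X = X" "X * e = X" "\<forall>i\<in>insert j J. X * B i = B i * X" and "\<gamma> \<in> g ` (\<A> \<times> \<Lambda>)"
    then obtain \<alpha> t where *: "\<gamma> = g (\<alpha>, t)" "\<alpha> \<in> \<A>" "t \<in> \<Lambda>" by auto
    then show "G \<gamma> * X = X * G \<gamma>"
      using comm[OF X(1,2) _ *(2)] commF[OF X(1,2) _ *(3)] X(3) by (simp add: Gg) (metis mult.assoc)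
  qed
  ultimately show ?case by blast
qed

text \<open>The quotient by the kernel of \<open>A i\<close> is the range of \<open>A i\<close>. So
  \<open>K i\<close> sends \<open>u\<close> to the coordinates of \<open>A i u\<close>, placed in
  block \<open>i\<close> of the direct sum \<open>S\<close> of the ranges, and \<open>s i\<close>
  picks a preimage under \<open>A i\<close> of the block \<open>i\<close> of a point of
  \<open>S\<close>. The ranges live in functions on pairs of an index and a natural number.\<close>

lemma block_quotient_exists:
  fixes A :: "'i \<Rightarrow> linop"
  assumes "finite I" and A: "\<And>i. i \<in> I \<Longrightarrow> idn N * A i = A i" "\<And>i. i \<in> I \<Longrightarrow> A i * idn N = A i"
  shows "\<exists>m K s. (\<forall>i\<in>I. idn m * K i = K i \<and> K i * idn N = K i \<and> idn N * s i = s i \<and> s i * idn m = s i) \<and>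
    (\<Sum>i\<in>I. K i * s i) = idn m \<and>
    (\<forall>i\<in>I. \<forall>j\<in>I. A i * s i * K j = (if i = j then A i else 0)) \<and>
    (\<forall>i\<in>I. \<forall>X. A i * X = 0 \<longrightarrow> K i * X = 0)"
proof -
  define blk where "blk i u = (\<lambda>(j, n). if j = i \<and> i \<in> I then u n else (0::complex))" for i :: 'i and u :: "nat \<Rightarrow> complex"
  define S where "S = {w. \<forall>i. (\<lambda>n. w (i, n)) \<in> (if i \<in> I then range (app (A i)) else {0})}"
  define unit where "unit = (\<lambda>x y :: 'i \<times> nat. if x = y then 1 else (0::complex))"
  have SI: "w \<in> S" if "\<And>i. i \<in> I \<Longrightarrow> (\<lambda>n. w (i, n)) = app (A i) (f i)" "\<And>i n. i \<notin> I \<Longrightarrow> w (i, n) = 0" for w f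
    unfolding S_def using that by (auto simp: fun_eq_iff)
  have SD: "\<exists>f. (\<forall>i\<in>I. (\<lambda>n. w (i, n)) = app (A i) (f i)) \<and> (\<forall>i n. i \<notin> I \<longrightarrow> w (i, n) = 0)" if "w \<in> S" for w
  proof -
    have "\<forall>i. \<exists>u. (i \<in> I \<longrightarrow> (\<lambda>n. w (i, n)) = app (A i) u) \<and> (i \<notin> I \<longrightarrow> (\<forall>n. w (i, n) = 0))"
    proof
      fix i have "(\<lambda>n. w (i, n)) \<in> (if i \<in> I then range (app (A i)) else {0})" using that by (simp add: S_def)
      then show "\<exists>u. (i \<in> I \<longrightarrow> (\<lambda>n. w (i, n)) = app (A i) u) \<and> (i \<notin> I \<longrightarrow> (\<forall>n. w (i, n) = 0))"
        by (cases "i \<in> I") (auto simp: fun_eq_iff)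
    qed
    then show ?thesis by metis
  qed
  have subS: "fvs.subspace S"
    unfolding fvs.subspace_def
  proof (intro conjI ballI allI)
    show "0 \<in> S" by (rule SI[of _ "\<lambda>_. 0"]) (auto simp: fun_eq_iff)
    fix x y assume "x \<in> S" "y \<in> S"
    then obtain f h where "\<forall>i\<in>I. (\<lambda>n. x (i, n)) = app (A i) (f i)" "\<forall>i n. i \<notin> I \<longrightarrow> x (i, n) = 0"
        "\<forall>i\<in>I. (\<lambda>n. y (i, n)) = app (A i) (h i)" "\<forall>i n. i \<notin> I \<longrightarrow> y (i, n) = 0"
      using SD by metis
    then show "x + y \<in> S" by (intro SI[of _ "\<lambda>i. f i + h i"]) (auto simp: fun_eq_iff)
  next
    fix c x assume "x \<in> S"
    then obtain f where "\<forall>i\<in>I. (\<lambda>n. x (i, n)) = app (A i) (f i)" "\<forall>i n. i \<notin> I \<longrightarrow> x (i, n) = 0"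
      using SD by metis
    then show "fscale c x \<in> S" by (intro SI[of _ "\<lambda>i. fscale c (f i)"]) (auto simp: fun_eq_iff)
  qed
  have "w \<in> fvs.span (unit ` (I \<times> {..<N}))" if "w \<in> S" for w
  proof -
    obtain f where f: "\<And>i. i \<in> I \<Longrightarrow> (\<lambda>n. w (i, n)) = app (A i) (f i)" "\<And>i n. i \<notin> I \<Longrightarrow> w (i, n) = 0"
      using SD[OF \<open>w \<in> S\<close>] by metis
    have "w (i, n) = 0" if x: "(i, n) \<notin> I \<times> {..<N}" for i n
    proof (cases "i \<in> I")
      case True
      have "(\<lambda>n. w (i, n)) = app (idn N) (app (A i) (f i))"
        using A(1)[OF True] f(1)[OF True] by (metis app_times)
      from fun_cong[OF this, of n] show ?thesis
        using x True by (simp add: app_idn)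
    qed (simp add: f)
    then have "w x = 0" if "x \<notin> I \<times> {..<N}" for x using that by (cases x) blast
    then have "w = (\<Sum>x\<in>I \<times> {..<N}. fscale (w x) (unit x))"
      using assms(1) by (auto simp: fun_eq_iff sum_fun_apply unit_def if_distrib[of "\<lambda>x. _ * x"] cong: if_cong)
    also have "\<dots> \<in> fvs.span (unit ` (I \<times> {..<N}))"
      by (intro fvs.span_sum fvs.span_scale fvs.span_base) auto
    finally show ?thesis .
  qed
  then have "S \<subseteq> fvs.span (unit ` (I \<times> {..<N}))" by blast
  with finite_imageI[OF finite_cartesian_product[OF assms(1) finite_lessThan]]
  obtain m \<Phi> \<Psi> where lin: "Vector_Spaces.linear fscale fscale \<Phi>" "Vector_Spaces.linear fscale fscale \<Psi>"
    and "\<And>j. j < m \<Longrightarrow> \<Phi> (delta j) \<in> S"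
    and \<Phi>idn: "\<And>x. \<Phi> (app (idn m) x) = \<Phi> x" and \<Phi>span: "\<And>x. \<Phi> x \<in> fvs.span S"
    and \<Phi>\<Psi>: "\<And>u. u \<in> fvs.span S \<Longrightarrow> \<Phi> (\<Psi> u) = u" and \<Psi>\<Phi>: "\<And>x. \<Psi> (\<Phi> x) = app (idn m) x"
    and \<Psi>idn: "\<And>u. app (idn m) (\<Psi> u) = \<Psi> u"
    by (rule subspace_coordinates) blast
  note spanS = fvs.span_eq_iff[THEN iffD2, OF subS]
  note lins = Vector_Spaces.linear_iff
  have \<Psi>add: "\<Psi> (u + v) = \<Psi> u + \<Psi> v" "\<Psi> (fscale c u) = fscale c (\<Psi> u)"
    and \<Phi>add: "\<Phi> (x + y) = \<Phi> x + \<Phi> y" "\<Phi> (fscale c x) = fscale c (\<Phi> x)" for u v c x y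
    using lin by (auto simp: lins)
  have \<Psi>0: "\<Psi> 0 = 0" using \<Psi>add(2)[of 0 0] by (simp add: fscale_def zero_fun_def)
  have \<Psi>sum: "\<Psi> (\<Sum>j\<in>T. f j) = (\<Sum>j\<in>T. \<Psi> (f j))" for T :: "'i set" and f
    by (induction T rule: infinite_finite_induct) (simp_all only: sum.infinite sum.empty sum.insert not_False_eq_True \<Psi>add \<Psi>0)
  have "\<exists>g. Vector_Spaces.linear fscale fscale g \<and> (\<forall>u. app (A i) (g (app (A i) u)) = app (A i) u)" for i
    using fvp.linear_exists_right_inverse_on[OF linear_app fvs.subspace_UNIV, of "A i"] by auto
  then obtain g where g: "\<And>i. Vector_Spaces.linear fscale fscale (g i)"
      "\<And>i u. app (A i) (g i (app (A i) u)) = app (A i) u" by metis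
  define K where "K i = Abs_linop (\<lambda>u. \<Psi> (blk i (app (A i) u)))" for i
  have blkadd: "blk i (u + v) = blk i u + blk i v" "blk i (fscale c u) = fscale c (blk i u)" for i u v c
    by (auto simp: blk_def fun_eq_iff)
  have appK: "app (K i) u = \<Psi> (blk i (app (A i) u))" for i u
  proof -
    have "app (K i) = (\<lambda>u. \<Psi> (blk i (app (A i) u)))"
      unfolding K_def by (rule app_Abs_linear) (simp add: lins blkadd \<Psi>add fvs.vector_space_axioms)
    then show ?thesis by simp
  qed
  define s0 where "s0 i = Abs_linop (\<lambda>x. g i (\<lambda>n. \<Phi> x (i, n)))" for i
  have apps0: "app (s0 i) x = g i (\<lambda>n. \<Phi> x (i, n))" for i x
  proof -
    have "app (s0 i) = (\<lambda>x. g i (\<lambda>n. \<Phi> x (i, n)))"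
      unfolding s0_def
    proof (rule app_Abs_linear, unfold lins, intro conjI allI)
      have gi: "g i (u + v) = g i u + g i v" "g i (fscale c u) = fscale c (g i u)" for u v c
        using g(1)[of i] by (auto simp: lins)
      fix x y show "g i (\<lambda>n. \<Phi> (x + y) (i, n)) = g i (\<lambda>n. \<Phi> x (i, n)) + g i (\<lambda>n. \<Phi> y (i, n))"
        unfolding \<Phi>add gi[symmetric] by (simp add: plus_fun_def)
      fix c show "g i (\<lambda>n. \<Phi> (fscale c x) (i, n)) = fscale c (g i (\<lambda>n. \<Phi> x (i, n)))"
        unfolding \<Phi>add gi[symmetric] by (simp add: fscale_def)
    qed (simp_all add: fvs.vector_space_axioms)
    then show ?thesis by simp
  qed
  \<comment> \<open>The linear right inverse \<open>g i\<close> of \<open>A i\<close> need not land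
    in the first \<open>N\<close> coordinates. Cutting it down is harmless because
    \<open>A i * idn N = A i\<close>.\<close>
  define s where "s i = idn N * s0 i * idn m" for i
  have As: "app (A i) (app (s i) x) = (\<lambda>n. \<Phi> x (i, n))" if i: "i \<in> I" for i x
  proof -
    have "\<Phi> x \<in> S" using \<Phi>span spanS by auto
    then obtain u where "(\<lambda>n. \<Phi> x (i, n)) = app (A i) u" using SD i by metis
    moreover have "app (A i) (app (s i) x) = app (A i * idn N) (g i (\<lambda>n. \<Phi> x (i, n)))"
      by (simp add: s_def apps0 \<Phi>idn)
    ultimately show ?thesis by (simp add: A(2)[OF i] g)
  qed
  have blkS: "blk i (app (A i) u) \<in> fvs.span S" for i u
    unfolding spanS by (rule SI[of _ "\<lambda>j. if j = i then u else 0"]) (auto simp: blk_def fun_eq_iff)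
  show ?thesis
  proof (intro exI conjI ballI allI impI)
    fix i assume i: "i \<in> I"
    show "idn m * K i = K i" by (rule linop_eqI) (simp add: appK \<Psi>idn)
    have "app (A i) (app (idn N) u) = app (A i) u" for u using A(2)[OF i] by (metis app_times)
    then show "K i * idn N = K i"
      by (intro linop_eqI) (simp add: appK)
    show "idn N * s i = s i" "s i * idn m = s i" by (simp_all add: s_def mult.assoc mult_rewrite[OF idn_idem])
    show "K i * X = 0" if "A i * X = 0" for X
    proof (rule linop_eqI)
      fix u have "app (A i) (app X u) = 0" using that by (metis app_0 app_times)
      then show "app (K i * X) u = app 0 u"
        using \<Psi>0 by (simp add: appK blk_def zero_fun_def case_prod_unfold cong: if_cong)
    qed
    fix j assume j: "j \<in> I"
    show "A i * s i * K j = (if i = j then A i else 0)"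
    proof (rule linop_eqI)
      fix u have "app (A i * s i * K j) u = (\<lambda>n. blk j (app (A j) u) (i, n))"
        by (simp add: As[OF i] appK \<Phi>\<Psi>[OF blkS])
      also have "\<dots> = app (if i = j then A i else 0) u" using j by (auto simp: blk_def fun_eq_iff)
      finally show "app (A i * s i * K j) u = app (if i = j then A i else 0) u" .
    qed
  next
    show "(\<Sum>i\<in>I. K i * s i) = idn m"
    proof (rule linop_eqI)
      fix x
      have "app (\<Sum>i\<in>I. K i * s i) x = \<Psi> (\<Sum>i\<in>I. blk i (\<lambda>n. \<Phi> x (i, n)))"
        by (simp add: app_sum appK As \<Psi>sum)
      also have "(\<Sum>i\<in>I. blk i (\<lambda>n. \<Phi> x (i, n))) = \<Phi> x"
      proof
        fix y :: "'i \<times> nat"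
        have "\<Phi> x y = 0" if "fst y \<notin> I"
          using SD[of "\<Phi> x"] \<Phi>span[of x] that unfolding spanS by (metis prod.collapse)
        then show "(\<Sum>i\<in>I. blk i (\<lambda>n. \<Phi> x (i, n))) y = \<Phi> x y"
          using assms(1) by (cases y) (auto simp: sum_fun_apply blk_def cong: if_cong)
      qed
      finally show "app (\<Sum>i\<in>I. K i * s i) x = app (idn m) x" by (simp add: \<Psi>\<Phi>)
    qed
  qed
qed

section \<open>Commutation of dual families\<close>

text \<open>\<open>G\<close> is the inverse of \<open>x - \<epsilon> S\<close> in the corner with
  unit \<open>e\<close>, and taking the commutator with \<open>R\<close> is a derivation; this is
  the rule for the derivative of an inverse.\<close>

lemma inverse_commutator:
  fixes R S G e :: linop
  assumes G: "x \<odot>\<^sub>C G - \<epsilon> \<odot>\<^sub>C (S * G) = e" "x \<odot>\<^sub>C G - \<epsilon> \<odot>\<^sub>C (G * S) = e"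
    and R: "e * R = R" "R * e = R"
  shows "G * R - R * G = \<epsilon> \<odot>\<^sub>C (G * (S * R - R * S) * G)"
proof -
  have "G * R = G * R * e" by (simp add: R mult.assoc)
  also have "\<dots> = x \<odot>\<^sub>C (G * R * G) - \<epsilon> \<odot>\<^sub>C (G * R * S * G)"
    by (simp flip: G(1) add: algebra_simps scl_distrib)
  finally have 1: "G * R = x \<odot>\<^sub>C (G * R * G) - \<epsilon> \<odot>\<^sub>C (G * R * S * G)" .
  have "R * G = e * R * G" by (simp add: R mult.assoc)
  also have "\<dots> = x \<odot>\<^sub>C (G * R * G) - \<epsilon> \<odot>\<^sub>C (G * S * R * G)"
    by (simp flip: G(2) add: algebra_simps scl_distrib)
  finally have 2: "R * G = x \<odot>\<^sub>C (G * R * G) - \<epsilon> \<odot>\<^sub>C (G * S * R * G)" .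
  show ?thesis
    by (rule trans[OF arg_cong2[of _ _ _ _ minus, OF 1 2]]) (simp add: algebra_simps scl_distrib)
qed

text \<open>The two factors are the dx- and dy-coefficients of the transform, with \<open>G\<close>
  the resolvent of \<open>S\<close>. The relations \<open>r1\<close> and \<open>r2\<close> carry
  \<open>R'\<close> through \<open>Q\<close> and \<open>P\<close> and turn it into \<open>R\<close>,
  \<open>inverse_commutator\<close> with \<open>r4\<close> evaluates the commutator of
  \<open>G\<close> and \<open>R\<close>, and \<open>r3\<close> absorbs what is left over from
  \<open>S * G\<close>.\<close>

lemma dual_commute_x:
  fixes S T Sy Ty P Q R R' G e :: linop
  assumes G: "x \<odot>\<^sub>C G - \<epsilon> \<odot>\<^sub>C (S * G) = e" "G * S = S * G"
    and Sy: "Sy * G = G * Sy"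
    and e: "e * P = P" "Q * e = Q" "e * R = R" "R * e = R"
    and T: "T * Ty = Ty * T"
    and r1: "R' * Q = Q * R + T * Q * Sy + Ty * Q * S"
    and r2: "P * R' = R * P + Sy * P * T + S * P * Ty"
    and r3: "T * R' - R' * T = Q * P * Ty - Ty * Q * P"
    and r4: "S * R - R * S = Sy * P * Q - P * Q * Sy"
    and eps: "\<epsilon> * \<epsilon> = 1"
  shows "(- (\<epsilon> \<odot>\<^sub>C T) - Q * G * P) * (R' - (\<epsilon> * x) \<odot>\<^sub>C Ty + \<epsilon> \<odot>\<^sub>C (Q * Sy * G * P))
    = (R' - (\<epsilon> * x) \<odot>\<^sub>C Ty + \<epsilon> \<odot>\<^sub>C (Q * Sy * G * P)) * (- (\<epsilon> \<odot>\<^sub>C T) - Q * G * P)"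
proof -
  define M U where "M = Q * G * P" and "U = Q * Sy * G * P"
  have comm: "G * R - R * G = \<epsilon> \<odot>\<^sub>C (G * (Sy * P * Q - P * Q * Sy) * G)"
    using inverse_commutator[of x G \<epsilon> S e R] G e r4 by simp
  have SG: "Q * (S * G) * P = (\<epsilon> * x) \<odot>\<^sub>C M - \<epsilon> \<odot>\<^sub>C (Q * P)"
  proof -
    have "S * G = (\<epsilon> * \<epsilon>) \<odot>\<^sub>C (S * G)" by (simp add: eps)
    also have "\<dots> = \<epsilon> \<odot>\<^sub>C (x \<odot>\<^sub>C G - e)" by (simp flip: G(1))
    finally have "S * G = \<epsilon> \<odot>\<^sub>C (x \<odot>\<^sub>C G - e)" .
    then show ?thesis by (simp only: M_def) (simp add: algebra_simps scl_distrib e)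
  qed
  have "M * R' - R' * M = Q * G * (P * R') - (R' * Q) * G * P" by (simp add: M_def mult.assoc)
  also have "\<dots> = Q * (G * R - R * G) * P + (Q * (G * Sy) * P * T - T * Q * (Sy * G) * P)
      + (Q * (G * S) * P * Ty - Ty * (Q * (S * G) * P))"
    unfolding r1 r2 by (simp add: algebra_simps)
  also have "\<dots> = \<epsilon> \<odot>\<^sub>C (U * M - M * U) + (U * T - T * U)
      + ((\<epsilon> * x) \<odot>\<^sub>C (M * Ty - Ty * M) - \<epsilon> \<odot>\<^sub>C (Q * P * Ty - Ty * Q * P))"
    unfolding comm G(2) SG
    by (simp add: M_def U_def algebra_simps scl_distrib mult_rewrite[OF Sy] Sy)
  finally have MR: "M * R' = R' * M + (\<epsilon> \<odot>\<^sub>C (U * M - M * U) + (U * T - T * U)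
      + ((\<epsilon> * x) \<odot>\<^sub>C (M * Ty - Ty * M) - \<epsilon> \<odot>\<^sub>C (Q * P * Ty - Ty * Q * P)))"
    by (simp add: algebra_simps)
  have TR: "T * R' = R' * T + (Q * P * Ty - Ty * Q * P)" using r3 by (simp add: algebra_simps)
  have "(- (\<epsilon> \<odot>\<^sub>C T) - M) * (R' - (\<epsilon> * x) \<odot>\<^sub>C Ty + \<epsilon> \<odot>\<^sub>C U)
      = (R' - (\<epsilon> * x) \<odot>\<^sub>C Ty + \<epsilon> \<odot>\<^sub>C U) * (- (\<epsilon> \<odot>\<^sub>C T) - M)"
    by (simp add: algebra_simps scl_distrib MR TR T eps)
  then show ?thesis unfolding M_def U_def by simp
qed

text \<open>This is the alternative in which \<open>T\<close> does not involve the other variables,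
  so the relations carry no derivative of \<open>T\<close>. The terms linear in \<epsilon> contain
  commutators of \<open>G\<close> with \<open>Ry\<close> and \<open>Rz\<close>; by
  \<open>inverse_commutator\<close> these produce quadratic terms, which cancel those of the product
  because \<epsilon> squares to 1.\<close>

lemma dual_commute_yz_const_T:
  fixes S T Sy Sz P Q Ry Rz Ry' Rz' G e :: linop
  assumes G: "x \<odot>\<^sub>C G - \<epsilon> \<odot>\<^sub>C (S * G) = e" "G * S = S * G"
    and S: "Sy * G = G * Sy" "Sz * G = G * Sz" "Sy * Sz = Sz * Sy"
    and e: "e * P = P" "Q * e = Q" "e * Ry = Ry" "Ry * e = Ry" "e * Rz = Rz" "Rz * e = Rz"
    and y1: "Ry' * Q = Q * Ry + T * Q * Sy" and z1: "Rz' * Q = Q * Rz + T * Q * Sz"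
    and y2: "P * Ry' = Ry * P + Sy * P * T" and z2: "P * Rz' = Rz * P + Sz * P * T"
    and y4: "S * Ry - Ry * S = Sy * P * Q - P * Q * Sy"
    and z4: "S * Rz - Rz * S = Sz * P * Q - P * Q * Sz"
    and RS: "Ry * Sz + Sy * Rz = Rz * Sy + Sz * Ry"
    and RR: "Ry' * Rz' = Rz' * Ry'"
    and eps: "\<epsilon> * \<epsilon> = 1"
  shows "(Ry' + \<epsilon> \<odot>\<^sub>C (Q * Sy * G * P)) * (Rz' + \<epsilon> \<odot>\<^sub>C (Q * Sz * G * P))
    = (Rz' + \<epsilon> \<odot>\<^sub>C (Q * Sz * G * P)) * (Ry' + \<epsilon> \<odot>\<^sub>C (Q * Sy * G * P))"
proof -
  have comm: "G * R - R * G = \<epsilon> \<odot>\<^sub>C (G * (s * P * Q - P * Q * s) * G)"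
    if "e * R = R" "R * e = R" "S * R - R * S = s * P * Q - P * Q * s" for R s
    using inverse_commutator[of x G \<epsilon> S e R] G that by simp
  have cy: "G * Ry = Ry * G + \<epsilon> \<odot>\<^sub>C (G * Sy * P * Q * G - G * P * Q * Sy * G)"
    using comm[OF e(3,4) y4] by (simp add: algebra_simps)
  have cz: "G * Rz = Rz * G + \<epsilon> \<odot>\<^sub>C (G * Sz * P * Q * G - G * P * Q * Sz * G)"
    using comm[OF e(5,6) z4] by (simp add: algebra_simps)
  have *: "Ry * Sz * G + Sy * Rz * G = Rz * Sy * G + Sz * Ry * G"
    using RS by (metis distrib_right)
  have "\<epsilon> \<odot>\<^sub>C (Ry' * Q * Sz * G * P - Q * Sz * G * (P * Ry') - (Rz' * Q * Sy * G * P - Q * Sy * G * (P * Rz')))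
    = \<epsilon> \<odot>\<^sub>C (Q * (Ry * Sz * G - Sz * (G * Ry) - (Rz * Sy * G - Sy * (G * Rz))) * P)
      + \<epsilon> \<odot>\<^sub>C (T * Q * (Sy * Sz - Sz * Sy) * G * P - Q * (Sz * (G * Sy) - Sy * (G * Sz)) * P * T)"
    unfolding y1 z1 y2 z2 by (simp add: algebra_simps scl_distrib)
  also have "Ry * Sz * G - Sz * (G * Ry) - (Rz * Sy * G - Sy * (G * Rz))
    = - (\<epsilon> \<odot>\<^sub>C (Sz * G * Sy * P * Q * G - Sz * G * P * Q * Sy * G))
      + \<epsilon> \<odot>\<^sub>C (Sy * G * Sz * P * Q * G - Sy * G * P * Q * Sz * G)"
    unfolding cy cz using * by (simp add: algebra_simps scl_distrib)
  also have "\<dots> = \<epsilon> \<odot>\<^sub>C (Sz * G * P * Q * Sy * G - Sy * G * P * Q * Sz * G)"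
    using S by (simp add: algebra_simps scl_distrib)
  also have "\<epsilon> \<odot>\<^sub>C (T * Q * (Sy * Sz - Sz * Sy) * G * P - Q * (Sz * (G * Sy) - Sy * (G * Sz)) * P * T) = 0"
    by (simp add: algebra_simps S mult_rewrite[OF S(1)] mult_rewrite[OF S(2)])
  finally have X: "\<epsilon> \<odot>\<^sub>C (Ry' * Q * Sz * G * P - Q * Sz * G * (P * Ry') - (Rz' * Q * Sy * G * P - Q * Sy * G * (P * Rz')))
    = Q * Sz * G * P * Q * Sy * G * P - Q * Sy * G * P * Q * Sz * G * P"
    by (simp add: algebra_simps eps scl_distrib)
  have "(Ry' + \<epsilon> \<odot>\<^sub>C (Q * Sy * G * P)) * (Rz' + \<epsilon> \<odot>\<^sub>C (Q * Sz * G * P))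
    - (Rz' + \<epsilon> \<odot>\<^sub>C (Q * Sz * G * P)) * (Ry' + \<epsilon> \<odot>\<^sub>C (Q * Sy * G * P))
    = (Ry' * Rz' - Rz' * Ry')
      + \<epsilon> \<odot>\<^sub>C (Ry' * Q * Sz * G * P - Q * Sz * G * (P * Ry') - (Rz' * Q * Sy * G * P - Q * Sy * G * (P * Rz')))
      + (\<epsilon> * \<epsilon>) \<odot>\<^sub>C (Q * Sy * G * P * Q * Sz * G * P - Q * Sz * G * P * Q * Sy * G * P)"
    by (simp add: algebra_simps scl_distrib)
  also have "\<dots> = 0" unfolding X RR eps by simp
  finally show ?thesis by simp
qed

text \<open>The two conclusions prepare for \<open>commutator_zero\<close>, which deduces from them
  that the commutator itself vanishes. Both follow by moving the primed operators through
  \<open>Q\<close> and \<open>T\<close> until only unprimed ones remain.\<close>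

lemma dual_residual_commute_const_T:
  fixes T Sy Sz Q Ry Rz Ry' Rz' :: linop
  assumes y1: "Ry' * Q = Q * Ry + T * Q * Sy" and z1: "Rz' * Q = Q * Rz + T * Q * Sz"
    and y3: "T * Ry' = Ry' * T" and z3: "T * Rz' = Rz' * T"
    and S: "Sy * Sz = Sz * Sy" and RS: "Ry * Sz + Sy * Rz = Rz * Sy + Sz * Ry"
    and R: "Ry * Rz = Rz * Ry"
  shows "(Ry' * Rz' - Rz' * Ry') * Q = 0" "T * (Ry' * Rz' - Rz' * Ry') = (Ry' * Rz' - Rz' * Ry') * T"
proof -
  have "Ry' * Rz' * Q = Q * (Ry * Rz) + T * Q * (Sy * Rz + Ry * Sz) + T * T * Q * (Sy * Sz)"
    by (simp add: mult.assoc z1) (simp add: algebra_simps y1 mult_rewrite[OF y1] mult_rewrite[OF y3[symmetric]])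
  moreover have "Rz' * Ry' * Q = Q * (Rz * Ry) + T * Q * (Sz * Ry + Rz * Sy) + T * T * Q * (Sz * Sy)"
    by (simp add: mult.assoc y1) (simp add: algebra_simps z1 mult_rewrite[OF z1] mult_rewrite[OF z3[symmetric]])
  moreover have "Sy * Rz + Ry * Sz = Sz * Ry + Rz * Sy" using RS by (simp add: algebra_simps)
  ultimately show "(Ry' * Rz' - Rz' * Ry') * Q = 0"
    by (simp add: left_diff_distrib S R)
  show "T * (Ry' * Rz' - Rz' * Ry') = (Ry' * Rz' - Rz' * Ry') * T"
    by (simp add: algebra_simps y3 z3 mult_rewrite[OF y3] mult_rewrite[OF z3])
qed

text \<open>The counterpart for constant \<open>S\<close>. Here \<open>Ry'\<close> and
  \<open>Rz'\<close> do not commute with \<open>T\<close>, so the commutator of \<open>T\<close>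
  with their commutator is expanded by the Jacobi identity. \<open>RT\<close> says that the mixed
  term is symmetric in y and z, and it removes what does not cancel otherwise.\<close>

lemma dual_residual_commute_const_S:
  fixes S T Ty Tz P Q Ry Rz Ry' Rz' :: linop
  assumes y1: "Ry' * Q = Q * Ry + Ty * Q * S" and z1: "Rz' * Q = Q * Rz + Tz * Q * S"
    and y2: "P * Ry' = Ry * P + S * P * Ty" and z2: "P * Rz' = Rz * P + S * P * Tz"
    and y3: "T * Ry' - Ry' * T = Q * P * Ty - Ty * Q * P"
    and z3: "T * Rz' - Rz' * T = Q * P * Tz - Tz * Q * P"
    and y4: "S * Ry = Ry * S" and z4: "S * Rz = Rz * S"
    and T: "Ty * Tz = Tz * Ty" and RT: "Ry' * Tz - Tz * Ry' = Rz' * Ty - Ty * Rz'"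
    and R: "Ry * Rz = Rz * Ry"
  shows "(Ry' * Rz' - Rz' * Ry') * Q = 0" "T * (Ry' * Rz' - Rz' * Ry') = (Ry' * Rz' - Rz' * Ry') * T"
proof -
  have RT': "Ry' * Tz = Tz * Ry' + (Rz' * Ty - Ty * Rz')" using RT by (simp add: algebra_simps)
  show "(Ry' * Rz' - Rz' * Ry') * Q = 0"
    by (simp add: left_diff_distrib mult.assoc y1 z1)
      (simp add: algebra_simps y1 z1 mult_rewrite[OF y1] mult_rewrite[OF z1] mult_rewrite[OF RT'] y4 z4
        mult_rewrite[OF y4] mult_rewrite[OF z4] R mult_rewrite[OF T])
  have qy: "Q * P * Ry' - Ry' * Q * P = Q * S * P * Ty - Ty * Q * S * P"
    by (simp add: mult.assoc y2) (simp add: algebra_simps mult_rewrite[OF y1])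
  have qz: "Q * P * Rz' - Rz' * Q * P = Q * S * P * Tz - Tz * Q * S * P"
    by (simp add: mult.assoc z2) (simp add: algebra_simps mult_rewrite[OF z1])
  let ?W = "Ry' * Rz' - Rz' * Ry'"
  have "T * ?W - ?W * T = (T * Ry' - Ry' * T) * Rz' - Rz' * (T * Ry' - Ry' * T)
      + Ry' * (T * Rz' - Rz' * T) - (T * Rz' - Rz' * T) * Ry'"
    by (simp add: algebra_simps)
  also have "\<dots> = (Q * P * Rz' - Rz' * Q * P) * Ty - Ty * (Q * P * Rz' - Rz' * Q * P)
      - ((Q * P * Ry' - Ry' * Q * P) * Tz - Tz * (Q * P * Ry' - Ry' * Q * P))
      + Q * P * ((Ry' * Tz - Tz * Ry') - (Rz' * Ty - Ty * Rz')) - ((Ry' * Tz - Tz * Ry') - (Rz' * Ty - Ty * Rz')) * Q * P"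
    unfolding y3 z3 by (simp add: algebra_simps)
  also have "\<dots> = 0"
    unfolding RT qy qz by (simp add: algebra_simps T mult_rewrite[OF T])
  finally show "T * ?W = ?W * T" by simp
qed

text \<open>After clearing denominators, a polynomial vanishes at all but finitely many points,
  hence identically. Its value at \<open>a k\<close> is a nonzero multiple of \<open>d k\<close>;
  once all these residues are gone, the linear factor must be zero.\<close>

lemma partial_fractions_scalar:
  fixes a d :: "'i \<Rightarrow> complex"
  assumes "finite I" and inj: "inj_on a I"
    and ev: "\<forall>\<^sub>F t in cofinite. c0 + c1 * t + (\<Sum>i\<in>I. d i / (t - a i)) = 0"
  shows "c0 = 0 \<and> c1 = 0 \<and> (\<forall>i\<in>I. d i = 0)"
proof -
  define L where "L J = (\<Prod>i\<in>J. [:- a i, 1:])" for J :: "'i set"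
  define p where "p = [:c0, c1:] * L I + (\<Sum>i\<in>I. Polynomial.smult (d i) (L (I - {i})))"
  have polyL: "poly (L J) t = (\<Prod>i\<in>J. t - a i)" for J t
    by (simp add: L_def poly_prod)
  have "\<forall>\<^sub>F t in cofinite. t \<notin> a ` I"
    using assms(1) by (simp add: eventually_cofinite)
  with ev have "\<forall>\<^sub>F t in cofinite. poly p t = 0"
  proof eventually_elim
    case (elim t)
    have "d i * poly (L (I - {i})) t = poly (L I) t * (d i / (t - a i))" if "i \<in> I" for i
    proof -
      have "t - a i \<noteq> 0" using elim that by auto
      then show ?thesis using assms(1) that
        by (simp add: polyL prod.remove[of I i])
    qed
    then have "poly p t = poly (L I) t * (c0 + c1 * t + (\<Sum>i\<in>I. d i / (t - a i)))"
      by (simp add: p_def poly_sum distrib_left sum_distrib_left mult.commute)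
    then show ?case using elim by simp
  qed
  then have "p = 0"
    by (metis (mono_tags, lifting) eventually_cofinite poly_roots_finite finite_Collect_not infinite_UNIV_char_0)
  have d: "d k = 0" if k: "k \<in> I" for k
  proof -
    have z: "poly (L J) (a k) = 0" if "finite J" "k \<in> J" for J
      unfolding polyL using that by (intro prod_zero) auto
    have "poly p (a k) = (\<Sum>i\<in>I. if i = k then d k * poly (L (I - {k})) (a k) else 0)"
    proof -
      have "poly (L (I - {i})) (a k) = 0" if "i \<noteq> k" for i
        using z[of "I - {i}"] assms(1) k that by simp
      then show ?thesis
        using z[OF assms(1) k] by (auto simp: p_def poly_sum intro!: sum.cong)
    qed
    also have "\<dots> = d k * poly (L (I - {k})) (a k)" using assms(1) k by simp
    finally have "d k * poly (L (I - {k})) (a k) = 0" using \<open>p = 0\<close> by simp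
    moreover have "poly (L (I - {k})) (a k) \<noteq> 0"
      using assms(1) inj k by (auto simp: polyL inj_on_def)
    ultimately show ?thesis by simp
  qed
  have "L I \<noteq> 0" using assms(1) by (auto simp: L_def)
  moreover have "p = [:c0, c1:] * L I" using d by (simp add: p_def)
  ultimately have "[:c0, c1:] = 0" using \<open>p = 0\<close> by (metis mult_eq_0_iff)
  then show ?thesis using d by simp
qed

lemma partial_fractions:
  fixes a :: "'i \<Rightarrow> complex"
  assumes "finite I" "inj_on a I"
    and "\<forall>\<^sub>F t in cofinite. C0 + t \<odot>\<^sub>C C1 + (\<Sum>i\<in>I. (1 / (t - a i)) \<odot>\<^sub>C D i) = 0"
  shows "C0 = 0 \<and> C1 = 0 \<and> (\<forall>i\<in>I. D i = 0)"
proof -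
  have "app C0 u n = 0 \<and> app C1 u n = 0 \<and> (\<forall>i\<in>I. app (D i) u n = 0)" for u n
  proof (rule partial_fractions_scalar[OF assms(1,2)])
    show "\<forall>\<^sub>F t in cofinite. app C0 u n + app C1 u n * t + (\<Sum>i\<in>I. app (D i) u n / (t - a i)) = 0"
      using assms(3)
    proof eventually_elim
      case (elim t)
      then have "app (C0 + t \<odot>\<^sub>C C1 + (\<Sum>i\<in>I. (1 / (t - a i)) \<odot>\<^sub>C D i)) u n = 0" by simp
      then show ?case by (simp add: app_sum sum_fun_apply mult.commute)
    qed
  qed
  then show ?thesis by (auto intro!: linop_eqI simp: fun_eq_iff)
qed

section \<open>Generic points and affine hyperplanes\<close>

text \<open>The complements of arrangements generate a filter, so that generic identities can be
  combined by the usual reasoning about \<open>eventually\<close>.\<close>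

definition genf :: "('n::finite point) filter" where
  "genf = Abs_filter generically"

lemma eventually_genf: "eventually Q genf \<longleftrightarrow> generically Q"
  unfolding genf_def
proof (rule eventually_Abs_filter, unfold_locales)
  show "generically (\<lambda>p::'a point. True)"
    unfolding generically_def by (intro exI[of _ "{}"]) (simp add: arrangement_def)
next
  fix P Q :: "'a point \<Rightarrow> bool"
  assume "generically P" "generically Q"
  then obtain \<G> \<H> where "arrangement \<G>" "\<forall>p. p \<notin> \<Union>\<G> \<longrightarrow> P p" "arrangement \<H>" "\<forall>p. p \<notin> \<Union>\<H> \<longrightarrow> Q p"
    unfolding generically_def by auto
  then show "generically (\<lambda>p. P p \<and> Q p)"
    unfolding generically_def arrangement_def by (intro exI[of _ "\<G> \<union> \<H>"]) auto
next
  fix P Q :: "'a point \<Rightarrow> bool"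
  assume "\<forall>x. P x \<longrightarrow> Q x" "generically P"
  then show "generically Q" unfolding generically_def by blast
qed

lemma eventually_off_arrangement: "arrangement \<G> \<Longrightarrow> \<forall>\<^sub>F p in genf. p \<notin> \<Union>\<G>"
  unfolding eventually_genf generically_def by auto

lemma aff_eval_update: "aff_eval f (p(i := t)) = aff_eval f p + pd f i * (t - p i)"
proof -
  have "(\<Sum>j\<in>UNIV. pd f j * (p(i := t)) j) = (\<Sum>j\<in>UNIV. pd f j * p j + (if j = i then pd f i * (t - p i) else 0))"
    by (intro sum.cong) (auto simp: algebra_simps)
  then show ?thesis by (simp add: aff_eval_def sum.distrib)
qed

lemma aff_eval_line:
  "aff_eval f (\<lambda>i. p i + t * (q i - p i)) = aff_eval f p + t * (aff_eval f q - aff_eval f p)"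
  by (simp add: aff_eval_def algebra_simps sum.distrib sum_distrib_left sum_subtractf)

lemma finite_affine_zeros: "(b::complex) \<noteq> 0 \<or> c \<noteq> 0 \<Longrightarrow> finite {t. c + b * t = 0}"
  by (cases "b = 0") (auto intro!: finite_subset[of _ "{- c / b}"] simp: field_simps add_eq_0_iff2)

lemma eventually_cofinite_update:
  assumes "arrangement \<G>" "p \<notin> \<Union>\<G>"
  shows "\<forall>\<^sub>F t in cofinite. p(l := t) \<notin> \<Union>\<G>"
proof -
  have "\<forall>\<^sub>F t in cofinite. p(l := t) \<notin> H" if H: "H \<in> \<G>" for H
  proof -
    obtain f where f: "H = {p. aff_eval f p = 0}"
      using assms(1) H unfolding arrangement_def defines_hyperplane_def by blast
    have "finite {t. (aff_eval f p - pd f l * p l) + pd f l * t = 0}"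
      using assms(2) H by (intro finite_affine_zeros) (auto simp: f)
    then show ?thesis
      by (simp add: eventually_cofinite f aff_eval_update algebra_simps)
  qed
  then have "\<forall>\<^sub>F t in cofinite. \<forall>H\<in>\<G>. p(l := t) \<notin> H"
    using assms(1) by (auto simp: arrangement_def intro!: eventually_ball_finite)
  then show ?thesis by simp
qed

text \<open>A line in direction \<open>l\<close> through a point off an arrangement meets it in
  finitely many points. A generic identity thus becomes, with the other coordinates fixed, an
  identity in the single variable \<open>t\<close>, to which the comparison of partial fractions
  applies.\<close>

lemma eventually_genf_update:
  assumes "eventually Q genf"
  shows "\<forall>\<^sub>F p in genf. \<forall>\<^sub>F t in cofinite. Q (p(l := t))"
proof -
  obtain \<G> where \<G>: "arrangement \<G>" "\<And>p. p \<notin> \<Union>\<G> \<Longrightarrow> Q p"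
    using assms unfolding eventually_genf generically_def by auto
  show ?thesis
    using eventually_off_arrangement[OF \<G>(1)]
  proof eventually_elim
    case (elim p)
    show ?case by (rule eventually_mono[OF eventually_cofinite_update[OF \<G>(1) elim]]) (rule \<G>(2))
  qed
qed

lemma arrangement_complement: "arrangement \<G> \<Longrightarrow> \<exists>p. p \<notin> \<Union>\<G>"
proof -
  assume "arrangement \<G>"
  then have "finite \<G>" "\<forall>H\<in>\<G>. \<exists>f. defines_hyperplane f H" by (auto simp: arrangement_def)
  then show ?thesis
  proof (induction \<G>)
    case (insert H \<G>)
    then obtain p where p: "p \<notin> \<Union>\<G>" by auto
    obtain f i where f: "H = {p. aff_eval f p = 0}" "pd f i \<noteq> 0"
      using insert.prems unfolding defines_hyperplane_def by auto
    have arr: "arrangement \<G>" using insert by (auto simp: arrangement_def)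
    have "\<forall>\<^sub>F t in cofinite. p(i := t) \<notin> \<Union>\<G> \<and> p(i := t) \<notin> H"
    proof (rule eventually_conj[OF eventually_cofinite_update[OF arr p]])
      have "finite {t. (aff_eval f p - pd f i * p i) + pd f i * t = 0}"
        using f(2) by (intro finite_affine_zeros) auto
      then show "\<forall>\<^sub>F t in cofinite. p(i := t) \<notin> H"
        by (simp add: eventually_cofinite f(1) aff_eval_update algebra_simps)
    qed
    then obtain t where "p(i := t) \<notin> \<Union>\<G> \<and> p(i := t) \<notin> H"
      unfolding eventually_cofinite using ex_new_if_finite[OF infinite_UNIV_char_0[where ?'a = complex]] by blast
    then show ?case by blast
  qed simp
qed

lemma genf_nontrivial [simp]: "genf \<noteq> (bot :: ('n::finite point) filter)"
  unfolding trivial_limit_def eventually_genf generically_def using arrangement_complement by blast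

lemma eventually_aff_neq_0:
  assumes "(\<exists>i. pd f i \<noteq> 0) \<or> const_term f \<noteq> 0"
  shows "\<forall>\<^sub>F p in genf. aff_eval f p \<noteq> 0"
proof (cases "\<exists>i. pd f i \<noteq> 0")
  case True
  then have "arrangement {{p. aff_eval f p = 0}}"
    by (auto simp: arrangement_def defines_hyperplane_def)
  from eventually_off_arrangement[OF this] show ?thesis by simp
next
  case False
  then show ?thesis using assms by (simp add: aff_eval_def)
qed

lemma aff_eval_diff: "aff_eval (aff_diff f g) p = aff_eval f p - aff_eval g p"
  by (simp add: aff_eval_def aff_diff_def algebra_simps sum_subtractf)

lemma eventually_aff_neq: "f \<noteq> g \<Longrightarrow> \<forall>\<^sub>F p in genf. aff_eval f p \<noteq> aff_eval g p"
proof -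
  assume "f \<noteq> g"
  then have "(\<exists>i. pd (aff_diff f g) i \<noteq> 0) \<or> const_term (aff_diff f g) \<noteq> 0"
    by (auto simp: aff_diff_def intro!: aff.expand)
  from eventually_aff_neq_0[OF this] show ?thesis by (simp add: aff_eval_diff)
qed

lemma eventually_inj_on_aff:
  assumes "finite I" "inj_on a I"
  shows "\<forall>\<^sub>F p in genf. inj_on (\<lambda>i. aff_eval (a i) p) I"
proof -
  have "\<forall>\<^sub>F p in genf. \<forall>i\<in>I. \<forall>j\<in>I. i \<noteq> j \<longrightarrow> aff_eval (a i) p \<noteq> aff_eval (a j) p"
    using assms by (intro eventually_ball_finite ballI)
      (auto intro!: eventually_aff_neq simp: inj_on_def eventually_conj_iff)
  then show ?thesis by eventually_elim (auto simp: inj_on_def)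
qed

lemma affine_linop_eq_0:
  assumes "\<forall>\<^sub>F p in genf. C + (\<Sum>j\<in>UNIV. p j \<odot>\<^sub>C B j) = 0"
  shows "C = 0 \<and> (\<forall>j. B j = 0)"
proof -
  have "app C u n = 0 \<and> (\<forall>j. app (B j) u n = 0)" for u n
  proof (rule ccontr)
    let ?f = "Aff (\<lambda>j. app (B j) u n) (app C u n)"
    assume "\<not> (app C u n = 0 \<and> (\<forall>j. app (B j) u n = 0))"
    then have "\<forall>\<^sub>F p in genf. aff_eval ?f p \<noteq> 0"
      by (intro eventually_aff_neq_0) auto
    with assms have "\<forall>\<^sub>F p::'a point in genf. False"
    proof eventually_elim
      case (elim p)
      have "app (C + (\<Sum>j\<in>UNIV. p j \<odot>\<^sub>C B j)) u n = aff_eval ?f p"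
        by (simp add: app_sum sum_fun_apply aff_eval_def mult.commute)
      then show ?case using elim by simp
    qed
    then show False by simp
  qed
  then show ?thesis by (auto intro!: linop_eqI simp: fun_eq_iff)
qed

lemma defines_hyperplane_defpoly:
  assumes "arrangement \<A>" "H \<in> \<A>" shows "defines_hyperplane (defpoly H) H"
  using assms unfolding arrangement_def defpoly_def by (metis someI_ex)

text \<open>Choose \<open>c\<close> so that \<open>g - c f\<close> does not involve the variable
  \<open>i\<close>. Moving a point along that variable into the hyperplane changes nothing in
  \<open>g - c f\<close>, and there both polynomials vanish; hence the difference is zero
  everywhere.\<close>

lemma defines_hyperplane_proportional:
  assumes f: "defines_hyperplane f H" and g: "defines_hyperplane g H"
  shows "\<exists>c. c \<noteq> 0 \<and> (\<forall>i. pd g i = c * pd f i) \<and> const_term g = c * const_term f"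
proof -
  obtain i where i: "pd f i \<noteq> 0" using f by (auto simp: defines_hyperplane_def)
  have zeros: "aff_eval f p = 0 \<longleftrightarrow> aff_eval g p = 0" for p
    using f g by (auto simp: defines_hyperplane_def)
  define c where "c = pd g i / pd f i"
  define h where "h = Aff (\<lambda>j. pd g j - c * pd f j) (const_term g - c * const_term f)"
  have h: "aff_eval h p = aff_eval g p - c * aff_eval f p" for p
    by (simp add: h_def aff_eval_def algebra_simps sum_subtractf sum_distrib_left)
  have "aff_eval h p = 0" for p
  proof -
    let ?q = "p(i := p i - aff_eval f p / pd f i)"
    have "aff_eval f ?q = 0" using i by (simp add: aff_eval_update)
    then have "aff_eval h ?q = 0" using zeros by (simp add: h)
    moreover have "pd h i = 0" using i by (simp add: h_def c_def)
    ultimately show ?thesis by (simp add: aff_eval_update)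
  qed
  then have "\<not> ((\<exists>i. pd h i \<noteq> 0) \<or> const_term h \<noteq> 0)"
    using eventually_aff_neq_0[of h] by auto
  then have eq: "pd g j = c * pd f j" "const_term g = c * const_term f" for j
    by (auto simp: h_def)
  moreover have "c \<noteq> 0" using eq g by (auto simp: defines_hyperplane_def)
  ultimately show ?thesis by blast
qed

text \<open>The chosen polynomial differs from \<open>g\<close> by a nonzero factor, which cancels
  in each of these quantities. This allows any convenient defining polynomial to be used in
  computations.\<close>

lemma defpoly_dlog:
  assumes "defines_hyperplane g H"
  shows "pd (defpoly H) i / aff_eval (defpoly H) p = pd g i / aff_eval g p"
    and "pd (defpoly H) i = 0 \<longleftrightarrow> pd g i = 0"
    and "aff_root i (defpoly H) = aff_root i g"
    and "defines_hyperplane (defpoly H) H"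
proof -
  show d: "defines_hyperplane (defpoly H) H"
    using assms unfolding defpoly_def by (rule someI)
  obtain c where c: "c \<noteq> 0" "\<And>i. pd (defpoly H) i = c * pd g i" "const_term (defpoly H) = c * const_term g"
    using defines_hyperplane_proportional[OF assms d] by auto
  have "aff_eval (defpoly H) p = c * aff_eval g p"
    by (simp add: aff_eval_def c algebra_simps sum_distrib_left)
  with c show "pd (defpoly H) i / aff_eval (defpoly H) p = pd g i / aff_eval g p"
    and "pd (defpoly H) i = 0 \<longleftrightarrow> pd g i = 0" and "aff_root i (defpoly H) = aff_root i g"
    by (auto simp: aff_root_def)
qed

lemma pd_aff_root: "pd (aff_root i f) j = (if j = i then 0 else - pd f j / pd f i)"
  by (simp add: aff_root_def)

lemma aff_eval_root:
  assumes "pd f i \<noteq> 0" shows "aff_eval f p = pd f i * (p i - aff_eval (aff_root i f) p)"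
proof -
  have "pd f i * (\<Sum>j\<in>UNIV. (if j = i then 0 else - pd f j / pd f i) * p j)
      = (\<Sum>j\<in>UNIV. (if j = i then pd f i * p i else 0) - pd f j * p j)"
    unfolding sum_distrib_left by (intro sum.cong) (use assms in auto)
  then show ?thesis using assms by (simp add: aff_root_def aff_eval_def sum_subtractf algebra_simps)
qed

lemma aff_eval_update_free: "pd f l = 0 \<Longrightarrow> aff_eval f (p(l := t)) = aff_eval f p"
  by (simp add: aff_eval_update)

section \<open>Hyperplanes as graphs over the remaining variables\<close>

definition graph_hyp :: "'n::finite \<Rightarrow> 'n aff \<Rightarrow> 'n point set" where
  "graph_hyp l \<alpha> = {p. p l = aff_eval \<alpha> p}"

lemma graph_hyp:
  assumes "pd \<alpha> l = 0"
  shows "defines_hyperplane (Aff (\<lambda>j. if j = l then 1 else - pd \<alpha> j) (- const_term \<alpha>)) (graph_hyp l \<alpha>)"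
    (is "defines_hyperplane ?f _")
    and "aff_root l (defpoly (graph_hyp l \<alpha>)) = \<alpha>"
    and "pd (defpoly (graph_hyp l \<alpha>)) l \<noteq> 0"
proof -
  have "aff_eval ?f p = p l - aff_eval \<alpha> p" for p
  proof -
    have "(\<Sum>j\<in>UNIV. (if j = l then 1 else - pd \<alpha> j) * p j) = (\<Sum>j\<in>UNIV. (if j = l then p l else 0) - pd \<alpha> j * p j)"
      using assms by (intro sum.cong) auto
    then show ?thesis by (simp add: aff_eval_def sum_subtractf)
  qed
  then show d: "defines_hyperplane ?f (graph_hyp l \<alpha>)"
    by (auto simp: defines_hyperplane_def graph_hyp_def intro: exI[of _ l])
  have "aff_root l ?f = \<alpha>"
    using assms by (intro aff.expand) (auto simp: aff_root_def)
  then show "aff_root l (defpoly (graph_hyp l \<alpha>)) = \<alpha>" using defpoly_dlog(3)[OF d] by simp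
  show "pd (defpoly (graph_hyp l \<alpha>)) l \<noteq> 0" using defpoly_dlog(2)[OF d, of l] by simp
qed

lemma dlog_hyp:
  assumes "defines_hyperplane f H" "pd (defpoly H) l \<noteq> 0"
  shows "pd (defpoly H) l / aff_eval (defpoly H) p = 1 / (p l - aff_eval (aH l H) p)"
    and "y \<noteq> l \<Longrightarrow> pd (defpoly H) y / aff_eval (defpoly H) p = - (pd (aH l H) y / (p l - aff_eval (aH l H) p))"
    and "H = graph_hyp l (aH l H)" and "pd (aH l H) l = 0"
    and "pd (defpoly H) y = 0 \<longleftrightarrow> (y \<noteq> l \<and> pd (aH l H) y = 0)"
proof -
  note e = aff_eval_root[OF assms(2), folded aH_def]
  show "pd (defpoly H) l / aff_eval (defpoly H) p = 1 / (p l - aff_eval (aH l H) p)"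
    using assms(2) by (simp add: e)
  show "pd (defpoly H) y / aff_eval (defpoly H) p = - (pd (aH l H) y / (p l - aff_eval (aH l H) p))" if "y \<noteq> l"
    unfolding e using assms(2) that by (simp add: aH_def pd_aff_root)
  show "pd (aH l H) l = 0" by (simp add: aH_def pd_aff_root)
  have "H = {p. aff_eval (defpoly H) p = 0}"
    using defpoly_dlog(4)[OF assms(1)] by (simp add: defines_hyperplane_def)
  also have "\<dots> = graph_hyp l (aH l H)"
    unfolding e graph_hyp_def using assms(2) by auto
  finally show "H = graph_hyp l (aH l H)" .
  show "pd (defpoly H) y = 0 \<longleftrightarrow> (y \<noteq> l \<and> pd (aH l H) y = 0)"
    using assms(2) by (auto simp: aH_def pd_aff_root)
qed

text \<open>Join \<open>p\<close> to a point \<open>q\<close> off the exceptional arrangement. The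
  line meets the arrangement in finitely many points, so the function vanishes on it for all other
  parameters, and by continuity also at parameter 0, the point \<open>p\<close> itself.\<close>

lemma vanishes_by_density:
  fixes \<phi> :: "'n::finite point \<Rightarrow> complex"
  assumes ev: "\<forall>\<^sub>F q in genf. \<phi> q = 0" and cont: "\<And>q. isCont (\<lambda>t. \<phi> (\<lambda>i. p i + t * (q i - p i))) 0"
  shows "\<phi> p = 0"
proof -
  obtain \<G> where \<G>: "arrangement \<G>" "\<And>p. p \<notin> \<Union>\<G> \<Longrightarrow> \<phi> p = 0"
    using ev unfolding eventually_genf generically_def by auto
  obtain q where q: "q \<notin> \<Union>\<G>" using arrangement_complement[OF \<G>(1)] by auto
  let ?\<psi> = "\<lambda>t. \<phi> (\<lambda>i. p i + t * (q i - p i))"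
  have "finite {t. (\<lambda>i. p i + t * (q i - p i)) \<in> H}" if "H \<in> \<G>" for H
  proof -
    obtain f where f: "H = {p. aff_eval f p = 0}"
      using defines_hyperplane_defpoly[OF \<G>(1) \<open>H \<in> \<G>\<close>] unfolding defines_hyperplane_def by blast
    have "aff_eval f q \<noteq> 0" using q that f by auto
    then have "finite {t. aff_eval f p + (aff_eval f q - aff_eval f p) * t = 0}"
      by (intro finite_affine_zeros) auto
    then show ?thesis by (simp add: f aff_eval_line mult.commute)
  qed
  then have "finite (\<Union>H\<in>\<G>. {t. (\<lambda>i. p i + t * (q i - p i)) \<in> H})"
    using \<G>(1) by (auto simp: arrangement_def)
  then have fin: "finite {t. ?\<psi> t \<noteq> 0}"
    by (rule rev_finite_subset) (use \<G>(2) in auto)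
  have "(?\<psi> \<longlongrightarrow> ?\<psi> 0) (at 0)" using cont by (simp add: isCont_def)
  moreover have "(?\<psi> \<longlongrightarrow> 0) (at 0)"
  proof (rule tendsto_eventually)
    have "open (- ({t. ?\<psi> t \<noteq> 0} - {0}))" using fin by (intro open_Compl finite_imp_closed) auto
    then show "\<forall>\<^sub>F t in at 0. ?\<psi> t = 0"
      unfolding eventually_at_topological by (intro exI[of _ "- ({t. ?\<psi> t \<noteq> 0} - {0})"]) auto
  qed
  ultimately have "?\<psi> 0 = 0" using LIM_unique by blast
  then show ?thesis by simp
qed

section \<open>Residues of an integrable form\<close>

definition com :: "linop \<Rightarrow> linop \<Rightarrow> linop" where
  "com X Y = X * Y - Y * X"

lemma com_simps [simp]: "com X X = 0" "com 0 X = 0" "com X 0 = 0"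
    "com (c \<odot>\<^sub>C X) Y = c \<odot>\<^sub>C com X Y" "com X (c \<odot>\<^sub>C Y) = c \<odot>\<^sub>C com X Y"
    "com (- X) Y = - com X Y" "com X (- Y) = - com X Y"
  by (simp_all add: com_def scl_distrib)

lemma com_distrib:
  "com (X + Y) Z = com X Z + com Y Z" "com X (Y + Z) = com X Y + com X Z"
  "com (X - Y) Z = com X Z - com Y Z" "com X (Y - Z) = com X Y - com X Z"
  by (simp_all add: com_def algebra_simps)

lemma com_sum: "com (\<Sum>i\<in>I. f i) Y = (\<Sum>i\<in>I. com (f i) Y)" "com X (\<Sum>i\<in>I. f i) = (\<Sum>i\<in>I. com X (f i))"
  by (simp_all add: com_def sum_distrib_left sum_distrib_right sum_subtractf)

lemma com_swap: "com X Y = - com Y X"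
  by (simp add: com_def)

lemma com_eq_0: "com X Y = 0 \<longleftrightarrow> X * Y = Y * X"
  by (simp add: com_def)

text \<open>Each product of two poles is split by 1/((t - a)(t - b)) = (1/(t - a) - 1/(t - b))/(a -
  b), and the second half is reindexed by exchanging the two summation variables. Diagonal terms
  contribute nothing: the commutator is zero, and the quotient by \<open>a i - a i\<close> is 0 by
  convention.\<close>

lemma cross_sum:
  assumes inj: "inj_on a I" and t: "t \<notin> a ` I"
  shows "(\<Sum>i\<in>I. \<Sum>j\<in>I. (b i * d j / ((t - a i) * (t - a j))) \<odot>\<^sub>C com (A i) (A j))
    = (\<Sum>i\<in>I. (1 / (t - a i)) \<odot>\<^sub>C (\<Sum>j\<in>I. ((b i * d j - b j * d i) / (a i - a j)) \<odot>\<^sub>C com (A i) (A j)))"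
proof -
  define u where "u i j = b i * d j / (a i - a j)" for i j
  define g where "g i = 1 / (t - a i)" for i
  have uu: "u i j + u j i = (b i * d j - b j * d i) / (a i - a j)" for i j
    by (cases "a i = a j") (simp_all add: u_def divide_simps, simp add: algebra_simps)
  have "(b i * d j / ((t - a i) * (t - a j))) \<odot>\<^sub>C com (A i) (A j)
      = (u i j * g i) \<odot>\<^sub>C com (A i) (A j) + (u i j * g j) \<odot>\<^sub>C com (A j) (A i)"
    if "i \<in> I" "j \<in> I" for i j
  proof (cases "i = j")
    case False
    then have n: "a i - a j \<noteq> 0" "t - a i \<noteq> 0" "t - a j \<noteq> 0"
      using inj t that by (auto simp: inj_on_def)
    then have "1 / ((t - a i) * (t - a j)) = (g i - g j) / (a i - a j)"
      unfolding g_def by (simp add: divide_simps)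
    have "b i * d j / ((t - a i) * (t - a j)) = b i * d j * (1 / ((t - a i) * (t - a j)))" by simp
    also have "\<dots> = b i * d j * ((g i - g j) / (a i - a j))" by (simp only: \<open>1 / _ = _\<close>)
    also have "\<dots> = u i j * g i - u i j * g j"
      by (simp add: u_def algebra_simps diff_divide_distrib)
    finally have "b i * d j / ((t - a i) * (t - a j)) = u i j * g i - u i j * g j" .
    then show ?thesis by (simp add: com_swap[of "A j"] scl_distrib)
  qed simp
  then have "(\<Sum>i\<in>I. \<Sum>j\<in>I. (b i * d j / ((t - a i) * (t - a j))) \<odot>\<^sub>C com (A i) (A j))
      = (\<Sum>i\<in>I. \<Sum>j\<in>I. (u i j * g i) \<odot>\<^sub>C com (A i) (A j)) + (\<Sum>i\<in>I. \<Sum>j\<in>I. (u i j * g j) \<odot>\<^sub>C com (A j) (A i))"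
    by (simp add: sum.distrib)
  also have "(\<Sum>i\<in>I. \<Sum>j\<in>I. (u i j * g j) \<odot>\<^sub>C com (A j) (A i)) = (\<Sum>i\<in>I. \<Sum>j\<in>I. (u j i * g i) \<odot>\<^sub>C com (A i) (A j))"
    by (rule sum.swap)
  also have "(\<Sum>i\<in>I. \<Sum>j\<in>I. (u i j * g i) \<odot>\<^sub>C com (A i) (A j)) + (\<Sum>i\<in>I. \<Sum>j\<in>I. (u j i * g i) \<odot>\<^sub>C com (A i) (A j))
      = (\<Sum>i\<in>I. g i \<odot>\<^sub>C (\<Sum>j\<in>I. (u i j + u j i) \<odot>\<^sub>C com (A i) (A j)))"
    by (simp add: scl_sum_right sum.distrib algebra_simps scl_distrib)
  also have "\<dots> = (\<Sum>i\<in>I. (1 / (t - a i)) \<odot>\<^sub>C (\<Sum>j\<in>I. ((b i * d j - b j * d i) / (a i - a j)) \<odot>\<^sub>C com (A i) (A j)))"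
    unfolding uu g_def ..
  finally show ?thesis .
qed

text \<open>The commutator of two rational coefficients is brought to the form to which
  \<open>partial_fractions\<close> applies: constant part, linear part and simple poles.
  \<open>XY\<close> removes the term in t^2, and t/(t - a) = 1 + a/(t - a) redistributes the mixed
  terms.\<close>

lemma com_rational:
  assumes inj: "inj_on a I" and t: "t \<notin> a ` I" and XY: "com X1 Y1 = 0"
  shows "com (X0 + t \<odot>\<^sub>C X1 + (\<Sum>i\<in>I. (b i / (t - a i)) \<odot>\<^sub>C A i)) (Y0 + t \<odot>\<^sub>C Y1 + (\<Sum>i\<in>I. (d i / (t - a i)) \<odot>\<^sub>C A i))
    = (com X0 Y0 + (\<Sum>i\<in>I. d i \<odot>\<^sub>C com X1 (A i)) + (\<Sum>i\<in>I. b i \<odot>\<^sub>C com (A i) Y1))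
      + t \<odot>\<^sub>C (com X0 Y1 + com X1 Y0)
      + (\<Sum>i\<in>I. (1 / (t - a i)) \<odot>\<^sub>C (d i \<odot>\<^sub>C com X0 (A i) + (a i * d i) \<odot>\<^sub>C com X1 (A i)
          + b i \<odot>\<^sub>C com (A i) Y0 + (a i * b i) \<odot>\<^sub>C com (A i) Y1
          + (\<Sum>j\<in>I. ((b i * d j - b j * d i) / (a i - a j)) \<odot>\<^sub>C com (A i) (A j))))"
proof -
  have tg: "t * (c / (t - a i)) = c + a i * c * (1 / (t - a i))" if "i \<in> I" for c i
  proof -
    have "t - a i \<noteq> 0" using t that by auto
    then show ?thesis by (simp add: field_simps)
  qed
  have s1: "(\<Sum>i\<in>I. (t * (d i / (t - a i))) \<odot>\<^sub>C com X1 (A i))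
      = (\<Sum>i\<in>I. d i \<odot>\<^sub>C com X1 (A i)) + (\<Sum>i\<in>I. (1 / (t - a i)) \<odot>\<^sub>C ((a i * d i) \<odot>\<^sub>C com X1 (A i)))"
    unfolding sum.distrib[symmetric] by (intro sum.cong refl) (simp only: tg scl_distrib scl_simps(3) mult.commute)
  have s2: "(\<Sum>i\<in>I. (t * (b i / (t - a i))) \<odot>\<^sub>C com (A i) Y1)
      = (\<Sum>i\<in>I. b i \<odot>\<^sub>C com (A i) Y1) + (\<Sum>i\<in>I. (1 / (t - a i)) \<odot>\<^sub>C ((a i * b i) \<odot>\<^sub>C com (A i) Y1))"
    unfolding sum.distrib[symmetric] by (intro sum.cong refl) (simp only: tg scl_distrib scl_simps(3) mult.commute)
  have c: "com (\<Sum>i\<in>I. (b i / (t - a i)) \<odot>\<^sub>C A i) (\<Sum>i\<in>I. (d i / (t - a i)) \<odot>\<^sub>C A i)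
      = (\<Sum>i\<in>I. \<Sum>j\<in>I. (b i * d j / ((t - a i) * (t - a j))) \<odot>\<^sub>C com (A i) (A j))"
    unfolding com_sum(1) unfolding com_sum(2) by (simp add: mult.commute)
  show ?thesis
    unfolding com_distrib c cross_sum[OF inj t]
    by (simp add: com_sum XY scl_sum_right s1[simplified] s2[simplified] scl_distrib sum.distrib)
      (use s1 in \<open>simp add: algebra_simps\<close>)
qed

section \<open>Coefficients of a form as operators\<close>

definition Sop :: "'n::finite pfaff \<Rightarrow> 'n \<Rightarrow> 'n point \<Rightarrow> linop" where
  "Sop \<Omega> l p = emb (S_coeff \<Omega> l p)"

definition Dop :: "'n::finite pfaff \<Rightarrow> 'n \<Rightarrow> 'n \<Rightarrow> linop" where
  "Dop \<Omega> l y = emb (mlin \<Omega> l y)"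

definition Aop :: "'n::finite pfaff \<Rightarrow> 'n point set \<Rightarrow> linop" where
  "Aop \<Omega> H = emb (res \<Omega> H)"

definition Fop :: "'n::finite pfaff \<Rightarrow> 'n \<Rightarrow> 'n point \<Rightarrow> linop" where
  "Fop \<Omega> y p = emb (form_coeff \<Omega> y p)"

text \<open>The part of the coefficient of \<open>dy\<close> that does not involve \<open>x\<^sub>l\<close>.\<close>

definition Rop :: "'n::finite pfaff \<Rightarrow> 'n \<Rightarrow> 'n \<Rightarrow> 'n point \<Rightarrow> linop" where
  "Rop \<Omega> l y p = emb (mconst \<Omega> y) + (\<Sum>z\<in>UNIV - {l, y}. p z \<odot>\<^sub>C emb (mlin \<Omega> y z))
    + (\<Sum>H\<in>hyps \<Omega> - hyps_dep \<Omega> l. (pd (defpoly H) y / aff_eval (defpoly H) p) \<odot>\<^sub>C Aop \<Omega> H)"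

abbreviation root_at :: "'n::finite \<Rightarrow> 'n point \<Rightarrow> 'n point set \<Rightarrow> complex" where
  "root_at l p H \<equiv> aff_eval (aH l H) p"

abbreviation droot :: "'n::finite \<Rightarrow> 'n \<Rightarrow> 'n point set \<Rightarrow> complex" where
  "droot l y H \<equiv> pd (aH l H) y"

locale pfaff_dir =
  fixes \<Omega> :: "'n::finite pfaff" and l :: 'n
  assumes form: "pfaff_form \<Omega>"
begin

abbreviation "N \<equiv> rk \<Omega>"
abbreviation "I \<equiv> hyps_dep \<Omega> l"
abbreviation "A \<equiv> Aop \<Omega>"

lemma arr: "arrangement (hyps \<Omega>)" using form by (simp add: pfaff_form_def)

lemma finite_hyps [simp]: "finite (hyps \<Omega>)" using arr by (simp add: arrangement_def)
lemma finite_I [simp]: "finite I" by (simp add: hyps_dep_def)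

lemma I_hyps: "H \<in> I \<Longrightarrow> H \<in> hyps \<Omega>" by (simp add: hyps_dep_def)

lemma carriers:
  "mconst \<Omega> i \<in> carrier_mat N N" "i \<noteq> j \<Longrightarrow> mlin \<Omega> i j \<in> carrier_mat N N"
  "H \<in> hyps \<Omega> \<Longrightarrow> res \<Omega> H \<in> carrier_mat N N"
  "S_coeff \<Omega> i p \<in> carrier_mat N N" "form_coeff \<Omega> i p \<in> carrier_mat N N"
  using form by (auto simp: pfaff_form_def S_coeff_def form_coeff_def)

lemma mlin_sym: "i \<noteq> j \<Longrightarrow> mlin \<Omega> i j = mlin \<Omega> j i"
  using form by (simp add: pfaff_form_def)

lemma hyp_dlog:
  assumes "H \<in> I"
  shows "pd (defpoly H) l / aff_eval (defpoly H) p = 1 / (p l - root_at l p H)"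
    and "y \<noteq> l \<Longrightarrow> pd (defpoly H) y / aff_eval (defpoly H) p = - (droot l y H / (p l - root_at l p H))"
    and "H = graph_hyp l (aH l H)" and "droot l l H = 0"
    and "pd (defpoly H) y = 0 \<longleftrightarrow> (y \<noteq> l \<and> droot l y H = 0)"
  using dlog_hyp[OF defines_hyperplane_defpoly[OF arr I_hyps[OF assms]]] assms
  by (auto simp: hyps_dep_def)

lemma inj_aH: "inj_on (aH l) I"
  using hyp_dlog(3) by (metis inj_onI)

lemma S_coeff_emb:
  "emb (S_coeff \<Omega> i p) = emb (mconst \<Omega> i) + (\<Sum>j\<in>UNIV - {i}. p j \<odot>\<^sub>C emb (mlin \<Omega> i j))"
proof -
  have "emb (msum N (\<lambda>j. p j \<cdot>\<^sub>m mlin \<Omega> i j) (UNIV - {i})) = (\<Sum>j\<in>UNIV - {i}. p j \<odot>\<^sub>C emb (mlin \<Omega> i j))"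
    by (subst emb_msum) (auto simp: emb_smult carriers)
  then show ?thesis by (simp add: S_coeff_def emb_add[OF carriers(1) msum_carrier])
qed

lemma Sop_eq: "Sop \<Omega> l p = emb (mconst \<Omega> l) + (\<Sum>z\<in>UNIV - {l}. p z \<odot>\<^sub>C Dop \<Omega> l z)"
  by (simp add: Sop_def S_coeff_emb Dop_def)

lemma Fop_eq: "Fop \<Omega> i p = emb (S_coeff \<Omega> i p) + (\<Sum>H\<in>hyps \<Omega>. (pd (defpoly H) i / aff_eval (defpoly H) p) \<odot>\<^sub>C A H)"
proof -
  have "emb (msum N (\<lambda>H. (pd (defpoly H) i / aff_eval (defpoly H) p) \<cdot>\<^sub>m res \<Omega> H) (hyps \<Omega>))
      = (\<Sum>H\<in>hyps \<Omega>. (pd (defpoly H) i / aff_eval (defpoly H) p) \<odot>\<^sub>C A H)"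
    by (subst emb_msum) (auto simp: emb_smult Aop_def carriers)
  then show ?thesis by (simp add: Fop_def form_coeff_def emb_add[OF carriers(4) msum_carrier])
qed

lemma sum_hyps_split: "(\<Sum>H\<in>hyps \<Omega>. f H) = (\<Sum>H\<in>I. f H) + (\<Sum>H\<in>hyps \<Omega> - I. (f H :: linop))"
  by (subst sum.subset_diff[of I "hyps \<Omega>"]) (auto simp: hyps_dep_def add.commute)

lemma Fop_x: "Fop \<Omega> l p = Sop \<Omega> l p + (\<Sum>H\<in>I. (1 / (p l - root_at l p H)) \<odot>\<^sub>C A H)"
proof -
  have "(\<Sum>H\<in>hyps \<Omega> - I. (pd (defpoly H) l / aff_eval (defpoly H) p) \<odot>\<^sub>C A H) = 0"
    by (intro sum.neutral) (auto simp: hyps_dep_def)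
  then show ?thesis by (simp add: Fop_eq sum_hyps_split Sop_def hyp_dlog(1))
qed

lemma Fop_y:
  assumes "y \<noteq> l"
  shows "Fop \<Omega> y p = Rop \<Omega> l y p + p l \<odot>\<^sub>C Dop \<Omega> l y - (\<Sum>H\<in>I. (droot l y H / (p l - root_at l p H)) \<odot>\<^sub>C A H)"
proof -
  have "(\<Sum>j\<in>UNIV - {y}. p j \<odot>\<^sub>C emb (mlin \<Omega> y j))
      = p l \<odot>\<^sub>C Dop \<Omega> l y + (\<Sum>j\<in>UNIV - {l, y}. p j \<odot>\<^sub>C emb (mlin \<Omega> y j))"
    using assms mlin_sym[of l y] by (subst sum.remove[of _ l]) (auto simp: Dop_def insert_commute intro!: sum.cong)
  then show ?thesis
    by (simp add: Fop_eq S_coeff_emb sum_hyps_split Rop_def hyp_dlog(2)[OF _ assms] sum_negf algebra_simps)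
qed

lemma update_l:
  "Sop \<Omega> l (p(l := t)) = Sop \<Omega> l p" "Rop \<Omega> l y (p(l := t)) = Rop \<Omega> l y p"
  "H \<in> I \<Longrightarrow> root_at l (p(l := t)) H = root_at l p H"
proof -
  show "Sop \<Omega> l (p(l := t)) = Sop \<Omega> l p"
    unfolding Sop_eq by (intro arg_cong2[of _ _ _ _ plus] sum.cong) auto
  show "Rop \<Omega> l y (p(l := t)) = Rop \<Omega> l y p"
    unfolding Rop_def
    by (intro arg_cong2[of _ _ _ _ plus] sum.cong refl) (auto simp: aff_eval_update hyps_dep_def)
  show "root_at l (p(l := t)) H = root_at l p H" if "H \<in> I"
    using hyp_dlog(4)[OF that] by (simp add: aff_eval_update)
qed

lemma idn_ops [simp]:
  "idn N * Sop \<Omega> l p = Sop \<Omega> l p" "Sop \<Omega> l p * idn N = Sop \<Omega> l p"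
  "y \<noteq> l \<Longrightarrow> idn N * Dop \<Omega> l y = Dop \<Omega> l y" "y \<noteq> l \<Longrightarrow> Dop \<Omega> l y * idn N = Dop \<Omega> l y"
  "H \<in> hyps \<Omega> \<Longrightarrow> idn N * A H = A H" "H \<in> hyps \<Omega> \<Longrightarrow> A H * idn N = A H"
  "H \<in> I \<Longrightarrow> idn N * A H = A H" "H \<in> I \<Longrightarrow> A H * idn N = A H"
  "idn N * emb (mconst \<Omega> i) = emb (mconst \<Omega> i)" "emb (mconst \<Omega> i) * idn N = emb (mconst \<Omega> i)"
  "idn N * Fop \<Omega> i p = Fop \<Omega> i p" "Fop \<Omega> i p * idn N = Fop \<Omega> i p"
  using carriers idn_emb[of _ N N] emb_idn[of _ N N] I_hyps
  by (auto simp: Sop_def Dop_def Aop_def Fop_def)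

lemma idn_Rop [simp]:
  assumes "y \<noteq> l" shows "idn N * Rop \<Omega> l y p = Rop \<Omega> l y p" "Rop \<Omega> l y p * idn N = Rop \<Omega> l y p"
proof -
  have "idn N * emb (mlin \<Omega> y z) = emb (mlin \<Omega> y z)" "emb (mlin \<Omega> y z) * idn N = emb (mlin \<Omega> y z)"
    if "z \<noteq> y" for z using that carriers(2)[of y z] by (auto simp: idn_emb emb_idn)
  then show "idn N * Rop \<Omega> l y p = Rop \<Omega> l y p" "Rop \<Omega> l y p * idn N = Rop \<Omega> l y p"
    by (auto simp: Rop_def distrib_left distrib_right sum_distrib_left sum_distrib_right
      intro!: arg_cong2[of _ _ _ _ plus] sum.cong)
qed

lemma generic_roots: "\<forall>\<^sub>F p in genf. inj_on (root_at l p) I"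
  using eventually_inj_on_aff[OF finite_I inj_aH] .

lemma generic_off: "\<forall>\<^sub>F p in genf. \<forall>H\<in>I. p l \<noteq> root_at l p H"
  using eventually_off_arrangement[OF arr]
proof eventually_elim
  case (elim p)
  show ?case
  proof
    fix H assume H: "H \<in> I"
    then have "p \<notin> graph_hyp l (aH l H)" using elim I_hyps hyp_dlog(3) by (metis UnionI)
    then show "p l \<noteq> root_at l p H" by (simp add: graph_hyp_def)
  qed
qed

end

locale integrable_dir = pfaff_dir +
  assumes integ: "completely_integrable \<Omega>" and D: "cond_D \<Omega> l" and I: "cond_I \<Omega> l"
begin

text \<open>Condition (I) read as a dichotomy: if a hyperplane depends on x and on another variable,
  then S_x is constant; otherwise every root a_H is constant. In both cases a product of a
  derivative of S_x with a derivative of a root is zero.\<close>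

lemma const_cases:
  "(\<forall>y. y \<noteq> l \<longrightarrow> Dop \<Omega> l y = 0) \<or> (\<forall>y. y \<noteq> l \<longrightarrow> (\<forall>H\<in>I. droot l y H = 0))"
proof (cases "\<exists>z. z \<noteq> l \<and> I \<inter> hyps_dep \<Omega> z \<noteq> {}")
  case True
  then show ?thesis using I by (auto simp: cond_I_def Dop_def)
next
  case False
  then have "pd (defpoly H) y = 0" if "y \<noteq> l" "H \<in> I" for y H
    using that I_hyps[OF that(2)] by (auto simp: hyps_dep_def)
  then show ?thesis using hyp_dlog(5) by blast
qed

lemma Fop_com: "\<forall>\<^sub>F p in genf. com (Fop \<Omega> i p) (Fop \<Omega> j p) = 0"
  using eventually_off_arrangement[OF arr]
proof eventually_elim
  case (elim p)
  then have "form_coeff \<Omega> i p * form_coeff \<Omega> j p - form_coeff \<Omega> j p * form_coeff \<Omega> i p = 0\<^sub>m N N"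
    using integ by (auto simp: completely_integrable_def)
  then have "emb (form_coeff \<Omega> i p * form_coeff \<Omega> j p - form_coeff \<Omega> j p * form_coeff \<Omega> i p) = 0" by simp
  then show ?case
    using carriers(5) by (simp add: com_def Fop_def emb_minus[of _ N N] emb_mult[of _ N N _ N] mult_carrier_mat[of _ N N])
qed

text \<open>The commutator of the dx- and dy-coefficients is a rational function of x that vanishes
  generically. The three statements are its linear part, its constant part, and its residues at the
  roots of the hyperplanes.\<close>

lemma residue_relations:
  assumes y: "y \<noteq> l"
  shows "\<forall>\<^sub>F p in genf. com (Sop \<Omega> l p) (Dop \<Omega> l y) = 0
    \<and> com (Sop \<Omega> l p) (Rop \<Omega> l y p) + (\<Sum>H\<in>I. com (A H) (Dop \<Omega> l y)) = 0
    \<and> (\<forall>H\<in>I. com (A H) (Rop \<Omega> l y p + droot l y H \<odot>\<^sub>C Sop \<Omega> l p + root_at l p H \<odot>\<^sub>C Dop \<Omega> l y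
        + (\<Sum>H'\<in>I. ((droot l y H - droot l y H') / (root_at l p H - root_at l p H')) \<odot>\<^sub>C A H')) = 0)"
  using generic_roots eventually_genf_update[OF Fop_com[of l y], of l]
proof eventually_elim
  case (elim p)
  let ?a = "root_at l p" and ?S = "Sop \<Omega> l p" and ?R = "Rop \<Omega> l y p" and ?d = "\<lambda>H. - droot l y H" and ?Y = "Dop \<Omega> l y"
  have "\<forall>\<^sub>F t in cofinite. t \<notin> ?a ` I" by (simp add: eventually_cofinite)
  with elim(2) have "\<forall>\<^sub>F t in cofinite. (com ?S ?R + (\<Sum>H\<in>I. com (A H) ?Y)) + t \<odot>\<^sub>C com ?S ?Y
      + (\<Sum>H\<in>I. (1 / (t - ?a H)) \<odot>\<^sub>C (?d H \<odot>\<^sub>C com ?S (A H) + com (A H) ?R + ?a H \<odot>\<^sub>C com (A H) ?Y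
          + (\<Sum>H'\<in>I. ((?d H' - ?d H) / (?a H - ?a H')) \<odot>\<^sub>C com (A H) (A H')))) = 0"
  proof eventually_elim
    case (elim t)
    have "Fop \<Omega> l (p(l := t)) = ?S + t \<odot>\<^sub>C 0 + (\<Sum>H\<in>I. (1 / (t - ?a H)) \<odot>\<^sub>C A H)"
      by (simp add: Fop_x update_l cong: sum.cong)
    moreover have "Fop \<Omega> y (p(l := t)) = ?R + t \<odot>\<^sub>C ?Y + (\<Sum>H\<in>I. (?d H / (t - ?a H)) \<odot>\<^sub>C A H)"
      by (simp add: Fop_y[OF y] update_l sum_negf cong: sum.cong)
    ultimately show ?case
      using elim(1) com_rational[OF \<open>inj_on ?a I\<close> elim(2), of 0 ?Y ?S "\<lambda>_. 1" A ?R ?d] by simp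
  qed
  note pf = partial_fractions[OF finite_I \<open>inj_on ?a I\<close> this]
  then have 1: "com ?S ?R + (\<Sum>H\<in>I. com (A H) ?Y) = 0" "com ?S ?Y = 0" by blast+
  from pf have 2: "?d H \<odot>\<^sub>C com ?S (A H) + com (A H) ?R + ?a H \<odot>\<^sub>C com (A H) ?Y
          + (\<Sum>H'\<in>I. ((?d H' - ?d H) / (?a H - ?a H')) \<odot>\<^sub>C com (A H) (A H')) = 0" if "H \<in> I" for H
    using that by blast+
  have "com (A H) (?R + droot l y H \<odot>\<^sub>C ?S + ?a H \<odot>\<^sub>C ?Y + (\<Sum>H'\<in>I. ((droot l y H - droot l y H') / (?a H - ?a H')) \<odot>\<^sub>C A H')) = 0"
    if "H \<in> I" for H
    using 2[OF that] by (simp add: com_distrib com_sum com_swap[of ?S "A H"] algebra_simps)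
  then show ?case using 1 by blast
qed

lemma mlin_commute:
  assumes y: "y \<noteq> l"
  shows "com (emb (mconst \<Omega> l)) (Dop \<Omega> l y) = 0" "z \<noteq> l \<Longrightarrow> com (Dop \<Omega> l z) (Dop \<Omega> l y) = 0"
proof -
  let ?B = "\<lambda>z. if z = l then 0 else com (Dop \<Omega> l z) (Dop \<Omega> l y)"
  have "\<forall>\<^sub>F p in genf. com (emb (mconst \<Omega> l)) (Dop \<Omega> l y) + (\<Sum>z\<in>UNIV. p z \<odot>\<^sub>C ?B z) = 0"
    using residue_relations[OF y]
  proof eventually_elim
    case (elim p)
    have "(\<Sum>z\<in>UNIV. p z \<odot>\<^sub>C ?B z) = (\<Sum>z\<in>UNIV - {l}. p z \<odot>\<^sub>C com (Dop \<Omega> l z) (Dop \<Omega> l y))"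
      by (rule sum.mono_neutral_cong_right) auto
    then show ?case using elim by (simp add: Sop_eq com_distrib com_sum)
  qed
  from affine_linop_eq_0[OF this]
  show "com (emb (mconst \<Omega> l)) (Dop \<Omega> l y) = 0" "z \<noteq> l \<Longrightarrow> com (Dop \<Omega> l z) (Dop \<Omega> l y) = 0"
    by (auto split: if_splits)
qed

text \<open>These are the constant and linear parts in x of the commutator of the dy- and
  dz-coefficients. Its residues at the roots give nothing that is used further on.\<close>

lemma residue_relations2:
  assumes y: "y \<noteq> l" and z: "z \<noteq> l"
  shows "\<forall>\<^sub>F p in genf. com (Rop \<Omega> l y p) (Rop \<Omega> l z p) = 0
    \<and> com (Rop \<Omega> l y p) (Dop \<Omega> l z) + com (Dop \<Omega> l y) (Rop \<Omega> l z p) = 0"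
  using generic_roots eventually_genf_update[OF Fop_com[of y z], of l]
proof eventually_elim
  case (elim p)
  let ?a = "root_at l p" and ?R = "\<lambda>y. Rop \<Omega> l y p" and ?d = "\<lambda>y H. - droot l y H" and ?Y = "Dop \<Omega> l"
  have "\<forall>\<^sub>F t in cofinite. t \<notin> ?a ` I" by (simp add: eventually_cofinite)
  with elim(2) have "\<forall>\<^sub>F t in cofinite. (com (?R y) (?R z) + (\<Sum>H\<in>I. ?d z H \<odot>\<^sub>C com (?Y y) (A H))
        + (\<Sum>H\<in>I. ?d y H \<odot>\<^sub>C com (A H) (?Y z)))
      + t \<odot>\<^sub>C (com (?R y) (?Y z) + com (?Y y) (?R z))
      + (\<Sum>H\<in>I. (1 / (t - ?a H)) \<odot>\<^sub>C (?d z H \<odot>\<^sub>C com (?R y) (A H) + (?a H * ?d z H) \<odot>\<^sub>C com (?Y y) (A H)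
          + ?d y H \<odot>\<^sub>C com (A H) (?R z) + (?a H * ?d y H) \<odot>\<^sub>C com (A H) (?Y z)
          + (\<Sum>H'\<in>I. ((?d y H * ?d z H' - ?d y H' * ?d z H) / (?a H - ?a H')) \<odot>\<^sub>C com (A H) (A H')))) = 0"
  proof eventually_elim
    case (elim t)
    have "Fop \<Omega> y (p(l := t)) = ?R y + t \<odot>\<^sub>C ?Y y + (\<Sum>H\<in>I. (?d y H / (t - ?a H)) \<odot>\<^sub>C A H)" if "y \<noteq> l" for y
      by (simp add: Fop_y[OF that] update_l sum_negf cong: sum.cong)
    then show ?case
      using elim(1) com_rational[OF \<open>inj_on ?a I\<close> elim(2) mlin_commute(2)[OF z y], of "?R y" "?d y" A "?R z" "?d z"] y z
      by simp
  qed
  from partial_fractions[OF finite_I \<open>inj_on ?a I\<close> this]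
  have 1: "com (?R y) (?R z) + (\<Sum>H\<in>I. ?d z H \<odot>\<^sub>C com (?Y y) (A H)) + (\<Sum>H\<in>I. ?d y H \<odot>\<^sub>C com (A H) (?Y z)) = 0"
    and 2: "com (?R y) (?Y z) + com (?Y y) (?R z) = 0" by blast+
  \<comment> \<open>Each term carries a derivative of a root and a derivative of S_x, and one of
    these is zero by the dichotomy.\<close>
  have "?d z H \<odot>\<^sub>C com (?Y y) (A H) = 0" "?d y H \<odot>\<^sub>C com (A H) (?Y z) = 0" if "H \<in> I" for H
    using const_cases y z that by auto
  then have "com (?R y) (?R z) = 0" using 1 by (simp cong: sum.cong)
  then show ?case using 2 by blast
qed

end

section \<open>Joint eigenvalues\<close>

abbreviation Eop :: "'n::finite pfaff \<Rightarrow> 'n \<Rightarrow> 'n aff \<Rightarrow> linop" where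
  "Eop \<Omega> l \<alpha> \<equiv> emb (eigproj \<Omega> l \<alpha>)"

lemma aff_eval_split: "aff_eval f p = const_term f + pd f l * p l + (\<Sum>z\<in>UNIV - {l}. pd f z * p z)"
  unfolding aff_eval_def by (subst sum.remove[of _ l]) auto

lemma resolution_cong:
  assumes "I = J" "\<And>i. i \<in> J \<Longrightarrow> E i = F i" "resolution e J F" shows "resolution e I E"
  using assms(3) unfolding assms(1) resolution_def by (auto simp: assms(2) cong: sum.cong)

context pfaff_dir
begin

lemma eigsp_seq: "v \<in> eigsp \<Omega> l \<alpha> \<longleftrightarrow> v \<in> carrier_vec N \<and> (\<forall>p. app (Sop \<Omega> l p) (seq_of v) = fscale (aff_eval \<alpha> p) (seq_of v))"
proof -
  have "S_coeff \<Omega> l p *\<^sub>v v = aff_eval \<alpha> p \<cdot>\<^sub>v v \<longleftrightarrow> app (Sop \<Omega> l p) (seq_of v) = fscale (aff_eval \<alpha> p) (seq_of v)"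
    if "v \<in> carrier_vec N" for p
    using that carriers(4)[of l p] seq_of_inj[of "S_coeff \<Omega> l p *\<^sub>v v" N "aff_eval \<alpha> p \<cdot>\<^sub>v v"]
    by (auto simp: Sop_def seq_of_mult[symmetric] seq_of_smult[symmetric] simp del: app_emb)
  then show ?thesis by (auto simp: eigsp_def)
qed

text \<open>Two distinct affine functions differ at some point, so \<open>E \<alpha>\<close> kills
  the joint eigenvectors for every eigenvalue other than \<alpha>, and the joint eigenspaces are the
  ranges of the \<open>E \<alpha>\<close>. As these ranges sum to C^N, the projection described by
  \<open>eigproj\<close> is unique. Members that are zero must be excluded, since they would not
  belong to an eigenvalue.\<close>

lemma eigproj_resolution:
  assumes r: "resolution (idn N) \<Lambda> E" and S: "\<And>p. Sop \<Omega> l p = (\<Sum>\<alpha>\<in>\<Lambda>. aff_eval \<alpha> p \<odot>\<^sub>C E \<alpha>)"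
    and E0: "\<And>\<alpha>. \<alpha> \<in> \<Lambda> \<Longrightarrow> E \<alpha> \<noteq> 0"
  shows "eigvals \<Omega> l = \<Lambda>" "\<alpha> \<in> \<Lambda> \<Longrightarrow> Eop \<Omega> l \<alpha> = E \<alpha>"
    "\<alpha> \<in> \<Lambda> \<Longrightarrow> eigproj \<Omega> l \<alpha> \<in> carrier_mat N N"
proof -
  have Eu: "app (E \<alpha>) (seq_of v) = 0" if v: "v \<in> eigsp \<Omega> l \<beta>" and \<alpha>: "\<alpha> \<in> \<Lambda>" "\<alpha> \<noteq> \<beta>" for v \<alpha> \<beta>
  proof -
    obtain p where p: "aff_eval \<alpha> p \<noteq> aff_eval \<beta> p"
      using eventually_happens'[OF genf_nontrivial eventually_aff_neq[OF \<alpha>(2)]] by auto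
    have "app (E \<alpha>) (app (Sop \<Omega> l p) (seq_of v)) = fscale (aff_eval \<alpha> p) (app (E \<alpha>) (seq_of v))"
      using resolution_lin_mult(2)[OF r \<alpha>(1), of "\<lambda>\<alpha>. aff_eval \<alpha> p"] by (simp flip: S app_times)
    moreover have "app (E \<alpha>) (app (Sop \<Omega> l p) (seq_of v)) = fscale (aff_eval \<beta> p) (app (E \<alpha>) (seq_of v))"
      using v by (simp add: eigsp_seq)
    ultimately show ?thesis using p by (metis fvs.scale_cancel_right)
  qed
  have sumE: "seq_of v = (\<Sum>\<alpha>\<in>\<Lambda>. app (E \<alpha>) (seq_of v))" if "v \<in> eigsp \<Omega> l \<beta>" for v \<beta>
    using that idn_seq_of[of v N] by (simp add: eigsp_seq flip: app_sum resolution_sum[OF r])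
  have mem: "vec N (app (E \<alpha>) u) \<in> eigsp \<Omega> l \<alpha>" "seq_of (vec N (app (E \<alpha>) u)) = app (E \<alpha>) u"
    if "\<alpha> \<in> \<Lambda>" for \<alpha> u
  proof -
    show 1: "seq_of (vec N (app (E \<alpha>) u)) = app (E \<alpha>) u"
      using resolution_unit(1)[OF r that] by (simp add: seq_of_vec flip: app_times)
    show "vec N (app (E \<alpha>) u) \<in> eigsp \<Omega> l \<alpha>"
      unfolding eigsp_seq 1 S using resolution_lin_mult(1)[OF r that] by (simp flip: app_times)
  qed
  show ev: "eigvals \<Omega> l = \<Lambda>"
  proof (intro Set.set_eqI iffI)
    fix \<beta> assume "\<beta> \<in> eigvals \<Omega> l"
    then obtain v where v: "v \<in> eigsp \<Omega> l \<beta>" "v \<noteq> 0\<^sub>v N" by (auto simp: eigvals_def)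
    have "v \<in> carrier_vec N" using v by (simp add: eigsp_seq)
    then have "seq_of v \<noteq> 0" using v(2) seq_of_inj[of v N "0\<^sub>v N"] by auto
    then show "\<beta> \<in> \<Lambda>" using sumE[OF v(1)] Eu[OF v(1)] by (metis (no_types, lifting) sum.neutral)
  next
    fix \<alpha> assume \<alpha>: "\<alpha> \<in> \<Lambda>"
    obtain u where "app (E \<alpha>) u \<noteq> 0" using E0[OF \<alpha>] by (metis app_0 linop_eqI)
    then have "vec N (app (E \<alpha>) u) \<noteq> 0\<^sub>v N" using mem(2)[OF \<alpha>] by (metis seq_of_zero)
    then show "\<alpha> \<in> eigvals \<Omega> l" using mem(1)[OF \<alpha>] by (auto simp: eigvals_def)
  qed
  assume \<alpha>: "\<alpha> \<in> \<Lambda>"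
  let ?P = "\<lambda>X. X \<in> carrier_mat N N \<and> (\<forall>v \<in> eigsp \<Omega> l \<alpha>. X *\<^sub>v v = v) \<and>
     (\<forall>\<beta> \<in> eigvals \<Omega> l - {\<alpha>}. \<forall>v \<in> eigsp \<Omega> l \<beta>. X *\<^sub>v v = 0\<^sub>v N)"
  let ?X = "unemb N N (E \<alpha>)"
  have embX: "emb ?X = E \<alpha>"
    using resolution_unit[OF r \<alpha>] by (simp add: emb_unemb)
  have P: "?P ?X"
  proof (intro conjI ballI)
    show "?X \<in> carrier_mat N N" by simp
    fix v assume v: "v \<in> eigsp \<Omega> l \<alpha>"
    have vc: "v \<in> carrier_vec N" using v by (simp add: eigsp_seq)
    have "app (E \<alpha>) (seq_of v) = seq_of v"
    proof -
      have "(\<Sum>\<beta>\<in>\<Lambda>. app (E \<beta>) (seq_of v)) = (\<Sum>\<beta>\<in>\<Lambda>. if \<beta> = \<alpha> then app (E \<alpha>) (seq_of v) else 0)"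
        using Eu[OF v] by (intro sum.cong) auto
      then show ?thesis using sumE[OF v] \<alpha> resolution_finite[OF r] by simp
    qed
    then have "seq_of (?X *\<^sub>v v) = seq_of v"
      using vc by (simp add: seq_of_mult[of _ N N] embX)
    then show "?X *\<^sub>v v = v" using vc seq_of_inj[of "?X *\<^sub>v v" N v] by (simp add: mult_mat_vec_carrier[of _ N N])
  next
    fix \<beta> v assume \<beta>: "\<beta> \<in> eigvals \<Omega> l - {\<alpha>}" and v: "v \<in> eigsp \<Omega> l \<beta>"
    have vc: "v \<in> carrier_vec N" using v by (simp add: eigsp_seq)
    have "seq_of (?X *\<^sub>v v) = seq_of (0\<^sub>v N)"
      using vc Eu[OF v \<alpha>] \<beta> by (auto simp add: seq_of_mult[of _ N N] embX)
    then show "?X *\<^sub>v v = 0\<^sub>v N" using vc seq_of_inj[of "?X *\<^sub>v v" N "0\<^sub>v N"] by (simp add: mult_mat_vec_carrier[of _ N N])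
  qed
  have "Y = ?X" if Y: "?P Y" for Y
  proof -
    have "emb Y * E \<beta> = (if \<beta> = \<alpha> then E \<alpha> else 0)" if \<beta>: "\<beta> \<in> \<Lambda>" for \<beta>
    proof (rule linop_eqI)
      fix u
      let ?v = "vec N (app (E \<beta>) u)"
      have "app (emb Y * E \<beta>) u = seq_of (Y *\<^sub>v ?v)"
        using Y mem(2)[OF \<beta>] by (simp add: seq_of_mult[of _ N N])
      also have "Y *\<^sub>v ?v = (if \<beta> = \<alpha> then ?v else 0\<^sub>v N)"
        using Y mem(1)[OF \<beta>, of u] \<beta> ev by auto
      also have "seq_of \<dots> = app (if \<beta> = \<alpha> then E \<alpha> else 0) u"
        using mem(2)[OF \<beta>] by auto
      finally show "app (emb Y * E \<beta>) u = app (if \<beta> = \<alpha> then E \<alpha> else 0) u" .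
    qed
    then have "(\<Sum>\<beta>\<in>\<Lambda>. emb Y * E \<beta>) = (\<Sum>\<beta>\<in>\<Lambda>. if \<beta> = \<alpha> then E \<alpha> else 0)"
      by (intro sum.cong) auto
    then have "emb Y * idn N = E \<alpha>"
      using \<alpha> resolution_finite[OF r] by (simp flip: sum_distrib_left add: resolution_sum[OF r])
    then have "emb Y = emb ?X" using Y by (simp add: embX emb_idn[of _ N N])
    then show ?thesis using Y by (intro emb_inj[of _ N N]) auto
  qed
  then have "eigproj \<Omega> l \<alpha> = ?X"
    unfolding eigproj_def using P by (intro the_equality) auto
  then show "Eop \<Omega> l \<alpha> = E \<alpha>" "eigproj \<Omega> l \<alpha> \<in> carrier_mat N N" by (simp_all add: embX)
qed

end

context integrable_dir
begin

abbreviation "\<Lambda> \<equiv> eigvals \<Omega> l"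
abbreviation "E \<alpha> \<equiv> Eop \<Omega> l \<alpha>"

lemma spectral_exists:
  "\<exists>L F. resolution (idn N) L F \<and> emb (mconst \<Omega> l) = (\<Sum>\<alpha>\<in>L. const_term \<alpha> \<odot>\<^sub>C F \<alpha>) \<and>
     (\<forall>y. y \<noteq> l \<longrightarrow> Dop \<Omega> l y = (\<Sum>\<alpha>\<in>L. pd \<alpha> y \<odot>\<^sub>C F \<alpha>)) \<and> (\<forall>\<alpha>\<in>L. F \<alpha> \<noteq> 0 \<and> pd \<alpha> l = 0)"
proof -
  define B where "B i = (if i = l then emb (mconst \<Omega> l) else Dop \<Omega> l i)" for i
  have 1: "\<exists>\<Lambda> E. resolution (idn N) \<Lambda> E \<and> B j = (\<Sum>t\<in>\<Lambda>. t \<odot>\<^sub>C E t)" for j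
    using diagonalizable_resolution[OF carriers(1), of l] diagonalizable_resolution[OF carriers(2), of l j] D
    by (auto simp: B_def Dop_def cond_D_def)
  have 2: "B i * B j = B j * B i" for i j
    using mlin_commute(1)[of i] mlin_commute(1)[of j] mlin_commute(2)[of j i] by (auto simp: B_def com_eq_0)
  obtain \<A> F where r: "resolution (idn N) \<A> F" and BF0: "\<forall>j\<in>UNIV. B j = (\<Sum>\<alpha>\<in>\<A>. \<alpha> j \<odot>\<^sub>C F \<alpha>)"
    using joint_resolution[of UNIV "idn N" B, OF finite_UNIV 1 2 idn_idem] by (elim exE conjE)
  have BF: "B j = (\<Sum>\<alpha>\<in>\<A>. \<alpha> j \<odot>\<^sub>C F \<alpha>)" for j using BF0 by simp
  \<comment> \<open>The joint spectrum consists of functions on the variables. S_x does not involve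
    x, so the slot \<open>l\<close> was used for the matrix \<open>mconst \<Omega> l\<close>; it
    becomes the constant term, and the coefficient of x is set to 0.\<close>
  define g where "g \<alpha> = Aff (\<alpha>(l := 0)) (\<alpha> l)" for \<alpha> :: "'a \<Rightarrow> complex"
  define h where "h f = (pd f)(l := const_term f)" for f :: "'a aff"
  have hg: "h (g \<alpha>) = \<alpha>" for \<alpha> by (simp add: h_def g_def)
  define L where "L = g ` {\<alpha>\<in>\<A>. F \<alpha> \<noteq> 0}"
  have inj: "inj_on g {\<alpha>\<in>\<A>. F \<alpha> \<noteq> 0}" by (rule inj_on_inverseI[of _ h]) (rule hg)
  have sumL: "(\<Sum>\<alpha>\<in>L. c \<alpha> \<odot>\<^sub>C F (h \<alpha>)) = (\<Sum>\<alpha>\<in>\<A>. c (g \<alpha>) \<odot>\<^sub>C F \<alpha>)" for c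
    unfolding L_def sum.reindex[OF inj] using resolution_finite[OF r]
    by (intro sum.mono_neutral_cong_left) (auto simp: hg)
  have "resolution (idn N) L (\<lambda>\<alpha>. F (h \<alpha>))"
    unfolding resolution_def
  proof (intro conjI ballI)
    show "finite L" using resolution_finite[OF r] by (simp add: L_def)
    show "(\<Sum>\<alpha>\<in>L. F (h \<alpha>)) = idn N" using sumL[of "\<lambda>_. 1"] resolution_sum[OF r] by simp
    fix \<alpha> \<beta> assume "\<alpha> \<in> L" "\<beta> \<in> L"
    then show "F (h \<alpha>) * F (h \<beta>) = (if \<alpha> = \<beta> then F (h \<alpha>) else 0)"
      using resolution_mult[OF r] hg by (auto simp: L_def)
  qed
  moreover have "emb (mconst \<Omega> l) = (\<Sum>\<alpha>\<in>L. const_term \<alpha> \<odot>\<^sub>C F (h \<alpha>))"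
    using BF[of l] by (simp add: sumL B_def g_def)
  moreover have "Dop \<Omega> l y = (\<Sum>\<alpha>\<in>L. pd \<alpha> y \<odot>\<^sub>C F (h \<alpha>))" if "y \<noteq> l" for y
    using BF[of y] that by (simp add: sumL B_def g_def)
  moreover have "F (h \<alpha>) \<noteq> 0 \<and> pd \<alpha> l = 0" if "\<alpha> \<in> L" for \<alpha>
    using that by (auto simp: L_def hg) (simp add: g_def)
  ultimately show ?thesis by (intro exI[of _ L] exI[of _ "\<lambda>\<alpha>. F (h \<alpha>)"]) auto
qed

lemma spectral:
  shows resolution_E: "resolution (idn N) \<Lambda> E" and Sop_E: "Sop \<Omega> l p = (\<Sum>\<alpha>\<in>\<Lambda>. aff_eval \<alpha> p \<odot>\<^sub>C E \<alpha>)"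
    and Dop_E: "y \<noteq> l \<Longrightarrow> Dop \<Omega> l y = (\<Sum>\<alpha>\<in>\<Lambda>. pd \<alpha> y \<odot>\<^sub>C E \<alpha>)"
    and mconst_E: "emb (mconst \<Omega> l) = (\<Sum>\<alpha>\<in>\<Lambda>. const_term \<alpha> \<odot>\<^sub>C E \<alpha>)"
    and E_nonzero: "\<alpha> \<in> \<Lambda> \<Longrightarrow> E \<alpha> \<noteq> 0" and pd_eigval: "\<alpha> \<in> \<Lambda> \<Longrightarrow> pd \<alpha> l = 0"
    and eigproj_carrier: "\<alpha> \<in> \<Lambda> \<Longrightarrow> eigproj \<Omega> l \<alpha> \<in> carrier_mat N N"
proof -
  obtain L F where r: "resolution (idn N) L F" and m: "emb (mconst \<Omega> l) = (\<Sum>\<alpha>\<in>L. const_term \<alpha> \<odot>\<^sub>C F \<alpha>)"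
    and d: "\<And>y. y \<noteq> l \<Longrightarrow> Dop \<Omega> l y = (\<Sum>\<alpha>\<in>L. pd \<alpha> y \<odot>\<^sub>C F \<alpha>)"
    and F: "\<And>\<alpha>. \<alpha> \<in> L \<Longrightarrow> F \<alpha> \<noteq> 0" "\<And>\<alpha>. \<alpha> \<in> L \<Longrightarrow> pd \<alpha> l = 0"
    using spectral_exists by blast
  have S: "Sop \<Omega> l p = (\<Sum>\<alpha>\<in>L. aff_eval \<alpha> p \<odot>\<^sub>C F \<alpha>)" for p
  proof -
    have "(\<Sum>z\<in>UNIV - {l}. p z \<odot>\<^sub>C Dop \<Omega> l z) = (\<Sum>z\<in>UNIV - {l}. \<Sum>\<alpha>\<in>L. (pd \<alpha> z * p z) \<odot>\<^sub>C F \<alpha>)"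
      by (intro sum.cong) (auto simp: d scl_sum_right mult.commute)
    also have "\<dots> = (\<Sum>\<alpha>\<in>L. (\<Sum>z\<in>UNIV - {l}. pd \<alpha> z * p z) \<odot>\<^sub>C F \<alpha>)"
      unfolding scl_sum_left by (rule sum.swap)
    finally show ?thesis
      unfolding Sop_eq m sum.distrib[symmetric]
      by (auto simp: sum.distrib[symmetric] scl_distrib(2)[symmetric] F aff_eval_split[of _ p l] intro!: sum.cong)
  qed
  have F1: "\<alpha> \<in> L \<Longrightarrow> F \<alpha> \<noteq> 0" for \<alpha> by (rule F(1))
  have e: "\<Lambda> = L" by (rule eigproj_resolution(1)[OF r S F1])
  have EF: "E \<alpha> = F \<alpha>" if "\<alpha> \<in> L" for \<alpha> by (rule eigproj_resolution(2)[OF r S F1 that])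
  have sumL: "(\<Sum>\<alpha>\<in>\<Lambda>. c \<alpha> \<odot>\<^sub>C E \<alpha>) = (\<Sum>\<alpha>\<in>L. c \<alpha> \<odot>\<^sub>C F \<alpha>)" for c
    by (rule sum.cong[OF e]) (simp only: EF)
  show "resolution (idn N) \<Lambda> E" 
    by (rule resolution_cong[OF e _ r]) (rule EF)
  show "Sop \<Omega> l p = (\<Sum>\<alpha>\<in>\<Lambda>. aff_eval \<alpha> p \<odot>\<^sub>C E \<alpha>)" by (simp only: S sumL)
  show "y \<noteq> l \<Longrightarrow> Dop \<Omega> l y = (\<Sum>\<alpha>\<in>\<Lambda>. pd \<alpha> y \<odot>\<^sub>C E \<alpha>)" by (simp add: d sumL)
  show "emb (mconst \<Omega> l) = (\<Sum>\<alpha>\<in>\<Lambda>. const_term \<alpha> \<odot>\<^sub>C E \<alpha>)" by (simp only: m sumL)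
  show "\<alpha> \<in> \<Lambda> \<Longrightarrow> E \<alpha> \<noteq> 0" "\<alpha> \<in> \<Lambda> \<Longrightarrow> pd \<alpha> l = 0" using F EF by (simp_all add: e)
  show "\<alpha> \<in> \<Lambda> \<Longrightarrow> eigproj \<Omega> l \<alpha> \<in> carrier_mat N N" using eigproj_resolution(3)[OF r S F1] e by simp
qed

lemma finite_eigvals [simp]: "finite \<Lambda>" using resolution_finite[OF resolution_E] .

lemma idn_E [simp]: "\<alpha> \<in> \<Lambda> \<Longrightarrow> idn N * E \<alpha> = E \<alpha>" "\<alpha> \<in> \<Lambda> \<Longrightarrow> E \<alpha> * idn N = E \<alpha>"
  using resolution_unit[OF resolution_E] by auto

end

section \<open>The Laplace transform in block form\<close>

text \<open>The data \<open>K\<^sub>H : \<complex>\<^sup>N \<rightarrow> \<complex>\<^sup>m\<close> of the quotient map by the sum of the kernels, with sections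
  \<open>s\<^sub>H : \<complex>\<^sup>m \<rightarrow> \<complex>\<^sup>N\<close> splitting it up to elements of that sum.\<close>

definition block_quotient ::
    "'n::finite pfaff \<Rightarrow> 'n \<Rightarrow> nat \<Rightarrow> ('n point set \<Rightarrow> linop) \<Rightarrow> ('n point set \<Rightarrow> linop) \<Rightarrow> bool" where
  "block_quotient \<Omega> l m K s \<longleftrightarrow>
     (\<forall>i\<in>hyps_dep \<Omega> l. idn m * K i = K i \<and> K i * idn (rk \<Omega>) = K i \<and> idn (rk \<Omega>) * s i = s i \<and> s i * idn m = s i) \<and>
     (\<Sum>i\<in>hyps_dep \<Omega> l. K i * s i) = idn m \<and>
     (\<forall>i\<in>hyps_dep \<Omega> l. \<forall>j\<in>hyps_dep \<Omega> l. Aop \<Omega> i * s i * K j = (if i = j then Aop \<Omega> i else 0)) \<and>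
     (\<forall>i\<in>hyps_dep \<Omega> l. \<forall>X. Aop \<Omega> i * X = 0 \<longrightarrow> K i * X = 0)"

text \<open>The blocks of the operators \<open>M\<^sub>y\<close>, with the two cases for \<open>y \<noteq> l\<close> unified; the quotient
  \<open>dlog_diff\<close> is the coefficient of \<open>dy\<close> in \<open>d log (a\<^sub>H - a\<^sub>H\<^sub>')\<close>, and is \<open>0\<close> if \<open>H = H'\<close>.\<close>

definition dlog_diff :: "'n::finite \<Rightarrow> 'n \<Rightarrow> 'n point \<Rightarrow> 'n point set \<Rightarrow> 'n point set \<Rightarrow> complex" where
  "dlog_diff l y p H H' = (droot l y H - droot l y H') / (root_at l p H - root_at l p H')"

lemma dlog_diff_refl [simp]: "dlog_diff l y p H H = 0"
  by (simp add: dlog_diff_def)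

lemma dlog_diff_sym: "dlog_diff l y p H H' = dlog_diff l y p H' H"
  unfolding dlog_diff_def by (metis minus_diff_eq minus_divide_divide)

definition resolvent :: "complex \<Rightarrow> 'n::finite pfaff \<Rightarrow> 'n \<Rightarrow> 'n point \<Rightarrow> linop" where
  "resolvent \<epsilon> \<Omega> l p = (\<Sum>\<alpha>\<in>eigvals \<Omega> l. (1 / (p l - \<epsilon> * aff_eval \<alpha> p)) \<odot>\<^sub>C Eop \<Omega> l \<alpha>)"

text \<open>This is the operator that commutes with the residue along \<open>H\<close> by the last
  clause of \<open>residue_relations\<close>. It therefore preserves the kernel of that residue,
  which is why the Laplace transform descends to the quotient.\<close>

definition diag_block :: "'n::finite pfaff \<Rightarrow> 'n \<Rightarrow> 'n \<Rightarrow> 'n point \<Rightarrow> 'n point set \<Rightarrow> linop" where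
  "diag_block \<Omega> l y p H = Rop \<Omega> l y p + root_at l p H \<odot>\<^sub>C Dop \<Omega> l y + droot l y H \<odot>\<^sub>C Sop \<Omega> l p
     + (\<Sum>H'\<in>hyps_dep \<Omega> l. dlog_diff l y p H H' \<odot>\<^sub>C Aop \<Omega> H')"

definition Mop :: "complex \<Rightarrow> 'n::finite pfaff \<Rightarrow> 'n \<Rightarrow> 'n \<Rightarrow> 'n point \<Rightarrow> 'n point set \<Rightarrow> 'n point set \<Rightarrow> linop" where
  "Mop \<epsilon> \<Omega> l y p H H' =
    (if y = l then (if H = H' then (- \<epsilon> * root_at l p H) \<odot>\<^sub>C idn (rk \<Omega>) else 0) - resolvent \<epsilon> \<Omega> l p * Aop \<Omega> H'
     else (if H = H' then diag_block \<Omega> l y p H - (\<epsilon> * droot l y H * p l) \<odot>\<^sub>C idn (rk \<Omega>) else 0)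
       - dlog_diff l y p H H' \<odot>\<^sub>C Aop \<Omega> H' + \<epsilon> \<odot>\<^sub>C (Dop \<Omega> l y * resolvent \<epsilon> \<Omega> l p * Aop \<Omega> H'))"

context pfaff_dir
begin

lemma blockspace_carrier: "v \<in> blockspace \<Omega> l \<Longrightarrow> H \<in> I \<Longrightarrow> v H \<in> carrier_vec N"
  by (auto simp: blockspace_def)

lemma res_apply_seq:
  assumes "v \<in> blockspace \<Omega> l"
  shows "res_apply \<Omega> l v \<in> carrier_vec N" "seq_of (res_apply \<Omega> l v) = (\<Sum>H\<in>I. app (A H) (seq_of (v H)))"
proof -
  have v: "v H \<in> carrier_vec N" "res \<Omega> H \<in> carrier_mat N N" if "H \<in> I" for H
    using that blockspace_carrier[OF assms] carriers I_hyps by auto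
  show "res_apply \<Omega> l v \<in> carrier_vec N" by (simp add: res_apply_def)
  show "seq_of (res_apply \<Omega> l v) = (\<Sum>H\<in>I. app (A H) (seq_of (v H)))"
    unfolding res_apply_def using v
    by (subst seq_of_vsum) (auto simp: Aop_def seq_of_mult[of _ N N] mult_mat_vec_carrier[of _ N N])
qed

lemma coord_seq:
  assumes "v \<in> blockspace \<Omega> l" "\<forall>H\<in>I. \<kappa> H \<in> carrier_mat m N"
  shows "coord_map \<Omega> l m \<kappa> v \<in> carrier_vec m"
    "seq_of (coord_map \<Omega> l m \<kappa> v) = (\<Sum>H\<in>I. app (emb (\<kappa> H)) (seq_of (v H)))"
proof -
  show "coord_map \<Omega> l m \<kappa> v \<in> carrier_vec m" by (simp add: coord_map_def)
  show "seq_of (coord_map \<Omega> l m \<kappa> v) = (\<Sum>H\<in>I. app (emb (\<kappa> H)) (seq_of (v H)))"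
    unfolding coord_map_def using assms blockspace_carrier
    by (subst seq_of_vsum) (auto simp: seq_of_mult[of _ m N] mult_mat_vec_carrier[of _ m N])
qed

lemma kernelspace_iff:
  assumes "v \<in> blockspace \<Omega> l"
  shows "v \<in> kernelspace \<Omega> l \<longleftrightarrow> (\<forall>H\<in>I. app (A H) (seq_of (v H)) = 0)"
proof -
  have "v H \<in> mat_kernel (res \<Omega> H) \<longleftrightarrow> app (A H) (seq_of (v H)) = 0" if H: "H \<in> I" for H
  proof -
    have c: "v H \<in> carrier_vec N" "res \<Omega> H \<in> carrier_mat N N"
      using H blockspace_carrier[OF assms] carriers I_hyps by auto
    then have "v H \<in> mat_kernel (res \<Omega> H) \<longleftrightarrow> res \<Omega> H *\<^sub>v v H = 0\<^sub>v N" by (auto simp: mat_kernel_def)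
    also have "\<dots> \<longleftrightarrow> seq_of (res \<Omega> H *\<^sub>v v H) = 0"
      using seq_of_inj[of "res \<Omega> H *\<^sub>v v H" N "0\<^sub>v N"] c by (auto simp: mult_mat_vec_carrier[of _ N N])
    finally show ?thesis using c by (simp add: Aop_def seq_of_mult[of _ N N])
  qed
  then show ?thesis using assms by (simp add: kernelspace_def)
qed

definition single :: "'a point set \<Rightarrow> complex vec \<Rightarrow> 'a point set \<Rightarrow> complex vec" where
  "single H u = (\<lambda>H'. if H' = H then u else 0\<^sub>v N)"

lemma single_blockspace [simp]: "u \<in> carrier_vec N \<Longrightarrow> single H u \<in> blockspace \<Omega> l"
  by (auto simp: single_def blockspace_def)

lemma sum_single: "H \<in> I \<Longrightarrow> (\<Sum>H'\<in>I. app (F H') (seq_of (single H u H'))) = app (F H) (seq_of u)"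
  by (subst sum.remove[of _ H]) (auto simp: single_def intro!: sum.neutral)

lemma linop_eq_deltaI:
  assumes "X * idn n = X" "Y * idn n = Y" "\<And>k. k < n \<Longrightarrow> app X (delta k) = app Y (delta k)"
  shows "X = Y"
proof (rule linop_eqI)
  fix u
  have "app Z u = (\<Sum>k<n. fscale (u k) (app Z (delta k)))" if "Z * idn n = Z" for Z
    using that by (metis (no_types, lifting) app_idn_sum app_scale_vec app_sum_vec app_times sum.cong)
  then show "app X u = app Y u" using assms by (metis (no_types, lifting) lessThan_iff sum.cong)
qed

text \<open>The columns of the sections are block vectors mapped to the unit vectors by the
  coordinate map. The remaining properties restate that the kernel of the coordinate map is the sum
  of the kernels of the residues.\<close>

lemma block_quotient_of_basis:
  assumes q: "quotient_basis \<Omega> l m \<kappa>"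
  shows "\<exists>s. block_quotient \<Omega> l m (\<lambda>H. emb (\<kappa> H)) s"
proof -
  have \<kappa>: "\<forall>H\<in>I. \<kappa> H \<in> carrier_mat m N"
    and surj: "coord_map \<Omega> l m \<kappa> ` blockspace \<Omega> l = carrier_vec m"
    and ker: "{v \<in> blockspace \<Omega> l. coord_map \<Omega> l m \<kappa> v = 0\<^sub>v m} = kernelspace \<Omega> l"
    using q by (auto simp: quotient_basis_def)
  let ?K = "\<lambda>H. emb (\<kappa> H)"
  have coord0: "coord_map \<Omega> l m \<kappa> v = 0\<^sub>v m \<longleftrightarrow> (\<Sum>H\<in>I. app (?K H) (seq_of (v H))) = 0" if "v \<in> blockspace \<Omega> l" for v
    using coord_seq[OF that \<kappa>] seq_of_inj[OF coord_seq(1)[OF that \<kappa>] zero_carrier_vec] by auto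
  have kill: "(\<forall>H\<in>I. app (A H) (seq_of (v H)) = 0) \<longleftrightarrow> (\<Sum>H\<in>I. app (?K H) (seq_of (v H))) = 0"
    if "v \<in> blockspace \<Omega> l" for v
    using ker coord0[OF that] kernelspace_iff[OF that] that by blast
  have "\<forall>k. \<exists>v. k < m \<longrightarrow> v \<in> blockspace \<Omega> l \<and> coord_map \<Omega> l m \<kappa> v = unit_vec m k"
    using surj by (metis imageE unit_vec_carrier)
  then obtain V where V: "\<And>k. k < m \<Longrightarrow> V k \<in> blockspace \<Omega> l" "\<And>k. k < m \<Longrightarrow> coord_map \<Omega> l m \<kappa> (V k) = unit_vec m k"
    by metis
  have seq_unit: "seq_of (unit_vec m k) = delta k" if "k < m" for k
    using that by (auto simp: fun_eq_iff seq_of_def delta_def unit_vec_def)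
  define s where "s H = emb (mat N m (\<lambda>(i, k). V k H $ i))" for H
  have s_delta: "app (s H) (delta k) = seq_of (V k H)" if "k < m" "H \<in> I" for k H
    using that blockspace_carrier[OF V(1)[OF that(1)] that(2)]
    by (auto simp: s_def fun_eq_iff app_emb seq_of_def delta_def if_distrib[of "\<lambda>x. _ * x"] cong: if_cong)
  have sid: "idn N * s H = s H" "s H * idn m = s H" for H
    by (simp_all add: s_def idn_emb[of _ N m] emb_idn[of _ N m])
  have Kid: "idn m * ?K H = ?K H" "?K H * idn N = ?K H" if "H \<in> I" for H
    using bspec[OF \<kappa> that] by (simp_all add: idn_emb emb_idn)
  have sum: "(\<Sum>H\<in>I. ?K H * s H) = idn m"
  proof (rule linop_eq_deltaI[of _ m])
    show "(\<Sum>H\<in>I. ?K H * s H) * idn m = (\<Sum>H\<in>I. ?K H * s H)"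
      by (simp add: sum_distrib_right mult.assoc sid)
    fix k assume k: "k < m"
    have "app (\<Sum>H\<in>I. ?K H * s H) (delta k) = (\<Sum>H\<in>I. app (?K H) (seq_of (V k H)))"
      unfolding app_sum by (intro sum.cong) (simp_all add: s_delta[OF k])
    also have "\<dots> = delta k"
      using coord_seq(2)[OF V(1)[OF k] \<kappa>] V(2)[OF k] seq_unit[OF k] by simp
    also have "\<dots> = app (idn m) (delta k)" using k by (auto simp: fun_eq_iff app_idn delta_def)
    finally show "app (\<Sum>H\<in>I. ?K H * s H) (delta k) = app (idn m) (delta k)" .
  qed simp
  have AsK: "A i * s i * ?K j = (if i = j then A i else 0)" if ij: "i \<in> I" "j \<in> I" for i j
  proof (rule linop_eq_vecI[of _ N])
    fix u :: "complex vec" assume u: "u \<in> carrier_vec N"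
    let ?w = "app (?K j) (seq_of u)"
    \<comment> \<open>The vector \<open>u\<close> in block \<open>j\<close> minus the lift of its
      own class has coordinates zero. So it lies in the sum of the kernels, and \<open>A i\<close>
      kills its component in block \<open>i\<close>.\<close>
    let ?b = "\<lambda>H. single j u H - vec N (app (s H) ?w)"
    have sb: "seq_of (?b H) = seq_of (single j u H) - app (s H) ?w" for H
    proof -
      have "single j u H \<in> carrier_vec N" using u by (simp add: single_def)
      then have "seq_of (?b H) = seq_of (single j u H) - seq_of (vec N (app (s H) ?w))"
        by (intro seq_of_minus[of _ N]) auto
      also have "seq_of (vec N (app (s H) ?w)) = app (s H) ?w"
        using sid(1)[of H] unfolding seq_of_vec by (metis app_times)
      finally show ?thesis .
    qed
    have b: "?b \<in> blockspace \<Omega> l" using u by (auto simp: blockspace_def single_def)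
    have "(\<Sum>H\<in>I. app (?K H) (seq_of (?b H))) = ?w - app (\<Sum>H\<in>I. ?K H * s H) ?w"
      unfolding sb by (simp add: sum_subtractf sum_single[OF ij(2)] app_sum)
    also have "\<dots> = 0" unfolding sum using Kid(1)[OF ij(2)] by (metis app_times cancel_comm_monoid_add_class.diff_cancel)
    finally have "app (A i) (seq_of (?b i)) = 0" using kill[OF b] ij(1) by blast
    then have "app (A i) (app (s i) ?w) = app (A i) (seq_of (single j u i))"
      unfolding sb by simp
    then show "app (A i * s i * ?K j) (seq_of u) = app (if i = j then A i else 0) (seq_of u)"
      by (auto simp: single_def)
  qed (use ij Kid in \<open>auto simp: mult.assoc\<close>)
  have "?K i * X = 0" if i: "i \<in> I" and X: "A i * X = 0" for i X
  proof (rule linop_eqI)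
    fix u
    let ?z = "vec N (app X u)"
    have b: "single i ?z \<in> blockspace \<Omega> l" by simp
    have "app (A i) (seq_of ?z) = app (A i * idn N * X) u" by (simp add: seq_of_vec)
    also have "\<dots> = 0" using X i by simp
    finally have "\<forall>H\<in>I. app (A H) (seq_of (single i ?z H)) = 0" by (auto simp: single_def)
    then have "app (?K i) (seq_of ?z) = 0" using kill[OF b] sum_single[OF i] by metis
    moreover have "app (?K i) (seq_of ?z) = app (?K i * idn N * X) u" by (simp add: seq_of_vec)
    ultimately show "app (?K i * X) u = app 0 u" using Kid[OF i] by simp
  qed
  then show ?thesis
    unfolding block_quotient_def using Kid sid sum AsK by (intro exI[of _ s]) blast
qed

lemma basis_of_block_quotient:
  assumes q: "block_quotient \<Omega> l m (\<lambda>H. emb (\<kappa> H)) s" and \<kappa>: "\<forall>H\<in>I. \<kappa> H \<in> carrier_mat m N"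
  shows "quotient_basis \<Omega> l m \<kappa>"
proof -
  let ?K = "\<lambda>H. emb (\<kappa> H)"
  have sid: "\<And>H. H \<in> I \<Longrightarrow> idn N * s H = s H" and sum: "(\<Sum>H\<in>I. ?K H * s H) = idn m"
    and AsK: "\<And>i j. i \<in> I \<Longrightarrow> j \<in> I \<Longrightarrow> A i * s i * ?K j = (if i = j then A i else 0)"
    and ker: "\<And>i X. i \<in> I \<Longrightarrow> A i * X = 0 \<Longrightarrow> ?K i * X = 0"
    using q unfolding block_quotient_def by blast+
  have coord0: "coord_map \<Omega> l m \<kappa> v = 0\<^sub>v m \<longleftrightarrow> (\<Sum>H\<in>I. app (?K H) (seq_of (v H))) = 0" if "v \<in> blockspace \<Omega> l" for v
    using coord_seq[OF that \<kappa>] seq_of_inj[OF coord_seq(1)[OF that \<kappa>] zero_carrier_vec] by auto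
  have kill: "app (?K i) (seq_of v) = 0" if "i \<in> I" "v \<in> carrier_vec N" "app (A i) (seq_of v) = 0" for i v
  proof -
    \<comment> \<open>The kernel condition is stated for operators. \<open>X\<close> is the operator
      of rank at most one with first column \<open>v\<close>, which transfers the condition to a
      single vector.\<close>
    define X where "X = emb (mat N 1 (\<lambda>(i, _). v $ i))"
    have X: "app X u = fscale (u 0) (seq_of v)" for u
      using that(2) by (auto simp: X_def fun_eq_iff app_emb seq_of_def)
    have "?K i * X = 0"
      using that by (intro ker) (auto intro!: linop_eqI simp: X)
    then have "app (?K i) (app X (delta 0)) = 0" by (metis app_0 app_times)
    moreover have "app X (delta 0) = seq_of v" by (auto simp: X fun_eq_iff delta_def)
    ultimately show ?thesis by simp
  qed
  have "coord_map \<Omega> l m \<kappa> ` blockspace \<Omega> l = carrier_vec m"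
  proof (intro Set.set_eqI iffI)
    fix x :: "complex vec" assume x: "x \<in> carrier_vec m"
    let ?v = "\<lambda>H. vec N (app (s H) (seq_of x))"
    have v: "?v \<in> blockspace \<Omega> l" by (auto simp: blockspace_def)
    have "seq_of (?v H) = app (s H) (seq_of x)" if "H \<in> I" for H
      using sid[OF that] unfolding seq_of_vec by (metis app_times)
    then have "(\<Sum>H\<in>I. app (?K H) (seq_of (?v H))) = app (\<Sum>H\<in>I. ?K H * s H) (seq_of x)"
      unfolding app_sum by (intro sum.cong) auto
    then have "seq_of (coord_map \<Omega> l m \<kappa> ?v) = seq_of x"
      using coord_seq(2)[OF v \<kappa>] x by (simp add: sum idn_seq_of)
    then show "x \<in> coord_map \<Omega> l m \<kappa> ` blockspace \<Omega> l"
      using seq_of_inj[OF coord_seq(1)[OF v \<kappa>] x] v by (metis image_eqI)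
  qed (use coord_seq(1) \<kappa> in auto)
  moreover have "(coord_map \<Omega> l m \<kappa> v = 0\<^sub>v m) \<longleftrightarrow> v \<in> kernelspace \<Omega> l" if v: "v \<in> blockspace \<Omega> l" for v
    unfolding coord0[OF v] kernelspace_iff[OF v]
  proof (intro iffI ballI)
    fix i assume i: "i \<in> I" and z: "(\<Sum>H\<in>I. app (?K H) (seq_of (v H))) = 0"
    have "app (A i) (seq_of (v i)) = (\<Sum>H\<in>I. app (if i = H then A i else 0) (seq_of (v H)))"
      using i by (simp add: if_distrib[of "\<lambda>X. app X _"] cong: if_cong)
    also have "\<dots> = (\<Sum>H\<in>I. app (A i) (app (s i) (app (?K H) (seq_of (v H)))))"
      by (intro sum.cong refl) (simp flip: AsK[OF i])
    also have "\<dots> = app (A i) (app (s i) (\<Sum>H\<in>I. app (?K H) (seq_of (v H))))"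
      by (simp add: app_sum_vec)
    finally show "app (A i) (seq_of (v i)) = 0" using z by simp
  next
    assume "\<forall>H\<in>I. app (A H) (seq_of (v H)) = 0"
    then show "(\<Sum>H\<in>I. app (?K H) (seq_of (v H))) = 0"
      using kill blockspace_carrier[OF v] by (intro sum.neutral) auto
  qed
  moreover have "kernelspace \<Omega> l \<subseteq> blockspace \<Omega> l" by (auto simp: kernelspace_def)
  ultimately show ?thesis using \<kappa> by (auto simp: quotient_basis_def)
qed

end

context integrable_dir
begin

lemma idn_resolvent [simp]:
  "idn N * resolvent \<epsilon> \<Omega> l p = resolvent \<epsilon> \<Omega> l p" "resolvent \<epsilon> \<Omega> l p * idn N = resolvent \<epsilon> \<Omega> l p"
  unfolding resolvent_def by (auto simp: sum_distrib_left sum_distrib_right intro!: sum.cong)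

lemma Dop_resolvent:
  "y \<noteq> l \<Longrightarrow> Dop \<Omega> l y * resolvent \<epsilon> \<Omega> l p = (\<Sum>\<alpha>\<in>\<Lambda>. (pd \<alpha> y / (p l - \<epsilon> * aff_eval \<alpha> p)) \<odot>\<^sub>C E \<alpha>)"
  unfolding resolvent_def Dop_E resolution_mult_lin[OF resolution_E] by simp

lemma eig_sum_seq:
  assumes v: "v \<in> blockspace \<Omega> l"
  shows "seq_of (vsum N (\<lambda>\<alpha>. c \<alpha> \<cdot>\<^sub>v (eigproj \<Omega> l \<alpha> *\<^sub>v res_apply \<Omega> l v)) \<Lambda>)
    = (\<Sum>H\<in>I. app ((\<Sum>\<alpha>\<in>\<Lambda>. c \<alpha> \<odot>\<^sub>C E \<alpha>) * A H) (seq_of (v H)))"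
proof -
  have "seq_of (vsum N (\<lambda>\<alpha>. c \<alpha> \<cdot>\<^sub>v (eigproj \<Omega> l \<alpha> *\<^sub>v res_apply \<Omega> l v)) \<Lambda>)
      = (\<Sum>\<alpha>\<in>\<Lambda>. fscale (c \<alpha>) (app (E \<alpha>) (seq_of (res_apply \<Omega> l v))))"
    using eigproj_carrier res_apply_seq(1)[OF v]
    by (subst seq_of_vsum) (auto simp: seq_of_smult seq_of_mult[of _ N N] mult_mat_vec_carrier[of _ N N])
  also have "\<dots> = app (\<Sum>\<alpha>\<in>\<Lambda>. c \<alpha> \<odot>\<^sub>C E \<alpha>) (seq_of (res_apply \<Omega> l v))"
    by (simp add: app_sum)
  finally show ?thesis by (simp add: res_apply_seq(2)[OF v] app_sum_vec)
qed

lemma Rop_mat: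
  fixes p :: "'a point"
  assumes "y \<noteq> l"
  defines "C \<equiv> msum N (\<lambda>z. p z \<cdot>\<^sub>m mlin \<Omega> y z) (UNIV - {l, y})
         + msum N (\<lambda>H'. (1 / (p y - aff_eval (bH y H') p)) \<cdot>\<^sub>m res \<Omega> H') (hyps_dep \<Omega> y - hyps_dep \<Omega> l)"
  shows "C \<in> carrier_mat N N" "emb (mconst \<Omega> y) + emb C = Rop \<Omega> l y p"
proof -
  show "C \<in> carrier_mat N N" unfolding C_def by (intro add_carrier_mat msum_carrier)
  have 1: "emb (msum N (\<lambda>z. p z \<cdot>\<^sub>m mlin \<Omega> y z) (UNIV - {l, y})) = (\<Sum>z\<in>UNIV - {l, y}. p z \<odot>\<^sub>C emb (mlin \<Omega> y z))"
    by (subst emb_msum) (auto simp: emb_smult carriers)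
  have "emb (msum N (\<lambda>H'. (1 / (p y - aff_eval (bH y H') p)) \<cdot>\<^sub>m res \<Omega> H') (hyps_dep \<Omega> y - I))
      = (\<Sum>H'\<in>hyps_dep \<Omega> y - I. (1 / (p y - aff_eval (bH y H') p)) \<odot>\<^sub>C A H')"
    by (subst emb_msum) (auto simp: emb_smult carriers Aop_def hyps_dep_def)
  also have "\<dots> = (\<Sum>H\<in>hyps \<Omega> - I. (pd (defpoly H) y / aff_eval (defpoly H) p) \<odot>\<^sub>C A H)"
  proof (rule sum.mono_neutral_cong_left)
    fix H assume "H \<in> hyps_dep \<Omega> y - I"
    then have "H \<in> hyps \<Omega>" "pd (defpoly H) y \<noteq> 0" by (auto simp: hyps_dep_def)
    then show "(1 / (p y - aff_eval (bH y H) p)) \<odot>\<^sub>C A H = (pd (defpoly H) y / aff_eval (defpoly H) p) \<odot>\<^sub>C A H"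
      using dlog_hyp(1)[OF defines_hyperplane_defpoly[OF arr], of H y p] by (simp add: aH_def bH_def)
  qed (auto simp: hyps_dep_def)
  finally show "emb (mconst \<Omega> y) + emb C = Rop \<Omega> l y p"
    unfolding C_def Rop_def by (simp add: emb_add[of _ N N] 1 add.assoc)
qed

text \<open>The factor 1/(y - c) with c = c_HH' is the dy-coefficient of d log (a_H - a_H'). It is
  \<open>dlog_diff\<close>, which is zero when the two derivatives agree, so the sum may be extended
  to all hyperplanes depending on x.\<close>

lemma exchange_seq:
  assumes v: "v \<in> blockspace \<Omega> l" and H: "H \<in> I" and T: "T = {H'\<in>I. droot l y H' \<noteq> droot l y H}"
  shows "seq_of (vsum N (\<lambda>H'. (1 / (p y - aff_eval (cH l y H H') p)) \<cdot>\<^sub>v (res \<Omega> H' *\<^sub>v (v H - v H'))) T)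
    = app (\<Sum>H'\<in>I. dlog_diff l y p H H' \<odot>\<^sub>C A H') (seq_of (v H))
      - (\<Sum>H'\<in>I. app (dlog_diff l y p H H' \<odot>\<^sub>C A H') (seq_of (v H')))"
proof -
  have vc: "v H' \<in> carrier_vec N" "res \<Omega> H' \<in> carrier_mat N N" if "H' \<in> I" for H'
    using that blockspace_carrier[OF v] carriers I_hyps by auto
  have cross: "1 / (p y - aff_eval (cH l y H H') p) = dlog_diff l y p H H'"
    if "droot l y H' \<noteq> droot l y H" for H'
  proof -
    have n: "pd (aff_diff (aH l H) (aH l H')) y \<noteq> 0" using that by (simp add: aff_diff_def)
    from aff_eval_root[OF n, of p] show ?thesis
      using n unfolding dlog_diff_def cH_def aff_eval_diff[symmetric]
      by (simp add: aff_diff_def)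
  qed
  have "seq_of (vsum N (\<lambda>H'. (1 / (p y - aff_eval (cH l y H H') p)) \<cdot>\<^sub>v (res \<Omega> H' *\<^sub>v (v H - v H'))) T)
      = (\<Sum>H'\<in>T. fscale (dlog_diff l y p H H') (app (A H') (seq_of (v H) - seq_of (v H'))))"
    using T vc H cross
    by (subst seq_of_vsum) (auto simp: seq_of_smult seq_of_mult[of _ N N] mult_mat_vec_carrier[of _ N N]
      seq_of_minus[of _ N] Aop_def intro!: sum.cong)
  also have "\<dots> = (\<Sum>H'\<in>I. fscale (dlog_diff l y p H H') (app (A H') (seq_of (v H) - seq_of (v H'))))"
    by (rule sum.mono_neutral_left) (auto simp: T dlog_diff_def fun_eq_iff)
  also have "\<dots> = (\<Sum>H'\<in>I. app (dlog_diff l y p H H' \<odot>\<^sub>C A H') (seq_of (v H)) - app (dlog_diff l y p H H' \<odot>\<^sub>C A H') (seq_of (v H')))"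
    by (intro sum.cong refl) (simp add: fun_eq_iff algebra_simps)
  finally show ?thesis by (simp only: sum_subtractf app_sum)
qed

text \<open>The two clauses for y agree with the uniform formula \<open>Mop\<close> by
  \<open>const_cases\<close>. If \<open>H\<close> depends on y, then S_x is constant and all terms
  containing \<open>Dop\<close> drop out; otherwise the derivative of the root a_H is zero. In both
  clauses the exchange terms run over the hyperplanes whose root has a different
  y-derivative.\<close>

lemma laplace_op_seq:
  assumes v: "v \<in> blockspace \<Omega> l" and H: "H \<in> I"
  shows "laplace_op \<epsilon> \<Omega> l y p v H \<in> carrier_vec N \<and>
    seq_of (laplace_op \<epsilon> \<Omega> l y p v H) = (\<Sum>H'\<in>I. app (Mop \<epsilon> \<Omega> l y p H H') (seq_of (v H')))"
proof -
  note vc = blockspace_carrier[OF v H]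
  have split: "(\<Sum>H'\<in>I. app (if H = H' then X else 0) (seq_of (v H'))) = app X (seq_of (v H))" for X
    using H by (simp add: if_distrib[of "\<lambda>X. app X _"] cong: if_cong)
  have idv: "app (idn N) (seq_of (v H)) = seq_of (v H)" using vc by (rule idn_seq_of)
  show ?thesis
  proof (cases "y = l")
    case True
    let ?w = "vsum N (\<lambda>\<alpha>. (1 / (p l - \<epsilon> * aff_eval \<alpha> p)) \<cdot>\<^sub>v (eigproj \<Omega> l \<alpha> *\<^sub>v res_apply \<Omega> l v)) \<Lambda>"
    have op: "laplace_op \<epsilon> \<Omega> l y p v H = (- \<epsilon> * root_at l p H) \<cdot>\<^sub>v v H - ?w"
      using True by (simp add: laplace_op_def laplace_op_x_def)
    have "seq_of (laplace_op \<epsilon> \<Omega> l y p v H) = fscale (- \<epsilon> * root_at l p H) (seq_of (v H)) - seq_of ?w"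
      unfolding op using vc by (subst seq_of_minus[of _ N]) (auto simp: seq_of_smult)
    moreover have "(\<Sum>H'\<in>I. app (Mop \<epsilon> \<Omega> l y p H H') (seq_of (v H')))
        = app ((- \<epsilon> * root_at l p H) \<odot>\<^sub>C idn N) (seq_of (v H))
          - (\<Sum>H'\<in>I. app (resolvent \<epsilon> \<Omega> l p * A H') (seq_of (v H')))"
      using True by (simp only: Mop_def if_True app_minus sum_subtractf split simp_thms)
    moreover have "laplace_op \<epsilon> \<Omega> l y p v H \<in> carrier_vec N"
      unfolding op using vc by (intro minus_carrier_vec) auto
    ultimately show ?thesis
      unfolding eig_sum_seq[OF v] resolvent_def[symmetric] by (simp add: idv)
  next
    case False
    define C where "C = msum N (\<lambda>z. p z \<cdot>\<^sub>m mlin \<Omega> y z) (UNIV - {l, y})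
         + msum N (\<lambda>H'. (1 / (p y - aff_eval (bH y H') p)) \<cdot>\<^sub>m res \<Omega> H') (hyps_dep \<Omega> y - hyps_dep \<Omega> l)"
    have C: "C \<in> carrier_mat N N" "emb (mconst \<Omega> y) + emb C = Rop \<Omega> l y p"
      using Rop_mat[OF False] unfolding C_def by auto
    have D: "mlin \<Omega> y l \<in> carrier_mat N N" "emb (mlin \<Omega> y l) = Dop \<Omega> l y"
      using carriers(2)[of y l] mlin_sym[of y l] False by (auto simp: Dop_def)
    define exch where "exch T = vsum N (\<lambda>H'. (1 / (p y - aff_eval (cH l y H H') p)) \<cdot>\<^sub>v (res \<Omega> H' *\<^sub>v (v H - v H'))) T" for T
    let ?X = "\<Sum>H'\<in>I. dlog_diff l y p H H' \<odot>\<^sub>C A H'"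
    let ?Y = "\<Sum>H'\<in>I. app (dlog_diff l y p H H' \<odot>\<^sub>C A H') (seq_of (v H'))"
    let ?Z = "\<Sum>H'\<in>I. app (Dop \<Omega> l y * resolvent \<epsilon> \<Omega> l p * A H') (seq_of (v H'))"
    have RHS: "(\<Sum>H'\<in>I. app (Mop \<epsilon> \<Omega> l y p H H') (seq_of (v H')))
      = app (diag_block \<Omega> l y p H - (\<epsilon> * droot l y H * p l) \<odot>\<^sub>C idn N) (seq_of (v H)) - ?Y + fscale \<epsilon> ?Z"
    proof -
      have "fscale \<epsilon> ?Z = (\<Sum>H'\<in>I. app (\<epsilon> \<odot>\<^sub>C (Dop \<Omega> l y * resolvent \<epsilon> \<Omega> l p * A H')) (seq_of (v H')))"
        by (simp only: app_scl fvs.scale_sum_right)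
      then show ?thesis
        using False by (simp only: Mop_def if_False app_minus app_plus sum_subtractf sum.distrib split)
    qed
    have dr: "droot l y H = 0 \<longleftrightarrow> H \<notin> hyps_dep \<Omega> y"
      using hyp_dlog(5)[OF H, of y] False I_hyps[OF H] by (auto simp: hyps_dep_def)
    show ?thesis
    proof (cases "H \<in> hyps_dep \<Omega> y")
      case True
      have D0: "Dop \<Omega> l y = 0" using const_cases dr True False H by auto
      have S: "Sop \<Omega> l p = emb (mconst \<Omega> l)"
        using const_cases dr True False H by (auto simp: Sop_eq intro!: sum.neutral)
      have T: "CH \<Omega> l y H = {H'\<in>I. droot l y H' \<noteq> droot l y H}"
        by (auto simp: CH_def aff_diff_def)
      let ?M = "mconst \<Omega> y + droot l y H \<cdot>\<^sub>m mconst \<Omega> l - (\<epsilon> * droot l y H * p l) \<cdot>\<^sub>m 1\<^sub>m N + C"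
      have op: "laplace_op \<epsilon> \<Omega> l y p v H = ?M *\<^sub>v v H + exch (CH \<Omega> l y H)"
        using False True by (simp add: laplace_op_def laplace_op_y_def Let_def C_def exch_def)
      have M: "?M \<in> carrier_mat N N" using carriers C by auto
      have "emb ?M = emb (mconst \<Omega> y) + droot l y H \<odot>\<^sub>C emb (mconst \<Omega> l) - (\<epsilon> * droot l y H * p l) \<odot>\<^sub>C idn N + emb C"
        using carriers C by (simp add: emb_add[of _ N N] emb_minus[of _ N N] emb_smult minus_carrier_mat)
      then have embM: "emb ?M + ?X = diag_block \<Omega> l y p H - (\<epsilon> * droot l y H * p l) \<odot>\<^sub>C idn N"
        unfolding diag_block_def D0 S C(2)[symmetric] by (simp add: algebra_simps)
      have "seq_of (laplace_op \<epsilon> \<Omega> l y p v H) = app (emb ?M) (seq_of (v H)) + (app ?X (seq_of (v H)) - ?Y)"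
        unfolding op using M vc
        by (subst seq_of_add[of _ N])
          (auto simp: exch_def seq_of_mult[of _ N N] exchange_seq[OF v H T] mult_mat_vec_carrier[of _ N N])
      also have "\<dots> = app (emb ?M + ?X) (seq_of (v H)) - ?Y" by simp
      finally have "seq_of (laplace_op \<epsilon> \<Omega> l y p v H) = app (emb ?M + ?X) (seq_of (v H)) - ?Y" .
      moreover have "?Z = 0" unfolding D0 by simp
      moreover have "laplace_op \<epsilon> \<Omega> l y p v H \<in> carrier_vec N"
        unfolding op using vc M by (auto simp: exch_def mult_mat_vec_carrier[of _ N N])
      ultimately show ?thesis unfolding RHS embM by simp
    next
      case nH: False
      have T: "I \<inter> hyps_dep \<Omega> y = {H'\<in>I. droot l y H' \<noteq> droot l y H}"
      proof -
        have "H' \<in> hyps_dep \<Omega> y \<longleftrightarrow> droot l y H' \<noteq> 0" if "H' \<in> I" for H'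
          using hyp_dlog(5)[OF that, of y] False I_hyps[OF that] by (simp add: hyps_dep_def)
        then show ?thesis using dr nH by auto
      qed
      let ?M = "mconst \<Omega> y + root_at l p H \<cdot>\<^sub>m mlin \<Omega> y l + C"
      let ?w = "vsum N (\<lambda>\<alpha>. (pd \<alpha> y / (p l - \<epsilon> * aff_eval \<alpha> p)) \<cdot>\<^sub>v (eigproj \<Omega> l \<alpha> *\<^sub>v res_apply \<Omega> l v)) \<Lambda>"
      have op: "laplace_op \<epsilon> \<Omega> l y p v H = ?M *\<^sub>v v H + exch (I \<inter> hyps_dep \<Omega> y) + \<epsilon> \<cdot>\<^sub>v ?w"
        using False nH by (simp add: laplace_op_def laplace_op_y_def Let_def C_def exch_def)
      have M: "?M \<in> carrier_mat N N" using carriers C D by auto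
      have "emb ?M = emb (mconst \<Omega> y) + root_at l p H \<odot>\<^sub>C Dop \<Omega> l y + emb C"
        using carriers C D by (simp add: emb_add[of _ N N] emb_smult)
      then have embM: "emb ?M + ?X = diag_block \<Omega> l y p H - (\<epsilon> * droot l y H * p l) \<odot>\<^sub>C idn N"
        unfolding diag_block_def C(2)[symmetric] using dr nH by (simp add: algebra_simps)
      have w: "seq_of ?w = ?Z"
        unfolding eig_sum_seq[OF v] Dop_resolvent[OF False] ..
      have "seq_of (laplace_op \<epsilon> \<Omega> l y p v H)
          = app (emb ?M) (seq_of (v H)) + (app ?X (seq_of (v H)) - ?Y) + fscale \<epsilon> ?Z"
        unfolding op using M vc
        by (simp add: seq_of_add[of _ N] exch_def seq_of_mult[of _ N N] exchange_seq[OF v H T]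
          mult_mat_vec_carrier[of _ N N] seq_of_smult w)
      also have "\<dots> = app (emb ?M + ?X) (seq_of (v H)) - ?Y + fscale \<epsilon> ?Z" by simp
      finally have "seq_of (laplace_op \<epsilon> \<Omega> l y p v H) = app (emb ?M + ?X) (seq_of (v H)) - ?Y + fscale \<epsilon> ?Z" .
      moreover have "laplace_op \<epsilon> \<Omega> l y p v H \<in> carrier_vec N"
        unfolding op using vc M by (auto simp: exch_def mult_mat_vec_carrier[of _ N N])
      ultimately show ?thesis unfolding RHS embM by simp
    qed
  qed
qed

lemma diag_block_idn:
  assumes "y \<noteq> l"
  shows "diag_block \<Omega> l y p H * idn N = diag_block \<Omega> l y p H" "idn N * diag_block \<Omega> l y p H = diag_block \<Omega> l y p H"
  using assms by (simp_all add: diag_block_def distrib_right distrib_left sum_distrib_right sum_distrib_left cong: sum.cong)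

lemma Mop_idn:
  assumes "H' \<in> I"
  shows "Mop \<epsilon> \<Omega> l y p H H' * idn N = Mop \<epsilon> \<Omega> l y p H H'"
  using assms by (cases "y = l"; cases "H = H'")
    (simp_all add: Mop_def left_diff_distrib distrib_right mult.assoc diag_block_idn)

text \<open>Testing on vectors supported in one block turns the identity for all block vectors into
  one operator identity for every column \<open>H'\<close>. The coordinate map is then handled only
  through the operators \<open>K H\<close> and their sections.\<close>

lemma middle_laplace_gen_iff:
  "middle_laplace_gen \<epsilon> l \<Omega> \<Omega>' \<longleftrightarrow> pfaff_form \<Omega>' \<and>
     hyps_dep \<Omega>' l = (\<lambda>\<alpha>. {p. p l = \<epsilon> * aff_eval \<alpha> p}) ` \<Lambda> \<and>
     (\<exists>K s. block_quotient \<Omega> l (rk \<Omega>') K s \<and>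
        (\<forall>y. \<forall>\<^sub>F p in genf. \<forall>H'\<in>I. (\<Sum>H\<in>I. K H * Mop \<epsilon> \<Omega> l y p H H') = Fop \<Omega>' y p * K H'))"
proof -
  let ?m = "rk \<Omega>'"
  have eq: "(\<forall>v \<in> blockspace \<Omega> l. coord_map \<Omega> l ?m \<kappa> (laplace_op \<epsilon> \<Omega> l y p v) = form_coeff \<Omega>' y p *\<^sub>v coord_map \<Omega> l ?m \<kappa> v)
      \<longleftrightarrow> (\<forall>H'\<in>I. (\<Sum>H\<in>I. emb (\<kappa> H) * Mop \<epsilon> \<Omega> l y p H H') = Fop \<Omega>' y p * emb (\<kappa> H'))"
    if f: "pfaff_form \<Omega>'" and \<kappa>: "\<forall>H\<in>I. \<kappa> H \<in> carrier_mat ?m N" for y p \<kappa>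
  proof -
    have F: "form_coeff \<Omega>' y p \<in> carrier_mat ?m ?m" using pfaff_dir.carriers(5)[of \<Omega>'] f by (simp add: pfaff_dir_def)
    have \<kappa>id: "emb (\<kappa> H) * idn N = emb (\<kappa> H)" if "H \<in> I" for H using \<kappa> that by (auto simp: emb_idn)
    have lhs: "seq_of (coord_map \<Omega> l ?m \<kappa> (laplace_op \<epsilon> \<Omega> l y p v))
        = (\<Sum>H'\<in>I. app (\<Sum>H\<in>I. emb (\<kappa> H) * Mop \<epsilon> \<Omega> l y p H H') (seq_of (v H')))"
      and rhs: "seq_of (form_coeff \<Omega>' y p *\<^sub>v coord_map \<Omega> l ?m \<kappa> v) = (\<Sum>H'\<in>I. app (Fop \<Omega>' y p * emb (\<kappa> H')) (seq_of (v H')))"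
      and eqv: "coord_map \<Omega> l ?m \<kappa> (laplace_op \<epsilon> \<Omega> l y p v) = form_coeff \<Omega>' y p *\<^sub>v coord_map \<Omega> l ?m \<kappa> v
        \<longleftrightarrow> seq_of (coord_map \<Omega> l ?m \<kappa> (laplace_op \<epsilon> \<Omega> l y p v)) = seq_of (form_coeff \<Omega>' y p *\<^sub>v coord_map \<Omega> l ?m \<kappa> v)"
      if v: "v \<in> blockspace \<Omega> l" for v
    proof -
      have L: "laplace_op \<epsilon> \<Omega> l y p v \<in> blockspace \<Omega> l"
        using laplace_op_seq[OF v] by (auto simp: blockspace_def)
      have "seq_of (coord_map \<Omega> l ?m \<kappa> (laplace_op \<epsilon> \<Omega> l y p v))
          = (\<Sum>H\<in>I. \<Sum>H'\<in>I. app (emb (\<kappa> H) * Mop \<epsilon> \<Omega> l y p H H') (seq_of (v H')))"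
        unfolding coord_seq(2)[OF L \<kappa>] using laplace_op_seq[OF v] by (intro sum.cong) (auto simp: app_sum_vec)
      also have "\<dots> = (\<Sum>H'\<in>I. \<Sum>H\<in>I. app (emb (\<kappa> H) * Mop \<epsilon> \<Omega> l y p H H') (seq_of (v H')))"
        by (rule sum.swap)
      finally show "seq_of (coord_map \<Omega> l ?m \<kappa> (laplace_op \<epsilon> \<Omega> l y p v))
        = (\<Sum>H'\<in>I. app (\<Sum>H\<in>I. emb (\<kappa> H) * Mop \<epsilon> \<Omega> l y p H H') (seq_of (v H')))"
        by (simp only: app_sum)
      show "seq_of (form_coeff \<Omega>' y p *\<^sub>v coord_map \<Omega> l ?m \<kappa> v) = (\<Sum>H'\<in>I. app (Fop \<Omega>' y p * emb (\<kappa> H')) (seq_of (v H')))"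
        unfolding seq_of_mult[OF F coord_seq(1)[OF v \<kappa>]] coord_seq(2)[OF v \<kappa>] by (simp add: app_sum_vec Fop_def)
      show "coord_map \<Omega> l ?m \<kappa> (laplace_op \<epsilon> \<Omega> l y p v) = form_coeff \<Omega>' y p *\<^sub>v coord_map \<Omega> l ?m \<kappa> v
        \<longleftrightarrow> seq_of (coord_map \<Omega> l ?m \<kappa> (laplace_op \<epsilon> \<Omega> l y p v)) = seq_of (form_coeff \<Omega>' y p *\<^sub>v coord_map \<Omega> l ?m \<kappa> v)"
        using seq_of_inj[OF coord_seq(1)[OF L \<kappa>] mult_mat_vec_carrier[OF F coord_seq(1)[OF v \<kappa>]]] by auto
    qed
    show ?thesis
    proof (intro iffI ballI)
      fix v assume h: "\<forall>H'\<in>I. (\<Sum>H\<in>I. emb (\<kappa> H) * Mop \<epsilon> \<Omega> l y p H H') = Fop \<Omega>' y p * emb (\<kappa> H')"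
        and v: "v \<in> blockspace \<Omega> l"
      show "coord_map \<Omega> l ?m \<kappa> (laplace_op \<epsilon> \<Omega> l y p v) = form_coeff \<Omega>' y p *\<^sub>v coord_map \<Omega> l ?m \<kappa> v"
        unfolding eqv[OF v] lhs[OF v] rhs[OF v] by (intro sum.cong refl) (simp only: h)
    next
      fix H' assume h: "\<forall>v \<in> blockspace \<Omega> l. coord_map \<Omega> l ?m \<kappa> (laplace_op \<epsilon> \<Omega> l y p v) = form_coeff \<Omega>' y p *\<^sub>v coord_map \<Omega> l ?m \<kappa> v"
        and H': "H' \<in> I"
      show "(\<Sum>H\<in>I. emb (\<kappa> H) * Mop \<epsilon> \<Omega> l y p H H') = Fop \<Omega>' y p * emb (\<kappa> H')"
      proof (rule linop_eq_vecI[of _ N])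
        show "(\<Sum>H\<in>I. emb (\<kappa> H) * Mop \<epsilon> \<Omega> l y p H H') * idn N = (\<Sum>H\<in>I. emb (\<kappa> H) * Mop \<epsilon> \<Omega> l y p H H')"
          using H' by (simp add: sum_distrib_right mult.assoc Mop_idn cong: sum.cong)
        show "Fop \<Omega>' y p * emb (\<kappa> H') * idn N = Fop \<Omega>' y p * emb (\<kappa> H')"
          by (simp add: mult.assoc \<kappa>id[OF H'])
        fix u :: "complex vec" assume u: "u \<in> carrier_vec N"
        have b: "single H' u \<in> blockspace \<Omega> l" using u by simp
        show "app (\<Sum>H\<in>I. emb (\<kappa> H) * Mop \<epsilon> \<Omega> l y p H H') (seq_of u) = app (Fop \<Omega>' y p * emb (\<kappa> H')) (seq_of u)"
          using h[rule_format, OF b] unfolding eqv[OF b] lhs[OF b] rhs[OF b] sum_single[OF H'] .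
      qed
    qed
  qed
  show ?thesis
  proof (rule iffI[rotated], elim conjE exE)
    assume "middle_laplace_gen \<epsilon> l \<Omega> \<Omega>'"
    then obtain \<kappa> where f: "pfaff_form \<Omega>'" and h: "hyps_dep \<Omega>' l = (\<lambda>\<alpha>. {p. p l = \<epsilon> * aff_eval \<alpha> p}) ` \<Lambda>"
      and q: "quotient_basis \<Omega> l ?m \<kappa>"
      and g: "\<forall>y. generically (\<lambda>p. \<forall>v \<in> blockspace \<Omega> l. coord_map \<Omega> l ?m \<kappa> (laplace_op \<epsilon> \<Omega> l y p v)
             = form_coeff \<Omega>' y p *\<^sub>v coord_map \<Omega> l ?m \<kappa> v)"
      unfolding middle_laplace_gen_def by blast
    have \<kappa>: "\<forall>H\<in>I. \<kappa> H \<in> carrier_mat ?m N" using q by (simp add: quotient_basis_def)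
    obtain s where s: "block_quotient \<Omega> l ?m (\<lambda>H. emb (\<kappa> H)) s" using block_quotient_of_basis[OF q] by blast
    have "\<forall>y. \<forall>\<^sub>F p in genf. \<forall>H'\<in>I. (\<Sum>H\<in>I. emb (\<kappa> H) * Mop \<epsilon> \<Omega> l y p H H') = Fop \<Omega>' y p * emb (\<kappa> H')"
      using g unfolding eq[OF f \<kappa>] eventually_genf by simp
    then show "pfaff_form \<Omega>' \<and> hyps_dep \<Omega>' l = (\<lambda>\<alpha>. {p. p l = \<epsilon> * aff_eval \<alpha> p}) ` \<Lambda> \<and>
      (\<exists>K s. block_quotient \<Omega> l (rk \<Omega>') K s \<and>
        (\<forall>y. \<forall>\<^sub>F p in genf. \<forall>H'\<in>I. (\<Sum>H\<in>I. K H * Mop \<epsilon> \<Omega> l y p H H') = Fop \<Omega>' y p * K H'))"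
      using f h s by blast
  next
    fix K s
    assume f: "pfaff_form \<Omega>'" and h: "hyps_dep \<Omega>' l = (\<lambda>\<alpha>. {p. p l = \<epsilon> * aff_eval \<alpha> p}) ` \<Lambda>"
      and q: "block_quotient \<Omega> l ?m K s"
      and g: "\<forall>y. \<forall>\<^sub>F p in genf. \<forall>H'\<in>I. (\<Sum>H\<in>I. K H * Mop \<epsilon> \<Omega> l y p H H') = Fop \<Omega>' y p * K H'"
    define \<kappa> where "\<kappa> H = unemb ?m N (K H)" for H
    have \<kappa>: "\<forall>H\<in>I. \<kappa> H \<in> carrier_mat ?m N" by (simp add: \<kappa>_def)
    have e: "emb (\<kappa> H) = K H" if "H \<in> I" for H
      using q that by (simp add: \<kappa>_def emb_unemb block_quotient_def)
    have "block_quotient \<Omega> l ?m (\<lambda>H. emb (\<kappa> H)) s"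
      using q unfolding block_quotient_def by (simp add: e cong: sum.cong)
    then have "quotient_basis \<Omega> l ?m \<kappa>" by (rule basis_of_block_quotient[OF _ \<kappa>])
    moreover have "generically (\<lambda>p. \<forall>v \<in> blockspace \<Omega> l. coord_map \<Omega> l ?m \<kappa> (laplace_op \<epsilon> \<Omega> l y p v)
             = form_coeff \<Omega>' y p *\<^sub>v coord_map \<Omega> l ?m \<kappa> v)" for y
      using g[rule_format, of y] unfolding eq[OF f \<kappa>] eventually_genf[symmetric]
      by (simp add: e cong: sum.cong ball_cong)
    ultimately show "middle_laplace_gen \<epsilon> l \<Omega> \<Omega>'" using f h unfolding middle_laplace_gen_def by blast
  qed
qed

end

section \<open>Harnad duality\<close>

locale quotient_dir = integrable_dir +
  fixes m K s
  assumes quot: "block_quotient \<Omega> l m K s"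
begin

lemma K_idn [simp]: "H \<in> I \<Longrightarrow> idn m * K H = K H" "H \<in> I \<Longrightarrow> K H * idn N = K H"
  "H \<in> I \<Longrightarrow> idn N * s H = s H" "H \<in> I \<Longrightarrow> s H * idn m = s H"
  using quot by (auto simp: block_quotient_def)

lemma sum_Ks: "(\<Sum>H\<in>I. K H * s H) = idn m"
  using quot by (simp add: block_quotient_def)

lemma AsK: "H \<in> I \<Longrightarrow> H' \<in> I \<Longrightarrow> A H * s H * K H' = (if H = H' then A H else 0)"
  using quot by (simp add: block_quotient_def)

lemma K_kill: "H \<in> I \<Longrightarrow> A H * X = 0 \<Longrightarrow> K H * X = 0"
  using quot by (simp add: block_quotient_def)

text \<open>\<open>A H\<close> kills the difference of \<open>s H * K H'\<close> and the expected
  multiple of the identity, and \<open>K H\<close> kills whatever \<open>A H\<close> kills.\<close>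

lemma KsK:
  assumes H: "H \<in> I" "H' \<in> I" shows "K H * s H * K H' = (if H = H' then K H else 0)"
proof -
  have "A H * (s H * K H' - (if H = H' then idn N else 0)) = 0"
    using AsK[OF H] H by (auto simp: right_diff_distrib mult.assoc)
  from K_kill[OF H(1) this] show ?thesis
    using H by (auto simp: right_diff_distrib mult.assoc split: if_splits)
qed

text \<open>\<open>Q\<close> sends a vector to the class of the family with all blocks equal to it,
  \<open>P\<close> is induced by the sum of the \<open>A H\<close> applied to the blocks, and
  \<open>proj H\<close> projects onto the summand of the quotient belonging to \<open>H\<close>. On
  that summand \<open>T p\<close> is multiplication by the root of \<open>H\<close>, and
  \<open>dT y\<close> is multiplication by its y-derivative. The residues factor as
  \<open>A H = P * proj H * Q\<close>.\<close>

definition "Q = (\<Sum>H\<in>I. K H)"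
definition "P = (\<Sum>H\<in>I. A H * s H)"
definition "proj H = K H * s H"
definition "T p = (\<Sum>H\<in>I. root_at l p H \<odot>\<^sub>C proj H)"
definition "dT y = (\<Sum>H\<in>I. droot l y H \<odot>\<^sub>C proj H)"

lemma resolution_proj: "resolution (idn m) I proj"
  unfolding resolution_def
proof (intro conjI ballI)
  fix H H' assume H: "H \<in> I" "H' \<in> I"
  have "proj H * proj H' = K H * s H * K H' * s H'" by (simp add: proj_def mult.assoc)
  then show "proj H * proj H' = (if H = H' then proj H else 0)" by (simp add: KsK[OF H] proj_def)
qed (simp_all add: sum_Ks proj_def)

lemma PK [simp]: "H \<in> I \<Longrightarrow> P * K H = A H"
  by (simp add: P_def sum_distrib_right AsK if_distrib cong: if_cong sum.cong)

lemma projK: "H \<in> I \<Longrightarrow> H' \<in> I \<Longrightarrow> proj H * K H' = (if H = H' then K H else 0)"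
  by (simp add: proj_def KsK)

lemma projQ: "H \<in> I \<Longrightarrow> proj H * Q = K H"
  by (simp add: Q_def sum_distrib_left projK)

lemma Pproj: "H \<in> I \<Longrightarrow> P * proj H = A H * s H"
  by (simp add: proj_def flip: mult.assoc)

lemma lin_projK: "H' \<in> I \<Longrightarrow> (\<Sum>H\<in>I. c H \<odot>\<^sub>C proj H) * K H' = c H' \<odot>\<^sub>C K H'"
  by (simp add: sum_distrib_right projK if_distrib[of "\<lambda>X. _ \<odot>\<^sub>C X"] cong: if_cong sum.cong)

lemma TK: "H \<in> I \<Longrightarrow> T p * K H = root_at l p H \<odot>\<^sub>C K H" "H \<in> I \<Longrightarrow> dT y * K H = droot l y H \<odot>\<^sub>C K H"
  unfolding T_def dT_def by (rule lin_projK; assumption)+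

lemma lin_projQ: "(\<Sum>H\<in>I. c H \<odot>\<^sub>C proj H) * Q = (\<Sum>H\<in>I. c H \<odot>\<^sub>C K H)"
  by (simp add: sum_distrib_right projQ cong: sum.cong)

lemma PQ: "P * Q = (\<Sum>H\<in>I. A H)" "P * (\<Sum>H\<in>I. c H \<odot>\<^sub>C proj H) * Q = (\<Sum>H\<in>I. c H \<odot>\<^sub>C A H)"
proof -
  show "P * Q = (\<Sum>H\<in>I. A H)" by (simp add: Q_def sum_distrib_left cong: sum.cong)
  show "P * (\<Sum>H\<in>I. c H \<odot>\<^sub>C proj H) * Q = (\<Sum>H\<in>I. c H \<odot>\<^sub>C A H)"
    unfolding mult.assoc lin_projQ by (simp add: sum_distrib_left cong: sum.cong)
qed

lemma PQ_idn [simp]: "idn N * P = P" "P * idn m = P" "idn m * Q = Q" "Q * idn N = Q"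
  by (simp_all add: P_def Q_def sum_distrib_left sum_distrib_right mult.assoc mult_rewrite cong: sum.cong)

lemma T_idn [simp]: "idn m * T p = T p" "T p * idn m = T p" "idn m * dT y = dT y" "dT y * idn m = dT y"
  unfolding T_def dT_def
  by (simp_all add: sum_distrib_left sum_distrib_right resolution_unit[OF resolution_proj] cong: sum.cong)

lemma T_comm: "T p * dT y = dT y * T p" "dT y * dT z = dT z * dT y"
  unfolding T_def dT_def resolution_mult_lin[OF resolution_proj] by (simp_all add: mult.commute)

lemma eq_on_K:
  assumes "X * idn m = X" "Y * idn m = Y" "\<And>H. H \<in> I \<Longrightarrow> X * K H = Y * K H"
  shows "X = Y"
proof -
  have "Z = (\<Sum>H\<in>I. Z * K H * s H)" if "Z * idn m = Z" for Z
    using that sum_Ks by (metis (no_types, lifting) mult.assoc sum.cong sum_distrib_left)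
  then show ?thesis using assms by (metis (no_types, lifting) sum.cong)
qed

text \<open>The operator on C^m induced by the Laplace operator. The formula makes sense at every
  point, but it describes an induced operator only where the diagonal blocks preserve the kernels,
  hence generically. \<open>Rd\<close> below is its part free of \<epsilon> when y differs from x;
  it will play the role of \<open>Rop\<close> for the transform.\<close>

definition "Mw \<epsilon> y p = (\<Sum>H\<in>I. \<Sum>H'\<in>I. K H * Mop \<epsilon> \<Omega> l y p H H' * s H')"

definition "Rd y p = (\<Sum>H\<in>I. K H * diag_block \<Omega> l y p H * s H)
  - (\<Sum>H\<in>I. \<Sum>H'\<in>I. dlog_diff l y p H H' \<odot>\<^sub>C (K H * A H' * s H'))"

lemma sum_diag: "H \<in> I \<Longrightarrow> (\<Sum>H'\<in>I. (if H = H' then X H' else 0) * (Y H' :: linop)) = X H * Y H"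
proof -
  assume "H \<in> I"
  have "(\<Sum>H'\<in>I. (if H = H' then X H' else 0) * Y H') = (\<Sum>H'\<in>I. if H' = H then X H * Y H else 0)"
    by (rule sum.cong) (simp_all split: if_split)
  then show ?thesis using \<open>H \<in> I\<close> by simp
qed

lemma Mw_l: "Mw \<epsilon> l p = - (\<epsilon> \<odot>\<^sub>C T p) - Q * resolvent \<epsilon> \<Omega> l p * P"
proof -
  have "Mw \<epsilon> l p = (\<Sum>H\<in>I. \<Sum>H'\<in>I. (if H = H' then K H * (- \<epsilon> * root_at l p H) \<odot>\<^sub>C idn N else 0) * s H'
      - K H * resolvent \<epsilon> \<Omega> l p * (A H' * s H'))"
    unfolding Mw_def by (intro sum.cong) (auto simp: Mop_def left_diff_distrib right_diff_distrib mult.assoc)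
  also have "\<dots> = (\<Sum>H\<in>I. (- \<epsilon> * root_at l p H) \<odot>\<^sub>C proj H) - (\<Sum>H\<in>I. K H * resolvent \<epsilon> \<Omega> l p * P)"
    unfolding sum_subtractf
    by (intro arg_cong2[of _ _ _ _ minus] sum.cong)
      (auto simp: sum_diag proj_def P_def sum_distrib_left mult.assoc)
  also have "(\<Sum>H\<in>I. (- \<epsilon> * root_at l p H) \<odot>\<^sub>C proj H) = - (\<epsilon> \<odot>\<^sub>C T p)"
    by (simp add: T_def scl_sum_right sum_negf)
  finally show ?thesis by (simp add: Q_def sum_distrib_right)
qed

lemma Mw_y:
  assumes "y \<noteq> l"
  shows "Mw \<epsilon> y p = Rd y p - (\<epsilon> * p l) \<odot>\<^sub>C dT y + \<epsilon> \<odot>\<^sub>C (Q * Dop \<Omega> l y * resolvent \<epsilon> \<Omega> l p * P)"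
proof -
  let ?V = "Dop \<Omega> l y * resolvent \<epsilon> \<Omega> l p"
  have "Mw \<epsilon> y p = (\<Sum>H\<in>I. \<Sum>H'\<in>I. (if H = H' then K H * (diag_block \<Omega> l y p H - (\<epsilon> * droot l y H * p l) \<odot>\<^sub>C idn N) else 0) * s H'
      - dlog_diff l y p H H' \<odot>\<^sub>C (K H * A H' * s H') + \<epsilon> \<odot>\<^sub>C (K H * ?V * (A H' * s H')))"
    unfolding Mw_def using assms
    by (intro sum.cong) (auto simp: Mop_def left_diff_distrib right_diff_distrib distrib_left distrib_right mult.assoc)
  also have "\<dots> = (\<Sum>H\<in>I. K H * diag_block \<Omega> l y p H * s H - (\<epsilon> * droot l y H * p l) \<odot>\<^sub>C proj H)
      - (\<Sum>H\<in>I. \<Sum>H'\<in>I. dlog_diff l y p H H' \<odot>\<^sub>C (K H * A H' * s H')) + (\<Sum>H\<in>I. \<epsilon> \<odot>\<^sub>C (K H * ?V * P))"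
    unfolding sum_subtractf sum.distrib
    by (intro arg_cong2[of _ _ _ _ minus] arg_cong2[of _ _ _ _ plus] sum.cong refl)
      (auto simp: sum_diag proj_def P_def sum_distrib_left right_diff_distrib left_diff_distrib mult.assoc scl_sum_right sum_subtractf)
  also have "(\<Sum>H\<in>I. \<epsilon> \<odot>\<^sub>C (K H * ?V * P)) = \<epsilon> \<odot>\<^sub>C (Q * ?V * P)"
    by (simp add: Q_def sum_distrib_right scl_sum_right)
  also have "(\<Sum>H\<in>I. K H * diag_block \<Omega> l y p H * s H - (\<epsilon> * droot l y H * p l) \<odot>\<^sub>C proj H)
      = (\<Sum>H\<in>I. K H * diag_block \<Omega> l y p H * s H) - (\<epsilon> * p l) \<odot>\<^sub>C dT y"
    by (simp add: sum_subtractf dT_def scl_sum_right ac_simps)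
  finally show ?thesis by (simp add: Rd_def algebra_simps)
qed

lemma Rd_idn [simp]: "idn m * Rd y p = Rd y p" "Rd y p * idn m = Rd y p"
  by (simp_all add: Rd_def right_diff_distrib left_diff_distrib sum_distrib_left sum_distrib_right mult.assoc
    mult_rewrite[OF K_idn(1)] cong: sum.cong)

section \<open>Invariance of the sum of the kernels\<close>

lemma diag_commute:
  assumes "y \<noteq> l"
  shows "\<forall>\<^sub>F p in genf. \<forall>H\<in>I. A H * diag_block \<Omega> l y p H = diag_block \<Omega> l y p H * A H"
  using residue_relations[OF assms]
proof eventually_elim
  case (elim p)
  show ?case
  proof
    fix H assume "H \<in> I"
    then have "com (A H) (Rop \<Omega> l y p + droot l y H \<odot>\<^sub>C Sop \<Omega> l p + root_at l p H \<odot>\<^sub>C Dop \<Omega> l y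
        + (\<Sum>H'\<in>I. dlog_diff l y p H H' \<odot>\<^sub>C A H')) = 0"
      using elim unfolding dlog_diff_def by blast
    then show "A H * diag_block \<Omega> l y p H = diag_block \<Omega> l y p H * A H"
      unfolding com_eq_0[symmetric] diag_block_def by (simp add: algebra_simps)
  qed
qed

text \<open>By commutation the diagonal block maps the kernel of \<open>A H\<close> into itself, so
  \<open>K H * diag_block\<close> depends only on classes modulo that kernel. Passing to the class
  and lifting it back by \<open>s H\<close> changes nothing.\<close>

lemma diag_K:
  assumes "A H * diag_block \<Omega> l y p H = diag_block \<Omega> l y p H * A H" "H \<in> I" "y \<noteq> l"
  shows "H' \<in> I \<Longrightarrow> K H * diag_block \<Omega> l y p H * s H * K H' = (if H = H' then K H * diag_block \<Omega> l y p H else 0)"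
proof -
  assume H': "H' \<in> I"
  have "A H * (s H * K H' - (if H = H' then idn N else 0)) = 0"
    using AsK[OF assms(2) H'] assms(2) by (auto simp: right_diff_distrib mult.assoc)
  then have "A H * (diag_block \<Omega> l y p H * (s H * K H' - (if H = H' then idn N else 0))) = 0"
    by (simp add: mult_rewrite[OF assms(1)] mult.assoc)
  from K_kill[OF assms(2) this] show ?thesis
    using diag_block_idn[OF assms(3)] by (auto simp: right_diff_distrib mult.assoc split: if_splits)
qed

lemma Rd_K:
  assumes "\<forall>H\<in>I. A H * diag_block \<Omega> l y p H = diag_block \<Omega> l y p H * A H" and y: "y \<noteq> l" and H: "H' \<in> I"
  shows "Rd y p * K H' = K H' * diag_block \<Omega> l y p H' - (\<Sum>H\<in>I. dlog_diff l y p H H' \<odot>\<^sub>C (K H * A H'))"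
proof -
  have "(\<Sum>H\<in>I. K H * diag_block \<Omega> l y p H * s H) * K H' = K H' * diag_block \<Omega> l y p H'"
    using assms by (simp add: sum_distrib_right diag_K cong: sum.cong if_cong)
  moreover have "(\<Sum>H\<in>I. \<Sum>H''\<in>I. dlog_diff l y p H H'' \<odot>\<^sub>C (K H * A H'' * s H'')) * K H'
      = (\<Sum>H\<in>I. \<Sum>H''\<in>I. if H'' = H' then dlog_diff l y p H H' \<odot>\<^sub>C (K H * A H') else 0)"
    unfolding sum_distrib_right using AsK[OF _ H]
    by (intro sum.cong refl) (auto simp: mult.assoc)
  ultimately show ?thesis using H by (simp add: Rd_def left_diff_distrib cong: sum.cong)
qed

text \<open>This is the invariance of the sum of the kernels: the block operator followed by the
  quotient map factors through the quotient, with \<open>Mw\<close> as the induced operator.\<close>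

lemma Mop_K:
  assumes "y \<noteq> l \<Longrightarrow> \<forall>H\<in>I. A H * diag_block \<Omega> l y p H = diag_block \<Omega> l y p H * A H" and H': "H' \<in> I"
  shows "(\<Sum>H\<in>I. K H * Mop \<epsilon> \<Omega> l y p H H') = Mw \<epsilon> y p * K H'"
proof (cases "y = l")
  case True
  have "(\<Sum>H\<in>I. K H * Mop \<epsilon> \<Omega> l y p H H')
      = (\<Sum>H\<in>I. (if H = H' then (- \<epsilon> * root_at l p H') \<odot>\<^sub>C K H' else 0) - K H * resolvent \<epsilon> \<Omega> l p * A H')"
    using True by (intro sum.cong) (auto simp: Mop_def right_diff_distrib mult.assoc)
  then show ?thesis
    using True H' by (simp add: Mw_l left_diff_distrib TK mult.assoc sum_subtractf Q_def sum_distrib_right)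
next
  case False
  let ?V = "Dop \<Omega> l y * resolvent \<epsilon> \<Omega> l p"
  have "(\<Sum>H\<in>I. K H * Mop \<epsilon> \<Omega> l y p H H')
      = (\<Sum>H\<in>I. (if H = H' then K H' * diag_block \<Omega> l y p H' - (\<epsilon> * droot l y H' * p l) \<odot>\<^sub>C K H' else 0)
          - dlog_diff l y p H H' \<odot>\<^sub>C (K H * A H') + \<epsilon> \<odot>\<^sub>C (K H * ?V * A H'))"
    using False by (intro sum.cong) (auto simp: Mop_def right_diff_distrib distrib_left mult.assoc)
  also have "\<dots> = Rd y p * K H' - (\<epsilon> * droot l y H' * p l) \<odot>\<^sub>C K H' + \<epsilon> \<odot>\<^sub>C (Q * ?V * A H')"
    using H' by (simp add: sum.distrib sum_subtractf Rd_K[OF assms(1)[OF False] False H'] Q_def sum_distrib_right scl_sum_right)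
  finally show ?thesis
    unfolding Mw_y[OF False] using H' by (simp add: left_diff_distrib distrib_right TK mult.assoc mult.commute mult.left_commute)
qed

lemma generic_Mop_K: "\<forall>\<^sub>F p in genf. \<forall>H'\<in>I. (\<Sum>H\<in>I. K H * Mop \<epsilon> \<Omega> l y p H H') = Mw \<epsilon> y p * K H'"
proof (cases "y = l")
  case True
  then show ?thesis by (intro always_eventually allI ballI Mop_K) auto
next
  case False
  show ?thesis using diag_commute[OF False] by eventually_elim (use Mop_K in blast)
qed

text \<open>The relations are symmetric under \<open>(S, T, P, Q) \<mapsto> (- \<epsilon> T, \<epsilon> S, - Q, P)\<close>, which exchanges
  \<open>\<Omega>\<close> and its transform, up to sign.\<close>

lemma dual_relations:
  assumes y: "y \<noteq> l"
  shows "\<forall>\<^sub>F p in genf. inj_on (root_at l p) I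
    \<and> Rd y p * Q = Q * Rop \<Omega> l y p + T p * Q * Dop \<Omega> l y + dT y * Q * Sop \<Omega> l p
    \<and> P * Rd y p = Rop \<Omega> l y p * P + Dop \<Omega> l y * P * T p + Sop \<Omega> l p * P * dT y
    \<and> T p * Rd y p - Rd y p * T p = Q * P * dT y - dT y * Q * P
    \<and> Sop \<Omega> l p * Rop \<Omega> l y p - Rop \<Omega> l y p * Sop \<Omega> l p = Dop \<Omega> l y * P * Q - P * Q * Dop \<Omega> l y
    \<and> Sop \<Omega> l p * Dop \<Omega> l y = Dop \<Omega> l y * Sop \<Omega> l p
    \<and> (\<forall>z. Rd y p * dT z - dT z * Rd y p
        = (\<Sum>H\<in>I. \<Sum>H'\<in>I. ((droot l z H - droot l z H') * dlog_diff l y p H H') \<odot>\<^sub>C (K H * A H' * s H')))"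
  using diag_commute[OF y] residue_relations[OF y] generic_roots
proof eventually_elim
  case (elim p)
  let ?a = "root_at l p" and ?b = "droot l y" and ?c = "dlog_diff l y p"
  let ?R = "Rop \<Omega> l y p" and ?S = "Sop \<Omega> l p" and ?Y = "Dop \<Omega> l y" and ?d = "diag_block \<Omega> l y p"
  note RK = Rd_K[OF elim(1) y]
  define W where "W H = ?R + ?a H \<odot>\<^sub>C ?Y + ?b H \<odot>\<^sub>C ?S" for H
  have d: "?d H = W H + (\<Sum>H'\<in>I. ?c H H' \<odot>\<^sub>C A H')" for H by (simp add: diag_block_def W_def)
  \<comment> \<open>On families with all blocks equal the exchange terms vanish, since they involve
    only differences of blocks. What remains is the part \<open>W\<close> of the diagonal.\<close>
  have "Rd y p * Q = (\<Sum>H'\<in>I. K H' * ?d H') - (\<Sum>H'\<in>I. \<Sum>H\<in>I. ?c H H' \<odot>\<^sub>C (K H * A H'))"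
    by (simp add: Q_def sum_distrib_left RK sum_subtractf cong: sum.cong)
  also have "(\<Sum>H'\<in>I. \<Sum>H\<in>I. ?c H H' \<odot>\<^sub>C (K H * A H')) = (\<Sum>H\<in>I. \<Sum>H'\<in>I. ?c H H' \<odot>\<^sub>C (K H * A H'))"
    by (rule sum.swap)
  also have "(\<Sum>H\<in>I. K H * ?d H) = (\<Sum>H\<in>I. K H * W H) + (\<Sum>H\<in>I. \<Sum>H'\<in>I. ?c H H' \<odot>\<^sub>C (K H * A H'))"
    by (simp add: d distrib_left sum_distrib_left sum.distrib)
  finally have "Rd y p * Q = (\<Sum>H\<in>I. K H * W H)" by simp
  also have "\<dots> = Q * ?R + T p * Q * ?Y + dT y * Q * ?S"
    unfolding T_def dT_def lin_projQ
    by (simp add: W_def Q_def distrib_left sum.distrib sum_distrib_right)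
  finally have r1: "Rd y p * Q = Q * ?R + T p * Q * ?Y + dT y * Q * ?S" .
  have "P * Rd y p = ?R * P + ?Y * P * T p + ?S * P * dT y"
  proof (rule eq_on_K)
    fix H' assume H': "H' \<in> I"
    have "P * Rd y p * K H' = A H' * ?d H' - (\<Sum>H\<in>I. ?c H H' \<odot>\<^sub>C (A H * A H'))"
      using H' by (simp add: mult.assoc RK right_diff_distrib sum_distrib_left mult_rewrite[OF PK] cong: sum.cong)
    \<comment> \<open>Once the residue stands on the right, the exchange terms in the diagonal block
      cancel the off-diagonal ones by the symmetry of \<open>dlog_diff\<close>.\<close>
    also have "A H' * ?d H' = ?d H' * A H'" using elim(1) H' by blast
    also have "\<dots> = W H' * A H' + (\<Sum>H\<in>I. ?c H' H \<odot>\<^sub>C (A H * A H'))"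
      by (simp add: d distrib_right sum_distrib_right)
    finally have "P * Rd y p * K H' = W H' * A H'" by (simp add: dlog_diff_sym[of l y p H'])
    then show "P * Rd y p * K H' = (?R * P + ?Y * P * T p + ?S * P * dT y) * K H'"
      using H' by (simp add: W_def distrib_right mult.assoc TK)
  qed (simp_all add: mult.assoc distrib_right)
  moreover have "T p * Rd y p - Rd y p * T p = Q * P * dT y - dT y * Q * P"
  proof (rule eq_on_K)
    fix H' assume H': "H' \<in> I"
    \<comment> \<open>Commuting with \<open>T\<close> multiplies an off-diagonal entry by a
      difference of roots, which cancels the denominator of \<open>dlog_diff\<close>. This is where
      the roots have to be distinct at \<open>p\<close>.\<close>
    have ca: "?c H H' * ?a H - ?c H H' * ?a H' = ?b H - ?b H'" if "H \<in> I" for H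
    proof (cases "H = H'")
      case False
      then have "?a H - ?a H' \<noteq> 0" using elim(3) that H' by (auto simp: inj_on_def)
      then have "?c H H' * (?a H - ?a H') = ?b H - ?b H'" by (simp add: dlog_diff_def)
      then show ?thesis by (simp only: right_diff_distrib)
    qed simp
    have "(T p * Rd y p - Rd y p * T p) * K H' = T p * (Rd y p * K H') - ?a H' \<odot>\<^sub>C (Rd y p * K H')"
      using H' by (simp add: left_diff_distrib mult.assoc TK)
    also have "\<dots> = - (\<Sum>H\<in>I. (?c H H' * ?a H - ?c H H' * ?a H') \<odot>\<^sub>C (K H * A H'))"
      using H' by (simp add: RK right_diff_distrib scl_distrib sum_distrib_left mult_rewrite[OF TK(1)] scl_sum_right
        sum_subtractf mult.commute cong: sum.cong)
    also have "\<dots> = - (\<Sum>H\<in>I. (?b H - ?b H') \<odot>\<^sub>C (K H * A H'))"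
      using ca by (simp cong: sum.cong)
    also have "\<dots> = (Q * P * dT y - dT y * Q * P) * K H'"
      using H' unfolding dT_def lin_projQ
      by (simp add: left_diff_distrib mult.assoc lin_projK)
        (simp add: Q_def sum_distrib_right scl_distrib sum_subtractf scl_sum_right)
    finally show "(T p * Rd y p - Rd y p * T p) * K H' = (Q * P * dT y - dT y * Q * P) * K H'" .
  qed (simp_all add: mult.assoc left_diff_distrib)
  moreover have "Rd y p * dT z - dT z * Rd y p
      = (\<Sum>H\<in>I. \<Sum>H'\<in>I. ((droot l z H - droot l z H') * ?c H H') \<odot>\<^sub>C (K H * A H' * s H'))" for z
  proof (rule eq_on_K)
    fix H' assume H': "H' \<in> I"
    let ?e = "droot l z"
    have "(Rd y p * dT z - dT z * Rd y p) * K H' = ?e H' \<odot>\<^sub>C (Rd y p * K H') - dT z * (Rd y p * K H')"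
      using H' by (simp add: left_diff_distrib mult.assoc TK)
    also have "\<dots> = (\<Sum>H\<in>I. ((?e H - ?e H') * ?c H H') \<odot>\<^sub>C (K H * A H'))"
      using H' by (simp add: RK right_diff_distrib left_diff_distrib scl_distrib sum_distrib_left mult_rewrite[OF TK(2)] scl_sum_right
        sum_subtractf mult.commute cong: sum.cong)
    also have "\<dots> = (\<Sum>H\<in>I. \<Sum>H''\<in>I. if H'' = H' then ((?e H - ?e H') * ?c H H') \<odot>\<^sub>C (K H * A H') else 0)"
      using H' by simp
    also have "\<dots> = (\<Sum>H\<in>I. \<Sum>H''\<in>I. ((?e H - ?e H'') * ?c H H'') \<odot>\<^sub>C (K H * A H'' * s H'')) * K H'"
      unfolding sum_distrib_right using AsK[OF _ H'] by (intro sum.cong refl) (auto simp: mult.assoc)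
    finally show "(Rd y p * dT z - dT z * Rd y p) * K H'
      = (\<Sum>H\<in>I. \<Sum>H''\<in>I. ((?e H - ?e H'') * ?c H H'') \<odot>\<^sub>C (K H * A H'' * s H'')) * K H'" .
  qed (simp_all add: mult.assoc left_diff_distrib sum_distrib_right cong: sum.cong)
  moreover have "?S * ?R - ?R * ?S = ?Y * P * Q - P * Q * ?Y" "?S * ?Y = ?Y * ?S"
  proof -
    show "?S * ?Y = ?Y * ?S" using elim(2) by (simp add: com_eq_0)
    have "com ?S ?R + com (P * Q) ?Y = 0" using elim(2) by (simp add: PQ com_sum)
    then show "?S * ?R - ?R * ?S = ?Y * P * Q - P * Q * ?Y"
      by (simp add: com_def mult.assoc algebra_simps add_eq_0_iff)
  qed
  ultimately show ?case using r1 elim(3) by blast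
qed

lemma generic_resolvent:
  assumes "\<epsilon> * \<epsilon> = 1"
  shows "\<forall>\<^sub>F p in genf. \<forall>\<alpha>\<in>\<Lambda>. p l \<noteq> \<epsilon> * aff_eval \<alpha> p"
proof (intro eventually_ball_finite ballI)
  fix \<alpha> assume \<alpha>: "\<alpha> \<in> \<Lambda>"
  let ?f = "Aff (\<lambda>j. (if j = l then 1 else 0) - \<epsilon> * pd \<alpha> j) (- \<epsilon> * const_term \<alpha>)"
  have "\<forall>\<^sub>F p in genf. aff_eval ?f p \<noteq> 0"
    using pd_eigval[OF \<alpha>] by (intro eventually_aff_neq_0) (auto intro!: exI[of _ l])
  moreover have "aff_eval ?f p = p l - \<epsilon> * aff_eval \<alpha> p" for p
    by (simp add: aff_eval_def left_diff_distrib sum_subtractf algebra_simps sum_distrib_left if_distrib[of "\<lambda>x. _ * x"] cong: if_cong)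
  ultimately show "\<forall>\<^sub>F p in genf. p l \<noteq> \<epsilon> * aff_eval \<alpha> p" by simp
qed simp

lemma resolvent_inverse:
  assumes "\<forall>\<alpha>\<in>\<Lambda>. p l \<noteq> \<epsilon> * aff_eval \<alpha> p"
  shows "p l \<odot>\<^sub>C resolvent \<epsilon> \<Omega> l p - \<epsilon> \<odot>\<^sub>C (Sop \<Omega> l p * resolvent \<epsilon> \<Omega> l p) = idn N"
    "resolvent \<epsilon> \<Omega> l p * Sop \<Omega> l p = Sop \<Omega> l p * resolvent \<epsilon> \<Omega> l p"
proof -
  show "resolvent \<epsilon> \<Omega> l p * Sop \<Omega> l p = Sop \<Omega> l p * resolvent \<epsilon> \<Omega> l p"
    unfolding resolvent_def Sop_E resolution_mult_lin[OF resolution_E] by simp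
  have "p l \<odot>\<^sub>C resolvent \<epsilon> \<Omega> l p - \<epsilon> \<odot>\<^sub>C (Sop \<Omega> l p * resolvent \<epsilon> \<Omega> l p)
      = (\<Sum>\<alpha>\<in>\<Lambda>. (p l / (p l - \<epsilon> * aff_eval \<alpha> p) - \<epsilon> * aff_eval \<alpha> p / (p l - \<epsilon> * aff_eval \<alpha> p)) \<odot>\<^sub>C E \<alpha>)"
    unfolding resolvent_def Sop_E resolution_mult_lin[OF resolution_E]
    by (simp add: scl_sum_right scl_distrib sum_subtractf)
  also have "\<dots> = (\<Sum>\<alpha>\<in>\<Lambda>. E \<alpha>)"
    using assms by (intro sum.cong refl) (simp flip: diff_divide_distrib)
  finally show "p l \<odot>\<^sub>C resolvent \<epsilon> \<Omega> l p - \<epsilon> \<odot>\<^sub>C (Sop \<Omega> l p * resolvent \<epsilon> \<Omega> l p) = idn N"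
    by (simp add: resolution_sum[OF resolution_E])
qed

lemma Dop_resolvent_commute: "y \<noteq> l \<Longrightarrow> Dop \<Omega> l y * resolvent \<epsilon> \<Omega> l p = resolvent \<epsilon> \<Omega> l p * Dop \<Omega> l y"
  unfolding resolvent_def Dop_E resolution_mult_lin[OF resolution_E] by simp

section \<open>Integrability of the induced operators\<close>

lemma Mw_commute_l:
  assumes "\<epsilon> * \<epsilon> = 1" "y \<noteq> l"
  shows "\<forall>\<^sub>F p in genf. Mw \<epsilon> l p * Mw \<epsilon> y p = Mw \<epsilon> y p * Mw \<epsilon> l p"
  using generic_resolvent[OF assms(1)] dual_relations[OF assms(2)]
proof eventually_elim
  case (elim p)
  note r = elim(2)
  note inv = resolvent_inverse[OF elim(1)]
  show ?case
    unfolding Mw_l Mw_y[OF assms(2)]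
    by (rule dual_commute_x[OF inv Dop_resolvent_commute[OF assms(2)] PQ_idn(1,4) _ _ T_comm(1) _ _ _ _ assms(1)])
      (use r assms in \<open>auto simp: mult.assoc\<close>)
qed

text \<open>\<open>T p\<close> has distinct eigenvalues on the summands, so \<open>W\<close>
  commutes with each \<open>proj H\<close>. Since \<open>K H = proj H * Q\<close>, it follows that
  \<open>W * K H = proj H * W * Q = 0\<close>, and the ranges of the \<open>K H\<close> span
  C^m.\<close>

lemma commutator_zero:
  assumes inj: "inj_on (root_at l p) I" and "W * Q = 0" "T p * W = W * T p" "idn m * W = W" "W * idn m = W"
  shows "W = 0"
proof (rule eq_on_K)
  fix H assume H: "H \<in> I"
  have "proj H * W = W * proj H"
    by (rule resolution_commute[OF resolution_proj assms(4,5) inj _ H]) (use assms(3) in \<open>simp add: T_def\<close>)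
  then have "W * K H = proj H * (W * Q)" by (simp add: projQ[OF H, symmetric] flip: mult.assoc)
  then show "W * K H = 0 * K H" using assms(2) by simp
qed (use assms in auto)

lemma Mw_commute_yz:
  assumes "\<epsilon> * \<epsilon> = 1" and y: "y \<noteq> l" and z: "z \<noteq> l"
  shows "\<forall>\<^sub>F p in genf. Mw \<epsilon> y p * Mw \<epsilon> z p = Mw \<epsilon> z p * Mw \<epsilon> y p"
  using generic_resolvent[OF assms(1)] dual_relations[OF y] dual_relations[OF z] residue_relations2[OF y z]
proof eventually_elim
  case (elim p)
  note inv = resolvent_inverse[OF elim(1)]
  note inj = elim(2)[THEN conjunct1]
  let ?Ry = "Rop \<Omega> l y p" and ?Rz = "Rop \<Omega> l z p" and ?S = "Sop \<Omega> l p" and ?Sy = "Dop \<Omega> l y" and ?Sz = "Dop \<Omega> l z"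
  let ?W = "Rd y p * Rd z p - Rd z p * Rd y p"
  have y1: "Rd y p * Q = Q * ?Ry + T p * Q * ?Sy + dT y * Q * ?S"
    and y2: "P * Rd y p = ?Ry * P + ?Sy * P * T p + ?S * P * dT y"
    and y3: "T p * Rd y p - Rd y p * T p = Q * P * dT y - dT y * Q * P"
    and y4: "?S * ?Ry - ?Ry * ?S = ?Sy * P * Q - P * Q * ?Sy" using elim(2) by blast+
  have z1: "Rd z p * Q = Q * ?Rz + T p * Q * ?Sz + dT z * Q * ?S"
    and z2: "P * Rd z p = ?Rz * P + ?Sz * P * T p + ?S * P * dT z"
    and z3: "T p * Rd z p - Rd z p * T p = Q * P * dT z - dT z * Q * P"
    and z4: "?S * ?Rz - ?Rz * ?S = ?Sz * P * Q - P * Q * ?Sz" using elim(3) by blast+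
  have RR: "?Ry * ?Rz = ?Rz * ?Ry" and RS: "?Ry * ?Sz + ?Sy * ?Rz = ?Rz * ?Sy + ?Sz * ?Ry"
    using elim(4) by (simp_all add: com_def algebra_simps)
  have S: "?Sy * ?Sz = ?Sz * ?Sy" using mlin_commute(2)[OF z y] by (simp add: com_eq_0)
  have Wid: "idn m * ?W = ?W" "?W * idn m = ?W" by (simp_all add: algebra_simps mult_rewrite[OF Rd_idn(1)] mult_rewrite[OF Rd_idn(2)])
  show ?case
  \<comment> \<open>The two alternatives of \<open>const_cases\<close>: either the derivatives of
    \<open>S\<close> vanish, or those of \<open>T\<close> do.\<close>
  proof (cases "\<forall>y. y \<noteq> l \<longrightarrow> Dop \<Omega> l y = 0")
    case True
    then have S0: "?Sy = 0" "?Sz = 0" using y z by auto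
    \<comment> \<open>The coefficients on the left are products of the y- and z-differences of the
      derivatives of two roots, divided by the difference of the roots; this is symmetric in y and
      z.\<close>
    have "Rd y p * dT z - dT z * Rd y p = Rd z p * dT y - dT y * Rd z p"
      using elim(2,3) by (simp add: dlog_diff_def mult.commute)
    note W = dual_residual_commute_const_S[OF _ _ _ _ y3 z3 _ _ T_comm(2) this RR, of ?S]
    have "?W * Q = 0" "T p * ?W = ?W * T p"
      by (rule W; use y1 z1 y2 z2 y4 z4 in \<open>simp add: S0\<close>)+
    then have "?W = 0" by (rule commutator_zero[OF inj _ _ Wid])
    let ?e = "\<epsilon> * p l"
    have "(Rd y p - ?e \<odot>\<^sub>C dT y) * (Rd z p - ?e \<odot>\<^sub>C dT z) - (Rd z p - ?e \<odot>\<^sub>C dT z) * (Rd y p - ?e \<odot>\<^sub>C dT y)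
      = ?W - ?e \<odot>\<^sub>C ((Rd y p * dT z - dT z * Rd y p) - (Rd z p * dT y - dT y * Rd z p))"
      by (simp add: algebra_simps scl_distrib T_comm(2))
    also have "\<dots> = 0"
      unfolding \<open>?W = 0\<close> \<open>Rd y p * dT z - dT z * Rd y p = Rd z p * dT y - dT y * Rd z p\<close> by simp
    finally have "(Rd y p - ?e \<odot>\<^sub>C dT y) * (Rd z p - ?e \<odot>\<^sub>C dT z) = (Rd z p - ?e \<odot>\<^sub>C dT z) * (Rd y p - ?e \<odot>\<^sub>C dT y)"
      by simp
    then show ?thesis unfolding Mw_y[OF y] Mw_y[OF z] S0 by simp
  next
    case False
    then have T0: "dT y = 0" "dT z = 0"
      using const_cases y z by (auto simp: dT_def intro!: sum.neutral)
    have "?W * Q = 0" "T p * ?W = ?W * T p"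
      by (rule dual_residual_commute_const_T[OF _ _ _ _ S RS RR, of _ _ "T p"]; use y1 z1 y3 z3 in \<open>simp add: T0\<close>)+
    then have "?W = 0" by (rule commutator_zero[OF inj _ _ Wid])
    then have RR': "Rd y p * Rd z p = Rd z p * Rd y p" by simp
    show ?thesis
      unfolding Mw_y[OF y] Mw_y[OF z] T0
      using dual_commute_yz_const_T[OF inv Dop_resolvent_commute[OF y] Dop_resolvent_commute[OF z] S PQ_idn(1,4)
        idn_Rop(1,2)[OF y] idn_Rop(1,2)[OF z] _ _ _ _ y4 z4 RS RR' assms(1), of "T p"] y1 z1 y2 z2 T0 by simp
  qed
qed

lemma Mw_com:
  assumes "\<epsilon> * \<epsilon> = 1" shows "\<forall>\<^sub>F p in genf. com (Mw \<epsilon> y p) (Mw \<epsilon> z p) = 0"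
proof -
  consider "y = z" | "y = l" "z \<noteq> l" | "y \<noteq> l" "z = l" | "y \<noteq> l" "z \<noteq> l" by blast
  then show ?thesis
  proof cases
    case 1
    then show ?thesis by simp
  next
    case 2
    show ?thesis using Mw_commute_l[OF assms 2(2)] unfolding com_eq_0 2(1) .
  next
    case 3
    show ?thesis using Mw_commute_l[OF assms 3(1)] unfolding com_eq_0 3(2) by (rule eventually_mono) (rule sym)
  next
    case 4
    show ?thesis using Mw_commute_yz[OF assms 4] unfolding com_eq_0 .
  qed
qed

end

section \<open>Irreducible systems\<close>

definition full :: "nat \<Rightarrow> (nat \<Rightarrow> complex) set" where
  "full n = {u. app (idn n) u = u}"

lemma seq_of_full: "seq_of ` carrier_vec n = full n"
proof (intro Set.set_eqI iffI)
  fix u assume "u \<in> full n"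
  then have "u = seq_of (vec n u)" by (simp add: full_def seq_of_vec)
  then show "u \<in> seq_of ` carrier_vec n" by (metis image_eqI vec_carrier)
qed (auto simp: full_def idn_seq_of)

lemma subspace_seq:
  assumes "W \<subseteq> carrier_vec n"
  shows "VectorSpace.subspace class_ring W (module_vec TYPE(complex) n) \<longleftrightarrow> fvs.subspace (seq_of ` W)"
proof
  assume "VectorSpace.subspace class_ring W (module_vec TYPE(complex) n)"
  then have s: "submodule class_ring W (module_vec TYPE(complex) n)"
    by (simp add: VectorSpace.subspace_def)
  have z: "0\<^sub>v n \<in> W" using submodule.zero_closed[OF s] by (simp add: module_vec_simps)
  have a: "v + w \<in> W" if "v \<in> W" "w \<in> W" for v w
    using submodule.m_closed[OF s that] by (simp add: module_vec_simps)
  have m: "c \<cdot>\<^sub>v v \<in> W" if "v \<in> W" for c v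
    using submodule.smult_closed[OF s _ that, of c] by (simp add: module_vec_simps)
  show "fvs.subspace (seq_of ` W)"
    unfolding fvs.subspace_def
  proof (intro conjI ballI allI)
    show "0 \<in> seq_of ` W" using z by (metis image_eqI seq_of_zero)
    fix x y assume "x \<in> seq_of ` W" "y \<in> seq_of ` W"
    then obtain v w where vw: "v \<in> W" "w \<in> W" "x = seq_of v" "y = seq_of w" by auto
    then have "x + y = seq_of (v + w)" using assms by (metis seq_of_add subsetD)
    then show "x + y \<in> seq_of ` W" using a vw by blast
  next
    fix c x assume "x \<in> seq_of ` W"
    then obtain v where "v \<in> W" "x = seq_of v" by auto
    then show "fscale c x \<in> seq_of ` W" using m by (metis image_eqI seq_of_smult)
  qed
next
  assume s: "fvs.subspace (seq_of ` W)"
  have mem: "v \<in> W" if "v \<in> carrier_vec n" "seq_of v \<in> seq_of ` W" for v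
    using that assms seq_of_inj by (metis image_iff subsetD)
  have vs: "vectorspace class_ring (module_vec TYPE(complex) n)" by (rule vec_vs)
  then have "module class_ring (module_vec TYPE(complex) n)" by (simp add: vectorspace_def)
  moreover have "0\<^sub>v n \<in> W" using mem[of "0\<^sub>v n"] fvs.subspace_0[OF s] by simp
  moreover have "v + w \<in> W" if "v \<in> W" "w \<in> W" for v w
  proof (rule mem)
    show "v + w \<in> carrier_vec n" using that assms by (intro add_carrier_vec) blast+
    have "seq_of (v + w) = seq_of v + seq_of w" using that assms by (metis seq_of_add subsetD)
    then show "seq_of (v + w) \<in> seq_of ` W" using fvs.subspace_add[OF s] that by auto
  qed
  moreover have "c \<cdot>\<^sub>v v \<in> W" if "v \<in> W" for c v
    using that assms fvs.subspace_scale[OF s] by (intro mem) (auto simp: seq_of_smult)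
  ultimately have "submodule class_ring W (module_vec TYPE(complex) n)"
    using assms by (intro submodule.intro) (auto simp: module_vec_simps)
  then show "VectorSpace.subspace class_ring W (module_vec TYPE(complex) n)"
    using vs by (simp add: VectorSpace.subspace_def)
qed

lemma stable_seq:
  assumes "W \<subseteq> carrier_vec n" "B \<in> carrier_mat n n"
  shows "stable B W \<longleftrightarrow> (\<forall>u\<in>seq_of ` W. app (emb B) u \<in> seq_of ` W)"
proof -
  have "B *\<^sub>v v \<in> W \<longleftrightarrow> app (emb B) (seq_of v) \<in> seq_of ` W" if v: "v \<in> W" for v
  proof -
    have vc: "v \<in> carrier_vec n" and Bv: "B *\<^sub>v v \<in> carrier_vec n"
      using v assms by (blast, metis mult_mat_vec_carrier subsetD)
    have "B *\<^sub>v v \<in> W" if s: "seq_of (B *\<^sub>v v) \<in> seq_of ` W"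
    proof -
      obtain w where "w \<in> W" "seq_of (B *\<^sub>v v) = seq_of w" using s by blast
      then show ?thesis using seq_of_inj[OF Bv, of w] assms(1) by blast
    qed
    then show ?thesis using seq_of_mult[OF assms(2) vc] by (metis imageI)
  qed
  then show ?thesis by (simp add: stable_def)
qed

text \<open>Lagrange interpolation: the product of the factors B - c_j over j different from i, with
  B the given combination, is a nonzero multiple of \<open>E i\<close>. Hence a subspace invariant
  under B is invariant under \<open>E i\<close>.\<close>

lemma resolution_invariant:
  assumes r: "resolution e I E" and inj: "inj_on c I"
    and U: "fvs.subspace U" "\<And>u. u \<in> U \<Longrightarrow> app (\<Sum>i\<in>I. c i \<odot>\<^sub>C E i) u \<in> U" "\<And>u. u \<in> U \<Longrightarrow> app e u = u"
    and i: "i \<in> I" and u: "u \<in> U"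
  shows "app (E i) u \<in> U"
proof -
  have 1: "app (\<Sum>k\<in>I. (\<Prod>j\<in>J. c k - c j) \<odot>\<^sub>C E k) u \<in> U" if "finite J" for J
    using that
  proof (induction J)
    case empty
    then show ?case using resolution_sum[OF r] U(3)[OF u] u by simp
  next
    case (insert j J)
    let ?X = "\<Sum>k\<in>I. (\<Prod>j\<in>J. c k - c j) \<odot>\<^sub>C E k"
    have "(\<Sum>k\<in>I. (\<Prod>j\<in>insert j J. c k - c j) \<odot>\<^sub>C E k) = (\<Sum>i\<in>I. c i \<odot>\<^sub>C E i) * ?X - c j \<odot>\<^sub>C ?X"
      unfolding resolution_mult_lin[OF r] using insert.hyps
      by (simp add: scl_sum_right left_diff_distrib scl_distrib sum_subtractf)
    then have "app (\<Sum>k\<in>I. (\<Prod>j\<in>insert j J. c k - c j) \<odot>\<^sub>C E k) u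
        = app (\<Sum>i\<in>I. c i \<odot>\<^sub>C E i) (app ?X u) - fscale (c j) (app ?X u)" by simp
    then show ?case
      using fvs.subspace_diff[OF U(1) U(2)[OF insert.IH] fvs.subspace_scale[OF U(1) insert.IH, of "c j"]]
      by (simp only:)
  qed
  let ?d = "\<Prod>j\<in>I - {i}. c i - c j"
  have fin: "finite I" using resolution_finite[OF r] .
  have "(\<Sum>k\<in>I. (\<Prod>j\<in>I - {i}. c k - c j) \<odot>\<^sub>C E k) = (\<Sum>k\<in>I. if k = i then ?d \<odot>\<^sub>C E i else 0)"
  proof (intro sum.cong refl)
    fix k assume "k \<in> I"
    show "(\<Prod>j\<in>I - {i}. c k - c j) \<odot>\<^sub>C E k = (if k = i then ?d \<odot>\<^sub>C E i else 0)"
    proof (cases "k = i")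
      case False
      then have "(\<Prod>j\<in>I - {i}. c k - c j) = 0" using \<open>k \<in> I\<close> fin by (intro prod_zero) auto
      then show ?thesis using False by simp
    qed simp
  qed
  then have "fscale ?d (app (E i) u) \<in> U" using 1[of "I - {i}"] fin i by simp
  then have "fscale (1 / ?d) (fscale ?d (app (E i) u)) \<in> U" using U(1) by (rule fvs.subspace_scale[rotated])
  moreover have "?d \<noteq> 0" using fin inj i by (auto simp: inj_on_def)
  ultimately show ?thesis by simp
qed

lemma linop_g_inverse:
  fixes M :: linop
  obtains G where "M * G * M = M"
proof -
  obtain g where g: "Vector_Spaces.linear fscale fscale g" "\<forall>u. app M (g (app M u)) = app M u"
    using fvp.linear_exists_right_inverse_on[OF linear_app fvs.subspace_UNIV, of M] by auto
  have "M * Abs_linop g * M = M"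
    using g(2) by (intro linop_eqI) (simp add: app_Abs_linear[OF g(1)])
  then show thesis by (rule that)
qed

definition invariant_seq :: "'n::finite pfaff \<Rightarrow> 'n \<Rightarrow> (nat \<Rightarrow> complex) set \<Rightarrow> bool" where
  "invariant_seq \<Omega> l U \<longleftrightarrow> fvs.subspace U \<and> U \<subseteq> full (rk \<Omega>) \<and>
     (\<forall>u\<in>U. app (emb (mconst \<Omega> l)) u \<in> U \<and> (\<forall>j. j \<noteq> l \<longrightarrow> app (Dop \<Omega> l j) u \<in> U) \<and>
       (\<forall>H\<in>hyps_dep \<Omega> l. app (Aop \<Omega> H) u \<in> U))"

context pfaff_dir
begin

lemma irreducible_seq:
  "irreducible_dir \<Omega> l \<longleftrightarrow> (\<forall>U. invariant_seq \<Omega> l U \<longrightarrow> U = {0} \<or> U = full N)"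
proof -
  have inv: "VectorSpace.subspace class_ring W (module_vec TYPE(complex) N) \<and>
       stable (mconst \<Omega> l) W \<and> (\<forall>j. j \<noteq> l \<longrightarrow> stable (mlin \<Omega> l j) W) \<and>
       (\<forall>H\<in>I. stable (res \<Omega> H) W) \<longleftrightarrow> invariant_seq \<Omega> l (seq_of ` W)" if W: "W \<subseteq> carrier_vec N" for W
  proof -
    let ?U = "seq_of ` W"
    have 1: "stable (mconst \<Omega> l) W \<longleftrightarrow> (\<forall>u\<in>?U. app (emb (mconst \<Omega> l)) u \<in> ?U)"
      by (rule stable_seq[OF W carriers(1)])
    have 2: "(\<forall>j. j \<noteq> l \<longrightarrow> stable (mlin \<Omega> l j) W) \<longleftrightarrow> (\<forall>j. j \<noteq> l \<longrightarrow> (\<forall>u\<in>?U. app (Dop \<Omega> l j) u \<in> ?U))"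
      using stable_seq[OF W carriers(2)] unfolding Dop_def by metis
    have 3: "(\<forall>H\<in>I. stable (res \<Omega> H) W) \<longleftrightarrow> (\<forall>H\<in>I. \<forall>u\<in>?U. app (A H) u \<in> ?U)"
      using stable_seq[OF W carriers(3)[OF I_hyps]] unfolding Aop_def by (intro ball_cong) auto
    have 4: "?U \<subseteq> full N" unfolding seq_of_full[symmetric] using W by (rule image_mono)
    show ?thesis
      unfolding subspace_seq[OF W] 1 2 3 invariant_seq_def ball_conj_distrib using 4 by (simp only:) blast
  qed
  have triv: "W = {0\<^sub>v N} \<longleftrightarrow> seq_of ` W = {0}" "W = carrier_vec N \<longleftrightarrow> seq_of ` W = full N" if W: "W \<subseteq> carrier_vec N" for W
  proof -
    have io: "inj_on seq_of (carrier_vec N :: complex vec set)" using seq_of_inj by (rule inj_onI)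
    show "W = {0\<^sub>v N} \<longleftrightarrow> seq_of ` W = {0}"
      using inj_on_image_eq_iff[OF io W, of "{0\<^sub>v N}"] by simp
    show "W = carrier_vec N \<longleftrightarrow> seq_of ` W = full N"
      using inj_on_image_eq_iff[OF io W order.refl] by (simp add: seq_of_full)
  qed
  have sub: "W \<subseteq> carrier_vec N" if "VectorSpace.subspace class_ring W (module_vec TYPE(complex) N)" for W
    using that submodule.subset by (fastforce simp: VectorSpace.subspace_def module_vec_simps)
  show ?thesis
  proof
    assume irr: "irreducible_dir \<Omega> l"
    show "\<forall>U. invariant_seq \<Omega> l U \<longrightarrow> U = {0} \<or> U = full N"
    proof (intro allI impI)
      fix U assume U: "invariant_seq \<Omega> l U"
      then obtain W where W: "W \<subseteq> carrier_vec N" "U = seq_of ` W"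
        unfolding invariant_seq_def seq_of_full[symmetric] by (meson subset_image_iff)
      then show "U = {0} \<or> U = full N"
        using irr inv[OF W(1)] triv[OF W(1)] U unfolding irreducible_dir_def by blast
    qed
  next
    assume h: "\<forall>U. invariant_seq \<Omega> l U \<longrightarrow> U = {0} \<or> U = full N"
    show "irreducible_dir \<Omega> l"
      unfolding irreducible_dir_def
    proof (intro allI impI)
      fix W assume a: "VectorSpace.subspace class_ring W (module_vec TYPE(complex) N) \<and>
       stable (mconst \<Omega> l) W \<and> (\<forall>j. j \<noteq> l \<longrightarrow> stable (mlin \<Omega> l j) W) \<and>
       (\<forall>H\<in>I. stable (res \<Omega> H) W)"
      then have W: "W \<subseteq> carrier_vec N" using sub by blast
      show "W = {0\<^sub>v N} \<or> W = carrier_vec N"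
        using h inv[OF W] triv[OF W] a by blast
    qed
  qed
qed

lemma form_coeff_entry:
  assumes "r < N" "c < N"
  shows "form_coeff \<Omega> i p $$ (r, c) = mconst \<Omega> i $$ (r, c) + (\<Sum>j\<in>UNIV - {i}. p j * mlin \<Omega> i j $$ (r, c))
    + (\<Sum>H\<in>hyps \<Omega>. pd (defpoly H) i / aff_eval (defpoly H) p * res \<Omega> H $$ (r, c))"
proof -
  have "(\<Sum>j\<in>UNIV - {i}. (p j \<cdot>\<^sub>m mlin \<Omega> i j) $$ (r, c)) = (\<Sum>j\<in>UNIV - {i}. p j * mlin \<Omega> i j $$ (r, c))"
  proof (intro sum.cong refl)
    fix j assume "j \<in> UNIV - {i}"
    then have "mlin \<Omega> i j \<in> carrier_mat N N" using carriers(2)[of i j] by auto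
    then show "(p j \<cdot>\<^sub>m mlin \<Omega> i j) $$ (r, c) = p j * mlin \<Omega> i j $$ (r, c)" using assms by simp
  qed
  moreover have "(\<Sum>H\<in>hyps \<Omega>. ((pd (defpoly H) i / aff_eval (defpoly H) p) \<cdot>\<^sub>m res \<Omega> H) $$ (r, c))
      = (\<Sum>H\<in>hyps \<Omega>. pd (defpoly H) i / aff_eval (defpoly H) p * res \<Omega> H $$ (r, c))"
  proof (intro sum.cong refl)
    fix H assume "H \<in> hyps \<Omega>"
    then have "res \<Omega> H \<in> carrier_mat N N" using carriers(3)[of H] by auto
    then show "((pd (defpoly H) i / aff_eval (defpoly H) p) \<cdot>\<^sub>m res \<Omega> H) $$ (r, c)
      = pd (defpoly H) i / aff_eval (defpoly H) p * res \<Omega> H $$ (r, c)" using assms by simp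
  qed
  ultimately show ?thesis
    using assms carriers(1)[of i] by (simp add: form_coeff_def S_coeff_def msum_def)
qed

text \<open>The entries of the coefficients are rational with poles only on the arrangement, so at a
  point off it they are continuous along every line. The generic identity then extends by
  \<open>vanishes_by_density\<close>.\<close>

lemma integrable_of_generic:
  assumes "\<And>i j. \<forall>\<^sub>F p in genf. com (Fop \<Omega> i p) (Fop \<Omega> j p) = 0"
  shows "completely_integrable \<Omega>"
  unfolding completely_integrable_def
proof (intro allI impI)
  fix p i j assume p: "p \<notin> \<Union>(hyps \<Omega>)"
  let ?X = "\<lambda>p. form_coeff \<Omega> i p * form_coeff \<Omega> j p - form_coeff \<Omega> j p * form_coeff \<Omega> i p"
  have Xc: "?X q \<in> carrier_mat N N" for q
    using carriers(5)[of i q] carriers(5)[of j q] by (intro minus_carrier_mat mult_carrier_mat)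
  show "?X p = 0\<^sub>m N N"
  proof (rule eq_matI)
    fix r c assume "r < dim_row (0\<^sub>m N N :: complex mat)" "c < dim_col (0\<^sub>m N N :: complex mat)"
    then have rc: "r < N" "c < N" by auto
    have "?X p $$ (r, c) = 0"
    proof (rule vanishes_by_density[where \<phi> = "\<lambda>q. ?X q $$ (r, c)" and p = p])
      show "\<forall>\<^sub>F q in genf. ?X q $$ (r, c) = 0"
        using assms[of i j]
      proof eventually_elim
        case (elim q)
        have "emb (?X q) = com (Fop \<Omega> i q) (Fop \<Omega> j q)"
          using carriers(5) by (simp add: com_def Fop_def emb_minus[of _ N N] emb_mult[of _ N N _ N] mult_carrier_mat[of _ N N])
        then have "?X q = 0\<^sub>m N N" using elim by (intro emb_inj[OF Xc]) auto
        then show ?case using rc by simp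
      qed
      fix q
      let ?L = "\<lambda>t::complex. (\<lambda>i. p i + t * (q i - p i))"
      have nz: "aff_eval (defpoly H) p \<noteq> 0" if "H \<in> hyps \<Omega>" for H
        using p that defines_hyperplane_defpoly[OF arr that] by (auto simp: defines_hyperplane_def)
      have cont: "isCont (\<lambda>t. form_coeff \<Omega> i (?L t) $$ (r, c)) 0" if "r < N" "c < N" for i r c
        unfolding form_coeff_entry[OF that] aff_eval_line
        by (intro continuous_intros) (use nz in auto)
      have "?X q' $$ (r, c) = (\<Sum>k<N. form_coeff \<Omega> i q' $$ (r, k) * form_coeff \<Omega> j q' $$ (k, c))
          - (\<Sum>k<N. form_coeff \<Omega> j q' $$ (r, k) * form_coeff \<Omega> i q' $$ (k, c))" for q'
        using rc carriers(5)[of i q'] carriers(5)[of j q'] by (simp add: scalar_prod_def lessThan_atLeast0)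
      then show "isCont (\<lambda>t. ?X (?L t) $$ (r, c)) 0"
        using rc by (simp only:) (intro continuous_intros cont; simp)
    qed
    then show "?X p $$ (r, c) = 0\<^sub>m N N $$ (r, c)" using rc by simp
  qed (use Xc[of p] in auto)
qed

end

locale irreducible_system = integrable_dir +
  assumes irr: "irreducible_dir \<Omega> l" and nonexc: "\<not> exceptional_dir \<Omega> l" and rk_pos: "rk \<Omega> \<ge> 1"
begin

lemma irredD: "invariant_seq \<Omega> l U \<Longrightarrow> U = {0} \<or> U = full N"
  using irr irreducible_seq by blast

text \<open>If S_x has a single eigenvalue and the residues vanish, then every line is invariant.
  Irreducibility, applied to the line through the first unit vector, forces rank one, and the system
  would be exceptional.\<close>

lemma not_scalar:
  assumes "\<alpha> \<in> \<Lambda>" "E \<alpha> = idn N" "\<And>H. H \<in> I \<Longrightarrow> A H = 0"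
  shows False
proof -
  have scal: "(\<Sum>\<beta>\<in>\<Lambda>. c \<beta> \<odot>\<^sub>C E \<beta>) = c \<alpha> \<odot>\<^sub>C idn N" for c
    using resolution_lin_mult(1)[OF resolution_E assms(1), of c] unfolding assms(2)
    by (simp add: sum_distrib_right)
  define U where "U = range (\<lambda>c. fscale c (delta 0))"
  have fU: "fscale c u \<in> U" if "u \<in> U" for c u using that unfolding U_def by auto
  have idU: "app (idn N) u = u" if "u \<in> U" for u
    using that rk_pos by (auto simp: U_def fun_eq_iff app_idn delta_def)
  have "invariant_seq \<Omega> l U"
    unfolding invariant_seq_def
  proof (intro conjI ballI allI impI)
    show "fvs.subspace U"
      unfolding fvs.subspace_def
    proof (intro conjI ballI allI)
      show "0 \<in> U" unfolding U_def by (intro range_eqI[of _ _ 0]) (simp add: fun_eq_iff)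
      fix x y assume "x \<in> U" "y \<in> U"
      then show "x + y \<in> U" unfolding U_def by (auto simp flip: fvs.scale_left_distrib)
    qed (use fU in blast)
    show "U \<subseteq> full N" using idU by (auto simp: full_def)
    fix u assume u: "u \<in> U"
    show "app (emb (mconst \<Omega> l)) u \<in> U" unfolding mconst_E scal using fU u idU by simp
    show "app (Dop \<Omega> l j) u \<in> U" if "j \<noteq> l" for j unfolding Dop_E[OF that] scal using fU u idU by simp
    show "app (A H) u \<in> U" if "H \<in> I" for H
      using assms(3)[OF that] fU[OF u, of 0] by (simp add: fscale_def zero_fun_def)
  qed
  moreover have "delta 0 \<in> U" unfolding U_def by (intro range_eqI[of _ _ 1]) simp
  moreover have "delta 0 \<noteq> 0" by (auto simp: fun_eq_iff delta_def)
  ultimately have "U = full N" using irredD by blast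
  have "N = 1"
  proof (rule ccontr)
    assume "N \<noteq> 1"
    then have "delta 1 \<in> full N" using rk_pos by (auto simp: full_def fun_eq_iff app_idn delta_def)
    then obtain c where "delta 1 = fscale c (delta 0)" using \<open>U = full N\<close> unfolding U_def by auto
    from fun_cong[OF this, of 1] show False by (simp add: delta_def)
  qed
  moreover have "res \<Omega> H = 0\<^sub>m N N" if "H \<in> I" for H
    using carriers(3)[OF I_hyps[OF that]] assms(3)[OF that] by (intro emb_inj[of _ N N]) (auto simp: Aop_def)
  ultimately show False using nonexc by (simp add: exceptional_dir_def)
qed

lemma commute_E:
  assumes "\<alpha> \<in> \<Lambda>"
  shows "emb (mconst \<Omega> l) * E \<alpha> = const_term \<alpha> \<odot>\<^sub>C E \<alpha>" "E \<alpha> * emb (mconst \<Omega> l) = const_term \<alpha> \<odot>\<^sub>C E \<alpha>"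
    "j \<noteq> l \<Longrightarrow> Dop \<Omega> l j * E \<alpha> = pd \<alpha> j \<odot>\<^sub>C E \<alpha>" "j \<noteq> l \<Longrightarrow> E \<alpha> * Dop \<Omega> l j = pd \<alpha> j \<odot>\<^sub>C E \<alpha>"
  unfolding mconst_E by (simp_all add: Dop_E resolution_lin_mult[OF resolution_E assms])

end

locale good_quotient = irreducible_system \<Omega> l + quotient_dir \<Omega> l m K s for \<Omega> l m K s
begin

lemma A_via_proj: "H \<in> I \<Longrightarrow> A H = P * proj H * Q"
  by (simp add: mult.assoc projQ)

text \<open>The kernel of \<open>Q\<close> in a joint eigenspace is invariant: S_x acts on it by
  scalars, and the residues kill it because they factor through \<open>Q\<close>. It is therefore
  zero or everything, and the latter is excluded by \<open>not_scalar\<close>. Injectivity is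
  phrased as cancellation on the left.\<close>

lemma Q_inj:
  assumes \<alpha>: "\<alpha> \<in> \<Lambda>" and X: "Q * E \<alpha> * X = 0" shows "E \<alpha> * X = 0"
proof -
  define U where "U = {u. app (E \<alpha>) u = u \<and> app Q u = 0}"
  have Au: "app (A H) u = 0" if "H \<in> I" "app Q u = 0" for H u
    using A_via_proj[OF that(1)] that(2) by simp
  have Bu: "app (c \<odot>\<^sub>C idn N) u = fscale c u" if "u \<in> U" for u c
  proof -
    have Eu: "app (E \<alpha>) u = u" using that by (simp add: U_def)
    have "app (idn N) (app (E \<alpha>) u) = app (E \<alpha>) u" using idn_E(1)[OF \<alpha>] by (metis app_times)
    then show ?thesis by (simp add: Eu)
  qed
  have sub: "fvs.subspace U" by (auto simp: U_def fvs.subspace_def)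
  have "invariant_seq \<Omega> l U"
    unfolding invariant_seq_def
  proof (intro conjI ballI allI impI)
    show "fvs.subspace U" by (rule sub)
    show "U \<subseteq> full N" using Bu[of _ 1] by (auto simp: full_def)
    fix u assume u: "u \<in> U"
    then have Eu: "app (E \<alpha>) u = u" by (simp add: U_def)
    have "app (emb (mconst \<Omega> l)) u = fscale (const_term \<alpha>) u"
      using commute_E(1)[OF \<alpha>] Eu by (metis app_scl app_times)
    then show "app (emb (mconst \<Omega> l)) u \<in> U" using fvs.subspace_scale[OF sub u] by simp
    show "app (Dop \<Omega> l j) u \<in> U" if "j \<noteq> l" for j
    proof -
      have "app (Dop \<Omega> l j) u = fscale (pd \<alpha> j) u"
        using commute_E(3)[OF \<alpha> that] Eu by (metis app_scl app_times)
      then show ?thesis using fvs.subspace_scale[OF sub u] by simp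
    qed
    show "app (A H) u \<in> U" if "H \<in> I" for H
      using Au[OF that] u fvs.subspace_0[OF sub] by (simp add: U_def)
  qed
  then consider "U = {0}" | "U = full N" using irredD by blast
  then show ?thesis
  proof cases
    case 1
    have "app (E \<alpha> * X) u \<in> U" for u
      using X resolution_mult[OF resolution_E \<alpha> \<alpha>] unfolding U_def by (simp flip: app_times add: mult.assoc) (metis app_0 mult.assoc)
    then show ?thesis using 1 by (intro linop_eqI) simp
  next
    case 2
    have f: "app (idn N) u \<in> U" for u unfolding 2 full_def by (simp flip: app_times)
    have "E \<alpha> = idn N"
    proof (rule linop_eqI)
      fix u have "app (E \<alpha>) (app (idn N) u) = app (idn N) u" using f by (simp add: U_def)
      then show "app (E \<alpha>) u = app (idn N) u" using idn_E(2)[OF \<alpha>] by (metis app_times)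
    qed
    moreover have "A H = 0" if "H \<in> I" for H
    proof (rule linop_eqI)
      fix u have "app (A H) (app (idn N) u) = 0" using f Au[OF that] by (simp add: U_def)
      then show "app (A H) u = app 0 u" using that by (simp flip: app_times)
    qed
    ultimately show ?thesis using not_scalar[OF \<alpha>] by blast
  qed
qed

text \<open>The dual argument uses the vectors whose \<alpha>-component lies in the range of
  \<open>E \<alpha> * P\<close>. They contain the range of \<open>P\<close>, hence the images of all
  residues, so they form an invariant subspace. If it were zero, \<open>P\<close> would vanish and
  \<open>E \<alpha>\<close> would be the identity, against \<open>not_scalar\<close>. Surjectivity
  is phrased as cancellation on the right.\<close>

lemma P_surj:
  assumes \<alpha>: "\<alpha> \<in> \<Lambda>" and C: "C * E \<alpha> * P = 0" shows "C * E \<alpha> = 0"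
proof -
  define U where "U = {u. app (idn N) u = u \<and> app (E \<alpha>) u \<in> range (app (E \<alpha> * P))}"
  have sub: "fvs.subspace U"
    unfolding fvs.subspace_def
  proof (intro conjI ballI allI)
    show "0 \<in> U" by (auto simp: U_def intro!: image_eqI[of _ _ 0])
    fix x y assume "x \<in> U" "y \<in> U"
    then obtain v w where "app (idn N) x = x" "app (idn N) y = y" "app (E \<alpha>) x = app (E \<alpha> * P) v" "app (E \<alpha>) y = app (E \<alpha> * P) w"
      unfolding U_def by blast
    then show "x + y \<in> U" unfolding U_def by (auto intro!: image_eqI[of _ _ "v + w"])
  next
    fix c x assume "x \<in> U"
    then obtain v where "app (idn N) x = x" "app (E \<alpha>) x = app (E \<alpha> * P) v" unfolding U_def by blast
    then show "fscale c x \<in> U" unfolding U_def by (auto intro!: image_eqI[of _ _ "fscale c v"])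
  qed
  have lin: "app B u \<in> U" if "idn N * B = B" "E \<alpha> * B = c \<odot>\<^sub>C E \<alpha>" "u \<in> U" for B c u
  proof -
    have "app (E \<alpha>) (app B u) = fscale c (app (E \<alpha>) u)" using that(2) by (metis app_scl app_times)
    moreover have "app (idn N) (app B u) = app B u" using that(1) by (metis app_times)
    ultimately show ?thesis using that(3) by (auto simp: U_def intro!: image_eqI[of _ _ "fscale c _"])
  qed
  have PU: "app P w \<in> U" for w
    unfolding U_def by (simp flip: app_times)
  have "invariant_seq \<Omega> l U"
    unfolding invariant_seq_def
  proof (intro conjI ballI allI impI)
    show "fvs.subspace U" by (rule sub)
    show "U \<subseteq> full N" by (auto simp: U_def full_def)
    fix u assume u: "u \<in> U"
    show "app (emb (mconst \<Omega> l)) u \<in> U" by (rule lin[OF _ commute_E(2)[OF \<alpha>] u]) simp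
    show "app (Dop \<Omega> l j) u \<in> U" if "j \<noteq> l" for j by (rule lin[OF _ commute_E(4)[OF \<alpha> that] u]) (simp add: that)
    show "app (A H) u \<in> U" if "H \<in> I" for H
      using PU A_via_proj[OF that] by simp
  qed
  then consider "U = {0}" | "U = full N" using irredD by blast
  then show ?thesis
  proof cases
    case 1
    have "P = 0" using PU 1 by (intro linop_eqI) auto
    then have "A H = 0" if "H \<in> I" for H using A_via_proj[OF that] by simp
    moreover have "E \<alpha> = idn N"
    proof (rule linop_eqI)
      fix u
      have "app (E \<alpha>) (app (idn N - E \<alpha>) u) = 0"
        using resolution_mult[OF resolution_E \<alpha> \<alpha>] idn_E(2)[OF \<alpha>] by (simp flip: app_times)
      moreover have "app (idn N) (app (idn N - E \<alpha>) u) = app (idn N - E \<alpha>) u"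
        using idn_E(1)[OF \<alpha>] by (simp flip: app_times)
      ultimately have "app (idn N - E \<alpha>) u \<in> U" unfolding U_def by (auto intro!: image_eqI[of _ _ 0])
      then show "app (E \<alpha>) u = app (idn N) u" using 1 by simp
    qed
    ultimately show ?thesis using not_scalar[OF \<alpha>] by blast
  next
    case 2
    show ?thesis
    proof (rule linop_eqI)
      fix u
      have "app (idn N) u \<in> U" unfolding 2 full_def by (simp flip: app_times)
      then obtain w where "app (E \<alpha>) (app (idn N) u) = app (E \<alpha> * P) w" unfolding U_def by auto
      then have "app (E \<alpha>) u = app (E \<alpha> * P) w" using idn_E(2)[OF \<alpha>] by (metis app_times)
      then have "app (C * E \<alpha>) u = app (C * E \<alpha> * P) w" by simp
      then show "app (C * E \<alpha>) u = app 0 u" using C by simp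
    qed
  qed
qed

lemma ex_eigval: "\<exists>\<alpha>. \<alpha> \<in> \<Lambda>"
proof (rule ccontr)
  assume "\<not> ?thesis"
  then have "idn N = 0" using resolution_sum[OF resolution_E] by (metis (no_types, lifting) sum.neutral)
  then have "app (idn N) (delta 0) 0 = 0" by simp
  then show False using rk_pos by (simp add: app_idn delta_def)
qed

end

section \<open>The dual system\<close>

context quotient_dir
begin

lemma Mw_idn [simp]: "Mw \<epsilon> y p * idn m = Mw \<epsilon> y p" "idn m * Mw \<epsilon> y p = Mw \<epsilon> y p"
  unfolding Mw_def by (simp_all add: sum_distrib_right sum_distrib_left mult.assoc mult_rewrite[OF K_idn(1)] cong: sum.cong)

lemma T_eq: "T p = (\<Sum>H\<in>I. const_term (aH l H) \<odot>\<^sub>C proj H) + (\<Sum>z\<in>UNIV - {l}. p z \<odot>\<^sub>C dT z)"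
proof -
  have "(\<Sum>z\<in>UNIV - {l}. p z \<odot>\<^sub>C dT z) = (\<Sum>z\<in>UNIV - {l}. \<Sum>H\<in>I. (droot l z H * p z) \<odot>\<^sub>C proj H)"
    by (simp add: dT_def scl_sum_right mult.commute)
  also have "\<dots> = (\<Sum>H\<in>I. (\<Sum>z\<in>UNIV - {l}. droot l z H * p z) \<odot>\<^sub>C proj H)"
    unfolding scl_sum_left by (rule sum.swap)
  finally show ?thesis
    unfolding T_def sum.distrib[symmetric]
    by (auto simp: sum.distrib[symmetric] scl_distrib(2)[symmetric] aff_eval_split[of _ p l] hyp_dlog(4) intro!: sum.cong)
qed

lemma T_update: "T (p(l := t)) = T p"
  unfolding T_def by (intro sum.cong) (auto simp: update_l)

lemma resolvent_sandwich:
  "Q * resolvent \<epsilon> \<Omega> l p * P = (\<Sum>\<alpha>\<in>\<Lambda>. (1 / (p l - \<epsilon> * aff_eval \<alpha> p)) \<odot>\<^sub>C (Q * E \<alpha> * P))"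
  "y \<noteq> l \<Longrightarrow> Q * Dop \<Omega> l y * resolvent \<epsilon> \<Omega> l p * P = (\<Sum>\<alpha>\<in>\<Lambda>. (pd \<alpha> y / (p l - \<epsilon> * aff_eval \<alpha> p)) \<odot>\<^sub>C (Q * E \<alpha> * P))"
proof -
  show "Q * resolvent \<epsilon> \<Omega> l p * P = (\<Sum>\<alpha>\<in>\<Lambda>. (1 / (p l - \<epsilon> * aff_eval \<alpha> p)) \<odot>\<^sub>C (Q * E \<alpha> * P))"
    by (simp add: resolvent_def sum_distrib_left sum_distrib_right)
  assume "y \<noteq> l"
  have "Q * Dop \<Omega> l y * resolvent \<epsilon> \<Omega> l p * P = Q * (Dop \<Omega> l y * resolvent \<epsilon> \<Omega> l p) * P" by (simp add: mult.assoc)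
  then show "Q * Dop \<Omega> l y * resolvent \<epsilon> \<Omega> l p * P = (\<Sum>\<alpha>\<in>\<Lambda>. (pd \<alpha> y / (p l - \<epsilon> * aff_eval \<alpha> p)) \<odot>\<^sub>C (Q * E \<alpha> * P))"
    unfolding Dop_resolvent[OF \<open>y \<noteq> l\<close>] by (simp add: sum_distrib_left sum_distrib_right)
qed

end

definition aff_scale :: "complex \<Rightarrow> 'n aff \<Rightarrow> 'n aff" where
  "aff_scale c f = Aff (\<lambda>j. c * pd f j) (c * const_term f)"

lemma aff_eval_scale: "aff_eval (aff_scale c f) p = c * aff_eval f p"
  by (simp add: aff_scale_def aff_eval_def sum_distrib_left algebra_simps)

text \<open>\<open>\<Omega>1\<close> is a transform of an irreducible non-exceptional system, in the
  operator form supplied by \<open>middle_laplace_gen_iff\<close>. The condition that \<epsilon>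
  squares to 1 covers both transforms at once.\<close>

locale middle_dual = good_quotient \<Omega> l "rk \<Omega>1" K s + W: pfaff_dir \<Omega>1 l
  for \<Omega> :: "'n::finite pfaff" and l and \<Omega>1 and K and s +
  fixes \<epsilon> :: complex
  assumes eps: "\<epsilon> * \<epsilon> = 1"
    and hyps1: "hyps_dep \<Omega>1 l = (\<lambda>\<alpha>. {p. p l = \<epsilon> * aff_eval \<alpha> p}) ` \<Lambda>"
    and gen: "\<And>y. \<forall>\<^sub>F p in genf. \<forall>H'\<in>I. (\<Sum>H\<in>I. K H * Mop \<epsilon> \<Omega> l y p H H') = Fop \<Omega>1 y p * K H'"
begin

lemma eps_nz: "\<epsilon> \<noteq> 0" using eps by auto

lemma Fop1: "\<forall>\<^sub>F p in genf. Fop \<Omega>1 y p = Mw \<epsilon> y p"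
  using gen[of y] generic_Mop_K[of \<epsilon> y]
proof eventually_elim
  case (elim p)
  show ?case
  proof (rule eq_on_K)
    fix H assume "H \<in> I"
    then show "Fop \<Omega>1 y p * K H = Mw \<epsilon> y p * K H" using elim by metis
  qed simp_all
qed

definition "hyp \<alpha> = graph_hyp l (aff_scale \<epsilon> \<alpha>)"

lemma hyps1': "W.I = hyp ` \<Lambda>"
  unfolding hyps1 hyp_def graph_hyp_def aff_eval_scale ..

lemma hyp_in: "\<alpha> \<in> \<Lambda> \<Longrightarrow> hyp \<alpha> \<in> W.I"
  unfolding hyps1' by (rule imageI)

lemma aH_hyp: "\<alpha> \<in> \<Lambda> \<Longrightarrow> aH l (hyp \<alpha>) = aff_scale \<epsilon> \<alpha>"
  using graph_hyp(2)[of "aff_scale \<epsilon> \<alpha>" l] pd_eigval[of \<alpha>] by (simp add: hyp_def aH_def aff_scale_def)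

lemma root_hyp: "\<alpha> \<in> \<Lambda> \<Longrightarrow> root_at l p (hyp \<alpha>) = \<epsilon> * aff_eval \<alpha> p" "\<alpha> \<in> \<Lambda> \<Longrightarrow> droot l y (hyp \<alpha>) = \<epsilon> * pd \<alpha> y"
  by (simp add: aH_hyp aff_eval_scale, simp add: aH_hyp aff_scale_def)

lemma inj_hyp: "inj_on hyp \<Lambda>"
proof (rule inj_onI)
  fix \<alpha> \<beta> assume "\<alpha> \<in> \<Lambda>" "\<beta> \<in> \<Lambda>" "hyp \<alpha> = hyp \<beta>"
  then have "aff_scale \<epsilon> \<alpha> = aff_scale \<epsilon> \<beta>" using aH_hyp by metis
  then show "\<alpha> = \<beta>" using eps_nz by (auto simp: aff_scale_def fun_eq_iff intro: aff.expand)
qed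

lemma sum_hyp: "(\<Sum>H\<in>W.I. f H) = (\<Sum>\<alpha>\<in>\<Lambda>. f (hyp \<alpha>))"
  unfolding hyps1' by (rule sum.reindex[OF inj_hyp, unfolded comp_def])

text \<open>Two expressions for the dx-coefficient of the transform are compared: the one given by
  its data as a form, and the induced operator. Both are partial fraction expansions in x with the
  poles \<epsilon> times the eigenvalues, so their coefficients agree.\<close>

lemma structure_x:
  "\<forall>\<^sub>F p in genf. Sop \<Omega>1 l p = - (\<epsilon> \<odot>\<^sub>C T p) \<and> (\<forall>\<alpha>\<in>\<Lambda>. Aop \<Omega>1 (hyp \<alpha>) = - (Q * E \<alpha> * P))"
proof -
  have "\<forall>\<^sub>F p in genf. inj_on (\<lambda>\<alpha>. aff_eval \<alpha> p) \<Lambda>"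
    by (rule eventually_inj_on_aff) auto
  then show ?thesis
    using eventually_genf_update[OF Fop1[of l], of l]
  proof eventually_elim
    case (elim p)
    let ?a = "\<lambda>\<alpha>. \<epsilon> * aff_eval \<alpha> p"
    have inj: "inj_on ?a \<Lambda>" using elim(1) eps_nz by (auto simp: inj_on_def)
    have "\<forall>\<^sub>F t in cofinite. (Sop \<Omega>1 l p + \<epsilon> \<odot>\<^sub>C T p) + t \<odot>\<^sub>C 0
        + (\<Sum>\<alpha>\<in>\<Lambda>. (1 / (t - ?a \<alpha>)) \<odot>\<^sub>C (Aop \<Omega>1 (hyp \<alpha>) + Q * E \<alpha> * P)) = 0"
      using elim(2)
    proof eventually_elim
      case (elim t)
      have "Fop \<Omega>1 l (p(l := t)) = Sop \<Omega>1 l p + (\<Sum>\<alpha>\<in>\<Lambda>. (1 / (t - ?a \<alpha>)) \<odot>\<^sub>C Aop \<Omega>1 (hyp \<alpha>))"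
        unfolding W.Fop_x sum_hyp
        by (intro arg_cong2[of _ _ _ _ plus] sum.cong) (auto simp: W.update_l root_hyp aff_eval_update_free pd_eigval)
      moreover have "Mw \<epsilon> l (p(l := t)) = - (\<epsilon> \<odot>\<^sub>C T p) - (\<Sum>\<alpha>\<in>\<Lambda>. (1 / (t - ?a \<alpha>)) \<odot>\<^sub>C (Q * E \<alpha> * P))"
        unfolding Mw_l resolvent_sandwich T_update
        by (intro arg_cong2[of _ _ _ _ minus] sum.cong) (auto simp: aff_eval_update_free pd_eigval)
      ultimately have eq: "Sop \<Omega>1 l p + (\<Sum>\<alpha>\<in>\<Lambda>. (1 / (t - ?a \<alpha>)) \<odot>\<^sub>C Aop \<Omega>1 (hyp \<alpha>))
          = - (\<epsilon> \<odot>\<^sub>C T p) - (\<Sum>\<alpha>\<in>\<Lambda>. (1 / (t - ?a \<alpha>)) \<odot>\<^sub>C (Q * E \<alpha> * P))"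
        using elim by simp
      have "(Sop \<Omega>1 l p + \<epsilon> \<odot>\<^sub>C T p) + t \<odot>\<^sub>C 0 + (\<Sum>\<alpha>\<in>\<Lambda>. (1 / (t - ?a \<alpha>)) \<odot>\<^sub>C (Aop \<Omega>1 (hyp \<alpha>) + Q * E \<alpha> * P))
        = (Sop \<Omega>1 l p + (\<Sum>\<alpha>\<in>\<Lambda>. (1 / (t - ?a \<alpha>)) \<odot>\<^sub>C Aop \<Omega>1 (hyp \<alpha>)))
          - (- (\<epsilon> \<odot>\<^sub>C T p) - (\<Sum>\<alpha>\<in>\<Lambda>. (1 / (t - ?a \<alpha>)) \<odot>\<^sub>C (Q * E \<alpha> * P)))"
        by (simp add: scl_distrib sum.distrib)
      also have "\<dots> = 0" unfolding eq by simp
      finally show ?case .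
    qed
    from partial_fractions[OF finite_eigvals inj this]
    show ?case by (auto simp: eq_neg_iff_add_eq_0)
  qed
qed

lemma A1: "\<alpha> \<in> \<Lambda> \<Longrightarrow> Aop \<Omega>1 (hyp \<alpha>) = - (Q * E \<alpha> * P)"
  using eventually_happens'[OF genf_nontrivial structure_x] by (elim exE conjE) (rule bspec)

lemma mconst1: "emb (mconst \<Omega>1 l) = (\<Sum>H\<in>I. (- \<epsilon> * const_term (aH l H)) \<odot>\<^sub>C proj H)"
  and Dop1: "z \<noteq> l \<Longrightarrow> Dop \<Omega>1 l z = - (\<epsilon> \<odot>\<^sub>C dT z)"
proof -
  let ?C = "emb (mconst \<Omega>1 l) + \<epsilon> \<odot>\<^sub>C (\<Sum>H\<in>I. const_term (aH l H) \<odot>\<^sub>C proj H)"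
  let ?B = "\<lambda>z. if z = l then 0 else Dop \<Omega>1 l z + \<epsilon> \<odot>\<^sub>C dT z"
  have "\<forall>\<^sub>F p in genf. ?C + (\<Sum>z\<in>UNIV. p z \<odot>\<^sub>C ?B z) = 0"
    using structure_x
  proof eventually_elim
    case (elim p)
    have "(\<Sum>z\<in>UNIV. p z \<odot>\<^sub>C ?B z) = (\<Sum>z\<in>UNIV - {l}. p z \<odot>\<^sub>C Dop \<Omega>1 l z) + \<epsilon> \<odot>\<^sub>C (\<Sum>z\<in>UNIV - {l}. p z \<odot>\<^sub>C dT z)"
      unfolding scl_sum_right sum.distrib[symmetric]
      by (rule sum.mono_neutral_cong_right) (auto simp: scl_distrib mult.commute)
    then have "?C + (\<Sum>z\<in>UNIV. p z \<odot>\<^sub>C ?B z) = Sop \<Omega>1 l p + \<epsilon> \<odot>\<^sub>C T p"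
      unfolding W.Sop_eq T_eq by (simp add: scl_distrib)
    then show ?case using elim by simp
  qed
  from affine_linop_eq_0[OF this] have C: "?C = 0" and B: "\<forall>z. ?B z = 0" by blast+
  show "emb (mconst \<Omega>1 l) = (\<Sum>H\<in>I. (- \<epsilon> * const_term (aH l H)) \<odot>\<^sub>C proj H)"
    using C by (simp add: eq_neg_iff_add_eq_0 scl_sum_right sum_negf)
  show "Dop \<Omega>1 l z = - (\<epsilon> \<odot>\<^sub>C dT z)" if "z \<noteq> l"
    using B[rule_format, of z] that by (simp add: eq_neg_iff_add_eq_0)
qed

lemma Sop1: "Sop \<Omega>1 l p = - (\<epsilon> \<odot>\<^sub>C T p)"
proof -
  have "(\<Sum>z\<in>UNIV - {l}. p z \<odot>\<^sub>C Dop \<Omega>1 l z) = - (\<epsilon> \<odot>\<^sub>C (\<Sum>z\<in>UNIV - {l}. p z \<odot>\<^sub>C dT z))"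
    unfolding scl_sum_right sum_negf[symmetric] by (intro sum.cong) (auto simp: Dop1 mult.commute)
  then show ?thesis
    unfolding W.Sop_eq T_eq mconst1 by (simp add: scl_distrib scl_sum_right sum_negf)
qed

lemma Rop1:
  assumes "y \<noteq> l"
  shows "\<forall>\<^sub>F p in genf. Rop \<Omega>1 l y p = Rd y p"
  using Fop1[of y]
proof eventually_elim
  case (elim p)
  have "(\<Sum>H\<in>W.I. (droot l y H / (p l - root_at l p H)) \<odot>\<^sub>C Aop \<Omega>1 H)
      = - (\<epsilon> \<odot>\<^sub>C (Q * Dop \<Omega> l y * resolvent \<epsilon> \<Omega> l p * P))"
    unfolding sum_hyp resolvent_sandwich(2)[OF assms] scl_sum_right sum_negf[symmetric]
    by (intro sum.cong) (auto simp: root_hyp A1)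
  then show ?case
    using elim unfolding W.Fop_y[OF assms] Mw_y[OF assms] Dop1[OF assms]
    by (simp add: mult.commute)
qed

lemma integrable1: "completely_integrable \<Omega>1"
proof (rule W.integrable_of_generic)
  fix i j
  show "\<forall>\<^sub>F p in genf. com (Fop \<Omega>1 i p) (Fop \<Omega>1 j p) = 0"
    using Fop1[of i] Fop1[of j] Mw_com[OF eps, of i j] by eventually_elim simp
qed

lemma cond_D1: "cond_D \<Omega>1 l"
  unfolding cond_D_def
proof (intro conjI allI impI)
  show "diagonalizable_mat (mconst \<Omega>1 l)"
    by (rule resolution_diagonalizable[OF resolution_proj W.carriers(1) mconst1])
  fix z assume z: "z \<noteq> l"
  have c: "mlin \<Omega>1 l z \<in> carrier_mat (rk \<Omega>1) (rk \<Omega>1)" using W.carriers(2)[of l z] z by auto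
  have "emb (mlin \<Omega>1 l z) = (\<Sum>H\<in>I. (- \<epsilon> * droot l z H) \<odot>\<^sub>C proj H)"
    using Dop1[OF z] by (simp add: Dop_def dT_def scl_sum_right sum_negf)
  then show "diagonalizable_mat (mlin \<Omega>1 l z)"
    by (rule resolution_diagonalizable[OF resolution_proj c])
qed

text \<open>Duality exchanges the alternatives of \<open>const_cases\<close>. A hyperplane of the
  transform depending on x and z comes from an eigenvalue of S_x depending on z; then the roots of
  the original hyperplanes are constant, and these are, up to \<epsilon>, the linear coefficients of
  the transform.\<close>

lemma cond_I1: "cond_I \<Omega>1 l"
  unfolding cond_I_def
proof (intro impI allI)
  assume "\<exists>z. z \<noteq> l \<and> W.I \<inter> hyps_dep \<Omega>1 z \<noteq> {}"
  then obtain z H where zH: "z \<noteq> l" "H \<in> W.I" "H \<in> hyps_dep \<Omega>1 z" by blast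
  obtain \<alpha> where \<alpha>: "\<alpha> \<in> \<Lambda>" "H = hyp \<alpha>" using zH(2) hyps1' by (metis imageE)
  have z: "z \<noteq> l" "\<alpha> \<in> \<Lambda>" "hyp \<alpha> \<in> hyps_dep \<Omega>1 z" using zH \<alpha> by simp_all
  have "hyp \<alpha> \<in> W.I" by (rule hyp_in[OF z(2)])
  then have "droot l z (hyp \<alpha>) \<noteq> 0" using W.hyp_dlog(5)[of "hyp \<alpha>" z] z by (auto simp: hyps_dep_def)
  then have "pd \<alpha> z \<noteq> 0" using root_hyp(2)[OF z(2)] by simp
  then have "Dop \<Omega> l z * E \<alpha> \<noteq> 0"
    using commute_E(3)[OF z(2,1)] E_nonzero[OF z(2)] by (simp add: scl_eq_0_iff)
  then have "\<not> (\<forall>y. y \<noteq> l \<longrightarrow> Dop \<Omega> l y = 0)" using z(1) by auto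
  then have d: "\<forall>y. y \<noteq> l \<longrightarrow> (\<forall>H\<in>I. droot l y H = 0)" using const_cases by blast
  fix y assume y: "y \<noteq> l"
  then have "dT y = 0" using d by (auto simp: dT_def intro!: sum.neutral)
  then have "emb (mlin \<Omega>1 l y) = 0" using Dop1[OF y] by (simp add: Dop_def)
  then show "mlin \<Omega>1 l y = 0\<^sub>m (rk \<Omega>1) (rk \<Omega>1)"
    using W.carriers(2)[of l y] y by (intro emb_inj[of _ "rk \<Omega>1" "rk \<Omega>1"]) auto
qed

lemma rk1_pos: "rk \<Omega>1 \<ge> 1"
proof (rule ccontr)
  assume "\<not> ?thesis"
  then have "rk \<Omega>1 = 0" by simp
  then have "idn (rk \<Omega>1) = 0" by (intro linop_eqI ext) (simp add: app_idn)
  then have "Q = 0" using PQ_idn(3) by (metis mult_zero_left)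
  obtain \<alpha> where \<alpha>: "\<alpha> \<in> \<Lambda>" using ex_eigval by blast
  have "E \<alpha> * 1 = 0" by (rule Q_inj[OF \<alpha>]) (simp add: \<open>Q = 0\<close>)
  then show False using E_nonzero[OF \<alpha>] by simp
qed

lemma admissible1: "admissible \<Omega>1 l"
  unfolding admissible_def using W.form rk1_pos integrable1 cond_D1 cond_I1 by blast

text \<open>In fact no residue of the transform along a hyperplane depending on x vanishes: by
  cancelling \<open>Q\<close> and \<open>P\<close> the eigenprojection itself would be zero.\<close>

lemma nonexc1: "\<not> exceptional_dir \<Omega>1 l"
proof
  assume e: "exceptional_dir \<Omega>1 l"
  obtain \<alpha> where \<alpha>: "\<alpha> \<in> \<Lambda>" using ex_eigval by blast
  then have "hyp \<alpha> \<in> W.I" by (rule hyp_in)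
  then have "Aop \<Omega>1 (hyp \<alpha>) = 0" using e by (simp add: exceptional_dir_def Aop_def)
  then have "Q * E \<alpha> * P = 0" using A1[OF \<alpha>] by simp
  then have "1 * E \<alpha> * P = 0" using Q_inj[OF \<alpha>, of P] by simp
  then have "1 * E \<alpha> = 0" by (rule P_surj[OF \<alpha>])
  then show False using E_nonzero[OF \<alpha>] by simp
qed

lemma proj_kill:
  assumes H: "H \<in> I" and "app P (app (proj H) u) = 0"
  shows "app (proj H) u = 0"
proof -
  define X where "X = Abs_linop (\<lambda>f. fscale (f 0) (app (s H) u))"
  have X: "app X f = fscale (f 0) (app (s H) u)" for f
    unfolding X_def by (subst app_Abs_linear, unfold_locales) (auto simp: fun_eq_iff algebra_simps)
  have "app (A H) (app (s H) u) = 0" using assms(2) Pproj[OF H] by (metis app_times)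
  then have "A H * X = 0" by (intro linop_eqI) (simp add: X)
  from K_kill[OF H this] have "app (K H) (app X (delta 0)) = 0" by (metis app_0 app_times)
  moreover have "app X (delta 0) = app (s H) u" by (simp add: X delta_def)
  ultimately show ?thesis by (simp add: proj_def)
qed

text \<open>An invariant \<open>U\<close> of the transform gives \<open>V\<close>, the sum of the
  subspaces \<open>E \<alpha> * P\<close> applied to \<open>U\<close>. It is invariant for \<Omega>,
  since \<open>Q\<close> maps \<open>V\<close> into \<open>U\<close> and \<open>P\<close> maps
  \<open>U\<close> into \<open>V\<close>. If \<open>V\<close> is zero, then \<open>P\<close> kills
  every component \<open>proj H\<close> of \<open>U\<close>, which forces \<open>U\<close> to be
  zero; if \<open>V\<close> is everything, then \<open>U\<close> contains the ranges of all
  \<open>proj H\<close>.\<close>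

lemma irreducible1: "irreducible_dir \<Omega>1 l"
  unfolding W.irreducible_seq
proof (intro allI impI)
  fix U assume U: "invariant_seq \<Omega>1 l U"
  have subU: "fvs.subspace U" and fullU: "\<And>u. u \<in> U \<Longrightarrow> app (idn (rk \<Omega>1)) u = u"
    using U by (auto simp: invariant_seq_def full_def)
  have QEP: "app (Q * E \<alpha> * P) u \<in> U" if "\<alpha> \<in> \<Lambda>" "u \<in> U" for \<alpha> u
  proof -
    have "hyp \<alpha> \<in> W.I" by (rule hyp_in[OF that(1)])
    then have "app (Aop \<Omega>1 (hyp \<alpha>)) u \<in> U" using U that(2) by (simp add: invariant_seq_def)
    then have "- app (Q * E \<alpha> * P) u \<in> U" using A1[OF that(1)] by (metis app_uminus)
    then show ?thesis using fvs.subspace_neg[OF subU] by (metis minus_minus)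
  qed
  \<comment> \<open>At a point with distinct roots, invariance under \<open>T p\<close> alone
    already yields invariance under every \<open>proj H\<close>.\<close>
  obtain p where p: "inj_on (root_at l p) I" using eventually_happens'[OF genf_nontrivial generic_roots] by auto
  have TU: "app (\<Sum>H\<in>I. root_at l p H \<odot>\<^sub>C proj H) u \<in> U" if u: "u \<in> U" for u
  proof -
    have "app (Sop \<Omega>1 l p) u \<in> U"
      unfolding W.Sop_eq app_plus app_sum app_scl
      using U u by (intro fvs.subspace_add[OF subU] fvs.subspace_sum[OF subU] fvs.subspace_scale[OF subU])
        (auto simp: invariant_seq_def)
    then have "fscale (- \<epsilon>) (app (Sop \<Omega>1 l p) u) \<in> U" by (rule fvs.subspace_scale[OF subU])
    moreover have "T p = (- \<epsilon>) \<odot>\<^sub>C Sop \<Omega>1 l p" by (simp add: Sop1 eps)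
    ultimately show ?thesis unfolding T_def[symmetric] by (metis app_scl)
  qed
  have projU: "app (proj H) u \<in> U" if "H \<in> I" "u \<in> U" for H u
    using resolution_invariant[OF resolution_proj p subU TU fullU that] by blast
  define V where "V = {v. \<exists>w. (\<forall>\<alpha>\<in>\<Lambda>. w \<alpha> \<in> U) \<and> v = (\<Sum>\<alpha>\<in>\<Lambda>. app (E \<alpha> * P) (w \<alpha>))}"
  have VI: "(\<Sum>\<alpha>\<in>\<Lambda>. app (E \<alpha> * P) (w \<alpha>)) \<in> V" if "\<And>\<alpha>. \<alpha> \<in> \<Lambda> \<Longrightarrow> w \<alpha> \<in> U" for w
    unfolding V_def using that by blast
  have PV: "app P u \<in> V" if "u \<in> U" for u
  proof -
    have "app P u = app (idn N * P) u" by simp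
    also have "\<dots> = (\<Sum>\<alpha>\<in>\<Lambda>. app (E \<alpha> * P) u)"
      by (simp only: app_sum sum_distrib_right flip: resolution_sum[OF resolution_E])
    also have "\<dots> \<in> V" using VI[of "\<lambda>_. u"] that by blast
    finally show ?thesis .
  qed
  have subV: "fvs.subspace V"
    unfolding fvs.subspace_def
  proof (intro conjI ballI allI)
    show "0 \<in> V" using PV[OF fvs.subspace_0[OF subU]] by simp
    fix x y assume "x \<in> V" "y \<in> V"
    then obtain f g where "\<forall>\<alpha>\<in>\<Lambda>. f \<alpha> \<in> U" "x = (\<Sum>\<alpha>\<in>\<Lambda>. app (E \<alpha> * P) (f \<alpha>))"
      "\<forall>\<alpha>\<in>\<Lambda>. g \<alpha> \<in> U" "y = (\<Sum>\<alpha>\<in>\<Lambda>. app (E \<alpha> * P) (g \<alpha>))" unfolding V_def by blast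
    then show "x + y \<in> V"
      using VI[of "\<lambda>\<alpha>. f \<alpha> + g \<alpha>"] fvs.subspace_add[OF subU] by (simp add: sum.distrib)
  next
    fix c x assume "x \<in> V"
    then obtain f where f: "\<forall>\<alpha>\<in>\<Lambda>. f \<alpha> \<in> U" "x = (\<Sum>\<alpha>\<in>\<Lambda>. app (E \<alpha> * P) (f \<alpha>))" unfolding V_def by blast
    have "fscale c x = (\<Sum>\<alpha>\<in>\<Lambda>. app (E \<alpha> * P) (fscale c (f \<alpha>)))"
      unfolding f(2) fvs.scale_sum_right by simp
    then show "fscale c x \<in> V" using VI[of "\<lambda>\<alpha>. fscale c (f \<alpha>)"] f(1) fvs.subspace_scale[OF subU] by simp
  qed
  have scaleV: "app B v \<in> V" if v: "v \<in> V" and B: "\<And>\<alpha>. \<alpha> \<in> \<Lambda> \<Longrightarrow> B * E \<alpha> = c \<alpha> \<odot>\<^sub>C E \<alpha>" for B v c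
  proof -
    obtain f where f: "\<forall>\<alpha>\<in>\<Lambda>. f \<alpha> \<in> U" "v = (\<Sum>\<alpha>\<in>\<Lambda>. app (E \<alpha> * P) (f \<alpha>))" using v unfolding V_def by blast
    have "app B v = (\<Sum>\<alpha>\<in>\<Lambda>. app (E \<alpha> * P) (fscale (c \<alpha>) (f \<alpha>)))"
      unfolding f(2) app_sum_vec
    proof (intro sum.cong refl)
      fix \<alpha> assume "\<alpha> \<in> \<Lambda>"
      then have "app B (app (E \<alpha>) x) = fscale (c \<alpha>) (app (E \<alpha>) x)" for x using B by (metis app_scl app_times)
      then show "app B (app (E \<alpha> * P) (f \<alpha>)) = app (E \<alpha> * P) (fscale (c \<alpha>) (f \<alpha>))" by simp
    qed
    then show ?thesis using VI[of "\<lambda>\<alpha>. fscale (c \<alpha>) (f \<alpha>)"] f(1) fvs.subspace_scale[OF subU] by simp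
  qed
  have QV: "app Q v \<in> U" if v: "v \<in> V" for v
  proof -
    obtain f where f: "\<forall>\<alpha>\<in>\<Lambda>. f \<alpha> \<in> U" "v = (\<Sum>\<alpha>\<in>\<Lambda>. app (E \<alpha> * P) (f \<alpha>))" using v unfolding V_def by blast
    have eq: "app Q v = (\<Sum>\<alpha>\<in>\<Lambda>. app (Q * E \<alpha> * P) (f \<alpha>))" unfolding f(2) app_sum_vec by simp
    show ?thesis unfolding eq by (intro fvs.subspace_sum[OF subU] QEP) (use f(1) in auto)
  qed
  have "invariant_seq \<Omega> l V"
    unfolding invariant_seq_def
  proof (intro conjI ballI allI impI)
    show "fvs.subspace V" by (rule subV)
    show "V \<subseteq> full N"
    proof
      fix v assume v: "v \<in> V"
      have "app (idn N) v = v"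
      proof -
        obtain f where "v = (\<Sum>\<alpha>\<in>\<Lambda>. app (E \<alpha> * P) (f \<alpha>))" using v unfolding V_def by blast
        moreover have "app (idn N) (app (E \<alpha> * P) (f \<alpha>)) = app (E \<alpha> * P) (f \<alpha>)" if "\<alpha> \<in> \<Lambda>" for \<alpha>
          using idn_E(1)[OF that] by (metis app_times)
        ultimately show ?thesis by (simp add: app_sum_vec del: app_times)
      qed
      then show "v \<in> full N" by (simp add: full_def)
    qed
    fix v assume v: "v \<in> V"
    show "app (emb (mconst \<Omega> l)) v \<in> V" by (rule scaleV[OF v commute_E(1)])
    show "app (Dop \<Omega> l j) v \<in> V" if "j \<noteq> l" for j by (rule scaleV[OF v commute_E(3)[OF _ that]])
    show "app (A H) v \<in> V" if "H \<in> I" for H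
      unfolding A_via_proj[OF that] using PV[OF projU[OF that QV[OF v]]] by simp
  qed
  then consider "V = {0}" | "V = full N" using irredD by blast
  then show "U = {0} \<or> U = full (rk \<Omega>1)"
  proof cases
    case 1
    have "u = 0" if u: "u \<in> U" for u
    proof -
      have "app (proj H) u = 0" if H: "H \<in> I" for H
        using PV[OF projU[OF H u]] 1 by (intro proj_kill[OF H]) auto
      then have "app (\<Sum>H\<in>I. proj H) u = 0" by (simp add: app_sum)
      then show ?thesis using fullU[OF u] resolution_sum[OF resolution_proj] by simp
    qed
    then show ?thesis using fvs.subspace_0[OF subU] by blast
  next
    case 2
    have "x \<in> U" if x: "x \<in> full (rk \<Omega>1)" for x
    proof -
      have "app (K H) (app (s H) x) \<in> U" if H: "H \<in> I" for H
      proof -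
        have "app (s H) x \<in> V" unfolding 2 full_def using K_idn(3)[OF H] by (simp flip: app_times)
        then have "app (proj H) (app Q (app (s H) x)) \<in> U" using projU[OF H QV] by blast
        then show ?thesis using projQ[OF H] by (metis app_times)
      qed
      then have "(\<Sum>H\<in>I. app (K H) (app (s H) x)) \<in> U" by (intro fvs.subspace_sum[OF subU])
      moreover have "(\<Sum>H\<in>I. app (K H) (app (s H) x)) = app (idn (rk \<Omega>1)) x"
        unfolding sum_Ks[symmetric] app_sum by simp
      ultimately show ?thesis using x by (simp add: full_def)
    qed
    then show ?thesis using fullU by (auto simp: full_def)
  qed
qed

end

section \<open>The double transform\<close>

text \<open>Equality of the ranks is not presupposed; it follows from the two-sided inverse. The
  conjugating matrix in the conclusion is \<open>Z\<close>, with inverse \<open>Y\<close>.\<close>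

lemma form_sim_of_intertwiner:
  assumes f: "pfaff_form \<Omega>" "pfaff_form \<Omega>2"
    and YZ: "Y * Z = idn (rk \<Omega>)" "Z * Y = idn (rk \<Omega>2)"
    and Y: "idn (rk \<Omega>) * Y = Y" "Y * idn (rk \<Omega>2) = Y"
    and Z: "idn (rk \<Omega>2) * Z = Z" "Z * idn (rk \<Omega>) = Z"
    and F: "\<And>i. \<forall>\<^sub>F p in genf. Y * Fop \<Omega>2 i p = Fop \<Omega> i p * Y"
  shows "form_sim \<Omega>2 \<Omega>"
proof -
  let ?N = "rk \<Omega>" and ?Y = "unemb (rk \<Omega>) (rk \<Omega>2) Y" and ?Z = "unemb (rk \<Omega>2) (rk \<Omega>) Z"
  interpret V: pfaff_dir \<Omega> undefined by unfold_locales (rule f)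
  interpret V2: pfaff_dir \<Omega>2 undefined by unfold_locales (rule f)
  have N: "rk \<Omega>2 = ?N"
    using idn_le_of_left_inverse[OF YZ(1) Z(1)] idn_le_of_left_inverse[OF YZ(2) Y(1)] by simp
  have e: "emb ?Y = Y" "emb ?Z = Z" using Y Z by (simp_all add: emb_unemb)
  have c: "?Y \<in> carrier_mat ?N ?N" "?Z \<in> carrier_mat ?N ?N" using N by simp_all
  have "emb (?Z * ?Y) = idn ?N" "emb (?Y * ?Z) = idn ?N"
    unfolding emb_mult[OF unemb_carrier unemb_carrier] e using YZ N by simp_all
  then have ZY: "?Z * ?Y = 1\<^sub>m ?N" "?Y * ?Z = 1\<^sub>m ?N"
    using emb_inj[OF mult_carrier_mat[OF c(2,1)] one_carrier_mat] emb_inj[OF mult_carrier_mat[OF c] one_carrier_mat]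
    by simp_all
  have "generically (\<lambda>p. form_coeff \<Omega> i p = ?Y * form_coeff \<Omega>2 i p * ?Z)" for i
    unfolding eventually_genf[symmetric]
    using F[of i]
  proof eventually_elim
    case (elim p)
    have fc: "form_coeff \<Omega> i p \<in> carrier_mat ?N ?N" "form_coeff \<Omega>2 i p \<in> carrier_mat ?N ?N"
      using V.carriers(5) V2.carriers(5) N by auto
    have "emb (?Y * form_coeff \<Omega>2 i p * ?Z) = Y * Fop \<Omega>2 i p * Z"
      using c fc e by (simp add: emb_mult[of _ ?N ?N _ ?N] mult_carrier_mat[of _ ?N ?N] Fop_def mult.assoc)
    also have "\<dots> = Fop \<Omega> i p * (Y * Z)" unfolding elim by (simp add: mult.assoc)
    also have "\<dots> = Fop \<Omega> i p" by (simp add: YZ)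
    finally have "emb (form_coeff \<Omega> i p) = emb (?Y * form_coeff \<Omega>2 i p * ?Z)" by (simp add: Fop_def)
    then show ?case using c fc by (intro emb_inj[of _ ?N ?N]) (auto intro!: mult_carrier_mat[of _ ?N ?N])
  qed
  then show ?thesis
    unfolding form_sim_def N using ZY by (intro conjI refl bexI[OF bexI[OF _ c(1)] c(2)]) (auto simp: N)
qed

locale double_dual = D1: middle_dual \<Omega> l \<Omega>1 K s \<epsilon> + D2: middle_dual \<Omega>1 l \<Omega>2 K2 s2 "- \<epsilon>"
  for \<Omega> :: "'n::finite pfaff" and l \<Omega>1 K s \<epsilon> \<Omega>2 K2 s2
begin

abbreviation "k \<alpha> \<equiv> K2 (D1.hyp \<alpha>)"
abbreviation "t \<alpha> \<equiv> s2 (D1.hyp \<alpha>)"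
abbreviation "V \<equiv> idn (rk \<Omega>)"

text \<open>The second quotient is C^N again. The residues of the transform are
  \<open>- Q * E \<alpha> * P\<close>, and \<open>Q\<close> is injective on the eigenspaces, so the
  quotient by their kernels is the sum of the ranges of \<open>E \<alpha> * P\<close>.
  \<open>Y\<close> is this identification: the class of \<open>w\<close> in the block of \<alpha>
  goes to \<open>E \<alpha> * P\<close> applied to \<open>w\<close>.\<close>

definition "Y = (\<Sum>\<alpha>\<in>D1.\<Lambda>. D1.E \<alpha> * D1.P * t \<alpha>)"

lemma EPtk:
  assumes "\<alpha> \<in> D1.\<Lambda>" "\<beta> \<in> D1.\<Lambda>"
  shows "D1.E \<alpha> * D1.P * t \<alpha> * k \<beta> = (if \<alpha> = \<beta> then D1.E \<alpha> * D1.P else 0)"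
proof -
  have "Aop \<Omega>1 (D1.hyp \<alpha>) * t \<alpha> * k \<beta> = (if \<alpha> = \<beta> then Aop \<Omega>1 (D1.hyp \<alpha>) else 0)"
    using D2.AsK[OF D1.hyp_in[OF assms(1)] D1.hyp_in[OF assms(2)]] D1.inj_hyp assms by (auto simp: inj_on_def)
  then have "D1.Q * D1.E \<alpha> * (D1.P * (t \<alpha> * k \<beta> - (if \<alpha> = \<beta> then idn (rk \<Omega>1) else 0))) = 0"
    using D1.A1[OF assms(1)] by (auto simp: right_diff_distrib mult.assoc split: if_splits)
  from D1.Q_inj[OF assms(1) this] show ?thesis
    by (auto simp: right_diff_distrib mult.assoc split: if_splits)
qed

lemma Yk: "\<beta> \<in> D1.\<Lambda> \<Longrightarrow> Y * k \<beta> = D1.E \<beta> * D1.P"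
  by (simp add: Y_def sum_distrib_right EPtk if_distrib cong: sum.cong if_cong)

lemma Y_idn: "V * Y = Y" "Y * idn (rk \<Omega>2) = Y"
  unfolding Y_def by (simp_all add: sum_distrib_left sum_distrib_right mult.assoc mult_rewrite[OF D1.idn_E(1)]
      D2.K_idn(4)[OF D1.hyp_in] cong: sum.cong)

lemma eq_on_k:
  assumes "X * idn (rk \<Omega>2) = X" "Z * idn (rk \<Omega>2) = Z" "\<And>\<beta>. \<beta> \<in> D1.\<Lambda> \<Longrightarrow> X * k \<beta> = Z * k \<beta>"
  shows "X = Z"
proof (rule D2.eq_on_K[OF assms(1,2)])
  fix H assume "H \<in> hyps_dep \<Omega>1 l"
  then obtain \<beta> where "\<beta> \<in> D1.\<Lambda>" "H = D1.hyp \<beta>" unfolding D1.hyps1' by blast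
  then show "X * K2 H = Z * K2 H" using assms(3) by simp
qed

text \<open>Together with \<open>YQ\<close>, \<open>YT\<close> and \<open>YdT\<close> this
  identifies the data of the second dual: under \<open>Y\<close> they are \<open>P\<close>,
  \<open>Q\<close> and \<open>S\<close> again, up to the sign of \<open>Q\<close> here and the
  factor \<epsilon> for \<open>S\<close>.\<close>

lemma QY: "D1.Q * Y = - D2.P"
proof (rule eq_on_k)
  fix \<beta> assume \<beta>: "\<beta> \<in> D1.\<Lambda>"
  show "D1.Q * Y * k \<beta> = - D2.P * k \<beta>"
    using D2.PK[OF D1.hyp_in[OF \<beta>]] D1.A1[OF \<beta>] by (simp add: mult.assoc Yk[OF \<beta>])
qed (simp_all add: mult.assoc Y_idn)

lemma YQ: "Y * D2.Q = D1.P"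
proof -
  have "Y * D2.Q = (\<Sum>\<beta>\<in>D1.\<Lambda>. Y * k \<beta>)" unfolding D2.Q_def D1.sum_hyp by (simp add: sum_distrib_left)
  also have "\<dots> = (\<Sum>\<beta>\<in>D1.\<Lambda>. D1.E \<beta>) * D1.P" by (simp add: Yk sum_distrib_right cong: sum.cong)
  finally show ?thesis by (simp add: resolution_sum[OF D1.resolution_E])
qed

lemma YT: "Y * D2.T p = \<epsilon> \<odot>\<^sub>C (Sop \<Omega> l p * Y)"
proof (rule eq_on_k)
  fix \<beta> assume \<beta>: "\<beta> \<in> D1.\<Lambda>"
  have YTk: "Y * D2.T p * k \<beta> = (\<epsilon> * aff_eval \<beta> p) \<odot>\<^sub>C (D1.E \<beta> * D1.P)"
    using D2.TK(1)[OF D1.hyp_in[OF \<beta>], of p] by (simp add: mult.assoc Yk[OF \<beta>] D1.root_hyp[OF \<beta>])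
  have S: "Sop \<Omega> l p * D1.E \<beta> = aff_eval \<beta> p \<odot>\<^sub>C D1.E \<beta>"
    unfolding D1.Sop_E by (rule resolution_lin_mult(1)[OF D1.resolution_E \<beta>])
  then show "Y * D2.T p * k \<beta> = (\<epsilon> \<odot>\<^sub>C (Sop \<Omega> l p * Y)) * k \<beta>"
    using YTk by (simp add: mult.assoc Yk[OF \<beta>] mult_rewrite[OF S])
qed (simp_all add: mult.assoc Y_idn)

lemma YdT:
  assumes y: "y \<noteq> l" shows "Y * D2.dT y = \<epsilon> \<odot>\<^sub>C (Dop \<Omega> l y * Y)"
proof (rule eq_on_k)
  fix \<beta> assume \<beta>: "\<beta> \<in> D1.\<Lambda>"
  have "Y * D2.dT y * k \<beta> = (\<epsilon> * pd \<beta> y) \<odot>\<^sub>C (D1.E \<beta> * D1.P)"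
    using D2.TK(2)[OF D1.hyp_in[OF \<beta>], of y] by (simp add: mult.assoc Yk[OF \<beta>] D1.root_hyp[OF \<beta>])
  then show "Y * D2.dT y * k \<beta> = (\<epsilon> \<odot>\<^sub>C (Dop \<Omega> l y * Y)) * k \<beta>"
    by (simp add: mult.assoc Yk[OF \<beta>] mult_rewrite[OF D1.commute_E(3)[OF \<beta> y]])
qed (simp_all add: mult.assoc Y_idn)

text \<open>Generalised inverses \<open>G \<alpha>\<close> of \<open>E \<alpha> * P\<close> give the
  candidate inverse. \<open>P_surj\<close> makes \<open>G \<alpha>\<close> a right inverse on the
  eigenspace, and on the other side the kernel property of the second quotient map removes the
  ambiguity of \<open>G \<alpha>\<close>.\<close>

lemma Y_inverse: "\<exists>Z. Y * Z = V \<and> Z * Y = idn (rk \<Omega>2) \<and> idn (rk \<Omega>2) * Z = Z \<and> Z * V = Z"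
proof -
  have "\<forall>\<alpha>. \<exists>G. D1.E \<alpha> * D1.P * G * (D1.E \<alpha> * D1.P) = D1.E \<alpha> * D1.P"
    using linop_g_inverse by metis
  then obtain G where G: "\<And>\<alpha>. D1.E \<alpha> * D1.P * G \<alpha> * (D1.E \<alpha> * D1.P) = D1.E \<alpha> * D1.P" by metis
  have EPG: "D1.E \<alpha> * D1.P * G \<alpha> * D1.E \<alpha> = D1.E \<alpha>" if \<alpha>: "\<alpha> \<in> D1.\<Lambda>" for \<alpha>
  proof -
    let ?C = "V - D1.E \<alpha> * D1.P * G \<alpha>"
    have "?C * D1.E \<alpha> * D1.P = 0"
      using G[of \<alpha>] D1.idn_E(1)[OF \<alpha>] by (simp add: left_diff_distrib mult.assoc mult_rewrite[OF D1.idn_E(1)[OF \<alpha>]])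
    from D1.P_surj[OF \<alpha> this] show ?thesis
      using D1.idn_E(1)[OF \<alpha>] by (simp add: left_diff_distrib)
  qed
  define Z where "Z = (\<Sum>\<alpha>\<in>D1.\<Lambda>. k \<alpha> * G \<alpha> * D1.E \<alpha>)"
  have "Y * Z = (\<Sum>\<alpha>\<in>D1.\<Lambda>. Y * k \<alpha> * G \<alpha> * D1.E \<alpha>)" by (simp add: Z_def sum_distrib_left mult.assoc)
  also have "\<dots> = V" by (simp add: Yk EPG resolution_sum[OF D1.resolution_E] cong: sum.cong)
  finally have YZ: "Y * Z = V" .
  have Zid: "idn (rk \<Omega>2) * Z = Z" "Z * V = Z"
    unfolding Z_def by (simp_all add: sum_distrib_left sum_distrib_right mult.assoc
        mult_rewrite[OF D2.K_idn(1)[OF D1.hyp_in]] cong: sum.cong)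
  have "Z * Y = idn (rk \<Omega>2)"
  proof (rule eq_on_k)
    fix \<beta> assume \<beta>: "\<beta> \<in> D1.\<Lambda>"
    have "Z * D1.E \<beta> = k \<beta> * G \<beta> * D1.E \<beta>"
    proof -
      have "Z * D1.E \<beta> = (\<Sum>\<alpha>\<in>D1.\<Lambda>. if \<alpha> = \<beta> then k \<beta> * G \<beta> * D1.E \<beta> else 0)"
        unfolding Z_def sum_distrib_right using resolution_mult[OF D1.resolution_E _ \<beta>]
        by (intro sum.cong refl) (auto simp: mult.assoc)
      then show ?thesis using \<beta> by simp
    qed
    then have ZYk: "Z * Y * k \<beta> = k \<beta> * G \<beta> * (D1.E \<beta> * D1.P)" by (simp add: mult.assoc Yk[OF \<beta>]) (metis mult.assoc)
    have "Aop \<Omega>1 (D1.hyp \<beta>) * (G \<beta> * (D1.E \<beta> * D1.P) - idn (rk \<Omega>1)) = 0"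
      using G[of \<beta>] by (simp add: D1.A1[OF \<beta>] right_diff_distrib mult.assoc)
    from D2.K_kill[OF D1.hyp_in[OF \<beta>] this]
    show "Z * Y * k \<beta> = idn (rk \<Omega>2) * k \<beta>"
      unfolding ZYk using D2.K_idn(1,2)[OF D1.hyp_in[OF \<beta>]] by (simp add: right_diff_distrib mult.assoc)
  qed (simp_all add: mult.assoc Y_idn)
  then show ?thesis using YZ Zid by blast
qed

text \<open>S_x of the transform is \<open>- \<epsilon> T\<close>, so its resolvent with parameter
  \<open>- \<epsilon>\<close> is a right inverse of \<open>x - T\<close>. The right-hand side is a
  left inverse, hence the two coincide. In this way the poles of \<Omega> at the roots
  reappear.\<close>

lemma resolvent1:
  assumes p: "\<forall>\<beta>\<in>D2.\<Lambda>. p l \<noteq> - \<epsilon> * aff_eval \<beta> p" "\<forall>H\<in>D1.I. p l \<noteq> root_at l p H"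
  shows "resolvent (- \<epsilon>) \<Omega>1 l p = (\<Sum>H\<in>D1.I. (1 / (p l - root_at l p H)) \<odot>\<^sub>C D1.proj H)"
proof -
  let ?G = "resolvent (- \<epsilon>) \<Omega>1 l p" and ?F = "\<Sum>H\<in>D1.I. (1 / (p l - root_at l p H)) \<odot>\<^sub>C D1.proj H"
  have G: "p l \<odot>\<^sub>C ?G - D1.T p * ?G = idn (rk \<Omega>1)"
    using D2.resolvent_inverse(1)[OF p(1)] by (simp add: D1.Sop1 D1.eps)
  have "?F * D1.T p = (\<Sum>H\<in>D1.I. (root_at l p H / (p l - root_at l p H)) \<odot>\<^sub>C D1.proj H)"
    unfolding D1.T_def resolution_mult_lin[OF D1.resolution_proj] by simp
  then have "p l \<odot>\<^sub>C ?F - ?F * D1.T p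
      = (\<Sum>H\<in>D1.I. (p l / (p l - root_at l p H) - root_at l p H / (p l - root_at l p H)) \<odot>\<^sub>C D1.proj H)"
    by (simp add: scl_sum_right scl_distrib sum_subtractf)
  also have "\<dots> = (\<Sum>H\<in>D1.I. D1.proj H)"
    using p(2) by (intro sum.cong refl) (simp flip: diff_divide_distrib)
  finally have G0: "p l \<odot>\<^sub>C ?F - ?F * D1.T p = idn (rk \<Omega>1)" by (simp add: resolution_sum[OF D1.resolution_proj])
  have "?F = ?F * idn (rk \<Omega>1)"
    by (simp add: sum_distrib_right resolution_unit[OF D1.resolution_proj] cong: sum.cong)
  also have "\<dots> = (p l \<odot>\<^sub>C ?F - ?F * D1.T p) * ?G"
    unfolding G[symmetric] by (simp only: right_diff_distrib left_diff_distrib scl_simps mult.assoc)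
  also have "\<dots> = ?G" unfolding G0 by simp
  finally show ?thesis by simp
qed

lemma Fop2_l: "\<forall>\<^sub>F p in genf. Y * Fop \<Omega>2 l p = Fop \<Omega> l p * Y"
  using D2.Fop1[of l] D2.generic_resolvent[OF D2.eps] D1.generic_off
proof eventually_elim
  case (elim p)
  let ?G = "resolvent (- \<epsilon>) \<Omega>1 l p"
  have "Y * Fop \<Omega>2 l p = \<epsilon> \<odot>\<^sub>C (Y * D2.T p) - Y * D2.Q * ?G * D2.P"
    unfolding elim(1) D2.Mw_l by (simp add: right_diff_distrib mult.assoc)
  also have "\<dots> = (Sop \<Omega> l p + D1.P * ?G * D1.Q) * Y"
    unfolding YT YQ using QY by (simp add: D1.eps distrib_right mult.assoc)
  also have "D1.P * ?G * D1.Q = (\<Sum>H\<in>D1.I. (1 / (p l - root_at l p H)) \<odot>\<^sub>C D1.A H)"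
    unfolding resolvent1[OF elim(2,3)] D1.PQ(2) ..
  finally show ?case unfolding D1.Fop_x .
qed

text \<open>Let \<open>X\<close> be the discrepancy. The relations of both dualities give
  \<open>S * X = \<epsilon> \<odot>\<^sub>C (X * T2)\<close> and \<open>X * Q2 = 0\<close>, where
  \<open>T2\<close> and \<open>Q2\<close> belong to the second dual. Moved to C^N by
  \<open>Z\<close>, the discrepancy commutes with \<open>S\<close> and kills \<open>P\<close>, hence
  is zero on each eigenspace by \<open>P_surj\<close>.\<close>

lemma Rd2:
  assumes y: "y \<noteq> l"
  shows "\<forall>\<^sub>F p in genf. Y * D2.Rd y p = Rop \<Omega> l y p * Y"
proof -
  obtain Z where Z: "Y * Z = V" "Z * Y = idn (rk \<Omega>2)" "idn (rk \<Omega>2) * Z = Z" "Z * V = Z"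
    using Y_inverse by blast
  have inj: "\<forall>\<^sub>F p in genf. inj_on (\<lambda>\<alpha>. aff_eval \<alpha> p) D1.\<Lambda>"
    using eventually_inj_on_aff[OF D1.finite_eigvals, of "\<lambda>\<alpha>. \<alpha>"] by simp
  show ?thesis
    using D1.dual_relations[OF y] D2.dual_relations[OF y] D1.Rop1[OF y] inj
  proof eventually_elim
    case (elim p)
    let ?R = "Rop \<Omega> l y p" and ?S = "Sop \<Omega> l p" and ?S' = "Dop \<Omega> l y" and ?R2 = "D2.Rd y p" and ?T2 = "D2.T p"
    have r2: "D1.P * D1.Rd y p = ?R * D1.P + ?S' * D1.P * D1.T p + ?S * D1.P * D1.dT y"
      and r4: "?S * ?R - ?R * ?S = ?S' * D1.P * D1.Q - D1.P * D1.Q * ?S'"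
      using elim(1) by blast+
    have q1: "?R2 * D2.Q = D2.Q * Rop \<Omega>1 l y p + ?T2 * D2.Q * Dop \<Omega>1 l y + D2.dT y * D2.Q * Sop \<Omega>1 l p"
      and q3: "?T2 * ?R2 - ?R2 * ?T2 = D2.Q * D2.P * D2.dT y - D2.dT y * D2.Q * D2.P"
      using elim(2) by blast+
    define X where "X = Y * ?R2 - ?R * Y"
    have SY: "?S * Y = \<epsilon> \<odot>\<^sub>C (Y * ?T2)" "?S' * Y = \<epsilon> \<odot>\<^sub>C (Y * D2.dT y)"
      unfolding YT YdT[OF y] by (simp_all add: D1.eps)
    have "?S * X - \<epsilon> \<odot>\<^sub>C (X * ?T2) = (?S * Y) * ?R2 - \<epsilon> \<odot>\<^sub>C (Y * ?R2 * ?T2) - (?S * ?R * Y - ?R * (\<epsilon> \<odot>\<^sub>C (Y * ?T2)))"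
      by (simp add: X_def left_diff_distrib right_diff_distrib scl_distrib mult.assoc)
    also have "\<dots> = \<epsilon> \<odot>\<^sub>C (Y * (?T2 * ?R2 - ?R2 * ?T2)) - (?S * ?R - ?R * ?S) * Y"
      unfolding SY[symmetric] by (simp add: left_diff_distrib right_diff_distrib scl_distrib mult.assoc SY)
    also have "\<epsilon> \<odot>\<^sub>C (Y * (?T2 * ?R2 - ?R2 * ?T2))
        = \<epsilon> \<odot>\<^sub>C ((Y * D2.Q) * (D2.P * D2.dT y) - (Y * D2.dT y) * (D2.Q * D2.P))"
      unfolding q3 by (simp add: right_diff_distrib mult.assoc)
    also have "D2.P * D2.dT y = - (D1.Q * (\<epsilon> \<odot>\<^sub>C (?S' * Y)))"
      using QY YdT[OF y] by (metis minus_minus mult.assoc mult_minus_left)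
    also have "(Y * D2.dT y) * (D2.Q * D2.P) = \<epsilon> \<odot>\<^sub>C (?S' * (Y * D2.Q) * D2.P)"
      unfolding YdT[OF y] by (simp add: mult.assoc)
    also have "\<epsilon> \<odot>\<^sub>C ((Y * D2.Q) * - (D1.Q * (\<epsilon> \<odot>\<^sub>C (?S' * Y))) - \<epsilon> \<odot>\<^sub>C (?S' * (Y * D2.Q) * D2.P))
        = (?S' * D1.P * D1.Q - D1.P * D1.Q * ?S') * Y"
    proof -
      have "D2.P = - (D1.Q * Y)" using QY by simp
      then show ?thesis
        unfolding YQ using D1.eps by (simp add: left_diff_distrib right_diff_distrib scl_distrib mult.assoc)
    qed
    finally have SX: "?S * X = \<epsilon> \<odot>\<^sub>C (X * ?T2)" unfolding r4 by simp
    have XQ: "X * D2.Q = 0"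
    proof -
      have "Y * (?R2 * D2.Q) = (Y * D2.Q) * D1.Rd y p - \<epsilon> \<odot>\<^sub>C ((Y * ?T2) * D2.Q * D1.dT y) - \<epsilon> \<odot>\<^sub>C ((Y * D2.dT y) * D2.Q * D1.T p)"
        unfolding q1 D1.Dop1[OF y] D1.Sop1 elim(3) by (simp add: distrib_left right_diff_distrib mult.assoc)
      also have "\<dots> = D1.P * D1.Rd y p - ?S * D1.P * D1.dT y - ?S' * D1.P * D1.T p"
        unfolding YT YdT[OF y] YQ by (simp add: mult.assoc YQ D1.eps)
      also have "\<dots> = ?R * (Y * D2.Q)" unfolding r2 YQ by simp
      finally show ?thesis by (simp add: X_def left_diff_distrib mult.assoc)
    qed
    let ?D = "X * Z"
    have Dc: "?S * ?D = ?D * ?S"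
    proof -
      have "Z * ?S = Z * (?S * Y) * Z" by (simp add: mult.assoc Z)
      also have "\<dots> = \<epsilon> \<odot>\<^sub>C ((Z * Y) * ?T2 * Z)" unfolding SY by (simp add: mult.assoc)
      finally have "Z * ?S = \<epsilon> \<odot>\<^sub>C (?T2 * Z)" by (simp add: Z)
      then have "?D * ?S = \<epsilon> \<odot>\<^sub>C (X * ?T2) * Z" by (simp add: mult.assoc)
      then show ?thesis using SX by (metis mult.assoc)
    qed
    have DP: "?D * D1.P = 0"
    proof -
      have "?D * D1.P = X * (Z * Y) * D2.Q" unfolding YQ[symmetric] by (simp add: mult.assoc)
      also have "\<dots> = X * D2.Q" by (simp add: Z mult.assoc)
      finally show ?thesis using XQ by simp
    qed
    have Did: "V * ?D = ?D" "?D * V = ?D"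
      using y by (simp_all add: X_def left_diff_distrib right_diff_distrib mult.assoc Z mult_rewrite[OF Y_idn(1)] mult_rewrite[OF D1.idn_Rop(1)])
    have "?D * D1.E \<alpha> = 0" if \<alpha>: "\<alpha> \<in> D1.\<Lambda>" for \<alpha>
    proof (rule D1.P_surj[OF \<alpha>])
      have "D1.E \<alpha> * ?D = ?D * D1.E \<alpha>"
        by (rule resolution_commute[OF D1.resolution_E Did elim(4) _ \<alpha>]) (simp add: Dc D1.Sop_E[symmetric])
      then have "?D * D1.E \<alpha> * D1.P = D1.E \<alpha> * (?D * D1.P)" by (metis mult.assoc)
      then show "?D * D1.E \<alpha> * D1.P = 0" unfolding DP by simp
    qed
    then have "?D * (\<Sum>\<alpha>\<in>D1.\<Lambda>. D1.E \<alpha>) = 0" by (simp add: sum_distrib_left)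
    then have "?D = 0" unfolding resolution_sum[OF D1.resolution_E] Did .
    then have "X * (Z * Y) = 0" by (metis mult.assoc mult_zero_left)
    then have "X * idn (rk \<Omega>2) = 0" by (simp add: Z)
    then have "X = 0" by (simp add: X_def left_diff_distrib mult.assoc Y_idn)
    then show ?case by (simp add: X_def)
  qed
qed

lemma Fop2_y:
  assumes y: "y \<noteq> l"
  shows "\<forall>\<^sub>F p in genf. Y * Fop \<Omega>2 y p = Fop \<Omega> y p * Y"
  using D2.Fop1[of y] D2.generic_resolvent[OF D2.eps] D1.generic_off Rd2[OF y]
proof eventually_elim
  case (elim p)
  let ?G = "resolvent (- \<epsilon>) \<Omega>1 l p"
  have "Y * Fop \<Omega>2 y p = Y * D2.Rd y p + (\<epsilon> * p l) \<odot>\<^sub>C (Y * D2.dT y) + (\<epsilon> * \<epsilon>) \<odot>\<^sub>C ((Y * D2.Q) * D1.dT y * ?G * D2.P)"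
    unfolding elim(1) D2.Mw_y[OF y] D1.Dop1[OF y] by (simp add: distrib_left mult.assoc)
  also have "\<dots> = Rop \<Omega> l y p * Y + p l \<odot>\<^sub>C (Dop \<Omega> l y * Y) - D1.P * (D1.dT y * ?G) * D1.Q * Y"
  proof -
    have "D2.P = - (D1.Q * Y)" using QY by simp
    moreover have e: "\<epsilon> * (p l * \<epsilon>) = p l" using D1.eps by (simp add: mult.left_commute)
    ultimately show ?thesis
      unfolding elim(4) YdT[OF y] YQ using D1.eps by (simp add: mult.assoc e)
  qed
  also have "D1.dT y * ?G = (\<Sum>H\<in>D1.I. (droot l y H / (p l - root_at l p H)) \<odot>\<^sub>C D1.proj H)"
    unfolding resolvent1[OF elim(2,3)] D1.dT_def resolution_mult_lin[OF D1.resolution_proj] by simp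
  finally show ?case
    unfolding D1.Fop_y[OF y] D1.PQ(2) by (simp add: distrib_right left_diff_distrib)
qed

lemma form_sim2: "form_sim \<Omega>2 \<Omega>"
proof -
  obtain Z where Z: "Y * Z = V" "Z * Y = idn (rk \<Omega>2)" "idn (rk \<Omega>2) * Z = Z" "Z * V = Z"
    using Y_inverse by blast
  show ?thesis
  proof (rule form_sim_of_intertwiner[OF D1.form D2.W.form Z(1,2) Y_idn Z(3,4)])
    show "\<forall>\<^sub>F p in genf. Y * Fop \<Omega>2 i p = Fop \<Omega> i p * Y" for i
      using Fop2_l Fop2_y by (cases "i = l") auto
  qed
qed

end

section \<open>Existence of the middle Laplace transform\<close>

lemma defpoly_zero_set:
  assumes "\<exists>i. pd f i \<noteq> 0"
  shows "defines_hyperplane f {p. aff_eval f p = 0}"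
  using assms by (simp add: defines_hyperplane_def)

text \<open>Different members of the family may have the same zero set, and such coincidences cannot
  be excluded for the transform. Their contributions are added up in the residue, which is
  consistent because d log does not depend on the defining polynomial.\<close>

lemma pfaff_of_family:
  fixes g :: "'s \<Rightarrow> 'n::finite aff" and Z :: "'s \<Rightarrow> linop" and B0 :: "'n \<Rightarrow> linop" and B1 :: "'n \<Rightarrow> 'n \<Rightarrow> linop"
  assumes fin: "finite J" and g: "\<And>j. j \<in> J \<Longrightarrow> \<exists>i. pd (g j) i \<noteq> 0"
    and Z: "\<And>j. j \<in> J \<Longrightarrow> idn m * Z j * idn m = Z j"
    and B0: "\<And>y. idn m * B0 y * idn m = B0 y" and B1: "\<And>y z. y \<noteq> z \<Longrightarrow> idn m * B1 y z * idn m = B1 y z"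
    and sym: "\<And>y z. y \<noteq> z \<Longrightarrow> B1 y z = B1 z y"
  shows "\<exists>\<Omega>1. pfaff_form \<Omega>1 \<and> rk \<Omega>1 = m \<and> (\<forall>l. hyps_dep \<Omega>1 l = (\<lambda>j. {p. aff_eval (g j) p = 0}) ` {j\<in>J. pd (g j) l \<noteq> 0}) \<and>
    (\<forall>y p. Fop \<Omega>1 y p = B0 y + (\<Sum>z\<in>UNIV - {y}. p z \<odot>\<^sub>C B1 y z)
       + (\<Sum>j\<in>J. (pd (g j) y / aff_eval (g j) p) \<odot>\<^sub>C Z j))"
proof -
  define h where "h j = {p. aff_eval (g j) p = 0}" for j
  define \<Omega>1 :: "'n pfaff" where "\<Omega>1 = \<lparr>rk = m, mconst = \<lambda>y. unemb m m (B0 y), mlin = \<lambda>y z. unemb m m (B1 y z),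
    hyps = h ` J, res = \<lambda>H. unemb m m (\<Sum>j\<in>{j\<in>J. h j = H}. Z j)\<rparr>"
  have def_h: "defines_hyperplane (g j) (h j)" if "j \<in> J" for j
    unfolding h_def by (rule defpoly_zero_set[OF g[OF that]])
  have form: "pfaff_form \<Omega>1"
    unfolding pfaff_form_def arrangement_def using fin def_h sym by (auto simp: \<Omega>1_def)
  interpret W: pfaff_dir \<Omega>1 undefined by unfold_locales (rule form)
  have "hyps_dep \<Omega>1 l = h ` {j\<in>J. pd (g j) l \<noteq> 0}" for l
    using defpoly_dlog(2)[OF def_h] by (auto simp: hyps_dep_def \<Omega>1_def)
  moreover have "Fop \<Omega>1 y p = B0 y + (\<Sum>z\<in>UNIV - {y}. p z \<odot>\<^sub>C B1 y z)
       + (\<Sum>j\<in>J. (pd (g j) y / aff_eval (g j) p) \<odot>\<^sub>C Z j)" for y p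
  proof -
    have "emb (mconst \<Omega>1 y) = B0 y" by (simp add: \<Omega>1_def emb_unemb B0)
    moreover have "(\<Sum>z\<in>UNIV - {y}. p z \<odot>\<^sub>C emb (mlin \<Omega>1 y z)) = (\<Sum>z\<in>UNIV - {y}. p z \<odot>\<^sub>C B1 y z)"
      by (intro sum.cong) (auto simp: \<Omega>1_def emb_unemb B1)
    moreover have "(\<Sum>H\<in>hyps \<Omega>1. (pd (defpoly H) y / aff_eval (defpoly H) p) \<odot>\<^sub>C Aop \<Omega>1 H)
        = (\<Sum>j\<in>J. (pd (g j) y / aff_eval (g j) p) \<odot>\<^sub>C Z j)"
    proof -
      have A: "Aop \<Omega>1 H = (\<Sum>j\<in>{j\<in>J. h j = H}. Z j)" for H
        unfolding Aop_def \<Omega>1_def using Z by (auto simp: emb_unemb sum_distrib_left sum_distrib_right intro!: sum.cong)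
      have "(pd (defpoly H) y / aff_eval (defpoly H) p) \<odot>\<^sub>C Aop \<Omega>1 H
          = (\<Sum>j\<in>{j\<in>J. h j = H}. (pd (g j) y / aff_eval (g j) p) \<odot>\<^sub>C Z j)" for H
        unfolding A scl_sum_right
      proof (intro sum.cong refl)
        fix j assume "j \<in> {j\<in>J. h j = H}"
        then show "(pd (defpoly H) y / aff_eval (defpoly H) p) \<odot>\<^sub>C Z j = (pd (g j) y / aff_eval (g j) p) \<odot>\<^sub>C Z j"
          using defpoly_dlog(1)[OF def_h, of j y p] by auto
      qed
      then have "(\<Sum>H\<in>hyps \<Omega>1. (pd (defpoly H) y / aff_eval (defpoly H) p) \<odot>\<^sub>C Aop \<Omega>1 H)
          = (\<Sum>H\<in>h ` J. \<Sum>j\<in>{j\<in>J. h j = H}. (pd (g j) y / aff_eval (g j) p) \<odot>\<^sub>C Z j)"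
        by (simp add: \<Omega>1_def)
      also have "\<dots> = (\<Sum>j\<in>J. (pd (g j) y / aff_eval (g j) p) \<odot>\<^sub>C Z j)"
        using sum.group[OF fin finite_imageI[OF fin], of h h] by simp
      finally show ?thesis .
    qed
    ultimately show ?thesis unfolding W.Fop_eq W.S_coeff_emb by simp
  qed
  ultimately show ?thesis
    using form by (intro exI[of _ \<Omega>1]) (simp add: h_def \<Omega>1_def)
qed

context quotient_dir
begin

text \<open>This displays \<open>Rd\<close> as a polynomial part plus logarithmic terms with
  constant residues. By \<open>const_cases\<close> the products of a root with \<open>Dop\<close>
  and of a root derivative with S_x have constant coefficients, and the exchange terms are
  logarithmic along the hyperplanes a_H = a_H'.\<close>

lemma Rd_expand:
  assumes y: "y \<noteq> l"
  shows "Rd y p = (\<Sum>H\<in>I. K H * (emb (mconst \<Omega> y) + const_term (aH l H) \<odot>\<^sub>C Dop \<Omega> l y + droot l y H \<odot>\<^sub>C emb (mconst \<Omega> l)) * s H)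
    + (\<Sum>z\<in>UNIV - {l, y}. p z \<odot>\<^sub>C (\<Sum>H\<in>I. K H * emb (mlin \<Omega> y z) * s H))
    + (\<Sum>G\<in>hyps \<Omega> - I. (pd (defpoly G) y / aff_eval (defpoly G) p) \<odot>\<^sub>C (\<Sum>H\<in>I. K H * A G * s H))
    + (\<Sum>H\<in>I. \<Sum>H'\<in>I. dlog_diff l y p H H' \<odot>\<^sub>C (K H * A H' * (s H - s H')))"
proof -
  have 1: "root_at l p H \<odot>\<^sub>C Dop \<Omega> l y = const_term (aH l H) \<odot>\<^sub>C Dop \<Omega> l y" if H: "H \<in> I" for H
  proof (cases "Dop \<Omega> l y = 0")
    case False
    then have "\<forall>z. z \<noteq> l \<longrightarrow> droot l z H = 0" using const_cases y H by blast
    then have "(\<Sum>z\<in>UNIV - {l}. droot l z H * p z) = 0" by (intro sum.neutral) auto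
    then have "root_at l p H = const_term (aH l H)"
      using hyp_dlog(4)[OF H] by (simp add: aff_eval_split[of _ p l])
    then show ?thesis by simp
  qed simp
  have 2: "droot l y H \<odot>\<^sub>C Sop \<Omega> l p = droot l y H \<odot>\<^sub>C emb (mconst \<Omega> l)" if H: "H \<in> I" for H
  proof (cases "droot l y H = 0")
    case False
    then have "\<forall>z. z \<noteq> l \<longrightarrow> Dop \<Omega> l z = 0" using const_cases y H by blast
    then have "(\<Sum>z\<in>UNIV - {l}. p z \<odot>\<^sub>C Dop \<Omega> l z) = 0" by (intro sum.neutral) auto
    then show ?thesis by (simp add: Sop_eq)
  qed simp
  let ?m = "emb (mconst \<Omega> y)" and ?M = "\<lambda>z. emb (mlin \<Omega> y z)"
  let ?w = "\<lambda>G. pd (defpoly G) y / aff_eval (defpoly G) p"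
  have "K H * diag_block \<Omega> l y p H * s H
      = K H * (?m + const_term (aH l H) \<odot>\<^sub>C Dop \<Omega> l y + droot l y H \<odot>\<^sub>C emb (mconst \<Omega> l)) * s H
        + (\<Sum>z\<in>UNIV - {l, y}. p z \<odot>\<^sub>C (K H * ?M z * s H))
        + (\<Sum>G\<in>hyps \<Omega> - I. ?w G \<odot>\<^sub>C (K H * A G * s H))
        + (\<Sum>H'\<in>I. dlog_diff l y p H H' \<odot>\<^sub>C (K H * A H' * s H))" if H: "H \<in> I" for H
    unfolding diag_block_def 1[OF H] 2[OF H] Rop_def
    by (simp add: distrib_left distrib_right sum_distrib_left sum_distrib_right mult.assoc)
  then have "(\<Sum>H\<in>I. K H * diag_block \<Omega> l y p H * s H)
      = (\<Sum>H\<in>I. K H * (?m + const_term (aH l H) \<odot>\<^sub>C Dop \<Omega> l y + droot l y H \<odot>\<^sub>C emb (mconst \<Omega> l)) * s H)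
        + (\<Sum>H\<in>I. \<Sum>z\<in>UNIV - {l, y}. p z \<odot>\<^sub>C (K H * ?M z * s H))
        + (\<Sum>H\<in>I. \<Sum>G\<in>hyps \<Omega> - I. ?w G \<odot>\<^sub>C (K H * A G * s H))
        + (\<Sum>H\<in>I. \<Sum>H'\<in>I. dlog_diff l y p H H' \<odot>\<^sub>C (K H * A H' * s H))"
    by (simp add: sum.distrib cong: sum.cong)
  also have "(\<Sum>H\<in>I. \<Sum>z\<in>UNIV - {l, y}. p z \<odot>\<^sub>C (K H * ?M z * s H)) = (\<Sum>z\<in>UNIV - {l, y}. p z \<odot>\<^sub>C (\<Sum>H\<in>I. K H * ?M z * s H))"
    unfolding scl_sum_right by (rule sum.swap)
  also have "(\<Sum>H\<in>I. \<Sum>G\<in>hyps \<Omega> - I. ?w G \<odot>\<^sub>C (K H * A G * s H)) = (\<Sum>G\<in>hyps \<Omega> - I. ?w G \<odot>\<^sub>C (\<Sum>H\<in>I. K H * A G * s H))"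
    unfolding scl_sum_right by (rule sum.swap)
  finally show ?thesis
    unfolding Rd_def by (simp add: right_diff_distrib scl_distrib sum_subtractf)
qed

lemma dual_exists:
  assumes eps: "\<epsilon> * \<epsilon> = 1"
  shows "\<exists>\<Omega>1. pfaff_form \<Omega>1 \<and> rk \<Omega>1 = m \<and> hyps_dep \<Omega>1 l = (\<lambda>\<alpha>. {p. p l = \<epsilon> * aff_eval \<alpha> p}) ` \<Lambda> \<and>
    (\<forall>y p. Fop \<Omega>1 y p = Mw \<epsilon> y p)"
proof -
  \<comment> \<open>The hyperplanes of the transform come from three sources: the eigenvalues of
    S_x, the original hyperplanes not involving x, and the loci where two roots a_H and a_H' meet.
    Pairs whose roots differ by a constant are left out; they define no hyperplane and their
    \<open>dlog_diff\<close> is zero. Every locus occurs for both orders of the pair.\<close>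
  let ?pairs = "{(H, H'). H \<in> I \<and> H' \<in> I \<and> (\<exists>z. droot l z H \<noteq> droot l z H')}"
  let ?J = "\<Lambda> <+> ((hyps \<Omega> - I) <+> ?pairs)"
  define f where "f \<alpha> = Aff (\<lambda>j. (if j = l then 1 else 0) - \<epsilon> * pd \<alpha> j) (- \<epsilon> * const_term \<alpha>)" for \<alpha> :: "'a aff"
  define d where "d = (\<lambda>(H, H'). aff_diff (aH l H) (aH l H'))"
  define g where "g = case_sum f (case_sum defpoly d)"
  define Z where "Z = case_sum (\<lambda>\<alpha>. - (Q * E \<alpha> * P)) (case_sum (\<lambda>G. \<Sum>H\<in>I. K H * A G * s H) (\<lambda>(H, H'). K H * A H' * (s H - s H')))"
  define B0 where "B0 y = (if y = l then \<Sum>H\<in>I. (- \<epsilon> * const_term (aH l H)) \<odot>\<^sub>C proj H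
    else \<Sum>H\<in>I. K H * (emb (mconst \<Omega> y) + const_term (aH l H) \<odot>\<^sub>C Dop \<Omega> l y + droot l y H \<odot>\<^sub>C emb (mconst \<Omega> l)) * s H)" for y
  define B1 where "B1 y z = (if y = l then - (\<epsilon> \<odot>\<^sub>C dT z) else if z = l then - (\<epsilon> \<odot>\<^sub>C dT y)
    else \<Sum>H\<in>I. K H * emb (mlin \<Omega> y z) * s H)" for y z
  have Ksid: "idn m * (\<Sum>H\<in>I. K H * X H * s H) * idn m = (\<Sum>H\<in>I. K H * X H * s H)" for X
    by (simp add: sum_distrib_left sum_distrib_right mult.assoc mult_rewrite[OF K_idn(1)] cong: sum.cong)
  have evf: "aff_eval (f \<alpha>) p = p l - \<epsilon> * aff_eval \<alpha> p" for \<alpha> p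
    by (simp add: f_def aff_eval_def left_diff_distrib sum_subtractf algebra_simps sum_distrib_left if_distrib[of "\<lambda>x. _ * x"] cong: if_cong)
  have pdf: "pd (f \<alpha>) y = (if y = l then 1 else - (\<epsilon> * pd \<alpha> y))" if "\<alpha> \<in> \<Lambda>" for \<alpha> y
    using pd_eigval[OF that] by (simp add: f_def)
  have pdG: "pd (defpoly G) l = 0" if "G \<in> hyps \<Omega> - I" for G using that by (auto simp: hyps_dep_def)
  have pdd: "pd (d (H, H')) y = droot l y H - droot l y H'" for H H' y by (simp add: d_def aff_diff_def)
  have pdl: "pd (d x) l = 0" if "x \<in> ?pairs" for x using that by (auto simp: pdd hyp_dlog(4))
  have finp: "finite ?pairs" by (rule finite_subset[of _ "I \<times> I"]) auto
  have "\<exists>\<Omega>1. pfaff_form \<Omega>1 \<and> rk \<Omega>1 = m \<and> (\<forall>l. hyps_dep \<Omega>1 l = (\<lambda>j. {p. aff_eval (g j) p = 0}) ` {j\<in>?J. pd (g j) l \<noteq> 0}) \<and>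
    (\<forall>y p. Fop \<Omega>1 y p = B0 y + (\<Sum>z\<in>UNIV - {y}. p z \<odot>\<^sub>C B1 y z) + (\<Sum>j\<in>?J. (pd (g j) y / aff_eval (g j) p) \<odot>\<^sub>C Z j))"
  proof (rule pfaff_of_family)
    show "finite ?J" using finp by (intro finite_Plus) auto
    fix j assume j: "j \<in> ?J"
    show "\<exists>i. pd (g j) i \<noteq> 0"
    proof (rule PlusE[OF j])
      fix \<alpha> assume "j = Inl \<alpha>" "\<alpha> \<in> \<Lambda>"
      then show ?thesis by (intro exI[of _ l]) (simp add: g_def pdf)
    next
      fix x assume x: "j = Inr x" "x \<in> (hyps \<Omega> - I) <+> ?pairs"
      show ?thesis
      proof (rule PlusE[OF x(2)])
        fix G assume "x = Inl G" "G \<in> hyps \<Omega> - I"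
        then show ?thesis
          using defines_hyperplane_defpoly[OF arr, of G] x(1) by (simp add: g_def defines_hyperplane_def)
      next
        fix y assume "x = Inr y" "y \<in> ?pairs"
        then show ?thesis using x(1) by (auto simp: g_def pdd)
      qed
    qed
    show "idn m * Z j * idn m = Z j"
    proof (rule PlusE[OF j])
      fix \<alpha> assume "j = Inl \<alpha>"
      then show ?thesis by (simp add: Z_def mult.assoc mult_rewrite[OF PQ_idn(3)])
    next
      fix x assume x: "j = Inr x" "x \<in> (hyps \<Omega> - I) <+> ?pairs"
      show ?thesis
      proof (rule PlusE[OF x(2)])
        fix G assume "x = Inl G"
        then show ?thesis using x(1) Ksid[of "\<lambda>_. A G"] by (simp add: Z_def)
      next
        fix y assume "x = Inr y" "y \<in> ?pairs"
        then show ?thesis using x(1)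
          by (auto simp: Z_def left_diff_distrib right_diff_distrib mult.assoc mult_rewrite[OF K_idn(1)])
      qed
    qed
  next
    fix y show "idn m * B0 y * idn m = B0 y"
      unfolding B0_def using Ksid
      by (simp add: sum_distrib_left sum_distrib_right resolution_unit[OF resolution_proj] cong: sum.cong)
  next
    fix y z :: 'a assume "y \<noteq> z"
    then show "idn m * B1 y z * idn m = B1 y z" "B1 y z = B1 z y"
      unfolding B1_def using Ksid mlin_sym[of y z] by simp_all
  qed
  then obtain \<Omega>1 where form: "pfaff_form \<Omega>1" and rk: "rk \<Omega>1 = m"
    and hyps: "\<forall>l. hyps_dep \<Omega>1 l = (\<lambda>j. {p. aff_eval (g j) p = 0}) ` {j\<in>?J. pd (g j) l \<noteq> 0}"
    and F: "\<forall>y p. Fop \<Omega>1 y p = B0 y + (\<Sum>z\<in>UNIV - {y}. p z \<odot>\<^sub>C B1 y z) + (\<Sum>j\<in>?J. (pd (g j) y / aff_eval (g j) p) \<odot>\<^sub>C Z j)"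
    by - (elim exE conjE, rule that, assumption+)
  note F = F[THEN spec, THEN spec]
  have "pd (g j) l \<noteq> 0 \<longleftrightarrow> j \<in> Inl ` \<Lambda>" if j: "j \<in> ?J" for j
  proof (rule PlusE[OF j])
    fix \<alpha> assume "j = Inl \<alpha>" "\<alpha> \<in> \<Lambda>"
    then show ?thesis by (simp add: g_def pdf)
  next
    fix x assume x: "j = Inr x" "x \<in> (hyps \<Omega> - I) <+> ?pairs"
    show ?thesis
      by (rule PlusE[OF x(2)]) (use pdG pdl in \<open>simp_all add: x(1) g_def image_iff\<close>)
  qed
  then have "{j\<in>?J. pd (g j) l \<noteq> 0} = Inl ` \<Lambda>"
    by (intro Set.set_eqI) (simp add: image_iff, blast intro: InlI)
  then have h: "hyps_dep \<Omega>1 l = (\<lambda>\<alpha>. {p. p l = \<epsilon> * aff_eval \<alpha> p}) ` \<Lambda>"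
    unfolding hyps[THEN spec] by (simp add: image_image g_def evf)
  have sumJ: "(\<Sum>j\<in>?J. (pd (g j) y / aff_eval (g j) p) \<odot>\<^sub>C Z j)
      = (\<Sum>\<alpha>\<in>\<Lambda>. (pd (f \<alpha>) y / (p l - \<epsilon> * aff_eval \<alpha> p)) \<odot>\<^sub>C - (Q * E \<alpha> * P))
        + ((\<Sum>G\<in>hyps \<Omega> - I. (pd (defpoly G) y / aff_eval (defpoly G) p) \<odot>\<^sub>C (\<Sum>H\<in>I. K H * A G * s H))
          + (\<Sum>x\<in>?pairs. (pd (d x) y / aff_eval (d x) p) \<odot>\<^sub>C (case x of (H, H') \<Rightarrow> K H * A H' * (s H - s H'))))" for y p
    using finp by (simp add: sum.Plus g_def Z_def evf)
  have "Fop \<Omega>1 y p = Mw \<epsilon> y p" for y p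
  proof (cases "y = l")
    case True
    have z: "(\<Sum>G\<in>hyps \<Omega> - I. (pd (defpoly G) l / aff_eval (defpoly G) p) \<odot>\<^sub>C (\<Sum>H\<in>I. K H * A G * s H)) = 0"
      "(\<Sum>x\<in>?pairs. (pd (d x) l / aff_eval (d x) p) \<odot>\<^sub>C (case x of (H, H') \<Rightarrow> K H * A H' * (s H - s H'))) = 0"
      by (intro sum.neutral ballI, simp only: pdG pdl, simp)+
    have "(\<Sum>j\<in>?J. (pd (g j) l / aff_eval (g j) p) \<odot>\<^sub>C Z j) = - (Q * resolvent \<epsilon> \<Omega> l p * P)"
      unfolding sumJ resolvent_sandwich(1)
      using z by (simp add: pdf sum_negf cong: sum.cong)
    moreover have "B0 l + (\<Sum>z\<in>UNIV - {l}. p z \<odot>\<^sub>C B1 l z) = - (\<epsilon> \<odot>\<^sub>C T p)"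
      unfolding T_eq by (simp add: B0_def B1_def scl_distrib scl_sum_right sum_negf mult.commute)
    ultimately show ?thesis unfolding True Mw_l F by simp
  next
    case False
    have "(\<Sum>x\<in>?pairs. (pd (d x) y / aff_eval (d x) p) \<odot>\<^sub>C (case x of (H, H') \<Rightarrow> K H * A H' * (s H - s H')))
        = (\<Sum>x\<in>I \<times> I. case x of (H, H') \<Rightarrow> dlog_diff l y p H H' \<odot>\<^sub>C (K H * A H' * (s H - s H')))"
    proof (rule sum.mono_neutral_cong_left)
      show "\<forall>x\<in>I \<times> I - ?pairs. (case x of (H, H') \<Rightarrow> dlog_diff l y p H H' \<odot>\<^sub>C (K H * A H' * (s H - s H'))) = 0"
      proof
        fix x assume x: "x \<in> I \<times> I - ?pairs"
        obtain H H' where e: "x = (H, H')" by (cases x)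
        have "droot l y H = droot l y H'" using x unfolding e by simp
        then show "(case x of (H, H') \<Rightarrow> dlog_diff l y p H H' \<odot>\<^sub>C (K H * A H' * (s H - s H'))) = 0"
          by (simp add: e dlog_diff_def)
      qed
      show "(pd (d x) y / aff_eval (d x) p) \<odot>\<^sub>C (case x of (H, H') \<Rightarrow> K H * A H' * (s H - s H'))
          = (case x of (H, H') \<Rightarrow> dlog_diff l y p H H' \<odot>\<^sub>C (K H * A H' * (s H - s H')))" for x
        by (cases x) (simp add: pdd dlog_diff_def, simp add: d_def aff_eval_diff)
    qed auto
    also have "\<dots> = (\<Sum>H\<in>I. \<Sum>H'\<in>I. dlog_diff l y p H H' \<odot>\<^sub>C (K H * A H' * (s H - s H')))"
      by (simp add: sum.cartesian_product)
    finally have pairs: "(\<Sum>x\<in>?pairs. (pd (d x) y / aff_eval (d x) p) \<odot>\<^sub>C (case x of (H, H') \<Rightarrow> K H * A H' * (s H - s H')))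
        = (\<Sum>H\<in>I. \<Sum>H'\<in>I. dlog_diff l y p H H' \<odot>\<^sub>C (K H * A H' * (s H - s H')))" .
    have eig: "(\<Sum>\<alpha>\<in>\<Lambda>. (pd (f \<alpha>) y / (p l - \<epsilon> * aff_eval \<alpha> p)) \<odot>\<^sub>C - (Q * E \<alpha> * P))
        = \<epsilon> \<odot>\<^sub>C (Q * Dop \<Omega> l y * resolvent \<epsilon> \<Omega> l p * P)"
      unfolding resolvent_sandwich(2)[OF False] scl_sum_right using False by (intro sum.cong) (auto simp: pdf)
    have "(\<Sum>z\<in>UNIV - {y}. p z \<odot>\<^sub>C B1 y z) = p l \<odot>\<^sub>C B1 y l + (\<Sum>z\<in>UNIV - {l, y}. p z \<odot>\<^sub>C B1 y z)"
      using False by (subst sum.remove[of _ l]) (auto simp: insert_commute intro!: sum.cong)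
    also have "\<dots> = - ((\<epsilon> * p l) \<odot>\<^sub>C dT y) + (\<Sum>z\<in>UNIV - {l, y}. p z \<odot>\<^sub>C (\<Sum>H\<in>I. K H * emb (mlin \<Omega> y z) * s H))"
      using False by (auto simp: B1_def mult.commute intro!: sum.cong)
    finally show ?thesis
      unfolding F sumJ pairs eig Mw_y[OF False] Rd_expand[OF False] using False by (simp add: B0_def algebra_simps)
  qed
  then show ?thesis using form rk h by blast
qed

end

context irreducible_system
begin

lemma middle_dual_iff:
  assumes eps: "\<epsilon> * \<epsilon> = 1"
  shows "middle_laplace_gen \<epsilon> l \<Omega> \<Omega>1 \<longleftrightarrow> (\<exists>K s. middle_dual \<Omega> l \<Omega>1 K s \<epsilon>)"
proof
  assume "middle_laplace_gen \<epsilon> l \<Omega> \<Omega>1"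
  then obtain K s where f: "pfaff_form \<Omega>1" and h: "hyps_dep \<Omega>1 l = (\<lambda>\<alpha>. {p. p l = \<epsilon> * aff_eval \<alpha> p}) ` \<Lambda>"
    and q: "block_quotient \<Omega> l (rk \<Omega>1) K s"
    and g: "\<forall>y. \<forall>\<^sub>F p in genf. \<forall>H'\<in>I. (\<Sum>H\<in>I. K H * Mop \<epsilon> \<Omega> l y p H H') = Fop \<Omega>1 y p * K H'"
    unfolding middle_laplace_gen_iff by blast
  have "middle_dual \<Omega> l \<Omega>1 K s \<epsilon>"
    by unfold_locales (use f h q g eps in blast)+
  then show "\<exists>K s. middle_dual \<Omega> l \<Omega>1 K s \<epsilon>" by blast
next
  assume "\<exists>K s. middle_dual \<Omega> l \<Omega>1 K s \<epsilon>"
  then obtain K s where "middle_dual \<Omega> l \<Omega>1 K s \<epsilon>" by blast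
  then interpret M: middle_dual \<Omega> l \<Omega>1 K s \<epsilon> .
  show "middle_laplace_gen \<epsilon> l \<Omega> \<Omega>1"
    unfolding middle_laplace_gen_iff using M.W.form M.hyps1 M.quot M.gen by blast
qed

lemma middle_laplace_exists:
  assumes eps: "\<epsilon> * \<epsilon> = 1" shows "\<exists>\<Omega>1. middle_laplace_gen \<epsilon> l \<Omega> \<Omega>1"
proof -
  have "\<exists>m K s. block_quotient \<Omega> l m K s"
    unfolding block_quotient_def by (rule block_quotient_exists) auto
  then obtain m K s where q: "block_quotient \<Omega> l m K s" by blast
  interpret B: quotient_dir \<Omega> l m K s by unfold_locales (rule q)
  obtain \<Omega>1 where o: "pfaff_form \<Omega>1" "rk \<Omega>1 = m" "hyps_dep \<Omega>1 l = (\<lambda>\<alpha>. {p. p l = \<epsilon> * aff_eval \<alpha> p}) ` \<Lambda>"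
    and F: "\<forall>y p. Fop \<Omega>1 y p = B.Mw \<epsilon> y p"
    using B.dual_exists[OF eps] by blast
  have "\<forall>y. \<forall>\<^sub>F p in genf. \<forall>H'\<in>I. (\<Sum>H\<in>I. K H * Mop \<epsilon> \<Omega> l y p H H') = Fop \<Omega>1 y p * K H'"
    using B.generic_Mop_K F by simp
  then show ?thesis
    unfolding middle_laplace_gen_iff using o q by (intro exI[of _ \<Omega>1]) blast
qed

text \<open>The transform satisfies all hypotheses imposed on \<Omega>, so the construction applies
  to it once more with the opposite sign. The two instances together form a
  \<open>double_dual\<close>.\<close>

lemma middle_laplace_facts:
  assumes eps: "\<epsilon> * \<epsilon> = 1" and M: "middle_laplace_gen \<epsilon> l \<Omega> \<Omega>1"
  shows "admissible \<Omega>1 l" "irreducible_dir \<Omega>1 l" "\<not> exceptional_dir \<Omega>1 l"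
    "\<exists>\<Omega>2. middle_laplace_gen (- \<epsilon>) l \<Omega>1 \<Omega>2" "middle_laplace_gen (- \<epsilon>) l \<Omega>1 \<Omega>2 \<Longrightarrow> form_sim \<Omega>2 \<Omega>"
proof -
  obtain K s where "middle_dual \<Omega> l \<Omega>1 K s \<epsilon>" using M middle_dual_iff[OF eps] by blast
  then interpret M: middle_dual \<Omega> l \<Omega>1 K s \<epsilon> .
  show adm: "admissible \<Omega>1 l" by (rule M.admissible1)
  show irr1: "irreducible_dir \<Omega>1 l" by (rule M.irreducible1)
  show ne1: "\<not> exceptional_dir \<Omega>1 l" by (rule M.nonexc1)
  interpret S: irreducible_system \<Omega>1 l
    by unfold_locales (use adm irr1 ne1 in \<open>auto simp: admissible_def\<close>)
  have eps': "(- \<epsilon>) * (- \<epsilon>) = 1" using eps by simp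
  show "\<exists>\<Omega>2. middle_laplace_gen (- \<epsilon>) l \<Omega>1 \<Omega>2" by (rule S.middle_laplace_exists[OF eps'])
  assume "middle_laplace_gen (- \<epsilon>) l \<Omega>1 \<Omega>2"
  then obtain K2 s2 where "middle_dual \<Omega>1 l \<Omega>2 K2 s2 (- \<epsilon>)" using S.middle_dual_iff[OF eps'] by blast
  then interpret D2: middle_dual \<Omega>1 l \<Omega>2 K2 s2 "- \<epsilon>" .
  interpret double_dual \<Omega> l \<Omega>1 K s \<epsilon> \<Omega>2 K2 s2 by unfold_locales
  show "form_sim \<Omega>2 \<Omega>" by (rule form_sim2)
qed

end

text \<open>The transforms are relations, since they involve the choice of a basis. The first part
  therefore asserts that transforms exist and that every choice at both stages leads back to a form
  conjugate to \<Omega>; \<open>admissible\<close> guarantees that the second transform is taken of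
  a system of the kind considered.\<close>

theorem theorem6p15:
  fixes \<Omega> :: "'n::finite pfaff" and l :: 'n
  assumes "pfaff_form \<Omega>" and "rk \<Omega> \<ge> 1" and "completely_integrable \<Omega>"
    and "cond_D \<Omega> l" and "cond_I \<Omega> l"
    and "irreducible_dir \<Omega> l" and "\<not> exceptional_dir \<Omega> l"
  shows
    "((\<exists>\<Omega>\<^sub>1. middle_laplace l \<Omega> \<Omega>\<^sub>1) \<and>
      (\<forall>\<Omega>\<^sub>1. middle_laplace l \<Omega> \<Omega>\<^sub>1 \<longrightarrow> admissible \<Omega>\<^sub>1 l \<and>
         (\<exists>\<Omega>\<^sub>2. inv_middle_laplace l \<Omega>\<^sub>1 \<Omega>\<^sub>2) \<and>
         (\<forall>\<Omega>\<^sub>2. inv_middle_laplace l \<Omega>\<^sub>1 \<Omega>\<^sub>2 \<longrightarrow> form_sim \<Omega>\<^sub>2 \<Omega>)) \<and>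
      (\<exists>\<Omega>\<^sub>1. inv_middle_laplace l \<Omega> \<Omega>\<^sub>1) \<and>
      (\<forall>\<Omega>\<^sub>1. inv_middle_laplace l \<Omega> \<Omega>\<^sub>1 \<longrightarrow> admissible \<Omega>\<^sub>1 l \<and>
         (\<exists>\<Omega>\<^sub>2. middle_laplace l \<Omega>\<^sub>1 \<Omega>\<^sub>2) \<and>
         (\<forall>\<Omega>\<^sub>2. middle_laplace l \<Omega>\<^sub>1 \<Omega>\<^sub>2 \<longrightarrow> form_sim \<Omega>\<^sub>2 \<Omega>))) \<and>
     ((\<forall>\<Omega>\<^sub>1. middle_laplace l \<Omega> \<Omega>\<^sub>1 \<longrightarrow> irreducible_dir \<Omega>\<^sub>1 l \<and> \<not> exceptional_dir \<Omega>\<^sub>1 l) \<and>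
      (\<forall>\<Omega>\<^sub>1. inv_middle_laplace l \<Omega> \<Omega>\<^sub>1 \<longrightarrow> irreducible_dir \<Omega>\<^sub>1 l \<and> \<not> exceptional_dir \<Omega>\<^sub>1 l))"
proof -
  interpret irreducible_system \<Omega> l by unfold_locales (use assms in auto)
  have e: "(1::complex) * 1 = 1" "(- 1 :: complex) * - 1 = 1" by simp_all
  show ?thesis
    unfolding middle_laplace_def inv_middle_laplace_def
    using middle_laplace_exists[OF e(1)] middle_laplace_exists[OF e(2)]
      middle_laplace_facts[OF e(1)] middle_laplace_facts[OF e(2)]
    by (simp only: minus_minus) blast
qed

end
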